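(* Let $b\ge 0$, $p\ge 4$, and assume $V$ satisfies $(V_0)$. Let $\mathcal N=\{u\in E\setminus\{0\}: I'(u)u=0\}$. Then the restriction of $I$ to $\mathcal N$ attains a global minimum, and every minimizer $\bar u$ of $I|_{\mathcal N}$ is a ground state solution of (1.5) satisfying $$I(\bar u)=\inf_{u\in E\setminus\{0\}}\sup_{t>0} I(tu).$$ Moreover, if $V$ is in addition locally Hölder continuous, then every such minimizer $\bar u$ belongs to $C^2(\mathbb R^2)$, is a classical solution of (1.5), and does not change sign in $\mathbb R^2$.
   Context: Let $V:\mathbb R^2\to\mathbb R$. Condition $(V_0)$: $V\in L^1_{loc}(\mathbb R^2)$, $V_0:=\inf_{\mathbb R^2}V>0$, and the Lebesgue measure of $\{x\in\mathbb R^2: V(x)\le M\}$ is finite for every $M>0$. $|\cdot|_s$ denotes the $L^s(\mathbb R^2)$-norm. $H_V=\{u\in H^1(\mathbb R^2):\int_{\mathbb R^2}Vu^2\,dx<\infty\}$ with norm $\|u\|_V=(\int_{\mathbb R^2}(|\nabla u|^2+V(x)u^2)\,dx)^{1/2}$. For measurable $u$, $|u|_*=(\int_{\mathbb R^2}\log(1+|x|)u^2\,dx)^{1/2}$. $E=\{u\in H_V:|u|_*<\infty\}$ is the Hilbert space with norm $\|u\|_E=(\|u\|_V^2+|u|_*^2)^{1/2}$. $N_0(u)=\frac1{2\pi}\int_{\mathbb R^2}\int_{\mathbb R^2}\log(|x-y|)u^2(x)u^2(y)\,dx\,dy$ (well defined for $u\in E$). For $b\ge0$, $p>2$, $I:E\to\mathbb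 R$ is $I(u)=\frac12\|u\|_V^2+\frac14N_0(u)-\frac bp|u|_p^p$, a $C^1$ functional. Equation (1.5) is $-\Delta u+V(x)u+\frac1{2\pi}(\log(|\cdot|)*|u|^2)u=b|u|^{p-2}u$ in $\mathbb R^2$; its (weak) solutions are the critical points of $I$ in $E$. A ground state solution is a critical point $u\ne0$ of $I$ with $I(u)\le I(w)$ for every critical point $w\ne0$ of $I$. *)

theory Defs
  imports "HOL-Analysis.Analysis"
begin

type_synonym R2 = "real ^ 2"

definition pdv :: "R2 \<Rightarrow> (R2 \<Rightarrow> real) \<Rightarrow> R2 \<Rightarrow> real" where
  "pdv i f x = deriv (\<lambda>t. f (x + t *\<^sub>R i)) 0"

fun ipdv :: "R2 list \<Rightarrow> (R2 \<Rightarrow> real) \<Rightarrow> R2 \<Rightarrow> real" where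
  "ipdv [] f = f"
| "ipdv (i # is) f = pdv i (ipdv is f)"

definition Ck :: "nat \<Rightarrow> (R2 \<Rightarrow> real) \<Rightarrow> bool" where
  "Ck k f \<longleftrightarrow> (\<forall>is. set is \<subseteq> Basis \<and> length is \<le> k \<longrightarrow>
      continuous_on UNIV (ipdv is f) \<and>
      (length is < k \<longrightarrow> (\<forall>i\<in>Basis. \<forall>x. (\<lambda>t. ipdv is f (x + t *\<^sub>R i)) differentiable (at 0))))"

definition smooth :: "(R2 \<Rightarrow> real) \<Rightarrow> bool" where
  "smooth f \<longleftrightarrow> (\<forall>k. Ck k f)"

definition test_fun :: "(R2 \<Rightarrow> real) \<Rightarrow> bool" where
  "test_fun \<phi> \<longleftrightarrow> smooth \<phi> \<and> compact (closure {x. \<phi> x \<noteq> 0})"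

definition weak_gradient :: "(R2 \<Rightarrow> real) \<Rightarrow> (R2 \<Rightarrow> R2) \<Rightarrow> bool" where
  "weak_gradient u G \<longleftrightarrow> (\<forall>\<phi>. test_fun \<phi> \<longrightarrow> (\<forall>i\<in>Basis.
      (\<integral>x. u x * pdv i \<phi> x \<partial>lebesgue) = - (\<integral>x. (G x \<bullet> i) * \<phi> x \<partial>lebesgue)))"

definition L2_grad :: "(R2 \<Rightarrow> real) \<Rightarrow> (R2 \<Rightarrow> R2) \<Rightarrow> bool" where
  "L2_grad u G \<longleftrightarrow> G \<in> borel_measurable lebesgue \<and>
      (\<integral>\<^sup>+ x. ennreal ((norm (G x))\<^sup>2) \<partial>lebesgue) < \<infinity> \<and> weak_gradient u G"

definition H1 :: "(R2 \<Rightarrow> real) set" where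
  "H1 = {u. u \<in> borel_measurable lebesgue \<and>
      (\<integral>\<^sup>+ x. ennreal ((u x)\<^sup>2) \<partial>lebesgue) < \<infinity> \<and> (\<exists>G. L2_grad u G)}"

definition grad :: "(R2 \<Rightarrow> real) \<Rightarrow> R2 \<Rightarrow> R2" where
  "grad u = (SOME G. L2_grad u G)"

text \<open>The space E (as a set of representatives).\<close>
definition E :: "(R2 \<Rightarrow> real) \<Rightarrow> (R2 \<Rightarrow> real) set" where
  "E V = {u \<in> H1. (\<integral>\<^sup>+ x. ennreal (V x * (u x)\<^sup>2) \<partial>lebesgue) < \<infinity> \<and>
      (\<integral>\<^sup>+ x. ennreal (ln (1 + norm x) * (u x)\<^sup>2) \<partial>lebesgue) < \<infinity>}"

definition normV_sq :: "(R2 \<Rightarrow> real) \<Rightarrow> (R2 \<Rightarrow> real) \<Rightarrow> real" where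
  "normV_sq V u = (\<integral>x. (norm (grad u x))\<^sup>2 + V x * (u x)\<^sup>2 \<partial>lebesgue)"

definition N0 :: "(R2 \<Rightarrow> real) \<Rightarrow> real" where
  "N0 u = 1 / (2 * pi) * (\<integral>z. ln (dist (fst z) (snd z)) * (u (fst z))\<^sup>2 * (u (snd z))\<^sup>2
      \<partial>(lebesgue \<Otimes>\<^sub>M lebesgue))"

definition Lp_pow :: "real \<Rightarrow> (R2 \<Rightarrow> real) \<Rightarrow> real" where
  "Lp_pow p u = (\<integral>x. \<bar>u x\<bar> powr p \<partial>lebesgue)"

definition I :: "(R2 \<Rightarrow> real) \<Rightarrow> real \<Rightarrow> real \<Rightarrow> (R2 \<Rightarrow> real) \<Rightarrow> real" where
  "I V b p u = 1/2 * normV_sq V u + 1/4 * N0 u - b / p * Lp_pow p u"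

definition dI :: "(R2 \<Rightarrow> real) \<Rightarrow> real \<Rightarrow> real \<Rightarrow> (R2 \<Rightarrow> real) \<Rightarrow> (R2 \<Rightarrow> real) \<Rightarrow> real \<Rightarrow> bool" where
  "dI V b p u v D \<longleftrightarrow> ((\<lambda>t. I V b p (\<lambda>x. u x + t * v x)) has_real_derivative D) (at 0)"

text \<open>u is nonzero as an element of E, i.e. not a.e. zero.\<close>
definition nonzero :: "(R2 \<Rightarrow> real) \<Rightarrow> bool" where
  "nonzero u \<longleftrightarrow> \<not> (AE x in lebesgue. u x = 0)"

definition Nehari :: "(R2 \<Rightarrow> real) \<Rightarrow> real \<Rightarrow> real \<Rightarrow> (R2 \<Rightarrow> real) set" where
  "Nehari V b p = {u \<in> E V. nonzero u \<and> dI V b p u u 0}"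

definition critical :: "(R2 \<Rightarrow> real) \<Rightarrow> real \<Rightarrow> real \<Rightarrow> (R2 \<Rightarrow> real) \<Rightarrow> bool" where
  "critical V b p u \<longleftrightarrow> u \<in> E V \<and> (\<forall>v\<in>E V. dI V b p u v 0)"

definition ground_state :: "(R2 \<Rightarrow> real) \<Rightarrow> real \<Rightarrow> real \<Rightarrow> (R2 \<Rightarrow> real) \<Rightarrow> bool" where
  "ground_state V b p u \<longleftrightarrow> critical V b p u \<and> nonzero u \<and>
      (\<forall>w. critical V b p w \<and> nonzero w \<longrightarrow> I V b p u \<le> I V b p w)"

definition V0_cond :: "(R2 \<Rightarrow> real) \<Rightarrow> bool" where
  "V0_cond V \<longleftrightarrow> (\<forall>K. compact K \<longrightarrow> set_integrable lebesgue K V) \<and>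
      bdd_below (range V) \<and> (INF x. V x) > 0 \<and>
      (\<forall>M>0. emeasure lebesgue {x. V x \<le> M} < \<infinity>)"

definition loc_holder :: "(R2 \<Rightarrow> real) \<Rightarrow> bool" where
  "loc_holder V \<longleftrightarrow> (\<forall>K. compact K \<longrightarrow> (\<exists>\<alpha> C. 0 < \<alpha> \<and> \<alpha> \<le> 1 \<and>
      (\<forall>x\<in>K. \<forall>y\<in>K. \<bar>V x - V y\<bar> \<le> C * dist x y powr \<alpha>)))"

definition laplacian :: "(R2 \<Rightarrow> real) \<Rightarrow> R2 \<Rightarrow> real" where
  "laplacian f x = (\<Sum>i\<in>Basis. pdv i (pdv i f) x)"

definition classical_sol :: "(R2 \<Rightarrow> real) \<Rightarrow> real \<Rightarrow> real \<Rightarrow> (R2 \<Rightarrow> real) \<Rightarrow> bool" where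
  "classical_sol V b p w \<longleftrightarrow> Ck 2 w \<and> (\<forall>x.
      - laplacian w x + V x * w x + 1 / (2 * pi) * (\<integral>y. ln (dist x y) * (w y)\<^sup>2 \<partial>lebesgue) * w x
      = b * \<bar>w x\<bar> powr (p - 2) * w x)"

end

theory Submission
  imports Defs "HOL-Complex_Analysis.Great_Picard" "HOL-Computational_Algebra.Polynomial"
begin

text \<open>Along a ray \<open>t u\<close> the energy is \<open>A t\<^sup>2 / 2 + N t^4 / 4 - b C t powr p / p\<close> with \<open>p \<ge> 4\<close>, so it has at most one critical
  point, a maximum; this gives the minimax formula. A minimizing sequence on the Nehari set is bounded in \<open>H\<^sub>V\<close>, hence compact in
  \<open>L\<^sup>2\<close> because the sublevel sets of \<open>V\<close> have finite measure; the negative part of the logarithmic energy and the \<open>L\<^sup>p\<close> term pass to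
  the limit, the remaining terms are lower semicontinuous, and projecting along the ray yields a minimizer. The constraint is natural by
  the intermediate value theorem on rays.

  All facts on Sobolev functions come from one identity: with \<open>\<rho>\<close>, \<open>\<psi>\<close> radial and \<open>\<Delta>\<psi> = -(2 \<rho> + z \<bullet> \<nabla>\<rho>)\<close>, the scale derivative of
  the mollification of \<open>u\<close> with \<open>\<rho>\<close> is \<open>s\<close> times the mollification of \<open>\<Delta>u\<close> with \<open>\<psi>\<close>. Integrating over scales expresses \<open>u\<close> through
  its gradient (Sobolev inequality, compactness) or its Laplacian (Hoelder and \<open>C\<^sup>2\<close> regularity), and a Gronwall argument in the
  scale, applied to the minimizer \<open>\<bar>u\<bar>\<close>, is the strong maximum principle. Lebesgue measurable functions are replaced by Borel
  representatives throughout.\<close>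

text \<open>The logarithmic energy has no sign, and this shapes the variational part. On the Nehari
  set it can be eliminated, leaving \<open>Aen u / 4 + b * (1/4 - 1/p) * Cen u\<close>; both terms
  are nonnegative because \<open>p \<ge> 4\<close>, and both shrink when \<open>u\<close> is
  multiplied by a factor below one. A limit with \<open>Q u \<le> 0\<close> is therefore as good as
  one on the constraint. The weight ln(1 + |x|) is not controlled along a minimizing sequence; for
  the limit it is recovered from the positive logarithmic energy, evaluated at one point where the
  limit does not vanish.

  In the plane the scale derivative of the mollification of an H1 function is O(1/s) in the supremum
  norm and O(1) in L2. The first fact allows logarithmic growth of mollifications, the second gives
  an error of order s. Splitting the values of \<open>u\<close> into layers and using the scale
  exp(-n) on the n-th layer balances the two, which gives every L^q with q \<ge> 2. The same two
  rates drive the compactness and the regularity proofs.\<close>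

abbreviation lborel2 :: "('a::euclidean_space \<times> 'b::euclidean_space) measure" where "lborel2 \<equiv> lborel \<Otimes>\<^sub>M lborel"
abbreviation L1 :: "('a::euclidean_space => 'b::{banach, second_countable_topology}) => bool" where "L1 \<equiv> integrable lborel"
abbreviation Bor :: "('a::topological_space => 'b::topological_space) set" where "Bor \<equiv> borel_measurable borel"
abbreviation sq :: "('a => real) => 'a => real" where "sq u \<equiv> \<lambda>x. (u x)\<^sup>2"
abbreviation unit_ind :: "real => real" where "unit_ind \<equiv> indicator {0<..<1}"
abbreviation LIMSEQ_ascii :: "(nat => 'a::topological_space) => 'a => bool" (infix "---->" 60) where "X ----> L \<equiv> X \<longlonglongrightarrow> L"

lemmas L1_add = Bochner_Integration.integrable_add
lemmas L1_diff = Bochner_Integration.integrable_diff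
lemmas L1_sum = Bochner_Integration.integrable_sum
lemmas L1_bound = Bochner_Integration.integrable_bound

section \<open>Test functions\<close>

text \<open>With s = 1/t, d/dt (P(s) exp(-s)) = s^2 (P(s) - P'(s)) exp(-s). The recursion is this
  rule, so \<open>bump n\<close> is the n-th derivative of the flat function exp(-1/t) extended by
  zero.\<close>

fun bump_poly :: "nat => real poly" where
  "bump_poly 0 = 1"
| "bump_poly (Suc n) = monom 1 2 * (bump_poly n - pderiv (bump_poly n))"

definition bump :: "nat => real => real" where
  "bump n t = (if t > 0 then poly (bump_poly n) (1 / t) * exp (- (1 / t)) else 0)"

lemma poly_exp_minus_tendsto_0: "((\<lambda>x. poly q x * exp (- x)) \<longlongrightarrow> 0) at_top" for q :: "real poly"
proof -
  have "((\<lambda>x::real. \<Sum>i\<le>degree q. coeff q i * (x ^ i / exp x)) \<longlongrightarrow> (\<Sum>i\<le>degree q. coeff q i * 0)) at_top"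
    by (intro tendsto_sum tendsto_mult tendsto_const tendsto_power_div_exp_0)
  moreover have "(\<lambda>x::real. \<Sum>i\<le>degree q. coeff q i * (x ^ i / exp x)) = (\<lambda>x. poly q x * exp (- x))"
    by (auto simp: poly_altdef sum_distrib_right sum_divide_distrib exp_minus field_simps)
  ultimately show ?thesis by simp
qed

lemma bump_tendsto_0_right: "((\<lambda>t. poly q (1 / t) * exp (- (1 / t))) \<longlongrightarrow> 0) (at_right 0)" for q :: "real poly"
  using filterlim_compose[OF poly_exp_minus_tendsto_0 filterlim_inverse_at_top_right]
  by (simp add: inverse_eq_divide)

lemma DERIV_bump: "(bump n has_real_derivative bump (Suc n) t) (at t)"
proof -
  consider "t > 0" | "t < 0" | "t = 0" by linarith
  then show ?thesis
  proof cases
    case 1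
    have "((\<lambda>t. poly (bump_poly n) (1 / t) * exp (- (1 / t))) has_real_derivative bump (Suc n) t) (at t)"
      using 1 by (auto intro!: derivative_eq_intros poly_DERIV[THEN DERIV_chain2] simp: bump_def poly_monom power2_eq_square field_simps)
    then show ?thesis
      by (rule has_field_derivative_transform_within_open[of _ _ _ "{0<..}"]) (use 1 in "auto simp: bump_def")
  next
    case 2
    have "((\<lambda>t. 0) has_real_derivative bump (Suc n) t) (at t)"
      using 2 by (simp add: bump_def)
    then show ?thesis
      by (rule has_field_derivative_transform_within_open[of _ _ _ "{..<0}"]) (use 2 in "auto simp: bump_def")
  next
    case 3
    have r: "((\<lambda>h. bump n h / h) \<longlongrightarrow> 0) (at_right 0)"
    proof (rule Lim_transform_eventually)
      \<comment> \<open>\<open>pCons 0\<close> multiplies the polynomial by its variable 1/t, which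
        absorbs the division by \<open>t\<close> in the difference quotient.\<close>
      show "((\<lambda>t. poly (pCons 0 (bump_poly n)) (1 / t) * exp (- (1 / t))) \<longlongrightarrow> 0) (at_right 0)"
        by (rule bump_tendsto_0_right)
      show "\<forall>\<^sub>F t in at_right 0. poly (pCons 0 (bump_poly n)) (1 / t) * exp (- (1 / t)) = bump n t / t"
        by (auto simp: eventually_at_right_less bump_def eventually_at_filter)
    qed
    have l: "((\<lambda>h. bump n h / h) \<longlongrightarrow> 0) (at_left 0)"
      by (rule Lim_transform_eventually[OF tendsto_const]) (auto simp: bump_def eventually_at_filter)
    have "((\<lambda>h. bump n h / h) \<longlongrightarrow> 0) (at 0)"
      using l r by (simp add: filterlim_at_split)
    then show ?thesis
      using 3 by (simp add: DERIV_def bump_def)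
  qed
qed

section \<open>Calculus of functions with continuous partial derivatives\<close>

lemma ipdv_snoc: "ipdv (is @ [i]) f = ipdv is (pdv i f)"
  by (induction "is") auto

lemma Ck_0: "Ck 0 f \<longleftrightarrow> continuous_on UNIV f"
  by (auto simp: Ck_def)

text \<open>In \<open>ipdv\<close> the last direction of the list is differentiated first; splitting
  the list there gives a recursion on the order. The closure properties below are inductions over
  this form, with the functions generalised.\<close>

lemma Ck_Suc: "Ck (Suc k) f \<longleftrightarrow> continuous_on UNIV f \<and>
   (\<forall>i\<in>Basis. (\<forall>x. (\<lambda>t. f (x + t *\<^sub>R i)) differentiable (at 0)) \<and> Ck k (pdv i f))"
proof
  assume L: "Ck (Suc k) f"
  have "continuous_on UNIV f" using L by (auto simp: Ck_def dest: spec[of _ "[]"])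
  moreover have "(\<lambda>t. f (x + t *\<^sub>R i)) differentiable (at 0)" if "i \<in> Basis" for i x
    using L that unfolding Ck_def by (auto dest: spec[of _ "[]"])
  moreover have "Ck k (pdv i f)" if "i \<in> Basis" for i
    unfolding Ck_def
  proof (intro allI impI)
    fix "is" :: "R2 list" assume *: "set is \<subseteq> Basis \<and> length is \<le> k"
    show "continuous_on UNIV (ipdv is (pdv i f)) \<and> (length is < k --> (\<forall>j\<in>Basis. \<forall>x. (\<lambda>t. ipdv is (pdv i f) (x + t *\<^sub>R j)) differentiable at 0))"
      using L[unfolded Ck_def, rule_format, of "is @ [i]"] * that by (auto simp: ipdv_snoc)
  qed
  ultimately show "continuous_on UNIV f \<and>
     (\<forall>i\<in>Basis. (\<forall>x. (\<lambda>t. f (x + t *\<^sub>R i)) differentiable (at 0)) \<and> Ck k (pdv i f))" by blast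
next
  assume R: "continuous_on UNIV f \<and>
   (\<forall>i\<in>Basis. (\<forall>x. (\<lambda>t. f (x + t *\<^sub>R i)) differentiable (at 0)) \<and> Ck k (pdv i f))"
  show "Ck (Suc k) f"
    unfolding Ck_def
  proof (intro allI impI)
    fix "is" :: "R2 list" assume *: "set is \<subseteq> Basis \<and> length is \<le> Suc k"
    show "continuous_on UNIV (ipdv is f) \<and> (length is < Suc k --> (\<forall>j\<in>Basis. \<forall>x. (\<lambda>t. ipdv is f (x + t *\<^sub>R j)) differentiable at 0))"
    proof (cases "is" rule: rev_cases)
      case Nil
      then show ?thesis using R by auto
    next
      case (snoc js j)
      then have "Ck k (pdv j f)" using R * by auto
      from this[unfolded Ck_def, rule_format, of js] show ?thesis
        using snoc * by (auto simp: ipdv_snoc)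
    qed
  qed
qed

lemma Ck_cont: "Ck k f ==> continuous_on UNIV f"
  by (cases k) (auto simp: Ck_0 Ck_Suc)

lemma Ck_dec: "Ck (Suc k) f ==> Ck k f"
  by (auto simp: Ck_def)

lemma Ck_has_pdv:
  assumes "Ck (Suc k) f" "i \<in> Basis"
  shows "((\<lambda>t. f (x + t *\<^sub>R i)) has_real_derivative pdv i f (x + t *\<^sub>R i)) (at t)"
proof -
  have "((\<lambda>s. f ((x + t *\<^sub>R i) + s *\<^sub>R i)) has_real_derivative pdv i f (x + t *\<^sub>R i)) (at 0)"
    using assms unfolding pdv_def Ck_Suc DERIV_deriv_iff_real_differentiable by blast
  from DERIV_shift[of "\<lambda>s. f (x + s *\<^sub>R i)" "pdv i f (x + t *\<^sub>R i)" 0 t] this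
  show ?thesis by (simp add: algebra_simps)
qed

lemma pdv_eqI: "((\<lambda>t. f (x + t *\<^sub>R i)) has_real_derivative d) (at 0) ==> pdv i f x = d"
  unfolding pdv_def by (rule DERIV_imp_deriv)

lemma Ck_SucI:
  assumes "continuous_on UNIV f"
    and f': "\<And>i x. i \<in> Basis ==> ((\<lambda>t. f (x + t *\<^sub>R i)) has_real_derivative f' i x) (at 0)"
    and "\<And>i. i \<in> Basis ==> Ck k (f' i)"
  shows "Ck (Suc k) f"
  unfolding Ck_Suc
proof (intro conjI ballI)
  fix i :: R2 assume i: "i \<in> Basis"
  then have "pdv i f = f' i" by (intro ext pdv_eqI f')
  then show "Ck k (pdv i f)" using assms i by simp
  show "\<forall>x. (\<lambda>t. f (x + t *\<^sub>R i)) differentiable (at 0)"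
    using f'[OF i] by (auto simp: real_differentiable_def)
qed (fact assms)

lemma Ck_const: "Ck k (\<lambda>x. c)"
proof (induction k arbitrary: c)
  case (Suc k)
  show ?case
    by (rule Ck_SucI[where f'="\<lambda>i x. 0"]) (auto intro!: Suc)
qed (simp add: Ck_0)

lemma Ck_inner: "Ck k (\<lambda>x. x \<bullet> j)"
proof (cases k)
  case (Suc m)
  show ?thesis unfolding Suc
    by (rule Ck_SucI[where f'="\<lambda>i x. i \<bullet> j"])
       (auto intro!: continuous_intros Ck_const derivative_eq_intros simp: inner_add_left)
qed (auto simp: Ck_0 intro!: continuous_intros)

lemma Ck_add: "Ck k f ==> Ck k g ==> Ck k (\<lambda>x. f x + g x)"
proof (induction k arbitrary: f g)
  case (Suc k)
  show ?case
  proof (rule Ck_SucI[where f'="\<lambda>i x. pdv i f x + pdv i g x"])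
    show "continuous_on UNIV (\<lambda>x. f x + g x)" by (intro continuous_intros Suc.prems[THEN Ck_cont])
    fix i :: R2 assume i: "i \<in> Basis"
    show "((\<lambda>t. f (x + t *\<^sub>R i) + g (x + t *\<^sub>R i)) has_real_derivative pdv i f x + pdv i g x) (at 0)" for x
      using Ck_has_pdv[OF Suc.prems(1) i, of x 0] Ck_has_pdv[OF Suc.prems(2) i, of x 0] by (auto intro!: derivative_eq_intros)
    show "Ck k (\<lambda>x. pdv i f x + pdv i g x)" using Suc i by (auto simp: Ck_Suc)
  qed
qed (auto simp: Ck_0 intro!: continuous_intros)

lemma Ck_mult: "Ck k f ==> Ck k g ==> Ck k (\<lambda>x. f x * g x)"
proof (induction k arbitrary: f g)
  case (Suc k)
  show ?case
  proof (rule Ck_SucI[where f'="\<lambda>i x. f x * pdv i g x + pdv i f x * g x"])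
    show "continuous_on UNIV (\<lambda>x. f x * g x)" by (intro continuous_intros Suc.prems[THEN Ck_cont])
    fix i :: R2 assume i: "i \<in> Basis"
    show "((\<lambda>t. f (x + t *\<^sub>R i) * g (x + t *\<^sub>R i)) has_real_derivative f x * pdv i g x + pdv i f x * g x) (at 0)" for x
      using Ck_has_pdv[OF Suc.prems(1) i, of x 0] Ck_has_pdv[OF Suc.prems(2) i, of x 0] by (auto intro!: derivative_eq_intros)
    show "Ck k (\<lambda>x. f x * pdv i g x + pdv i f x * g x)" using Suc i by (auto simp: Ck_Suc intro!: Ck_add Suc.IH Ck_dec[of k f] Ck_dec[of k g])
  qed
qed (auto simp: Ck_0 intro!: continuous_intros)

text \<open>The outer function comes with all its derivatives as one sequence, so the chain rule
  stays inside the family: differentiating \<open>F n (q x)\<close> involves only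
  \<open>F (Suc n)\<close>.\<close>

lemma Ck_comp:
  assumes F: "\<And>n x. (F n has_real_derivative F (Suc n) x) (at x)"
  shows "Ck k q ==> Ck k (\<lambda>x. F n (q x))"
proof (induction k arbitrary: n)
  case 0
  have "continuous_on UNIV (F n)" using F by (meson DERIV_continuous_on has_field_derivative_at_within)
  from continuous_on_compose2[OF this Ck_cont[OF 0]] show ?case by (simp add: Ck_0)
next
  case (Suc k)
  show ?case
  proof (rule Ck_SucI[where f'="\<lambda>i x. F (Suc n) (q x) * pdv i q x"])
    have "continuous_on UNIV (F n)" using F by (meson DERIV_continuous_on has_field_derivative_at_within)
    from continuous_on_compose2[OF this Ck_cont[OF Suc.prems]]
    show "continuous_on UNIV (\<lambda>x. F n (q x))" by simp
    fix i :: R2 assume i: "i \<in> Basis"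
    show "((\<lambda>t. F n (q (x + t *\<^sub>R i))) has_real_derivative F (Suc n) (q x) * pdv i q x) (at 0)" for x
      using DERIV_chain2[OF F[of n] Ck_has_pdv[OF Suc.prems i, of x 0]] by simp
    have "Ck k (pdv i q)" using Suc.prems i by (simp add: Ck_Suc)
    then show "Ck k (\<lambda>x. F (Suc n) (q x) * pdv i q x)"
      by (intro Ck_mult[OF Suc.IH[OF Ck_dec[OF Suc.prems]]])
  qed
qed

lemma pdv_affine:
  assumes "Ck (Suc k) f" "i \<in> Basis"
  shows "((\<lambda>t. f (a + c *\<^sub>R (x + t *\<^sub>R i))) has_real_derivative c * pdv i f (a + c *\<^sub>R x)) (at 0)"
proof -
  have "((\<lambda>t. f ((a + c *\<^sub>R x) + (c * t) *\<^sub>R i)) has_real_derivative pdv i f ((a + c *\<^sub>R x) + (c * 0) *\<^sub>R i) * c) (at 0)"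
    by (rule DERIV_chain2[OF Ck_has_pdv[OF assms]]) (auto intro!: derivative_eq_intros)
  then show ?thesis by (simp add: algebra_simps)
qed

lemma Ck_affine: "Ck k f ==> Ck k (\<lambda>y. f (a + c *\<^sub>R y))"
proof (induction k arbitrary: f)
  case 0
  show ?case unfolding Ck_0
    by (rule continuous_on_compose2[OF Ck_cont[OF 0]]) (auto intro!: continuous_intros)
next
  case (Suc k)
  show ?case
  proof (rule Ck_SucI[where f'="\<lambda>i x. c * pdv i f (a + c *\<^sub>R x)"])
    show "continuous_on UNIV (\<lambda>y. f (a + c *\<^sub>R y))"
      by (rule continuous_on_compose2[OF Ck_cont[OF Suc.prems]]) (auto intro!: continuous_intros)
    fix i :: R2 assume i: "i \<in> Basis"
    show "Ck k (\<lambda>y. c * pdv i f (a + c *\<^sub>R y))"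
      using Suc i by (auto intro!: Ck_mult Ck_const simp: Ck_Suc[of _ f])
    show "((\<lambda>t. f (a + c *\<^sub>R (x + t *\<^sub>R i))) has_real_derivative c * pdv i f (a + c *\<^sub>R x)) (at 0)" for x
      by (rule pdv_affine[OF Suc.prems i])
  qed
qed

lemma smooth_pdv: "smooth f ==> i \<in> Basis ==> smooth (pdv i f)"
  unfolding smooth_def using Ck_Suc by blast

lemma R2_Basis: "(Basis :: R2 set) = {axis 1 1, axis 2 1}"
  by (auto simp: Basis_vec_def UNIV_2)

lemma axis_R2_neq: "axis 1 1 \<noteq> (axis 2 1 :: R2)"
  by (auto simp: axis_eq_axis)

lemma R2_sum_Basis: "(\<Sum>i\<in>(Basis::R2 set). f i) = f (axis 1 1) + f (axis 2 1)"
  by (simp add: R2_Basis axis_R2_neq)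

text \<open>The increment is split into a horizontal and a vertical leg; on each the mean value
  inequality applies, because the partial derivative is nearly constant close to
  \<open>x\<close>.\<close>

lemma Ck_has_derivative:
  assumes f: "Ck (Suc k) f"
  shows "(f has_derivative (\<lambda>v. \<Sum>i\<in>Basis. (v \<bullet> i) * pdv i f x)) (at x)"
proof -
  define e1 e2 :: R2 where "e1 = axis 1 1" and "e2 = axis 2 1"
  have B: "e1 \<in> Basis" "e2 \<in> Basis" by (auto simp: e1_def e2_def R2_Basis)
  have rep: "v = (v \<bullet> e1) *\<^sub>R e1 + (v \<bullet> e2) *\<^sub>R e2" for v :: R2
    using euclidean_representation[of v] by (simp add: R2_sum_Basis e1_def e2_def)
  have c: "isCont (pdv i f) x" if "i \<in> Basis" for i
    using f that Ck_cont by (auto simp: Ck_Suc continuous_on_eq_continuous_at)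
  show ?thesis
    unfolding has_derivative_at_alt
  proof (intro conjI allI impI)
    show "bounded_linear (\<lambda>v. \<Sum>i\<in>Basis. (v \<bullet> i) * pdv i f x)"
      by (intro bounded_linear_sum bounded_linear_mult_const bounded_linear_inner_left)
    fix e :: real assume e: "e > 0"
    have "\<exists>d>0. \<forall>y. dist y x < d --> dist (pdv i f y) (pdv i f x) < e / 2" if "i \<in> Basis" for i
      using c[OF that, unfolded continuous_at_eps_delta, rule_format, of "e/2"] e by auto
    then obtain d1 d2 where d: "d1 > 0" "d2 > 0"
      "\<And>y. dist y x < d1 ==> dist (pdv e1 f y) (pdv e1 f x) < e / 2"
      "\<And>y. dist y x < d2 ==> dist (pdv e2 f y) (pdv e2 f x) < e / 2"
      using B by meson
    \<comment> \<open>Mean value inequality for \<open>f (y + t *\<^sub>R i) - t * pdv i f x\<close>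
      as a function of \<open>t\<close>; each of the two legs may use half of the admissible error
      \<open>e\<close>.\<close>
    have seg: "\<bar>f (y + b *\<^sub>R i) - f y - b * pdv i f x\<bar> \<le> e / 2 * \<bar>b\<bar>"
      if i: "i \<in> Basis" and D: "\<And>t. \<bar>t\<bar> \<le> \<bar>b\<bar> ==> dist (pdv i f (y + t *\<^sub>R i)) (pdv i f x) < e / 2" for y b i
    proof -
      have "norm ((f (y + b *\<^sub>R i) - b * pdv i f x) - (f (y + 0 *\<^sub>R i) - 0 * pdv i f x)) \<le> (e/2) * norm (b - 0)"
      proof (rule field_differentiable_bound[where S="{-\<bar>b\<bar>..\<bar>b\<bar>}" and f="\<lambda>t. f (y + t *\<^sub>R i) - t * pdv i f x" and f'="\<lambda>t. pdv i f (y + t *\<^sub>R i) - pdv i f x"])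
        fix t assume "t \<in> {-\<bar>b\<bar>..\<bar>b\<bar>}"
        then show "norm (pdv i f (y + t *\<^sub>R i) - pdv i f x) \<le> e / 2"
          using D[of t] by (auto simp: dist_norm abs_le_iff)
        show "((\<lambda>t. f (y + t *\<^sub>R i) - t * pdv i f x) has_field_derivative pdv i f (y + t *\<^sub>R i) - pdv i f x) (at t within {-\<bar>b\<bar>..\<bar>b\<bar>})"
          using Ck_has_pdv[OF f i, of y t]
          by (auto intro!: derivative_eq_intros simp: has_field_derivative_at_within)
      qed auto
      then show ?thesis by (simp add: algebra_simps)
    qed
    show "\<exists>d>0. \<forall>y. norm (y - x) < d --> norm (f y - f x - (\<Sum>i\<in>Basis. ((y - x) \<bullet> i) * pdv i f x)) \<le> e * norm (y - x)"
    proof (intro exI[of _ "min d1 d2"] conjI allI impI)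
      fix y assume y: "norm (y - x) < min d1 d2"
      define a b where "a = (y - x) \<bullet> e1" and "b = (y - x) \<bullet> e2"
      have yx: "y = x + a *\<^sub>R e1 + b *\<^sub>R e2" using rep[of "y - x"] by (simp add: a_def b_def algebra_simps)
      have ab: "\<bar>a\<bar> \<le> norm (y - x)" "\<bar>b\<bar> \<le> norm (y - x)"
        unfolding a_def b_def using B by (auto intro: Basis_le_norm)
      have n2: "norm (a *\<^sub>R e1 + t *\<^sub>R e2) \<le> norm (y - x)" if "\<bar>t\<bar> \<le> \<bar>b\<bar>" for t
      proof -
        have o: "e1 \<bullet> e2 = 0" "e1 \<bullet> e1 = 1" "e2 \<bullet> e2 = 1" using B axis_R2_neq by (auto simp: inner_Basis e1_def e2_def)
        have "(norm (a *\<^sub>R e1 + s *\<^sub>R e2))\<^sup>2 = a^2 + s^2" for s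
          unfolding power2_norm_eq_inner
          by (simp add: inner_add_left inner_add_right o inner_commute[of e2 e1] power2_eq_square)
        then have "(norm (a *\<^sub>R e1 + t *\<^sub>R e2))\<^sup>2 \<le> (norm (a *\<^sub>R e1 + b *\<^sub>R e2))\<^sup>2"
          using that by (simp add: abs_le_square_iff)
        then show ?thesis using yx by (simp add: power2_le_iff_abs_le add.assoc)
      qed
      have "\<bar>f (x + a *\<^sub>R e1) - f x - a * pdv e1 f x\<bar> \<le> e / 2 * \<bar>a\<bar>"
      proof (rule seg[OF B(1)])
        fix t assume "\<bar>t\<bar> \<le> \<bar>a\<bar>"
        then have "dist (x + t *\<^sub>R e1) x < d1" using ab y B by (auto simp: dist_norm)
        then show "dist (pdv e1 f (x + t *\<^sub>R e1)) (pdv e1 f x) < e / 2" by (rule d)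
      qed
      moreover have "\<bar>f (x + a *\<^sub>R e1 + b *\<^sub>R e2) - f (x + a *\<^sub>R e1) - b * pdv e2 f x\<bar> \<le> e / 2 * \<bar>b\<bar>"
      proof (rule seg[OF B(2)])
        fix t assume "\<bar>t\<bar> \<le> \<bar>b\<bar>"
        then have "dist (x + a *\<^sub>R e1 + t *\<^sub>R e2) x < d2" using n2 y by (fastforce simp: dist_norm add.assoc)
        then show "dist (pdv e2 f (x + a *\<^sub>R e1 + t *\<^sub>R e2)) (pdv e2 f x) < e / 2" by (rule d)
      qed
      ultimately have "\<bar>f y - f x - (a * pdv e1 f x + b * pdv e2 f x)\<bar> \<le> e / 2 * \<bar>a\<bar> + e / 2 * \<bar>b\<bar>"
        unfolding yx by linarith
      also have "... \<le> e / 2 * norm (y - x) + e / 2 * norm (y - x)"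
        using ab e by (intro add_mono mult_left_mono) auto
      finally show "norm (f y - f x - (\<Sum>i\<in>Basis. ((y - x) \<bullet> i) * pdv i f x)) \<le> e * norm (y - x)"
        by (simp add: R2_sum_Basis a_def b_def e1_def e2_def)
    qed (use d in auto)
  qed
qed

section \<open>Closure properties of test functions\<close>

lemma test_funI:
  assumes "smooth \<phi>" "\<And>x. norm x > r ==> \<phi> x = 0"
  shows "test_fun \<phi>"
proof -
  have "{x. \<phi> x \<noteq> 0} \<subseteq> cball 0 r" using assms(2) by (force simp: not_less[symmetric])
  then have "bounded {x. \<phi> x \<noteq> 0}" using bounded_cball bounded_subset by blast
  then show ?thesis
    using assms(1) by (simp add: test_fun_def compact_eq_bounded_closed bounded_closure)
qed

lemma test_fun_support:
  assumes "test_fun \<phi>"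
  obtains r where "r > 0" "\<And>x. norm x > r ==> \<phi> x = 0"
proof -
  have "bounded (closure {x. \<phi> x \<noteq> 0})" using assms by (simp add: test_fun_def compact_imp_bounded)
  then obtain r where "\<forall>x\<in>closure {x. \<phi> x \<noteq> 0}. norm x \<le> r" "r > 0" using bounded_pos by blast
  then have "\<phi> x = 0" if "norm x > r" for x using that closure_subset[of "{x. \<phi> x \<noteq> 0}"] by force
  with \<open>r > 0\<close> show ?thesis by (rule that)
qed

lemma pdv_eq_0_outside:
  assumes "\<And>x. norm x > r ==> \<phi> x = 0" "norm x > r"
  shows "pdv i \<phi> x = 0"
proof -
  have "open {y::R2. norm y > r}" by (intro open_Collect_less continuous_intros)
  then have "open ((\<lambda>t. x + t *\<^sub>R i) -` {y. norm y > r})"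
    by (intro open_vimage continuous_intros)
  then have "\<forall>\<^sub>F t in nhds 0. t \<in> (\<lambda>t. x + t *\<^sub>R i) -` {y. norm y > r}"
    using assms by (intro eventually_nhds_in_open) auto
  then have "\<forall>\<^sub>F t in nhds 0. \<phi> (x + t *\<^sub>R i) = 0"
    by eventually_elim (use assms in auto)
  then have "pdv i \<phi> x = deriv (\<lambda>t. 0) (0::real)" unfolding pdv_def by (intro deriv_cong_ev) auto
  then show ?thesis by simp
qed

lemma test_fun_pdv: "test_fun \<phi> ==> i \<in> Basis ==> test_fun (pdv i \<phi>)"
  by (metis pdv_eq_0_outside smooth_pdv test_funI test_fun_def test_fun_support)

lemma test_fun_Ck: "test_fun \<phi> ==> Ck k \<phi>"
  by (simp add: test_fun_def smooth_def)

lemma test_fun_cont: "test_fun \<phi> ==> continuous_on UNIV \<phi>"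
  by (rule Ck_cont[OF test_fun_Ck])

lemma test_fun_has_pdv:
  "test_fun \<phi> ==> i \<in> Basis ==> ((\<lambda>t. \<phi> (x + t *\<^sub>R i)) has_real_derivative pdv i \<phi> (x + t *\<^sub>R i)) (at t)"
  by (rule Ck_has_pdv[OF test_fun_Ck])

lemma test_fun_borel: "test_fun \<phi> ==> \<phi> \<in> Bor"
  by (intro borel_measurable_continuous_onI test_fun_cont)

lemma test_fun_bounded:
  assumes "test_fun \<phi>" obtains B where "B > 0" "\<And>x. \<bar>\<phi> x\<bar> \<le> B"
proof -
  obtain r where r: "r > 0" "\<And>x. norm x > r ==> \<phi> x = 0" using test_fun_support[OF assms] by blast
  have "compact (\<phi> ` cball 0 r)"
    using test_fun_cont[OF assms] by (intro compact_continuous_image) (auto intro: continuous_on_subset)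
  then obtain B where B: "B > 0" "\<forall>y\<in>\<phi> ` cball 0 r. norm y \<le> B" using compact_imp_bounded bounded_pos by blast
  have "\<bar>\<phi> x\<bar> \<le> B" for x using B r(2)[of x] by (cases "norm x \<le> r") auto
  with B show ?thesis using that by blast
qed

lemma test_fun_mult_Ck:
  assumes "test_fun \<phi>" "\<And>k. Ck k f" shows "test_fun (\<lambda>x. f x * \<phi> x)"
proof -
  obtain r where "\<And>x. norm x > r ==> \<phi> x = 0" using test_fun_support[OF assms(1)] by blast
  then show ?thesis
    by (intro test_funI[where r=r]) (auto simp: smooth_def intro: Ck_mult assms test_fun_Ck)
qed

lemma test_fun_add:
  assumes "test_fun \<phi>" "test_fun \<psi>" shows "test_fun (\<lambda>x. \<phi> x + \<psi> x)"
proof -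
  obtain r where r: "\<And>x. norm x > r ==> \<phi> x = 0" using test_fun_support[OF assms(1)] by blast
  obtain s where s: "\<And>x. norm x > s ==> \<psi> x = 0" using test_fun_support[OF assms(2)] by blast
  show ?thesis
    by (intro test_funI[where r="max r s"]) (use r s in "auto simp: smooth_def intro: Ck_add assms test_fun_Ck")
qed

lemma test_fun_affine:
  assumes "test_fun \<phi>" "c \<noteq> 0" shows "test_fun (\<lambda>x. \<phi> (a + c *\<^sub>R x))"
proof -
  obtain r where r: "\<And>x. norm x > r ==> \<phi> x = 0" using test_fun_support[OF assms(1)] by blast
  show ?thesis
  proof (intro test_funI[where r="(r + norm a) / \<bar>c\<bar>"])
    fix x :: R2 assume "norm x > (r + norm a) / \<bar>c\<bar>"
    then have "\<bar>c\<bar> * norm x > r + norm a" using assms by (simp add: field_simps)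
    moreover have "\<bar>c\<bar> * norm x \<le> norm (a + c *\<^sub>R x) + norm a"
      using norm_triangle_ineq4[of "a + c *\<^sub>R x" a] by simp
    ultimately show "\<phi> (a + c *\<^sub>R x) = 0" by (intro r) auto
  qed (auto simp: smooth_def intro: Ck_affine assms test_fun_Ck)
qed

lemma pdv_test_affine:
  assumes "test_fun \<phi>" "i \<in> Basis"
  shows "pdv i (\<lambda>x. \<phi> (a + c *\<^sub>R x)) = (\<lambda>x. c * pdv i \<phi> (a + c *\<^sub>R x))"
  by (rule ext, rule pdv_eqI, rule pdv_affine[OF test_fun_Ck[OF assms(1)] assms(2)])

lemma pdv_cmult_test:
  assumes "test_fun \<phi>" "i \<in> Basis"
  shows "pdv i (\<lambda>x. c * \<phi> x) = (\<lambda>x. c * pdv i \<phi> x)"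
proof
  fix x
  show "pdv i (\<lambda>x. c * \<phi> x) x = c * pdv i \<phi> x"
    using test_fun_has_pdv[OF assms, of x 0] by (auto intro!: pdv_eqI derivative_eq_intros)
qed

lemma laplacian_test_affine:
  assumes "test_fun \<phi>" "c \<noteq> 0"
  shows "laplacian (\<lambda>x. \<phi> (a + c *\<^sub>R x)) x = c\<^sup>2 * laplacian \<phi> (a + c *\<^sub>R x)"
proof -
  have "pdv i (pdv i (\<lambda>x. \<phi> (a + c *\<^sub>R x))) x = c\<^sup>2 * pdv i (pdv i \<phi>) (a + c *\<^sub>R x)" if i: "i \<in> Basis" for i
    unfolding pdv_test_affine[OF assms(1) i]
      pdv_cmult_test[OF test_fun_affine[OF test_fun_pdv[OF assms(1) i] assms(2)] i]
      pdv_test_affine[OF test_fun_pdv[OF assms(1) i] i]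
    by (simp add: power2_eq_square)
  then show ?thesis by (simp add: laplacian_def sum_distrib_left)
qed

lemma test_fun_laplacian: assumes "test_fun \<phi>" shows "test_fun (laplacian \<phi>)"
  unfolding laplacian_def R2_sum_Basis
  by (intro test_fun_add test_fun_pdv assms) (auto simp: R2_Basis)

section \<open>The two radial kernels\<close>

definition euler :: "(R2 => real) => R2 => real" where
  "euler \<phi> z = (\<Sum>i\<in>Basis. (z \<bullet> i) * pdv i \<phi> z)"

lemma test_fun_euler: assumes "test_fun \<phi>" shows "test_fun (euler \<phi>)"
  unfolding euler_def R2_sum_Basis
  by (intro test_fun_add test_fun_mult_Ck test_fun_pdv Ck_inner assms) (auto simp: R2_Basis)

text \<open>The gradient of 1 - |z|^2 is -2 z; the factor 2 in \<open>\<rho>\<close> makes the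
  gradient of \<open>\<psi>\<close> equal to - z times \<open>\<rho>\<close>. Neither kernel is
  normalised, which keeps this relation free of constants.\<close>

definition \<psi> :: "R2 => real" where "\<psi> z = bump 0 (1 - z \<bullet> z)"
definition \<rho> :: "R2 => real" where "\<rho> z = 2 * bump (Suc 0) (1 - z \<bullet> z)"

lemma smooth_radial: "Ck k (\<lambda>z. bump n (1 - z \<bullet> z))"
proof -
  have "Ck k (\<lambda>z::R2. 1 + (-1) * (\<Sum>i\<in>Basis. (z \<bullet> i) * (z \<bullet> i)))"
    unfolding R2_sum_Basis by (intro Ck_add Ck_mult Ck_const Ck_inner)
  then have "Ck k (\<lambda>z::R2. 1 - z \<bullet> z)" by (simp add: euclidean_inner[symmetric])
  from Ck_comp[of bump, OF DERIV_bump this] show ?thesis .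
qed

lemma radial_outside: "norm z > 1 ==> bump n (1 - z \<bullet> z) = 0"
  by (cases "z \<bullet> z < 1") (auto simp: bump_def dot_square_norm power_less_one_iff abs_square_less_1)

lemma test_psi: "test_fun \<psi>"
  by (rule test_funI[where r=1]) (simp_all add: smooth_def \<psi>_def[abs_def] radial_outside smooth_radial)

lemma test_rho: "test_fun \<rho>"
proof (rule test_funI[where r=1])
  show "smooth \<rho>"
    unfolding smooth_def \<rho>_def[abs_def] by (intro allI Ck_mult[OF Ck_const smooth_radial])
qed (simp add: \<rho>_def radial_outside)

lemma psi_outside: "norm z > 1 ==> \<psi> z = 0" and rho_outside: "norm z > 1 ==> \<rho> z = 0"
  by (simp_all add: \<psi>_def \<rho>_def radial_outside)

lemma bump_1: "bump (Suc 0) t = (if t > 0 then (1 / t)\<^sup>2 * exp (- (1 / t)) else 0)"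
  by (simp add: bump_def poly_monom power_one_over)

lemma psi_nonneg: "\<psi> z \<ge> 0" by (simp add: \<psi>_def bump_def)
lemma rho_nonneg: "\<rho> z \<ge> 0" by (simp add: \<rho>_def bump_1)
lemma rho_pos: "norm z < 1 ==> \<rho> z > 0"
  using abs_square_less_1[of "norm z"]
  by (auto simp: \<rho>_def bump_1 dot_square_norm intro!: mult_pos_pos zero_less_power divide_pos_pos)
lemma psi_pos: "norm z < 1 ==> \<psi> z > 0"
  by (simp add: \<psi>_def bump_def dot_square_norm power_less_one_iff abs_square_less_1)

text \<open>Where \<open>\<psi>\<close> is positive, \<open>\<rho>\<close> carries the additional
  factor 2 / (1 - |z|^2)^2, which is at least 2. In the maximum principle this bounds averages
  against \<open>\<psi>\<close> by averages against \<open>\<rho>\<close>.\<close>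

lemma psi_le_rho: "2 * \<psi> z \<le> \<rho> z"
proof (cases "z \<bullet> z < 1")
  case True
  have "1 \<le> 1 / (1 - z \<bullet> z)" using True by simp
  then have "1 \<le> (1 / (1 - z \<bullet> z))\<^sup>2" by (rule one_le_power)
  then have "exp (- (1 / (1 - z \<bullet> z))) * 1 \<le> exp (- (1 / (1 - z \<bullet> z))) * (1 / (1 - z \<bullet> z))\<^sup>2" by (intro mult_left_mono) auto
  then show ?thesis using True by (simp add: \<psi>_def \<rho>_def bump_def[of 0] bump_1 mult.commute)
qed (simp add: \<psi>_def \<rho>_def bump_def)

lemma pdv_psi: assumes "i \<in> Basis" shows "pdv i \<psi> z = - (z \<bullet> i) * \<rho> z"
proof (rule pdv_eqI)
  have "((\<lambda>t. bump 0 (1 - (z + t *\<^sub>R i) \<bullet> (z + t *\<^sub>R i))) has_real_derivative bump (Suc 0) (1 - (z + 0 *\<^sub>R i) \<bullet> (z + 0 *\<^sub>R i)) * (- 2 * (z \<bullet> i))) (at 0)"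
    by (rule DERIV_chain2[OF DERIV_bump]) (auto intro!: derivative_eq_intros simp: inner_simps inner_commute[of i z])
  then show "((\<lambda>t. \<psi> (z + t *\<^sub>R i)) has_real_derivative - (z \<bullet> i) * \<rho> z) (at 0)"
    by (simp add: \<psi>_def \<rho>_def mult_ac)
qed

text \<open>The two radial profiles are tied by this identity; it turns the scale derivative of
  mollifications with \<^term>\<open>\<rho>\<close> into a Laplacian of mollifications with \<^term>\<open>\<psi>\<close>.\<close>

lemma laplacian_psi: "laplacian \<psi> z = - (2 * \<rho> z + euler \<rho> z)"
proof -
  have "pdv i (pdv i \<psi>) z = - (\<rho> z + (z \<bullet> i) * pdv i \<rho> z)" if i: "i \<in> Basis" for i
  proof -
    have "((\<lambda>t. - ((z + t *\<^sub>R i) \<bullet> i) * \<rho> (z + t *\<^sub>R i)) has_real_derivative - (\<rho> z + (z \<bullet> i) * pdv i \<rho> z)) (at 0)"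
      using test_fun_has_pdv[OF test_rho i, of z 0] i by (auto intro!: derivative_eq_intros simp: inner_simps)
    moreover have "pdv i \<psi> = (\<lambda>z. - (z \<bullet> i) * \<rho> z)" using pdv_psi[OF i] by auto
    ultimately show ?thesis by (auto intro: pdv_eqI)
  qed
  then show ?thesis unfolding laplacian_def euler_def R2_sum_Basis by (simp add: R2_Basis)
qed

section \<open>Mollification\<close>

text \<open>Domination is asked of the increments from \<open>t0\<close>, so differentiability is
  used at \<open>t0\<close> alone; dominated convergence of the difference quotients along sequences
  gives the derivative.\<close>

lemma has_real_derivative_integral:
  fixes F :: "real => 'a => real"
  assumes d: "d > 0"
    and int: "\<And>t. \<bar>t - t0\<bar> < d ==> integrable M (F t)"
    and [measurable]: "F' \<in> borel_measurable M"
    and der: "\<And>y. y \<in> space M ==> ((\<lambda>t. F t y) has_real_derivative F' y) (at t0)"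
    and lip: "\<And>t y. y \<in> space M ==> \<bar>t - t0\<bar> < d ==> \<bar>F t y - F t0 y\<bar> \<le> \<bar>t - t0\<bar> * w y"
    and w: "integrable M w"
  shows "((\<lambda>t. \<integral>y. F t y \<partial>M) has_real_derivative (\<integral>y. F' y \<partial>M)) (at t0)"
proof -
  have "((\<lambda>t. ((\<integral>y. F t y \<partial>M) - (\<integral>y. F t0 y \<partial>M)) / (t - t0)) \<longlongrightarrow> (\<integral>y. F' y \<partial>M)) (at t0 within ball t0 d)"
    unfolding tendsto_at_iff_sequentially
  proof (intro allI impI)
    fix X :: "nat => real" assume X: "\<forall>i. X i \<in> ball t0 d - {t0}" "X ----> t0"
    have Xd: "\<bar>X n - t0\<bar> < d" "X n \<noteq> t0" for n using X(1) by (auto simp: dist_real_def abs_minus_commute)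
    have [measurable]: "F (X n) \<in> borel_measurable M" "F t0 \<in> borel_measurable M" for n
      using int[OF Xd(1)[of n]] int[of t0] d by auto
    have "(\<lambda>n. \<integral>y. (F (X n) y - F t0 y) / (X n - t0) \<partial>M) ----> (\<integral>y. F' y \<partial>M)"
    proof (rule integral_dominated_convergence[where w=w])
      show "AE y in M. (\<lambda>n. (F (X n) y - F t0 y) / (X n - t0)) ----> F' y"
      proof (rule AE_I2)
        fix y assume "y \<in> space M"
        then have "((\<lambda>t. (F t y - F t0 y) / (t - t0)) \<longlongrightarrow> F' y) (at t0)"
          using der by (simp add: has_field_derivative_iff)
        then show "(\<lambda>n. (F (X n) y - F t0 y) / (X n - t0)) ----> F' y"
          using X(2) Xd(2) by (auto simp: tendsto_at_iff_sequentially comp_def)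
      qed
      show "AE y in M. norm ((F (X n) y - F t0 y) / (X n - t0)) \<le> w y" for n
        using lip[OF _ Xd(1)[of n]] Xd(2)[of n] by (auto intro!: AE_I2 simp: field_simps)
    qed (use w in auto)
    moreover have "(\<integral>y. (F (X n) y - F t0 y) / (X n - t0) \<partial>M) = ((\<integral>y. F (X n) y \<partial>M) - (\<integral>y. F t0 y \<partial>M)) / (X n - t0)" for n
      using int[OF Xd(1)[of n]] int[of t0] d by simp
    ultimately show "((\<lambda>t. ((\<integral>y. F t y \<partial>M) - (\<integral>y. F t0 y \<partial>M)) / (t - t0)) \<circ> X) ----> (\<integral>y. F' y \<partial>M)"
      by (simp only: comp_def)
  qed
  then show ?thesis
    using d by (simp add: has_field_derivative_iff at_within_open[of t0 "ball t0 d"])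
qed

section \<open>Locally integrable functions and their mollifications\<close>

definition locint :: "(R2 => real) => bool" where
  "locint f \<longleftrightarrow> f \<in> Bor \<and> (\<forall>r. set_integrable lborel (cball 0 r) f)"

lemma locint_borel [measurable_dest]: "locint f ==> f \<in> Bor"
  by (simp add: locint_def)

lemma locint_ball: "locint f ==> L1 (\<lambda>x. indicator (cball 0 r) x * f x)"
  by (simp add: locint_def set_integrable_def)

lemma locint_ball_abs: "locint f ==> L1 (\<lambda>x. indicator (cball 0 r) x * \<bar>f x\<bar>)"
  using integrable_norm[OF locint_ball] by (simp add: abs_mult)

lemma locint_mult:
  assumes f: "locint f" and k [measurable]: "k \<in> Bor"
    and B: "\<And>x. \<bar>k x\<bar> \<le> B" and r: "\<And>x. norm x > r ==> k x = 0"
  shows "L1 (\<lambda>x. f x * k x)"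
proof (rule L1_bound)
  show "L1 (\<lambda>x. B * (indicator (cball 0 r) x * \<bar>f x\<bar>))"
    by (intro integrable_mult_right locint_ball_abs f)
  note locint_borel[OF f, measurable]
  show "(\<lambda>x. f x * k x) \<in> borel_measurable lborel" by measurable
  have "\<bar>f x\<bar> * \<bar>k x\<bar> \<le> \<bar>B\<bar> * (indicator (cball 0 r) x * \<bar>f x\<bar>)" for x
  proof (cases "norm x \<le> r")
    case True
    have "\<bar>k x\<bar> \<le> \<bar>B\<bar>" using B[of x] by linarith
    then have "\<bar>f x\<bar> * \<bar>k x\<bar> \<le> \<bar>f x\<bar> * \<bar>B\<bar>" by (intro mult_left_mono) auto
    then show ?thesis using True by (simp add: mult.commute)
  qed (use r[of x] in "auto simp: not_le")
  then show "AE x in lborel. norm (f x * k x) \<le> norm (B * (indicator (cball 0 r) x * \<bar>f x\<bar>))"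
    by (auto simp: abs_mult)
qed

lemma locint_test: "locint f ==> test_fun \<phi> ==> L1 (\<lambda>x. f x * \<phi> x)"
  by (metis locint_mult test_fun_borel test_fun_bounded test_fun_support)

lemma cball_R2_borel [measurable]: "cball (a :: R2) r \<in> sets borel" by simp

lemma integrable_indicator_cball: "L1 (\<lambda>x::R2. indicator (cball a r) x :: real)"
  using emeasure_lborel_cball_finite by (intro integrable_real_indicator) auto

lemma locint_continuous: assumes "continuous_on UNIV f" shows "locint f"
proof -
  have [measurable]: "f \<in> Bor" using assms by (rule borel_measurable_continuous_onI)
  have "set_integrable lborel (cball 0 r) f" for r
    unfolding set_integrable_def
    using borel_integrable_compact[of "cball 0 r" f] assms
    by (simp add: continuous_on_subset)
  then show ?thesis by (simp add: locint_def)
qed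

lemma locint_L2:
  assumes [measurable]: "f \<in> Bor" and "\<And>r. L1 (\<lambda>x. indicator (cball 0 r) x * (f x)\<^sup>2)"
  shows "locint f"
  unfolding locint_def set_integrable_def
proof (intro conjI allI)
  fix r
  show "L1 (\<lambda>x. indicat_real (cball 0 r) x *\<^sub>R f x)"
  proof (rule L1_bound)
    show "L1 (\<lambda>x. indicator (cball 0 r) x + indicator (cball 0 r) x * (f x)\<^sup>2)"
      by (intro L1_add assms integrable_indicator_cball)
    have "\<bar>a\<bar> \<le> 1 + a\<^sup>2" for a :: real
      using sum_squares_bound[of "\<bar>a\<bar>" 1] by (simp add: power2_eq_square)
    then show "AE x in lborel. norm (indicat_real (cball 0 r) x *\<^sub>R f x) \<le> norm (indicator (cball 0 r) x + indicator (cball 0 r) x * (f x)\<^sup>2)"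
      by (auto intro!: AE_I2 simp: indicator_def)
    show "(\<lambda>x. indicat_real (cball 0 r) x *\<^sub>R f x) \<in> borel_measurable lborel"
      using assms(1) by (intro borel_measurable_scaleR borel_measurable_indicator) auto
  qed
qed (fact assms(1))

lemma test_locint: "test_fun \<phi> ==> locint \<phi>"
  by (rule locint_continuous[OF test_fun_cont])

lemma test_integrable:
  assumes "test_fun \<phi>" shows "integrable lborel \<phi>"
  using locint_test[OF locint_continuous[of "\<lambda>_. 1"] assms] by simp

lemma test_fun_abs_integrable:
  assumes "test_fun \<phi>" shows "L1 (\<lambda>x. \<bar>\<phi> x\<bar>)"
  using integrable_norm[OF test_integrable[OF assms]] by simp

lemma test_integrable_sq:
  assumes "test_fun \<phi>" shows "L1 (\<lambda>x. (\<phi> x)\<^sup>2)"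
  using locint_test[OF test_locint[OF assms] assms] by (simp add: power2_eq_square)

lemma lborel_integral_affine:
  fixes F :: "'a::euclidean_space => 'b::{banach, second_countable_topology}"
  assumes [measurable]: "F \<in> Bor" and c: "c \<noteq> 0"
  shows "(LBINT y. F y) = \<bar>c\<bar> ^ DIM('a) *\<^sub>R (LBINT z. F (t + c *\<^sub>R z))"
    and "integrable lborel F \<longleftrightarrow> L1 (\<lambda>z. F (t + c *\<^sub>R z))"
proof -
  have m [measurable]: "(\<lambda>x. t + c *\<^sub>R x) \<in> borel \<rightarrow>\<^sub>M borel" by measurable
  have "(LBINT y. F y) = (\<integral>y. F y \<partial>density (distr lborel borel (\<lambda>x. t + c *\<^sub>R x)) (\<lambda>_. ennreal (\<bar>c\<bar> ^ DIM('a))))"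
    using lborel_affine[OF c, of t] by (simp add: ennreal_power)
  also have "... = \<bar>c\<bar> ^ DIM('a) *\<^sub>R (LBINT z. F (t + c *\<^sub>R z))"
    by (subst integral_density) (auto simp: integral_distr)
  finally show "(LBINT y. F y) = \<bar>c\<bar> ^ DIM('a) *\<^sub>R (LBINT z. F (t + c *\<^sub>R z))" .
  have "integrable lborel F \<longleftrightarrow> integrable (density (distr lborel borel (\<lambda>x. t + c *\<^sub>R x)) (\<lambda>_. ennreal (\<bar>c\<bar> ^ DIM('a)))) F"
    using lborel_affine[OF c, of t] by (simp add: ennreal_power)
  also have "... \<longleftrightarrow> L1 (\<lambda>z. F (t + c *\<^sub>R z))"
  proof (subst integrable_density)
    have "L1 (\<lambda>x. \<bar>c\<bar> ^ DIM('a) *\<^sub>R F (t + c *\<^sub>R x)) \<longleftrightarrow> L1 (\<lambda>z. F (t + c *\<^sub>R z))"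
    proof
      assume "L1 (\<lambda>x. \<bar>c\<bar> ^ DIM('a) *\<^sub>R F (t + c *\<^sub>R x))"
      from integrable_scaleR_right[OF this, of "inverse (\<bar>c\<bar> ^ DIM('a))"]
      show "L1 (\<lambda>z. F (t + c *\<^sub>R z))" using c by simp
    qed simp
    then show "integrable (distr lborel borel (\<lambda>x. t + c *\<^sub>R x)) (\<lambda>x. \<bar>c\<bar> ^ DIM('a) *\<^sub>R F x) \<longleftrightarrow> L1 (\<lambda>z. F (t + c *\<^sub>R z))"
      by (simp add: integrable_distr_eq)
  qed auto
  finally show "integrable lborel F \<longleftrightarrow> L1 (\<lambda>z. F (t + c *\<^sub>R z))" .
qed

lemma DIM_R2: "DIM(R2) = 2" by simp

text \<open>The scale sits in the argument of \<open>f\<close>, so no power of \<open>s\<close>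
  appears and the limit at scale zero is \<open>f\<close> times the integral of
  \<open>\<phi>\<close>. With the scale on the kernel, as in \<open>mol_kernel\<close>, the plane
  contributes the factor \<open>1 / s\<^sup>2\<close>.\<close>

definition mol :: "(R2 => real) => real => (R2 => real) => R2 => real" where
  "mol \<phi> s f x = (LBINT z. f (x - s *\<^sub>R z) * \<phi> z)"

lemma mol_kernel:
  assumes [measurable]: "f \<in> Bor" "\<phi> \<in> Bor" and s: "s > 0"
  shows "mol \<phi> s f x = (LBINT y. f y * \<phi> ((1 / s) *\<^sub>R (x - y))) / s\<^sup>2"
  using lborel_integral_affine(1)[of "\<lambda>y. f y * \<phi> ((1 / s) *\<^sub>R (x - y))" "- s" x] s
  by (simp add: mol_def DIM_R2)

lemma test_kernel:
  assumes "test_fun \<phi>" "s > 0"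
  shows "test_fun (\<lambda>y. \<phi> ((1 / s) *\<^sub>R (x - y)))"
proof -
  have "(\<lambda>y. \<phi> ((1 / s) *\<^sub>R (x - y))) = (\<lambda>y. \<phi> ((1 / s) *\<^sub>R x + (- (1 / s)) *\<^sub>R y))"
    by (simp add: scaleR_diff_right)
  then show ?thesis using test_fun_affine[OF assms(1), of "- (1/s)" "(1/s) *\<^sub>R x"] assms by simp
qed

lemma pdv_kernel:
  assumes "test_fun \<phi>" "i \<in> Basis"
  shows "pdv i (\<lambda>y. \<phi> ((1 / s) *\<^sub>R (x - y))) = (\<lambda>y. - (1 / s) * pdv i \<phi> ((1 / s) *\<^sub>R (x - y)))"
  using pdv_test_affine[OF assms, of "(1/s) *\<^sub>R x" "- (1/s)"] by (simp add: scaleR_diff_right)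

lemma laplacian_kernel:
  assumes "test_fun \<phi>" "s > 0"
  shows "laplacian (\<lambda>y. \<phi> ((1 / s) *\<^sub>R (x - y))) y = laplacian \<phi> ((1 / s) *\<^sub>R (x - y)) / s\<^sup>2"
  using laplacian_test_affine[OF assms(1), of "- (1/s)" "(1/s) *\<^sub>R x" y] assms(2)
  by (simp add: scaleR_diff_right power_divide)

lemma mol_integrable:
  assumes "locint f" "test_fun \<phi>" "s > 0"
  shows "L1 (\<lambda>z. f (x - s *\<^sub>R z) * \<phi> z)"
  using lborel_integral_affine(2)[of "\<lambda>y. f y * \<phi> ((1 / s) *\<^sub>R (x - y))" "- s" x]
    locint_test[OF assms(1) test_kernel[OF assms(2,3), of x]] assms locint_borel[OF assms(1)] test_fun_borel[OF assms(2)]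
  by simp

lemma mol_add:
  assumes "locint f" "test_fun \<phi>" "test_fun \<xi>" "s > 0"
  shows "mol (\<lambda>z. \<phi> z + \<xi> z) s f x = mol \<phi> s f x + mol \<xi> s f x"
  unfolding mol_def using assms
  by (subst Bochner_Integration.integral_add[symmetric]) (auto intro: mol_integrable simp: distrib_left)

lemma mol_cmult: "mol (\<lambda>z. c * \<phi> z) s f x = c * mol \<phi> s f x"
  by (simp add: mol_def mult.left_commute)

lemma Ck_lipschitz:
  assumes f: "Ck (Suc k) f" and B: "\<And>i x. i \<in> Basis ==> \<bar>pdv i f x\<bar> \<le> B"
  shows "\<bar>f x - f y\<bar> \<le> 2 * B * norm (x - y)"
proof -
  have on: "onorm (\<lambda>v. \<Sum>i\<in>Basis. (v \<bullet> i) * pdv i f x) \<le> 2 * B" for x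
  proof (rule onorm_le)
    fix v :: R2
    have "\<bar>(v \<bullet> i) * pdv i f x\<bar> \<le> norm v * B" if "i \<in> Basis" for i
      unfolding abs_mult using B[OF that, of x] Basis_le_norm[OF that, of v] by (intro mult_mono) auto
    then have "(\<Sum>i\<in>Basis. \<bar>(v \<bullet> i) * pdv i f x\<bar>) \<le> (\<Sum>i\<in>(Basis::R2 set). norm v * B)" by (rule sum_mono)
    also have "... = 2 * B * norm v" by simp
    finally show "norm (\<Sum>i\<in>Basis. (v \<bullet> i) * pdv i f x) \<le> 2 * B * norm v"
      unfolding real_norm_def by (rule order_trans[OF sum_abs])
  qed
  have "norm (f x - f y) \<le> 2 * B * norm (x - y)"
    by (rule differentiable_bound[of UNIV f "\<lambda>x v. \<Sum>i\<in>Basis. (v \<bullet> i) * pdv i f x"])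
       (use Ck_has_derivative[OF f] on in auto)
  then show ?thesis by simp
qed

lemma test_fun_lipschitz:
  assumes "test_fun \<phi>" obtains L where "L > 0" "\<And>x y. \<bar>\<phi> x - \<phi> y\<bar> \<le> L * norm (x - y)"
proof -
  obtain B1 where B1: "B1 > 0" "\<And>x. \<bar>pdv (axis 1 1) \<phi> x\<bar> \<le> B1"
    using test_fun_bounded[OF test_fun_pdv[OF assms, of "axis 1 1"]] by (auto simp: R2_Basis)
  obtain B2 where B2: "B2 > 0" "\<And>x. \<bar>pdv (axis 2 1) \<phi> x\<bar> \<le> B2"
    using test_fun_bounded[OF test_fun_pdv[OF assms, of "axis 2 1"]] by (auto simp: R2_Basis)
  have "\<bar>pdv i \<phi> x\<bar> \<le> max B1 B2" if "i \<in> Basis" for i x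
    using that B1(2)[of x] B2(2)[of x] by (auto simp: R2_Basis)
  from Ck_lipschitz[OF test_fun_Ck[OF assms] this] show ?thesis
    using that[of "2 * max B1 B2"] B1 by auto
qed

lemma less_norm_scaleR: "s > 0 ==> s * r < norm v ==> r < norm ((1 / s) *\<^sub>R v)" for s :: real
  by (simp add: field_simps)

text \<open>The derivative falls on the kernel, so local integrability of \<open>f\<close> is
  enough; each derivative costs one power of the scale.\<close>

lemma mol_has_pdv:
  assumes f: "locint f" and \<phi>: "test_fun \<phi>" and s: "s > 0" and i: "i \<in> Basis"
  shows "((\<lambda>t. mol \<phi> s f (x + t *\<^sub>R i)) has_real_derivative mol (pdv i \<phi>) s f (x + t *\<^sub>R i) / s) (at t)"
proof -
  note [measurable] = locint_borel[OF f] test_fun_borel[OF \<phi>] test_fun_borel[OF test_fun_pdv[OF \<phi> i]]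
  obtain r where r: "r > 0" "\<And>x. norm x > r ==> \<phi> x = 0" using test_fun_support[OF \<phi>] by blast
  obtain L where L: "L > 0" "\<And>x y. \<bar>\<phi> x - \<phi> y\<bar> \<le> L * norm (x - y)" using test_fun_lipschitz[OF \<phi>] by blast
  \<comment> \<open>Outside this ball the kernel vanishes for every parameter within distance 1 of
    \<open>t\<close>, so one integrable majorant serves all difference quotients.\<close>
  define R where "R = norm x + \<bar>t\<bar> + 1 + s * r"
  have supp: "\<phi> ((1 / s) *\<^sub>R (x + u *\<^sub>R i - y)) = 0" if "norm y > R" "\<bar>u - t\<bar> < 1" for u y
  proof (rule r(2))
    have "norm y \<le> norm (x + u *\<^sub>R i - y) + norm x + \<bar>u\<bar>"
      using norm_triangle_ineq4[of "x + u *\<^sub>R i" "x + u *\<^sub>R i - y"] norm_triangle_ineq[of x "u *\<^sub>R i"] i by simp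
    then have "norm (x + u *\<^sub>R i - y) > s * r" using that by (auto simp: R_def)
    with s show "r < norm ((1 / s) *\<^sub>R (x + u *\<^sub>R i - y))" by (rule less_norm_scaleR)
  qed
  have "((\<lambda>t. LBINT y. f y * \<phi> ((1 / s) *\<^sub>R (x + t *\<^sub>R i - y))) has_real_derivative
      (LBINT y. f y * (pdv i \<phi> ((1 / s) *\<^sub>R (x + t *\<^sub>R i - y)) / s))) (at t)"
  proof (rule has_real_derivative_integral[where d=1 and w="\<lambda>y. L / s * (indicator (cball 0 R) y * \<bar>f y\<bar>)"])
    show "L1 (\<lambda>y. f y * \<phi> ((1 / s) *\<^sub>R (x + u *\<^sub>R i - y)))" for u
      by (intro locint_test f test_kernel \<phi> s)
    show "((\<lambda>t. f y * \<phi> ((1 / s) *\<^sub>R (x + t *\<^sub>R i - y))) has_real_derivative f y * (pdv i \<phi> ((1 / s) *\<^sub>R (x + t *\<^sub>R i - y)) / s)) (at t)" for y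
    proof -
      have "((\<lambda>u. \<phi> ((1 / s) *\<^sub>R (x - y) + (u / s) *\<^sub>R i)) has_real_derivative pdv i \<phi> ((1 / s) *\<^sub>R (x - y) + (t / s) *\<^sub>R i) * (1 / s)) (at t)"
        by (rule DERIV_chain2[OF test_fun_has_pdv[OF \<phi> i]]) (use s in "auto intro!: derivative_eq_intros")
      moreover have "(1 / s) *\<^sub>R (x - y) + (u / s) *\<^sub>R i = (1 / s) *\<^sub>R (x + u *\<^sub>R i - y)" for u
        by (simp add: algebra_simps)
      ultimately have "((\<lambda>u. \<phi> ((1 / s) *\<^sub>R (x + u *\<^sub>R i - y))) has_real_derivative pdv i \<phi> ((1 / s) *\<^sub>R (x + t *\<^sub>R i - y)) * (1 / s)) (at t)"
        by simp
      from DERIV_cmult[OF this, of "f y"] show ?thesis by simp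
    qed
    show "\<bar>f y * \<phi> ((1 / s) *\<^sub>R (x + u *\<^sub>R i - y)) - f y * \<phi> ((1 / s) *\<^sub>R (x + t *\<^sub>R i - y))\<bar> \<le> \<bar>u - t\<bar> * (L / s * (indicator (cball 0 R) y * \<bar>f y\<bar>))"
      if "\<bar>u - t\<bar> < 1" for u y
    proof (cases "norm y \<le> R")
      case True
      have "(1 / s) *\<^sub>R (x + u *\<^sub>R i - y) - (1 / s) *\<^sub>R (x + t *\<^sub>R i - y) = ((u - t) / s) *\<^sub>R i"
        by (simp add: algebra_simps diff_divide_distrib)
      then have "\<bar>\<phi> ((1 / s) *\<^sub>R (x + u *\<^sub>R i - y)) - \<phi> ((1 / s) *\<^sub>R (x + t *\<^sub>R i - y))\<bar> \<le> L * (\<bar>u - t\<bar> / s)"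
        using L(2)[of "(1 / s) *\<^sub>R (x + u *\<^sub>R i - y)" "(1 / s) *\<^sub>R (x + t *\<^sub>R i - y)"] i s by simp
      then have "\<bar>f y\<bar> * \<bar>\<phi> ((1 / s) *\<^sub>R (x + u *\<^sub>R i - y)) - \<phi> ((1 / s) *\<^sub>R (x + t *\<^sub>R i - y))\<bar> \<le> \<bar>f y\<bar> * (L * (\<bar>u - t\<bar> / s))"
        by (intro mult_left_mono) auto
      then show ?thesis using True by (simp add: right_diff_distrib[symmetric] abs_mult mult_ac)
    qed (use supp that in auto)
    show "L1 (\<lambda>y. L / s * (indicator (cball 0 R) y * \<bar>f y\<bar>))"
      by (intro integrable_mult_right locint_ball_abs f)
  qed (use s in auto)
  from DERIV_cdivide[OF this, of "s\<^sup>2"] show ?thesis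
    using s by (simp add: mol_kernel divide_simps mult_ac)
qed

text \<open>With the scale on the kernel, \<open>mol\<close> is an integral divided by
  \<open>s\<^sup>2\<close>. Differentiating the dilated kernel gives \<open>euler\<close>, the
  generator of dilations; differentiating the denominator gives \<open>2 * \<phi>\<close>, where 2
  is the dimension.\<close>

lemma mol_has_sderiv:
  assumes f: "locint f" and \<phi>: "test_fun \<phi>" and s: "s > 0"
  shows "((\<lambda>s. mol \<phi> s f x) has_real_derivative - (mol (\<lambda>z. 2 * \<phi> z + euler \<phi> z) s f x / s)) (at s)"
proof -
  note [measurable] = locint_borel[OF f] test_fun_borel[OF \<phi>] test_fun_borel[OF test_fun_euler[OF \<phi>]]
  obtain r where r: "r > 0" "\<And>x. norm x > r ==> \<phi> x = 0" using test_fun_support[OF \<phi>] by blast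
  obtain L where L: "L > 0" "\<And>x y. \<bar>\<phi> x - \<phi> y\<bar> \<le> L * norm (x - y)" using test_fun_lipschitz[OF \<phi>] by blast
  define R where "R = norm x + 2 * s * r"
  have supp: "\<phi> ((1 / u) *\<^sub>R (x - y)) = 0" if "norm (x - y) > 2 * s * r" "\<bar>u - s\<bar> < s / 2" for u y
  proof (rule r(2))
    have u: "u > 0" "u < 2 * s" using that(2) s by linarith+
    then have "u * r < 2 * s * r" using r by simp
    then have "u * r < norm (x - y)" using that by simp
    with u(1) show "r < norm ((1 / u) *\<^sub>R (x - y))" by (rule less_norm_scaleR)
  qed
  have D: "((\<lambda>s. LBINT y. f y * \<phi> ((1 / s) *\<^sub>R (x - y))) has_real_derivative
      (LBINT y. f y * (- (euler \<phi> ((1 / s) *\<^sub>R (x - y)) / s)))) (at s)"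
  \<comment> \<open>For |u - s| < s/2 the scale \<open>u\<close> lies between s/2 and 2 s. Hence all
    kernels are supported in |x - y| \<le> 2 s r, and there |1/u - 1/s| |x - y| \<le> 4 r |u - s| /
    s, which gives the majorant.\<close>
  proof (rule has_real_derivative_integral[where d="s/2" and w="\<lambda>y. 4 * r * L / s * (indicator (cball 0 R) y * \<bar>f y\<bar>)"])
    show "L1 (\<lambda>y. f y * \<phi> ((1 / u) *\<^sub>R (x - y)))" if "\<bar>u - s\<bar> < s/2" for u
      using that s by (intro locint_test f test_kernel \<phi>) linarith
    show "((\<lambda>s. f y * \<phi> ((1 / s) *\<^sub>R (x - y))) has_real_derivative f y * (- (euler \<phi> ((1 / s) *\<^sub>R (x - y)) / s))) (at s)" for y
    proof -
      have "((\<lambda>s. \<phi> ((1 / s) *\<^sub>R (x - y))) has_derivative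
          (\<lambda>v. \<Sum>i\<in>Basis. ((- (v / s\<^sup>2)) *\<^sub>R (x - y) \<bullet> i) * pdv i \<phi> ((1 / s) *\<^sub>R (x - y)))) (at s)"
      proof (rule has_derivative_compose[OF _ Ck_has_derivative[OF test_fun_Ck[OF \<phi>]]])
        show "((\<lambda>s. (1 / s) *\<^sub>R (x - y)) has_derivative (\<lambda>v. (- (v / s\<^sup>2)) *\<^sub>R (x - y))) (at s)"
          using s by (auto intro!: derivative_eq_intros simp: power2_eq_square divide_inverse)
      qed
      moreover have "(\<lambda>v. \<Sum>i\<in>Basis. ((- (v / s\<^sup>2)) *\<^sub>R (x - y) \<bullet> i) * pdv i \<phi> ((1 / s) *\<^sub>R (x - y))) = (*) (- (euler \<phi> ((1 / s) *\<^sub>R (x - y)) / s))"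
      proof -
        define a where "a = x - y"
        show ?thesis unfolding a_def[symmetric]
          using s by (auto simp: euler_def R2_sum_Basis field_simps power2_eq_square)
      qed
      ultimately have "((\<lambda>s. \<phi> ((1 / s) *\<^sub>R (x - y))) has_real_derivative (- (euler \<phi> ((1 / s) *\<^sub>R (x - y)) / s))) (at s)"
        by (simp add: has_field_derivative_def)
      from DERIV_cmult[OF this, of "f y"] show ?thesis .
    qed
    show "\<bar>f y * \<phi> ((1 / u) *\<^sub>R (x - y)) - f y * \<phi> ((1 / s) *\<^sub>R (x - y))\<bar> \<le> \<bar>u - s\<bar> * (4 * r * L / s * (indicator (cball 0 R) y * \<bar>f y\<bar>))"
      if u: "\<bar>u - s\<bar> < s/2" for u y
    proof (cases "norm (x - y) \<le> 2 * s * r")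
      case True
      have u0: "u > s / 2" using u s by linarith
      have "norm y \<le> R" using True norm_triangle_ineq4[of x "x - y"] by (simp add: R_def)
      have "\<bar>1 / u - 1 / s\<bar> = \<bar>u - s\<bar> / (u * s)"
        using u0 s by (simp add: field_simps abs_div_pos[symmetric] abs_minus_commute)
      also have "... \<le> \<bar>u - s\<bar> / (s / 2 * s)" using u0 s by (intro divide_left_mono mult_right_mono) auto
      finally have "\<bar>1 / u - 1 / s\<bar> * norm (x - y) \<le> \<bar>u - s\<bar> / (s / 2 * s) * (2 * s * r)"
        using True s by (intro mult_mono) auto
      also have "... = 4 * r / s * \<bar>u - s\<bar>" using s by (simp add: field_simps)
      finally have *: "\<bar>1 / u - 1 / s\<bar> * norm (x - y) \<le> 4 * r / s * \<bar>u - s\<bar>" .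
      have "\<bar>\<phi> ((1 / u) *\<^sub>R (x - y)) - \<phi> ((1 / s) *\<^sub>R (x - y))\<bar> \<le> L * (4 * r / s * \<bar>u - s\<bar>)"
        using L(2)[of "(1 / u) *\<^sub>R (x - y)" "(1 / s) *\<^sub>R (x - y)"] mult_left_mono[OF *, of L] L(1)
        by (simp add: scaleR_diff_left[symmetric])
      then have "\<bar>f y\<bar> * \<bar>\<phi> ((1 / u) *\<^sub>R (x - y)) - \<phi> ((1 / s) *\<^sub>R (x - y))\<bar> \<le> \<bar>f y\<bar> * (L * (4 * r / s * \<bar>u - s\<bar>))"
        by (intro mult_left_mono) auto
      then show ?thesis using \<open>norm y \<le> R\<close> by (simp add: right_diff_distrib[symmetric] abs_mult mult_ac)
    next
      case False
      then show ?thesis using supp[of y u] supp[of y s] u L r s by simp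
    qed
    show "L1 (\<lambda>y. 4 * r * L / s * (indicator (cball 0 R) y * \<bar>f y\<bar>))"
      by (intro integrable_mult_right locint_ball_abs f)
  qed (use s in auto)
  define N where "N = (\<lambda>s. LBINT y. f y * \<phi> ((1 / s) *\<^sub>R (x - y)))"
  have N': "(LBINT y. f y * (- (euler \<phi> ((1 / s) *\<^sub>R (x - y)) / s))) = - s * mol (euler \<phi>) s f x"
    using s by (simp add: mol_kernel power2_eq_square)
  have "((\<lambda>s. N s / s\<^sup>2) has_real_derivative ((- s * mol (euler \<phi>) s f x) * s\<^sup>2 - N s * (2 * s)) / (s\<^sup>2 * s\<^sup>2)) (at s)"
    using D s unfolding N_def[symmetric] N' by (auto intro!: derivative_eq_intros)
  moreover have "((- s * mol (euler \<phi>) s f x) * s\<^sup>2 - N s * (2 * s)) / (s\<^sup>2 * s\<^sup>2) = - (mol (\<lambda>z. 2 * \<phi> z + euler \<phi> z) s f x / s)"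
  proof -
    have "mol (\<lambda>z. 2 * \<phi> z + euler \<phi> z) s f x = 2 * mol \<phi> s f x + mol (euler \<phi>) s f x"
      using mol_add[OF f test_fun_mult_Ck[OF \<phi> Ck_const[of _ 2]] test_fun_euler[OF \<phi>] s] by (simp add: mol_cmult)
    moreover have "mol \<phi> s f x = N s / s\<^sup>2" using s by (simp add: mol_kernel N_def)
    ultimately show ?thesis using s by (simp add: field_simps power2_eq_square)
  qed
  ultimately have "((\<lambda>s. N s / s\<^sup>2) has_real_derivative - (mol (\<lambda>z. 2 * \<phi> z + euler \<phi> z) s f x / s)) (at s)" by simp
  then show ?thesis
    by (rule has_field_derivative_transform_within_open[of _ _ _ "{0<..}"]) (use s in "auto simp: N_def mol_kernel")
qed

text \<open>The dilation derivative of \<open>\<rho>\<close> is, up to sign, the Laplacian of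
  \<open>\<psi>\<close>. In this form integration by parts can move one derivative to
  \<open>f\<close>, for Sobolev functions, or both, for functions with a weak Laplacian.\<close>

lemma mol_rho_has_sderiv:
  assumes f: "locint f" and s: "s > 0"
  shows "((\<lambda>s. mol \<rho> s f x) has_real_derivative mol (laplacian \<psi>) s f x / s) (at s)"
proof -
  have "mol (laplacian \<psi>) s f x = - mol (\<lambda>z. 2 * \<rho> z + euler \<rho> z) s f x"
    unfolding mol_def laplacian_psi by (simp only: mult_minus_right Bochner_Integration.integral_minus)
  then show ?thesis using mol_has_sderiv[OF f test_rho s, of x] by simp
qed

lemma mol_joint_borel [measurable (raw)]:
  fixes s :: "'a => real" and x :: "'a => R2"
  assumes [measurable]: "f \<in> Bor" "\<phi> \<in> Bor" "s \<in> borel_measurable M" "x \<in> borel_measurable M"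
  shows "(\<lambda>w. mol \<phi> (s w) f (x w)) \<in> borel_measurable M"
  unfolding mol_def by measurable

lemma mol_continuous:
  assumes f: "locint f" and \<phi>: "test_fun \<phi>" and s: "s > 0"
  shows "continuous_on UNIV (mol \<phi> s f)"
  unfolding continuous_on_sequentially
proof (intro ballI allI impI, elim conjE)
  fix X :: "nat => R2" and x assume X: "X ----> x"
  note [measurable] = locint_borel[OF f] test_fun_borel[OF \<phi>]
  obtain r where r: "r > 0" "\<And>x. norm x > r ==> \<phi> x = 0" using test_fun_support[OF \<phi>] by blast
  obtain B where B: "B > 0" "\<And>x. \<bar>\<phi> x\<bar> \<le> B" using test_fun_bounded[OF \<phi>] by blast
  obtain C where C: "\<And>n. norm (X n) \<le> C" using convergent_imp_Bseq[OF convergentI[OF X]] by (auto simp: Bseq_def)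
  define R where "R = C + s * r"
  have "(\<lambda>n. LBINT y. f y * \<phi> ((1 / s) *\<^sub>R (X n - y))) ----> (LBINT y. f y * \<phi> ((1 / s) *\<^sub>R (x - y)))"
  proof (rule integral_dominated_convergence[where w="\<lambda>y. B * (indicator (cball 0 R) y * \<bar>f y\<bar>)"])
    show "L1 (\<lambda>y. B * (indicator (cball 0 R) y * \<bar>f y\<bar>))"
      by (intro integrable_mult_right locint_ball_abs f)
    have "isCont \<phi> y" for y using test_fun_cont[OF \<phi>] by (simp add: continuous_on_eq_continuous_at)
    then show "AE y in lborel. (\<lambda>n. f y * \<phi> ((1 / s) *\<^sub>R (X n - y))) ----> f y * \<phi> ((1 / s) *\<^sub>R (x - y))"
      by (intro AE_I2 tendsto_intros isCont_tendsto_compose[of _ \<phi>] X) auto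
    show "AE y in lborel. norm (f y * \<phi> ((1 / s) *\<^sub>R (X n - y))) \<le> B * (indicator (cball 0 R) y * \<bar>f y\<bar>)" for n
    proof (rule AE_I2)
      fix y
      show "norm (f y * \<phi> ((1 / s) *\<^sub>R (X n - y))) \<le> B * (indicator (cball 0 R) y * \<bar>f y\<bar>)"
      proof (cases "norm y \<le> R")
        case True
        then show ?thesis using mult_left_mono[OF B(2)[of "(1 / s) *\<^sub>R (X n - y)"], of "\<bar>f y\<bar>"] by (simp add: abs_mult mult_ac)
      next
        case False
        then have "norm (X n - y) > s * r" using norm_triangle_ineq4[of "X n" "X n - y"] C[of n] by (simp add: R_def)
        with s have "r < norm ((1 / s) *\<^sub>R (X n - y))" by (rule less_norm_scaleR)
        then show ?thesis using r(2) False by simp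
      qed
    qed
  qed auto
  then have "(\<lambda>n. (LBINT y. f y * \<phi> ((1 / s) *\<^sub>R (X n - y))) / s\<^sup>2) ----> (LBINT y. f y * \<phi> ((1 / s) *\<^sub>R (x - y))) / s\<^sup>2"
    using s by (intro tendsto_intros) auto
  then show "(mol \<phi> s f \<circ> X) ----> mol \<phi> s f x" using s by (simp add: comp_def mol_kernel)
qed

lemma mol_Ck:
  assumes f: "locint f" and s: "s > 0"
  shows "test_fun \<phi> ==> Ck k (mol \<phi> s f)"
proof (induction k arbitrary: \<phi>)
  case 0
  then show ?case by (simp add: Ck_0 mol_continuous f s)
next
  case (Suc k)
  show ?case
  proof (rule Ck_SucI[where f'="\<lambda>i x. (1/s) * mol (pdv i \<phi>) s f x"])
    show "((\<lambda>t. mol \<phi> s f (x + t *\<^sub>R i)) has_real_derivative 1 / s * mol (pdv i \<phi>) s f x) (at 0)" if "i \<in> Basis" for i x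
      using mol_has_pdv[OF f Suc.prems s that, of x 0] by simp
    show "Ck k (\<lambda>x. (1/s) * mol (pdv i \<phi>) s f x)" if "i \<in> Basis" for i
      by (intro Ck_mult[OF Ck_const] Suc.IH test_fun_pdv Suc.prems that)
  qed (intro mol_continuous f s Suc.prems)
qed

section \<open>Convergence of mollifications on boxes and the fundamental lemma\<close>

lemma box_subset_cball: obtains r where "box a b \<subseteq> cball (0::R2) r"
  using bounded_box[of a b] unfolding bounded_iff by (auto simp: subset_iff)

text \<open>Boxes are stable under intersection and generate the Borel sets. Integrability makes the
  class of sets with vanishing integral closed under countable disjoint unions; closure under
  complements uses the integral over the whole plane, obtained by exhausting it with boxes.\<close>

lemma set_integral_box_induct:
  fixes f :: "R2 => real"
  assumes f: "integrable lborel f" and box: "\<And>a b. (LBINT x. indicator (box a b) x * f x) = 0"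
    and A: "A \<in> sets lborel"
  shows "(LBINT x. indicator A x * f x) = 0"
proof -
  let ?G = "range (\<lambda>(a, b). box a b) :: R2 set set"
  have int: "L1 (\<lambda>x. indicator B x * f x)" if "B \<in> sets borel" for B
    using integrable_mult_indicator[OF _ f, of B] that by simp
  have "Int_stable ?G" by (auto simp: Int_stable_def box_Int_box)
  moreover have "?G \<subseteq> Pow UNIV" by simp
  moreover have "A \<in> sigma_sets UNIV ?G" using A by (simp add: borel_eq_box)
  ultimately show ?thesis
  proof (induction rule: sigma_sets_induct_disjoint)
    case (basic A) then show ?case using box by auto
  next
    case empty then show ?case by simp
  next
    case (compl A)
    then have A: "A \<in> sets borel" by (simp add: borel_eq_box)
    have "(\<Union>i::nat. box (- (real i *\<^sub>R One)) (real i *\<^sub>R One)) = (UNIV::R2 set)" by (rule UN_box_eq_UNIV)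
    have "(\<lambda>i::nat. LBINT x. indicator (box (- (real i *\<^sub>R One)) (real i *\<^sub>R One)) x * f x) ----> (LBINT x. f x)"
    proof (rule integral_dominated_convergence[where w="\<lambda>x. \<bar>f x\<bar>"])
      show "AE x in lborel. (\<lambda>i. indicator (box (- (real i *\<^sub>R One)) (real i *\<^sub>R One)) x * f x) ----> f x"
      proof (rule AE_I2)
        fix x :: R2
        obtain i :: nat where i: "x \<in> box (- (real i *\<^sub>R One)) (real i *\<^sub>R One)"
          using UN_box_eq_UNIV[where 'a=R2] by (auto simp: set_eq_iff)
        have "\<forall>\<^sub>F n in sequentially. indicator (box (- (real n *\<^sub>R One)) (real n *\<^sub>R One)) x * f x = f x"
        proof (rule eventually_sequentiallyI[of i])
          fix n assume "i \<le> n"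
          then have "x \<in> box (- (real n *\<^sub>R One)) (real n *\<^sub>R One)"
            using i by (force simp: box_def intro: less_le_trans le_less_trans)
          then show "indicator (box (- (real n *\<^sub>R One)) (real n *\<^sub>R One)) x * f x = f x" by simp
        qed
        then show "(\<lambda>i. indicator (box (- (real i *\<^sub>R One)) (real i *\<^sub>R One)) x * f x) ----> f x"
          by (rule tendsto_eventually)
      qed
    qed (use f in "auto simp: indicator_def")
    then have 0: "(LBINT x. f x) = 0" using box by (simp add: LIMSEQ_const_iff)
    have "(LBINT x. indicator (UNIV - A) x * f x) = (LBINT x. f x - indicator A x * f x)"
      by (intro Bochner_Integration.integral_cong) (auto simp: indicator_def)
    also have "... = 0" using 0 compl f int[OF A] by simp
    finally show ?case by simp
  next
    case (union A)
    have Am [measurable]: "A i \<in> sets borel" for i using union by (auto simp: borel_eq_box)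
    have "(\<lambda>n. LBINT x. indicator (\<Union>i<n. A i) x * f x) ----> (LBINT x. indicator (\<Union>i. A i) x * f x)"
    proof (rule integral_dominated_convergence[where w="\<lambda>x. \<bar>f x\<bar>"])
      show "AE x in lborel. (\<lambda>n. indicator (\<Union>i<n. A i) x * f x) ----> indicator (\<Union>i. A i) x * f x"
        by (intro AE_I2 tendsto_mult tendsto_const LIMSEQ_indicator_UN)
    qed (use f in "auto simp: indicator_def")
    moreover have "(LBINT x. indicator (\<Union>i<n. A i) x * f x) = 0" for n
    proof (induction n)
      case (Suc n)
      have "A i \<inter> A n = {}" if "i < n" for i
        using union(1) that by (intro disjoint_family_onD[of A UNIV]) auto
      then have "(\<Union>i<n. A i) \<inter> A n = {}" by auto
      then have "indicator (\<Union>i<Suc n. A i) x = indicator (\<Union>i<n. A i) x + (indicator (A n) x :: real)" for x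
        by (auto simp: indicator_def lessThan_Suc)
      then show ?case using Suc union int by (simp add: distrib_right)
    qed simp
    ultimately show ?case by (simp add: LIMSEQ_const_iff)
  qed
qed

text \<open>Cutting off with a large box restores integrability, and a box intersected with the
  cutoff is again a box, so the hypothesis applies to the cut-off difference.\<close>

lemma AE_eq_of_box_integrals:
  assumes f: "locint f" and g: "locint g"
    and eq: "\<And>a b. (LBINT x. indicator (box a b) x * f x) = (LBINT x. indicator (box a b) x * g x)"
  shows "AE x in lborel. f x = g x"
proof -
  note [measurable] = locint_borel[OF f] locint_borel[OF g]
  have "AE x in lborel. indicator (box (- (real n *\<^sub>R One)) (real n *\<^sub>R One)) x * (f x - g x) = 0" for n
  proof -
    let ?B = "box (- (real n *\<^sub>R One)) (real n *\<^sub>R One) :: R2 set"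
    obtain r where r: "?B \<subseteq> cball 0 r" using box_subset_cball by blast
    have boxi: "L1 (\<lambda>x. h x * indicator (box a b \<inter> ?B) x)" if "locint h" for h a b
      using that by (rule locint_mult[where B=1 and r=r]) (use r in "auto simp: indicator_def")
    let ?h = "\<lambda>x. indicator ?B x * (f x - g x)"
    have "L1 (\<lambda>x. f x * indicator ?B x - g x * indicator ?B x)"
      using f g by (intro L1_diff locint_mult[where B=1 and r=r]) (use r in "auto simp: indicator_def")
    then have h: "integrable lborel ?h" by (simp add: algebra_simps)
    have "(LBINT x. indicator (box a b) x * ?h x) = 0" for a b
    proof -
      obtain c d where cd: "box a b \<inter> ?B = box c d" using box_Int_box by blast
      have "(LBINT x. indicator (box a b) x * ?h x) = (LBINT x. f x * indicator (box a b \<inter> ?B) x - g x * indicator (box a b \<inter> ?B) x)"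
        by (intro Bochner_Integration.integral_cong) (auto simp: indicator_def)
      also have "... = 0" using boxi[OF f, of a b] boxi[OF g, of a b] eq[of c d] unfolding cd by (simp add: mult.commute)
      finally show ?thesis .
    qed
    then have "(LBINT x. indicator A x * ?h x) = 0" if "A \<in> sets lborel" for A
      using set_integral_box_induct[OF h _ that] by blast
    then show ?thesis
      using density_unique_real[OF h, of "\<lambda>_. 0"] by (simp add: set_lebesgue_integral_def)
  qed
  then have "AE x in lborel. \<forall>n. indicator (box (- (real n *\<^sub>R One)) (real n *\<^sub>R One)) x * (f x - g x) = 0"
    unfolding AE_all_countable by blast
  then show ?thesis
  proof eventually_elim
    case (elim x)
    obtain i :: nat where "x \<in> box (- (real i *\<^sub>R One)) (real i *\<^sub>R One)"
      using UN_box_eq_UNIV[where 'a=R2] by (auto simp: set_eq_iff)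
    then show ?case using elim[rule_format, of i] by simp
  qed
qed

lemma AE_not_in_frontier_box: "AE x in lborel. x \<notin> frontier (box a b :: R2 set)"
proof -
  have "cbox a b - box a b \<in> null_sets lborel" by (rule null_sets_cbox_Diff_box)
  moreover have "frontier (box a b) \<subseteq> cbox a b - box a b"
    unfolding frontier_def using closure_minimal[OF box_subset_cbox closed_cbox, of a b] by (auto simp: interior_open[OF open_box])
  ultimately show ?thesis by (auto intro!: AE_I' )
qed

text \<open>Fubini turns the left side into an average of \<open>H (s n *\<^sub>R z)\<close> against
  \<open>\<phi>\<close>, where \<open>H v\<close> is the integral of \<open>f\<close> over the box
  translated by \<open>- v\<close>. As the frontier of a box is a null set, these values tend to
  \<open>H 0\<close>. Box integrals determine a function almost everywhere, so this weak convergence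
  is enough to identify limits.\<close>

lemma mol_tendsto_box:
  assumes f: "locint f" and \<phi>: "test_fun \<phi>" and s: "\<And>n. s n > 0" "s ----> 0"
  shows "(\<lambda>n. LBINT x. indicator (box a b) x * mol \<phi> (s n) f x)
    ----> (LBINT z. \<phi> z) * (LBINT x. indicator (box a b) x * f x)"
proof -
  note [measurable] = locint_borel[OF f] test_fun_borel[OF \<phi>]
  let ?B = "box a b"
  obtain r where r: "r > 0" "\<And>x. norm x > r ==> \<phi> x = 0" using test_fun_support[OF \<phi>] by blast
  obtain R where R: "?B \<subseteq> cball 0 R" using box_subset_cball by blast
  have "Bseq s" using s(2) convergentI convergent_imp_Bseq by blast
  then obtain S where S: "S > 0" "\<And>n. s n \<le> S" using s(1) by (auto simp: Bseq_def abs_of_pos)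
  define R' where "R' = R + S * r"
  define C where "C = (LBINT y. indicator (cball 0 R') y * \<bar>f y\<bar>)"
  define H where "H v = (LBINT y. indicator ?B (y + v) * f y)" for v
  have dom: "\<bar>indicator ?B (y + v) * f y\<bar> \<le> indicator (cball 0 R') y * \<bar>f y\<bar>" if "norm v \<le> S * r" for y v
  proof (cases "y + v \<in> ?B")
    case True
    then have "norm (y + v) \<le> R" using R by auto
    then have "norm y \<le> R'" using norm_triangle_ineq4[of "y + v" v] that by (simp add: R'_def)
    then show ?thesis using True by simp
  qed simp
  have Hint: "L1 (\<lambda>y. indicator ?B (y + v) * f y)" if "norm v \<le> S * r" for v
    by (rule L1_bound[OF locint_ball_abs[OF f, of R']]) (use dom[OF that] in auto)
  have HC: "(LBINT y. \<bar>indicator ?B (y + v) * f y\<bar>) \<le> C" if "norm v \<le> S * r" for v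
    unfolding C_def using dom[OF that] Hint[OF that] by (intro integral_mono locint_ball_abs f integrable_abs) auto
  have HC': "\<bar>H v\<bar> \<le> C" if "norm v \<le> S * r" for v
    unfolding H_def by (rule order_trans[OF integral_abs_bound HC[OF that]])
  have eq: "(LBINT x. indicator ?B x * mol \<phi> t f x) = (LBINT z. \<phi> z * H (t *\<^sub>R z))" if t: "0 < t" "t \<le> S" for t
  proof -
    have tz: "norm (t *\<^sub>R z) \<le> S * r" if "norm z \<le> r" for z :: R2 using that t r S by (simp add: mult_mono)
    let ?F = "\<lambda>z x. indicator ?B x * (f (x - t *\<^sub>R z) * \<phi> z)"
    have sh: "(LBINT x. indicator ?B x * f (x - v)) = H v" "L1 (\<lambda>x. indicator ?B x * f (x - v)) \<longleftrightarrow> L1 (\<lambda>y. indicator ?B (y + v) * f y)"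
      "(LBINT x. \<bar>indicator ?B x * f (x - v)\<bar>) = (LBINT y. \<bar>indicator ?B (y + v) * f y\<bar>)" for v
      unfolding H_def using lborel_integral_affine[of "\<lambda>x. indicator ?B x * f (x - v)" 1 v] lborel_integral_affine(1)[of "\<lambda>x. \<bar>indicator ?B x * f (x - v)\<bar>" 1 v]
      by (simp_all add: add.commute)
    have zint: "L1 (?F z)" for z
    proof (cases "norm z \<le> r")
      case True
      have "L1 (\<lambda>x. \<phi> z * (indicator ?B x * f (x - t *\<^sub>R z)))"
        using sh(2)[of "t *\<^sub>R z"] Hint[OF tz[OF True]] by simp
      then show ?thesis by (simp add: mult_ac)
    qed (use r in auto)
    have "integrable lborel2 (case_prod ?F)"
    proof (rule lborel_pair.Fubini_integrable)
      show "L1 (\<lambda>z. LBINT x. norm (case (z, x) of (z, x) => ?F z x))"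
      proof (rule L1_bound[where f="\<lambda>z. C * \<bar>\<phi> z\<bar>"])
        show "L1 (\<lambda>z. C * \<bar>\<phi> z\<bar>)" by (intro integrable_mult_right test_fun_abs_integrable \<phi>)
        show "AE z in lborel. norm (LBINT x. norm (case (z, x) of (z, x) => ?F z x)) \<le> norm (C * \<bar>\<phi> z\<bar>)"
        proof (rule AE_I2)
          fix z
          have "(LBINT x. \<bar>?F z x\<bar>) = \<bar>\<phi> z\<bar> * (LBINT x. \<bar>indicator ?B x * f (x - t *\<^sub>R z)\<bar>)"
            by (subst integral_mult_right_zero[symmetric]) (simp add: abs_mult mult_ac)
          also have "... \<le> \<bar>\<phi> z\<bar> * C"
          proof (cases "norm z \<le> r")
            case True
            then show ?thesis using HC[OF tz[OF True]] unfolding sh(3) by (intro mult_left_mono) auto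
          qed (use r in auto)
          finally show "norm (LBINT x. norm (case (z, x) of (z, x) => ?F z x)) \<le> norm (C * \<bar>\<phi> z\<bar>)"
            by (simp add: mult.commute)
        qed
      qed measurable
    qed (use zint in auto)
    from lborel_pair.Fubini_integral[OF this]
    have "(LBINT x. (LBINT z. ?F z x)) = (LBINT z. (LBINT x. ?F z x))" .
    moreover have "(LBINT z. ?F z x) = indicator ?B x * mol \<phi> t f x" for x
      by (simp add: mol_def)
    moreover have "(LBINT x. ?F z x) = \<phi> z * H (t *\<^sub>R z)" for z
      unfolding sh(1)[symmetric] by (subst integral_mult_right_zero[symmetric]) (simp add: mult_ac)
    ultimately show ?thesis by (simp only:)
  qed
  have [measurable]: "H \<in> Bor" unfolding H_def by measurable
  have Hlim: "(\<lambda>n. H (s n *\<^sub>R z)) ----> H 0" if z: "norm z \<le> r" for z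
    unfolding H_def
  proof (rule integral_dominated_convergence[where w="\<lambda>y. indicator (cball 0 R') y * \<bar>f y\<bar>"])
    show "AE y in lborel. (\<lambda>n. indicator ?B (y + s n *\<^sub>R z) * f y) ----> indicator ?B (y + 0) * f y"
      using AE_not_in_frontier_box[of a b]
    proof eventually_elim
      case (elim y)
      have lim: "(\<lambda>n. y + s n *\<^sub>R z) ----> y" using tendsto_add[OF tendsto_const[of y] tendsto_scaleR[OF s(2) tendsto_const[of z]]] by simp
      have "\<forall>\<^sub>F n in sequentially. indicator ?B (y + s n *\<^sub>R z) = (indicator ?B y :: real)"
      proof (cases "y \<in> ?B")
        case True
        then have "\<forall>\<^sub>F n in sequentially. y + s n *\<^sub>R z \<in> ?B" using lim open_box topological_tendstoD by blast
        then show ?thesis by eventually_elim (use True in simp)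
      next
        case False
        then have "y \<in> - closure ?B" using elim by (auto simp: frontier_def interior_open[OF open_box])
        moreover have "open (- closure ?B)" by auto
        ultimately have "\<forall>\<^sub>F n in sequentially. y + s n *\<^sub>R z \<in> - closure ?B" using lim topological_tendstoD by blast
        then show ?thesis by eventually_elim (use False closure_subset[of "box a b"] in \<open>auto simp: indicator_def\<close>)
      qed
      then have "(\<lambda>n. indicator ?B (y + s n *\<^sub>R z) :: real) ----> indicator ?B y" by (rule tendsto_eventually)
      then show ?case by (intro tendsto_intros) auto
    qed
    show "AE y in lborel. norm (indicator ?B (y + s n *\<^sub>R z) * f y) \<le> indicator (cball 0 R') y * \<bar>f y\<bar>" for n
      using dom[of "s n *\<^sub>R z"] z s(1)[of n] S r by (auto simp: mult_mono)
  qed (use locint_ball_abs[OF f] in auto)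
  have "(\<lambda>n. LBINT z. \<phi> z * H (s n *\<^sub>R z)) ----> (LBINT z. \<phi> z * H 0)"
  proof (rule integral_dominated_convergence[where w="\<lambda>z. \<bar>\<phi> z\<bar> * C"])
    show "L1 (\<lambda>z. \<bar>\<phi> z\<bar> * C)" by (intro integrable_mult_left test_fun_abs_integrable \<phi>)
    show "AE z in lborel. (\<lambda>n. \<phi> z * H (s n *\<^sub>R z)) ----> \<phi> z * H 0"
    proof (rule AE_I2)
      fix z show "(\<lambda>n. \<phi> z * H (s n *\<^sub>R z)) ----> \<phi> z * H 0"
        using Hlim[of z] r(2)[of z] by (cases "norm z \<le> r") (auto intro!: tendsto_intros)
    qed
    show "AE z in lborel. norm (\<phi> z * H (s n *\<^sub>R z)) \<le> \<bar>\<phi> z\<bar> * C" for n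
    proof (rule AE_I2)
      fix z show "norm (\<phi> z * H (s n *\<^sub>R z)) \<le> \<bar>\<phi> z\<bar> * C"
      proof (cases "norm z \<le> r")
        case True
        then have "\<bar>H (s n *\<^sub>R z)\<bar> \<le> C" using s(1)[of n] S r by (intro HC') (auto simp: mult_mono)
        then show ?thesis by (simp add: abs_mult mult_left_mono)
      qed (use r in auto)
    qed
  qed auto
  moreover have "(LBINT z. \<phi> z * H 0) = (LBINT z. \<phi> z) * (LBINT x. indicator ?B x * f x)"
    by (simp add: H_def)
  ultimately show ?thesis unfolding eq[OF s(1) S(2)] by (simp only:)
qed

definition mass :: real where "mass = (LBINT z. \<rho> z)"

lemma mass_pos: "mass > 0"
proof -
  have "mass \<noteq> 0"
  proof
    assume "mass = 0"
    then have "AE z in lborel. \<rho> z = 0"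
      unfolding mass_def using integral_nonneg_eq_0_iff_AE[OF test_integrable[OF test_rho]] rho_nonneg by auto
    then have "AE z in lborel. z \<notin> ball (0::R2) 1"
      by eventually_elim (use rho_pos in "force simp: dist_norm")
    then have "emeasure lborel (ball (0::R2) 1) = 0"
      by (subst (asm) AE_iff_measurable[of "ball 0 1"]) auto
    then have "measure lebesgue (ball (0::R2) 1) = 0" by (simp add: measure_def)
    then show False using content_ball_pos[of 1 "0::R2"] by simp
  qed
  moreover have "mass \<ge> 0" unfolding mass_def using rho_nonneg by (intro integral_nonneg_AE) auto
  ultimately show ?thesis by simp
qed

text \<open>Testing with rescaled and translated copies of \<open>\<rho>\<close> makes the
  mollifications of \<open>f\<close> and \<open>g\<close> coincide at every scale; in the limit
  their box integrals coincide.\<close>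

lemma fundamental_lemma:
  assumes f: "locint f" and g: "locint g"
    and eq: "\<And>\<phi>. test_fun \<phi> ==> (LBINT x. f x * \<phi> x) = (LBINT x. g x * \<phi> x)"
  shows "AE x in lborel. f x = g x"
proof (rule AE_eq_of_box_integrals[OF f g])
  fix a b :: R2
  note [measurable] = locint_borel[OF f] locint_borel[OF g] test_fun_borel[OF test_rho]
  have "mol \<rho> (1 / Suc n) f x = mol \<rho> (1 / Suc n) g x" for n x
    using eq[OF test_kernel[OF test_rho, of "1 / Suc n" x]] by (simp add: mol_kernel)
  then have "(\<lambda>n. LBINT x. indicator (box a b) x * mol \<rho> (1 / Suc n) f x) = (\<lambda>n. LBINT x. indicator (box a b) x * mol \<rho> (1 / Suc n) g x)"
    by simp
  moreover have "\<And>n. 0 < 1 / real (Suc n)" "(\<lambda>n. 1 / real (Suc n)) ----> 0"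
    using LIMSEQ_inverse_real_of_nat by (simp_all add: inverse_eq_divide)
  note l = mol_tendsto_box[OF f test_rho this, of a b] mol_tendsto_box[OF g test_rho this, of a b]
  ultimately have "mass * (LBINT x. indicator (box a b) x * f x) = mass * (LBINT x. indicator (box a b) x * g x)"
    unfolding mass_def using LIMSEQ_unique[OF l(1)] l(2) by simp
  then show "(LBINT x. indicator (box a b) x * f x) = (LBINT x. indicator (box a b) x * g x)"
    using mass_pos by simp
qed

section \<open>Square-integrable functions\<close>

lemma Cauchy_Schwarz_integral:
  fixes f g :: "'a => real"
  assumes [measurable]: "f \<in> borel_measurable M" "g \<in> borel_measurable M"
    and f2: "integrable M (sq f)" and g2: "integrable M (sq g)"
  shows "integrable M (\<lambda>x. f x * g x)" (is ?int)
    and "(\<integral>x. \<bar>f x * g x\<bar> \<partial>M)\<^sup>2 \<le> (\<integral>x. (f x)\<^sup>2 \<partial>M) * (\<integral>x. (g x)\<^sup>2 \<partial>M)" (is ?le)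
    and "\<bar>\<integral>x. f x * g x \<partial>M\<bar> \<le> sqrt (\<integral>x. (f x)\<^sup>2 \<partial>M) * sqrt (\<integral>x. (g x)\<^sup>2 \<partial>M)" (is ?le2)
proof -
  have ab: "\<bar>a * b\<bar> \<le> \<bar>a\<^sup>2 + b\<^sup>2\<bar>" for a b :: real
  proof -
    have "2 * (\<bar>a\<bar> * \<bar>b\<bar>) \<le> a\<^sup>2 + b\<^sup>2" using sum_squares_bound[of "\<bar>a\<bar>" "\<bar>b\<bar>"] by simp
    moreover have "0 \<le> \<bar>a\<bar> * \<bar>b\<bar>" by simp
    ultimately show ?thesis unfolding abs_mult by linarith
  qed
  show ?int
  proof (rule L1_bound[OF L1_add[OF f2 g2]])
    show "AE x in M. norm (f x * g x) \<le> norm ((f x)\<^sup>2 + (g x)\<^sup>2)"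
      unfolding real_norm_def by (intro AE_I2 ab)
  qed measurable
  then have i: "integrable M (\<lambda>x. \<bar>f x * g x\<bar>)" by (rule integrable_abs)
  have "(\<integral>\<^sup>+x. ennreal \<bar>f x\<bar> * ennreal \<bar>g x\<bar> \<partial>M)\<^sup>2 \<le> (\<integral>\<^sup>+x. ennreal \<bar>f x\<bar> ^ 2 \<partial>M) * (\<integral>\<^sup>+x. ennreal \<bar>g x\<bar> ^ 2 \<partial>M)"
    by (rule Cauchy_Schwarz_nn_integral) auto
  moreover have "(\<integral>\<^sup>+x. ennreal \<bar>f x\<bar> * ennreal \<bar>g x\<bar> \<partial>M) = ennreal (\<integral>x. \<bar>f x * g x\<bar> \<partial>M)"
    using nn_integral_eq_integral[OF i] by (simp add: ennreal_mult[symmetric] abs_mult)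
  moreover have "(\<integral>\<^sup>+x. ennreal \<bar>f x\<bar> ^ 2 \<partial>M) = ennreal (\<integral>x. (f x)\<^sup>2 \<partial>M)"
    using nn_integral_eq_integral[OF f2] by (simp add: ennreal_power)
  moreover have "(\<integral>\<^sup>+x. ennreal \<bar>g x\<bar> ^ 2 \<partial>M) = ennreal (\<integral>x. (g x)\<^sup>2 \<partial>M)"
    using nn_integral_eq_integral[OF g2] by (simp add: ennreal_power)
  ultimately have "ennreal ((\<integral>x. \<bar>f x * g x\<bar> \<partial>M)\<^sup>2) \<le> ennreal ((\<integral>x. (f x)\<^sup>2 \<partial>M) * (\<integral>x. (g x)\<^sup>2 \<partial>M))"
    by (simp add: ennreal_power ennreal_mult)
  then show ?le by (subst (asm) ennreal_le_iff) auto
  then have "(\<integral>x. \<bar>f x * g x\<bar> \<partial>M) \<le> sqrt ((\<integral>x. (f x)\<^sup>2 \<partial>M) * (\<integral>x. (g x)\<^sup>2 \<partial>M))" by (rule real_le_rsqrt)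
  then show ?le2 unfolding real_sqrt_mult by (rule order_trans[OF integral_abs_bound])
qed

lemma Fatou_real:
  fixes g :: "'a => real"
  assumes [measurable]: "g \<in> borel_measurable M"
    and F: "\<And>n::nat. integrable M (F n)" "\<And>n x. F n x \<ge> 0" "\<And>n. (\<integral>x. F n x \<partial>M) \<le> C"
    and lim: "AE x in M. (\<lambda>n. F n x) ----> g x"
  shows "integrable M g" "(\<integral>x. g x \<partial>M) \<le> C"
proof -
  have [measurable]: "F n \<in> borel_measurable M" for n using F(1) by auto
  have nn: "AE x in M. g x \<ge> 0" using lim by eventually_elim (use F(2) in "auto intro: LIMSEQ_le_const")
  have "0 \<le> (\<integral>x. F 0 x \<partial>M)" using F(2) by (intro integral_nonneg_AE) auto
  then have C: "C \<ge> 0" using F(3)[of 0] by linarith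
  have "(\<integral>\<^sup>+x. ennreal (g x) \<partial>M) = (\<integral>\<^sup>+x. liminf (\<lambda>n. ennreal (F n x)) \<partial>M)"
  proof (rule nn_integral_cong_AE)
    show "AE x in M. ennreal (g x) = liminf (\<lambda>n. ennreal (F n x))"
      using lim by eventually_elim (auto intro!: lim_imp_Liminf[symmetric] tendsto_ennrealI)
  qed
  also have "... \<le> liminf (\<lambda>n. \<integral>\<^sup>+x. ennreal (F n x) \<partial>M)" by (rule nn_integral_liminf) auto
  also have "... \<le> liminf (\<lambda>n::nat. ennreal C)"
    using F by (intro Liminf_mono always_eventually allI) (simp add: nn_integral_eq_integral ennreal_leI)
  also have "... = ennreal C" by (simp add: Liminf_const)
  finally have le: "(\<integral>\<^sup>+x. ennreal (g x) \<partial>M) \<le> ennreal C" .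
  then show g: "integrable M g" using nn by (intro integrableI_nonneg) (auto simp: top_unique less_top[symmetric] le_less_trans)
  have "ennreal (\<integral>x. g x \<partial>M) \<le> ennreal C" using le nn_integral_eq_integral[OF g nn] by simp
  then show "(\<integral>x. g x \<partial>M) \<le> C" using C by simp
qed

definition sqint :: "(R2 => 'a::euclidean_space) => bool" where
  "sqint f \<longleftrightarrow> f \<in> Bor \<and> L1 (\<lambda>x. (norm (f x))\<^sup>2)"

definition nsq :: "(R2 => 'a::euclidean_space) => real" where
  "nsq f = (LBINT x. (norm (f x))\<^sup>2)"

abbreviation dsq :: "(R2 => 'a::euclidean_space) => (R2 => 'a) => real" where "dsq u v \<equiv> nsq (\<lambda>x. u x - v x)"

lemma sqint_borel [measurable_dest]: "sqint f ==> f \<in> Bor"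
  by (simp add: sqint_def)

lemma nsq_nonneg: "nsq f \<ge> 0" by (simp add: nsq_def)

lemma nsq_real: "nsq (f :: R2 => real) = (LBINT x. (f x)\<^sup>2)" by (simp add: nsq_def)

lemma sqint_real: "sqint (f :: R2 => real) \<longleftrightarrow> f \<in> Bor \<and> L1 (sq f)"
  by (simp add: sqint_def)

lemma norm_add_sq_le: "(norm (a + b))\<^sup>2 \<le> 2 * (norm a)\<^sup>2 + 2 * (norm b)\<^sup>2" for a b :: "'a::real_normed_vector"
proof -
  have "(norm (a + b))\<^sup>2 \<le> (norm a + norm b)\<^sup>2" by (intro power_mono norm_triangle_ineq) auto
  also have "... \<le> 2 * (norm a)\<^sup>2 + 2 * (norm b)\<^sup>2"
    using sum_squares_bound[of "norm a" "norm b"] by (simp add: power2_sum)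
  finally show ?thesis .
qed

lemma sqint_add:
  assumes "sqint f" "sqint g"
  shows "sqint (\<lambda>x. f x + g x)" "nsq (\<lambda>x. f x + g x) \<le> 2 * nsq f + 2 * nsq g"
proof -
  have [measurable]: "f \<in> Bor" "g \<in> Bor" using assms by auto
  have i: "L1 (\<lambda>x. 2 * (norm (f x))\<^sup>2 + 2 * (norm (g x))\<^sup>2)"
    using assms by (simp add: sqint_def)
  have j: "L1 (\<lambda>x. (norm (f x + g x))\<^sup>2)"
    by (rule L1_bound[OF i]) (auto intro!: AE_I2 norm_add_sq_le)
  then show "sqint (\<lambda>x. f x + g x)" by (simp add: sqint_def)
  have "nsq (\<lambda>x. f x + g x) \<le> (LBINT x. 2 * (norm (f x))\<^sup>2 + 2 * (norm (g x))\<^sup>2)"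
    unfolding nsq_def by (rule integral_mono[OF j i norm_add_sq_le])
  also have "... = 2 * nsq f + 2 * nsq g" using assms by (simp add: sqint_def nsq_def)
  finally show "nsq (\<lambda>x. f x + g x) \<le> 2 * nsq f + 2 * nsq g" .
qed

lemma sqint_scaleR:
  assumes "sqint f" shows "sqint (\<lambda>x. c *\<^sub>R f x)" "nsq (\<lambda>x. c *\<^sub>R f x) = c\<^sup>2 * nsq f"
  using assms by (auto simp: sqint_def nsq_def power_mult_distrib)

lemma sqint_cmult:
  assumes "sqint f" shows "sqint (\<lambda>x. c * f x :: real)" "nsq (\<lambda>x. c * f x) = c\<^sup>2 * nsq f"
  using sqint_scaleR[OF assms, of c] by auto

lemma sqint_diff:
  assumes "sqint f" "sqint g"
  shows "sqint (\<lambda>x. f x - g x)" "dsq f g \<le> 2 * nsq f + 2 * nsq g"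
  using sqint_add[OF assms(1) sqint_scaleR(1)[OF assms(2), of "-1"]] sqint_scaleR(2)[OF assms(2), of "-1"]
  by auto

lemma nsq_commute: "dsq f g = dsq g f"
  by (simp add: nsq_def norm_minus_commute)

lemma nsq_parallelogram:
  assumes "sqint f" "sqint g"
  shows "nsq (\<lambda>x. f x + g x) + dsq f g = 2 * nsq f + 2 * nsq g"
proof -
  have "nsq (\<lambda>x. f x + g x) + dsq f g = (LBINT x. (norm (f x + g x))\<^sup>2 + (norm (f x - g x))\<^sup>2)"
    using sqint_add(1)[OF assms] sqint_diff(1)[OF assms] by (simp add: sqint_def nsq_def)
  also have "... = (LBINT x. 2 * (norm (f x))\<^sup>2 + 2 * (norm (g x))\<^sup>2)"
    by (intro Bochner_Integration.integral_cong)
       (auto simp: power2_norm_eq_inner inner_add_left inner_add_right inner_diff_left inner_diff_right inner_commute)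
  also have "... = 2 * nsq f + 2 * nsq g" using assms by (simp add: sqint_def nsq_def)
  finally show ?thesis .
qed

lemma sqint_inner:
  assumes "sqint G" "i \<in> Basis" shows "sqint (\<lambda>x. G x \<bullet> i)" "nsq (\<lambda>x. G x \<bullet> i) \<le> nsq G"
proof -
  have [measurable]: "G \<in> Bor" using assms by auto
  have i: "L1 (\<lambda>x. (norm (G x))\<^sup>2)" using assms by (simp add: sqint_def)
  have le: "(G x \<bullet> i)\<^sup>2 \<le> (norm (G x))\<^sup>2" for x
    using Basis_le_norm[OF assms(2), of "G x"] by (metis abs_ge_zero power2_abs power_mono)
  have j: "L1 (\<lambda>x. (G x \<bullet> i)\<^sup>2)"
    by (rule L1_bound[OF i]) (use le in auto)
  then show "sqint (\<lambda>x. G x \<bullet> i)" by (simp add: sqint_def)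
  show "nsq (\<lambda>x. G x \<bullet> i) \<le> nsq G" unfolding nsq_def using i j le by (intro integral_mono) auto
qed

lemma sqint_bound:
  assumes g: "sqint g" and [measurable]: "f \<in> Bor" and le: "AE x in lborel. norm (f x) \<le> norm (g x)"
  shows "sqint f" "nsq f \<le> nsq g"
proof -
  have i: "L1 (\<lambda>x. (norm (g x))\<^sup>2)" using g by (simp add: sqint_def)
  have le': "AE x in lborel. (norm (f x))\<^sup>2 \<le> (norm (g x))\<^sup>2"
    using le by eventually_elim (auto intro: power_mono)
  have j: "L1 (\<lambda>x. (norm (f x))\<^sup>2)"
    by (rule L1_bound[OF i]) (use le' in auto)
  then show "sqint f" by (simp add: sqint_def)
  show "nsq f \<le> nsq g" unfolding nsq_def using i j le' by (intro integral_mono_AE) auto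
qed

lemma sqint_prod:
  assumes "sqint f" "sqint g"
  shows "L1 (\<lambda>x. f x * g x :: real)" "\<bar>LBINT x. f x * g x\<bar> \<le> sqrt (nsq f) * sqrt (nsq g)"
    "(LBINT x. \<bar>f x * g x\<bar>) \<le> sqrt (nsq f) * sqrt (nsq g)"
  using assms Cauchy_Schwarz_integral[of f lborel g]
  by (auto simp: sqint_real nsq_real real_sqrt_mult[symmetric] intro: real_le_rsqrt)

lemma sqint_locint: "sqint f ==> locint f"
  using integrable_mult_indicator[of _ lborel "\<lambda>x. (f x)\<^sup>2"] by (intro locint_L2) (auto simp: sqint_real)

lemma test_sqint: "test_fun \<phi> ==> sqint \<phi>"
  by (simp add: sqint_real test_fun_borel test_integrable_sq)

text \<open>Riesz-Fischer. Consecutive members of the subsequence have squared distance below 4^-n;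
  weighted with 2^n the squares still have summable integrals, and 2 d \<le> 2^n d^2 + 2^-n turns
  this into absolute convergence of the telescoping series almost everywhere. Fatou then gives
  convergence of the full sequence.\<close>

lemma sqint_complete:
  fixes F :: "nat => R2 => 'a::euclidean_space"
  assumes F: "\<And>n. sqint (F n)"
    and cau: "\<And>e. e > 0 ==> \<exists>N. \<forall>m\<ge>N. \<forall>n\<ge>N. dsq (F m) (F n) < e"
  obtains f r where "sqint f" "(\<lambda>n. dsq (F n) f) ----> 0" "strict_mono (r :: nat => nat)"
    "AE x in lborel. (\<lambda>n. F (r n) x) ----> f x"
proof -
  note [measurable] = sqint_borel[OF F]
  obtain N where N: "\<And>k m n. m \<ge> N k ==> n \<ge> N k ==> dsq (F m) (F n) < (1/4)^k"
    using cau[of "(1/4)^_"] by (metis zero_less_divide_1_iff zero_less_numeral zero_less_power)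
  \<comment> \<open>Summing \<open>Suc (N i)\<close> up to \<open>n\<close> makes the indices
    strictly increasing and at least \<open>N n\<close>.\<close>
  define r where "r n = (\<Sum>i\<le>n. Suc (N i))" for n
  have r: "strict_mono r" unfolding strict_mono_Suc_iff r_def by simp
  have rN: "r n \<ge> N n" for n unfolding r_def by (cases n) auto
  define D where "D n x = norm (F (r (Suc n)) x - F (r n) x)" for n x
  have Dm [measurable]: "D n \<in> Bor" for n unfolding D_def by measurable
  have D1: "(\<integral>\<^sup>+x. ennreal (2^n * (D n x)\<^sup>2) \<partial>lborel) \<le> ennreal ((1/2)^n)" for n
  proof -
    have i: "L1 (\<lambda>x. 2^n * (D n x)\<^sup>2)"
      using sqint_diff(1)[OF F F, of "r (Suc n)" "r n"] by (simp add: D_def sqint_def)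
    have "(LBINT x. 2^n * (D n x)\<^sup>2) = 2^n * nsq (\<lambda>x. F (r (Suc n)) x - F (r n) x)" by (simp add: D_def nsq_def)
    also have "... \<le> 2^n * (1/4)^n"
      using N[of n "r (Suc n)" "r n"] rN[of n] strict_mono_leD[OF r, of n "Suc n"] by (intro mult_left_mono) auto
    also have "... = (1/2)^n" by (simp add: power_mult_distrib[symmetric])
    finally show ?thesis using nn_integral_eq_integral[OF i] by (simp add: ennreal_leI)
  qed
  have "(\<integral>\<^sup>+x. (\<Sum>n. ennreal (2^n * (D n x)\<^sup>2)) \<partial>lborel) = (\<Sum>n. \<integral>\<^sup>+x. ennreal (2^n * (D n x)\<^sup>2) \<partial>lborel)"
    by (rule nn_integral_suminf) auto
  also have "... \<le> (\<Sum>n. ennreal ((1/2)^n))" by (intro suminf_le D1) auto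
  also have "... = ennreal (\<Sum>n. (1/2)^n)" by (rule suminf_ennreal2) (auto intro!: summable_geometric)
  finally have "(\<integral>\<^sup>+x. (\<Sum>n. ennreal (2^n * (D n x)\<^sup>2)) \<partial>lborel) \<noteq> \<infinity>" by (auto simp: top_unique)
  then have "AE x in lborel. (\<Sum>n. ennreal (2^n * (D n x)\<^sup>2)) \<noteq> \<infinity>"
    by (intro nn_integral_PInf_AE) auto
  then have conv: "AE x in lborel. convergent (\<lambda>n. F (r n) x)"
  proof eventually_elim
    case (elim x)
    have s1: "summable (\<lambda>n. 2^n * (D n x)\<^sup>2)"
      by (rule summable_suminf_not_top) (use elim in auto)
    have "summable (\<lambda>n. (1/2)^n + 2^n * (D n x)\<^sup>2)"
      by (intro summable_add s1 summable_geometric) auto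
    then have "summable (\<lambda>n. F (r (Suc n)) x - F (r n) x)"
    proof (rule summable_comparison_test[rotated], intro exI[of _ 0] allI impI)
      fix n
      have "2 * ((2::real)^n * D n x) * 1 \<le> (2^n * D n x)\<^sup>2 + 1\<^sup>2" by (rule sum_squares_bound)
      then have "2 * 2^n * D n x \<le> 2^n * (2^n * (D n x)\<^sup>2) + 1" by (simp add: power2_eq_square mult_ac)
      then have "2 * D n x \<le> 2^n * (D n x)\<^sup>2 + (1/2)^n" by (simp add: field_simps power_divide)
      then show "norm (F (r (Suc n)) x - F (r n) x) \<le> (1/2)^n + 2^n * (D n x)\<^sup>2"
        unfolding D_def using norm_ge_zero[of "F (r (Suc n)) x - F (r n) x"] by linarith
    qed
    then have "convergent (\<lambda>n. \<Sum>k<n. F (r (Suc k)) x - F (r k) x)" by (simp add: summable_iff_convergent)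
    then have "convergent (\<lambda>n. F (r n) x - F (r 0) x)"
      unfolding sum_lessThan_telescope[of "\<lambda>n. F (r n) x"] .
    from convergent_add[OF this convergent_const[of "F (r 0) x"]] show ?case by simp
  qed
  define f where "f x = lim (\<lambda>n. F (r n) x)" for x
  have [measurable]: "f \<in> Bor" unfolding f_def by (rule borel_measurable_lim_metric) measurable
  have lim: "AE x in lborel. (\<lambda>n. F (r n) x) ----> f x"
    using conv by eventually_elim (simp add: f_def convergent_LIMSEQ_iff)
  have est: "L1 (\<lambda>x. (norm (F n x - f x))\<^sup>2) \<and> dsq (F n) f \<le> (1/4)^k" if "n \<ge> N k" for n k
  proof -
    have l: "AE x in lborel. (\<lambda>j. (norm (F n x - F (r (j + k)) x))\<^sup>2) ----> (norm (F n x - f x))\<^sup>2"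
      using lim by eventually_elim (intro tendsto_intros LIMSEQ_ignore_initial_segment)
    have "N k \<le> r (j + k)" for j using rN[of k] strict_mono_leD[OF r, of k "j + k"] by simp
    then have b: "(LBINT x. (norm (F n x - F (r (j + k)) x))\<^sup>2) \<le> (1/4)^k" for j
      using N[OF that, of "r (j + k)"] by (simp add: nsq_def less_imp_le)
    have i: "L1 (\<lambda>x. (norm (F n x - F (r (j + k)) x))\<^sup>2)" for j
      using sqint_diff(1)[OF F F] by (simp add: sqint_def)
    show ?thesis using Fatou_real[OF _ i _ b l] by (simp add: nsq_def)
  qed
  have "sqint (\<lambda>x. F (N 0) x - f x)" using est[of 0 "N 0"] by (simp add: sqint_def)
  from sqint_diff(1)[OF F[of "N 0"] this] have "sqint f" by simp
  moreover have "(\<lambda>n. dsq (F n) f) ----> 0"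
  proof (rule LIMSEQ_I)
    fix e :: real assume "e > 0"
    then obtain k where k: "(1/4)^k < e" using real_arch_pow_inv[of e "1/4"] by auto
    have "norm (dsq (F n) f - 0) < e" if "n \<ge> N k" for n
      using est[OF that] k nsq_nonneg[of "\<lambda>x. F n x - f x"] by simp
    then show "\<exists>no. \<forall>n\<ge>no. norm (dsq (F n) f - 0) < e" by blast
  qed
  ultimately show ?thesis using that r lim by blast
qed

text \<open>Completeness produces some limit in the mean together with an almost everywhere
  convergent subsequence; uniqueness of limits in the mean identifies it with
  \<open>f\<close>.\<close>

lemma sqint_conv_AE_subseq:
  fixes F :: "nat => R2 => 'a::euclidean_space"
  assumes F: "\<And>n. sqint (F n)" and f: "sqint f" and lim: "(\<lambda>n. dsq (F n) f) ----> 0"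
  obtains r where "strict_mono (r :: nat => nat)" "AE x in lborel. (\<lambda>n. F (r n) x) ----> f x"
proof -
  have tri: "dsq (F m) (F n) \<le> 2 * dsq (F m) f + 2 * dsq (F n) f" for m n
    using sqint_diff(2)[OF sqint_diff(1)[OF F[of m] f] sqint_diff(1)[OF F[of n] f]] by simp
  have "\<exists>N. \<forall>m\<ge>N. \<forall>n\<ge>N. dsq (F m) (F n) < e" if e: "e > 0" for e
  proof -
    obtain N where N: "\<forall>n\<ge>N. norm (dsq (F n) f - 0) < e / 4"
      using LIMSEQ_D[OF lim, of "e/4"] e by auto
    have lt: "dsq (F n) f < e / 4" if "n \<ge> N" for n
      using N[rule_format, OF that] by (simp add: abs_less_iff)
    have "dsq (F m) (F n) < e" if "m \<ge> N" "n \<ge> N" for m n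
      using tri[of m n] lt[OF that(1)] lt[OF that(2)] by linarith
    then show ?thesis by blast
  qed
  from sqint_complete[OF F this] obtain g r where g: "sqint g" "(\<lambda>n. dsq (F n) g) ----> 0" "strict_mono r"
    "AE x in lborel. (\<lambda>n. F (r n) x) ----> g x" by blast
  have "dsq f g \<le> 2 * dsq (F n) g + 2 * dsq (F n) f" for n
    using sqint_diff(2)[OF sqint_diff(1)[OF F[of n] g(1)] sqint_diff(1)[OF F[of n] f]] by simp
  moreover have "(\<lambda>n. 2 * dsq (F n) g + 2 * dsq (F n) f) ----> 2 * 0 + 2 * 0"
    by (intro tendsto_intros g lim)
  ultimately have "dsq f g \<le> 0" using LIMSEQ_le_const by fastforce
  then have "dsq f g = 0" using nsq_nonneg[of "\<lambda>x. f x - g x"] by simp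
  then have "AE x in lborel. (norm (f x - g x))\<^sup>2 = 0"
    using sqint_diff(1)[OF f g(1)] unfolding nsq_def sqint_def
    by (subst integral_nonneg_eq_0_iff_AE[symmetric]) auto
  then have "AE x in lborel. (\<lambda>n. F (r n) x) ----> f x" using g(4) by eventually_elim simp
  then show ?thesis using that g(3) by blast
qed

section \<open>Mollification estimates\<close>

text \<open>Cauchy-Schwarz; the substitution in the plane turns the squared norm of z \<mapsto> f(x
  - s z) into \<open>nsq f / s\<^sup>2\<close>, whence the rate 1/s.\<close>

lemma mol_sup:
  assumes f: "sqint f" and \<phi>: "test_fun \<phi>" and s: "s > 0"
  shows "\<bar>mol \<phi> s f x\<bar> \<le> sqrt (nsq \<phi>) * sqrt (nsq f) / s"
proof -
  note [measurable] = sqint_borel[OF f] test_fun_borel[OF \<phi>]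
  have q: "nsq f = s\<^sup>2 * (LBINT z. (f (x - s *\<^sub>R z))\<^sup>2)" "L1 (\<lambda>z. (f (x - s *\<^sub>R z))\<^sup>2)"
    using lborel_integral_affine[of "\<lambda>x. (f x)\<^sup>2" "- s" x] s f by (auto simp: nsq_real sqint_real DIM_R2)
  have "\<bar>mol \<phi> s f x\<bar> \<le> sqrt (LBINT z. (f (x - s *\<^sub>R z))\<^sup>2) * sqrt (nsq \<phi>)"
    unfolding mol_def nsq_real using q(2) test_integrable_sq[OF \<phi>] by (intro Cauchy_Schwarz_integral(3)) auto
  also have "... = sqrt (nsq \<phi>) * sqrt (nsq f) / s"
    using s by (simp add: q(1) real_sqrt_mult)
  finally show ?thesis .
qed

text \<open>Young's inequality for the exponents 1 and 2: Cauchy-Schwarz with the kernel split into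
  two square roots, then Fubini and translation invariance. The bound is uniform in the
  scale.\<close>

lemma mol_L2:
  assumes f: "sqint f" and \<phi>: "test_fun \<phi>" and s: "s > 0"
  shows "sqint (mol \<phi> s f)" "nsq (mol \<phi> s f) \<le> (LBINT z. \<bar>\<phi> z\<bar>)\<^sup>2 * nsq f"
proof -
  note [measurable] = sqint_borel[OF f] test_fun_borel[OF \<phi>]
  define m where "m = (LBINT z. \<bar>\<phi> z\<bar>)"
  have m: "m \<ge> 0" unfolding m_def by simp
  have mi: "(\<integral>\<^sup>+z. ennreal \<bar>\<phi> z\<bar> \<partial>lborel) = ennreal m"
    unfolding m_def using test_fun_abs_integrable[OF \<phi>] by (intro nn_integral_eq_integral) auto
  obtain B where B: "B > 0" "\<And>x. \<bar>\<phi> x\<bar> \<le> B" using test_fun_bounded[OF \<phi>] by blast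
  have sh: "(\<integral>\<^sup>+x. ennreal ((f (x - v))\<^sup>2) \<partial>lborel) = ennreal (nsq f)" for v
  proof -
    have "L1 (\<lambda>x. (f (x - v))\<^sup>2)" "(LBINT x. (f (x - v))\<^sup>2) = nsq f"
      using lborel_integral_affine[of "\<lambda>x. (f x)\<^sup>2" 1 "- v"] f by (auto simp: nsq_real sqint_real)
    then show ?thesis by (subst nn_integral_eq_integral) auto
  qed
  have pt: "ennreal ((mol \<phi> s f x)\<^sup>2) \<le> ennreal m * (\<integral>\<^sup>+z. ennreal ((f (x - s *\<^sub>R z))\<^sup>2 * \<bar>\<phi> z\<bar>) \<partial>lborel)" for x
  proof -
    have q: "L1 (\<lambda>z. (f (x - s *\<^sub>R z))\<^sup>2)"
      using lborel_integral_affine[of "\<lambda>x. (f x)\<^sup>2" "- s" x] s f by (auto simp: sqint_real)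
    have i: "L1 (\<lambda>z. (f (x - s *\<^sub>R z))\<^sup>2 * \<bar>\<phi> z\<bar>)"
    proof (rule L1_bound)
      show "L1 (\<lambda>z. B * (f (x - s *\<^sub>R z))\<^sup>2)" using q by simp
      show "AE z in lborel. norm ((f (x - s *\<^sub>R z))\<^sup>2 * \<bar>\<phi> z\<bar>) \<le> norm (B * (f (x - s *\<^sub>R z))\<^sup>2)"
        using B by (auto simp: abs_mult mult.commute mult_right_mono)
    qed measurable
    have "(LBINT z. \<bar>f (x - s *\<^sub>R z) * sqrt \<bar>\<phi> z\<bar> * sqrt \<bar>\<phi> z\<bar>\<bar>)\<^sup>2 \<le> (LBINT z. (f (x - s *\<^sub>R z) * sqrt \<bar>\<phi> z\<bar>)\<^sup>2) * (LBINT z. (sqrt \<bar>\<phi> z\<bar>)\<^sup>2)"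
      using i test_fun_abs_integrable[OF \<phi>]
      by (intro Cauchy_Schwarz_integral(2)) (auto simp: power_mult_distrib)
    then have 1: "(LBINT z. \<bar>f (x - s *\<^sub>R z) * \<phi> z\<bar>)\<^sup>2 \<le> (LBINT z. (f (x - s *\<^sub>R z))\<^sup>2 * \<bar>\<phi> z\<bar>) * m"
      by (simp add: power_mult_distrib m_def mult.assoc abs_mult)
    have "\<bar>mol \<phi> s f x\<bar> \<le> (LBINT z. \<bar>f (x - s *\<^sub>R z) * \<phi> z\<bar>)"
      unfolding mol_def by (rule integral_abs_bound)
    then have "(mol \<phi> s f x)\<^sup>2 \<le> (LBINT z. \<bar>f (x - s *\<^sub>R z) * \<phi> z\<bar>)\<^sup>2"
      using power_mono[of "\<bar>mol \<phi> s f x\<bar>" _ 2] by simp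
    with 1 have "(mol \<phi> s f x)\<^sup>2 \<le> m * (LBINT z. (f (x - s *\<^sub>R z))\<^sup>2 * \<bar>\<phi> z\<bar>)" by (simp add: mult.commute)
    then show ?thesis
      using nn_integral_eq_integral[OF i] m by (simp add: ennreal_mult[symmetric] ennreal_leI)
  qed
  have "(\<integral>\<^sup>+x. ennreal ((mol \<phi> s f x)\<^sup>2) \<partial>lborel) \<le> (\<integral>\<^sup>+x. ennreal m * (\<integral>\<^sup>+z. ennreal ((f (x - s *\<^sub>R z))\<^sup>2 * \<bar>\<phi> z\<bar>) \<partial>lborel) \<partial>lborel)"
    by (intro nn_integral_mono pt)
  also have "... = ennreal m * (\<integral>\<^sup>+x. (\<integral>\<^sup>+z. ennreal ((f (x - s *\<^sub>R z))\<^sup>2 * \<bar>\<phi> z\<bar>) \<partial>lborel) \<partial>lborel)"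
    by (rule nn_integral_cmult) measurable
  also have "(\<integral>\<^sup>+x. (\<integral>\<^sup>+z. ennreal ((f (x - s *\<^sub>R z))\<^sup>2 * \<bar>\<phi> z\<bar>) \<partial>lborel) \<partial>lborel) = (\<integral>\<^sup>+z. (\<integral>\<^sup>+x. ennreal ((f (x - s *\<^sub>R z))\<^sup>2 * \<bar>\<phi> z\<bar>) \<partial>lborel) \<partial>lborel)"
    by (rule lborel_pair.Fubini') measurable
  also have "... = (\<integral>\<^sup>+z. ennreal (nsq f) * ennreal \<bar>\<phi> z\<bar> \<partial>lborel)"
    by (intro nn_integral_cong) (simp add: ennreal_mult nn_integral_multc sh)
  also have "... = ennreal (nsq f) * ennreal m"
    by (subst nn_integral_cmult) (auto simp: mi)
  also have "ennreal m * (ennreal (nsq f) * ennreal m) = ennreal (m\<^sup>2 * nsq f)"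
    using m nsq_nonneg[of f] by (simp add: ennreal_mult power2_eq_square mult_ac)
  finally have le: "(\<integral>\<^sup>+x. ennreal ((mol \<phi> s f x)\<^sup>2) \<partial>lborel) \<le> ennreal (m\<^sup>2 * nsq f)" .
  have i: "L1 (\<lambda>x. (mol \<phi> s f x)\<^sup>2)"
    by (rule integrableI_nonneg) (use le in "auto simp: le_less_trans")
  then show "sqint (mol \<phi> s f)" by (simp add: sqint_real)
  have "ennreal (nsq (mol \<phi> s f)) \<le> ennreal (m\<^sup>2 * nsq f)"
    using le nn_integral_eq_integral[OF i] by (simp add: nsq_real)
  then show "nsq (mol \<phi> s f) \<le> (LBINT z. \<bar>\<phi> z\<bar>)\<^sup>2 * nsq f"
    using nsq_nonneg[of f] by (simp add: m_def)
qed

section \<open>Sobolev functions\<close>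

text \<open>The gradient is an explicit argument because it is determined only almost everywhere;
  Borel representatives are built in through \<open>sqint\<close>.\<close>

definition sob :: "(R2 => real) => (R2 => R2) => bool" where
  "sob u G \<longleftrightarrow> sqint u \<and> sqint G \<and> (\<forall>\<phi>. test_fun \<phi> --> (\<forall>i\<in>Basis.
      (LBINT x. u x * pdv i \<phi> x) = - (LBINT x. (G x \<bullet> i) * \<phi> x)))"

lemma sobD:
  assumes "sob u G"
  shows "sqint u" "sqint G" "test_fun \<phi> ==> i \<in> Basis ==> (LBINT x. u x * pdv i \<phi> x) = - (LBINT x. (G x \<bullet> i) * \<phi> x)"
  using assms by (auto simp: sob_def)

lemma sob_lincomb:
  assumes u: "sob u G" and v: "sob v H"
  shows "sob (\<lambda>x. a * u x + b * v x) (\<lambda>x. a *\<^sub>R G x + b *\<^sub>R H x)"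
  unfolding sob_def
proof (intro conjI allI impI ballI)
  show "sqint (\<lambda>x. a * u x + b * v x)" "sqint (\<lambda>x. a *\<^sub>R G x + b *\<^sub>R H x)"
    by (intro sqint_add sqint_cmult sqint_scaleR sobD[OF u] sobD[OF v])+
  fix \<phi> :: "R2 => real" and i :: R2 assume \<phi>: "test_fun \<phi>" and i: "i \<in> Basis"
  have l: "L1 (\<lambda>x. f x * \<phi>' x)" if "sqint f" "test_fun \<phi>'" for f \<phi>'
    using that by (intro locint_test sqint_locint)
  note p = test_fun_pdv[OF \<phi> i]
  note j = l[OF sobD(1)[OF u] p] l[OF sobD(1)[OF v] p] l[OF sqint_inner(1)[OF sobD(2)[OF u] i] \<phi>] l[OF sqint_inner(1)[OF sobD(2)[OF v] i] \<phi>]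
  have "(LBINT x. (a * u x + b * v x) * pdv i \<phi> x) = (LBINT x. a * (u x * pdv i \<phi> x) + b * (v x * pdv i \<phi> x))"
    by (simp add: algebra_simps)
  also have "... = a * (LBINT x. u x * pdv i \<phi> x) + b * (LBINT x. v x * pdv i \<phi> x)"
    using j by simp
  also have "... = - (a * (LBINT x. (G x \<bullet> i) * \<phi> x) + b * (LBINT x. (H x \<bullet> i) * \<phi> x))"
    using sobD(3)[OF u \<phi> i] sobD(3)[OF v \<phi> i] by simp
  also have "... = - (LBINT x. a * ((G x \<bullet> i) * \<phi> x) + b * ((H x \<bullet> i) * \<phi> x))"
    using j by simp
  also have "... = - (LBINT x. ((a *\<^sub>R G x + b *\<^sub>R H x) \<bullet> i) * \<phi> x)"
    by (simp add: algebra_simps inner_add_left)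
  finally show "(LBINT x. (a * u x + b * v x) * pdv i \<phi> x) = - (LBINT x. ((a *\<^sub>R G x + b *\<^sub>R H x) \<bullet> i) * \<phi> x)" .
qed

lemma sob_unique:
  assumes u: "sob u G" and v: "sob u H" shows "AE x in lborel. G x = H x"
proof -
  have "AE x in lborel. G x \<bullet> i = H x \<bullet> i" if i: "i \<in> Basis" for i
    using sobD(3)[OF u _ i] sobD(3)[OF v _ i]
    by (intro fundamental_lemma sqint_locint sqint_inner(1) sobD(2)[OF u] sobD(2)[OF v] i) simp
  then have "AE x in lborel. \<forall>i\<in>Basis. G x \<bullet> i = H x \<bullet> i" by (intro AE_finite_allI) auto
  then show ?thesis by eventually_elim (auto intro: euclidean_eqI)
qed

lemma sob_cong_AE:
  assumes u: "sob u G" and [measurable]: "v \<in> Bor" "H \<in> Bor"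
    and eq: "AE x in lborel. u x = v x" "AE x in lborel. G x = H x"
  shows "sob v H"
proof -
  note [measurable] = sqint_borel[OF sobD(1)[OF u]] sqint_borel[OF sobD(2)[OF u]]
  have "sqint v" by (rule sqint_bound[OF sobD(1)[OF u]]) (use eq in auto)
  moreover have "sqint H" by (rule sqint_bound[OF sobD(2)[OF u]]) (use eq in auto)
  moreover have "(LBINT x. v x * pdv i \<phi> x) = - (LBINT x. (H x \<bullet> i) * \<phi> x)" if \<phi>: "test_fun \<phi>" and i: "i \<in> Basis" for \<phi> i
  proof -
    note [measurable] = test_fun_borel[OF \<phi>] test_fun_borel[OF test_fun_pdv[OF \<phi> i]]
    have "(LBINT x. v x * pdv i \<phi> x) = (LBINT x. u x * pdv i \<phi> x)"
      by (rule integral_cong_AE) (use eq in auto)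
    moreover have "(LBINT x. (H x \<bullet> i) * \<phi> x) = (LBINT x. (G x \<bullet> i) * \<phi> x)"
      by (rule integral_cong_AE) (use eq in auto)
    ultimately show ?thesis using sobD(3)[OF u \<phi> i] by simp
  qed
  ultimately show ?thesis by (simp add: sob_def)
qed

text \<open>The rescaled kernel is itself a test function. Differentiating it produces 1/s, so
  moving the derivative to \<open>u\<close> gains a factor \<open>s\<close>.\<close>

lemma mol_weak_gradient:
  assumes u: "sob u G" and \<phi>: "test_fun \<phi>" and i: "i \<in> Basis" and s: "s > 0"
  shows "mol (pdv i \<phi>) s u x = s * mol \<phi> s (\<lambda>y. G y \<bullet> i) x"
proof -
  note [measurable] = sqint_borel[OF sobD(1)[OF u]] sqint_borel[OF sobD(2)[OF u]] test_fun_borel[OF \<phi>] test_fun_borel[OF test_fun_pdv[OF \<phi> i]]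
  have "(LBINT y. u y * (- (1 / s) * pdv i \<phi> ((1 / s) *\<^sub>R (x - y)))) = - (LBINT y. (G y \<bullet> i) * \<phi> ((1 / s) *\<^sub>R (x - y)))"
    using sobD(3)[OF u test_kernel[OF \<phi> s, of x] i] unfolding pdv_kernel[OF \<phi> i] .
  then have "(LBINT y. u y * pdv i \<phi> ((1 / s) *\<^sub>R (x - y))) = s * (LBINT y. (G y \<bullet> i) * \<phi> ((1 / s) *\<^sub>R (x - y)))"
    using s by (simp add: field_simps)
  then show ?thesis using s by (simp add: mol_kernel)
qed

text \<open>The scale derivative of \<open>mol \<rho> s u\<close> for a Sobolev function: of the two
  derivatives in the Laplacian of \<open>\<psi>\<close> one is moved to \<open>u\<close>, and the
  gained factor \<open>s\<close> cancels the division by \<open>s\<close>.\<close>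

definition kgrad :: "(R2 => R2) => real => R2 => real" where
  "kgrad G s x = (\<Sum>i\<in>Basis. mol (pdv i \<psi>) s (\<lambda>y. G y \<bullet> i) x)"

lemma mol_sum_laplacian:
  assumes f: "locint f" and \<phi>: "test_fun \<phi>" and s: "s > 0"
  shows "mol (laplacian \<phi>) s f x = (\<Sum>i\<in>Basis. mol (pdv i (pdv i \<phi>)) s f x)"
proof -
  have B: "axis 1 1 \<in> (Basis :: R2 set)" "axis 2 1 \<in> (Basis :: R2 set)" by (auto simp: R2_Basis)
  show ?thesis unfolding laplacian_def[abs_def] R2_sum_Basis
    by (rule mol_add[OF f _ _ s]) (intro test_fun_pdv \<phi> B)+
qed

lemma mol_rho_sderiv_sob:
  assumes u: "sob u G" and s: "s > 0"
  shows "((\<lambda>s. mol \<rho> s u x) has_real_derivative kgrad G s x) (at s)"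
proof -
  have "mol (laplacian \<psi>) s u x = s * kgrad G s x"
    unfolding mol_sum_laplacian[OF sqint_locint[OF sobD(1)[OF u]] test_psi s] kgrad_def sum_distrib_left
    by (intro sum.cong mol_weak_gradient[OF u] test_fun_pdv test_psi s refl)
  then show ?thesis using mol_rho_has_sderiv[OF sqint_locint[OF sobD(1)[OF u]] s, of x] s by simp
qed

section \<open>Reproducing formula and mollification error\<close>

lemma mol_continuous_scale:
  assumes f: "locint f" and \<phi>: "test_fun \<phi>"
  shows "continuous_on {0<..} (\<lambda>s. mol \<phi> s f x)"
  by (rule DERIV_continuous_on) (use mol_has_sderiv[OF f \<phi>] has_field_derivative_at_within in blast)

text \<open>The fundamental theorem of calculus in the scale, between \<open>t\<close> and 1. Fubini
  gives integrability of \<open>k\<close> down to scale zero for almost every point, so the limit at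
  scale zero exists almost everywhere; box integrals identify it with
  \<open>mass * u\<close>.\<close>

lemma mol_reproducing:
  fixes k :: "real => R2 => real"
  assumes u: "locint u"
    and [measurable]: "(\<lambda>(x, s). k s x) \<in> Bor"
    and der: "\<And>x s. 0 < s ==> s \<le> 1 ==> ((\<lambda>s. mol \<rho> s u x) has_real_derivative k s x) (at s)"
    and cont: "\<And>x. continuous_on {0<..} (\<lambda>s. k s x)"
    and int: "\<And>R. integrable lborel2 (\<lambda>(x, s). indicator (cball 0 R) x * (unit_ind s * k s x))"
  shows "AE x in lborel. L1 (\<lambda>s. unit_ind s * k s x) \<and>
     (\<forall>t. 0 < t \<and> t \<le> 1 --> mass * u x = mol \<rho> t u x - (LBINT s. indicator {0<..<t} s * k s x))"
proof -
  note [measurable] = locint_borel[OF u] test_fun_borel[OF test_rho]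
  have km [measurable]: "(\<lambda>s. k s x) \<in> Bor" for x
    using measurable_compose[OF measurable_Pair1'[of x borel borel] assms(2)[unfolded borel_prod[symmetric]]] by simp
  have km2 [measurable]: "(\<lambda>(x, s). k s x) \<in> borel_measurable (borel \<Otimes>\<^sub>M borel)"
    unfolding borel_prod by (rule assms(2))
  have FTC: "(LBINT s. indicator {a..b} s * k s x) = mol \<rho> b u x - mol \<rho> a u x"
    if "0 < a" "a \<le> b" "b \<le> 1" for a b x
  proof -
    have "isCont (\<lambda>s. k s x) s" if "s > 0" for s
      using cont[of x] that by (simp add: continuous_on_eq_continuous_at)
    then have "(LBINT s. k s x * indicator {a..b} s) = mol \<rho> b u x - mol \<rho> a u x"
      using that by (intro integral_FTC_Icc_real der) auto
    then show ?thesis by (simp add: mult.commute)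
  qed
  \<comment> \<open>At points with integrable \<open>k\<close>, \<open>w x\<close> is the limit of
    \<open>mol \<rho> t u x\<close> at scale zero. Together with the mollification at scale 1, the
    function \<open>K\<close> defined next gives a locally integrable majorant for all
    \<open>t\<close>.\<close>
  define w where "w x = mol \<rho> 1 u x - (LBINT s. unit_ind s * k s x)" for x
  define K where "K x = (LBINT s. \<bar>unit_ind s * k s x\<bar>)" for x
  have wm [measurable]: "w \<in> Bor" unfolding w_def by measurable
  have "AE x in lborel. L1 (\<lambda>s. indicator (cball 0 (real n)) x * (unit_ind s * k s x))" for n
    using lborel_pair.AE_integrable_fst[OF int[of "real n"]] by simp
  then have "AE x in lborel. \<forall>n. L1 (\<lambda>s. indicator (cball 0 (real n)) x * (unit_ind s * k s x))"
    unfolding AE_all_countable by blast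
  then have AEint: "AE x in lborel. L1 (\<lambda>s. unit_ind s * k s x)"
  proof eventually_elim
    case (elim x)
    obtain n where "norm x \<le> real n" using real_arch_simple by blast
    then show ?case using elim[rule_format, of n] by simp
  qed
  have Kint: "L1 (\<lambda>x. indicator (cball 0 R) x * K x)" for R
  proof -
    have i: "integrable lborel2 (\<lambda>(x, s). \<bar>indicator (cball 0 R) x * (unit_ind s * k s x)\<bar>)"
      using integrable_norm[OF int[of R]] by (simp add: case_prod_beta')
    have "(LBINT s. \<bar>indicator (cball 0 R) x * (unit_ind s * k s x)\<bar>) = indicator (cball 0 R) x * K x" for x
      by (simp add: K_def abs_mult)
    then show ?thesis using lborel_pair.integrable_fst[OF i] by simp
  qed
  have molb: "locint (mol \<rho> 1 u)" by (intro locint_continuous mol_continuous u test_rho) simp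
  have nkey: "mol \<rho> t u x = w x + (LBINT s. indicator {0<..<t} s * k s x)"
    if "L1 (\<lambda>s. unit_ind s * k s x)" "0 < t" "t \<le> 1" for x t
  proof -
    have i1: "L1 (\<lambda>s. indicator {0<..<t} s * k s x)"
      by (rule L1_bound[OF that(1)]) (use that in "auto simp: indicator_def")
    have i2: "L1 (\<lambda>s. indicator {t..1} s * k s x)"
    proof (rule integrable_cong_AE_imp)
      show "L1 (\<lambda>s. unit_ind s * k s x - indicator {0<..<t} s * k s x)"
        using that(1) i1 by simp
      show "AE s in lborel. unit_ind s * k s x - indicator {0<..<t} s * k s x = indicator {t..1} s * k s x"
        using AE_lborel_singleton[of 1] by eventually_elim (use that in "auto simp: indicator_def")
    qed measurable
    have "(LBINT s. unit_ind s * k s x) = (LBINT s. indicator {0<..<t} s * k s x + indicator {t..1} s * k s x)"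
    proof (rule integral_cong_AE)
      show "AE s in lborel. unit_ind s * k s x = indicator {0<..<t} s * k s x + indicator {t..1} s * k s x"
        using AE_lborel_singleton[of 1] by eventually_elim (use that in "auto simp: indicator_def")
    qed measurable
    also have "... = (LBINT s. indicator {0<..<t} s * k s x) + (mol \<rho> 1 u x - mol \<rho> t u x)"
      using i1 i2 FTC[of t 1 x] that by simp
    finally show ?thesis by (simp add: w_def)
  qed
  have bnd: "\<bar>mol \<rho> t u x\<bar> \<le> \<bar>mol \<rho> 1 u x\<bar> + K x" "\<bar>w x\<bar> \<le> \<bar>mol \<rho> 1 u x\<bar> + K x"
    if i: "L1 (\<lambda>s. unit_ind s * k s x)" and t: "0 < t" "t \<le> 1" for x t
  proof -
    have "\<bar>LBINT s. unit_ind s * k s x\<bar> \<le> K x" unfolding K_def by (rule integral_abs_bound)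
    then show "\<bar>w x\<bar> \<le> \<bar>mol \<rho> 1 u x\<bar> + K x" unfolding w_def by linarith
    have "\<bar>LBINT s. indicator {t..1} s * k s x\<bar> \<le> (LBINT s. \<bar>indicator {t..1} s * k s x\<bar>)" by (rule integral_abs_bound)
    also have "... \<le> K x" unfolding K_def
    proof (rule integral_mono_AE)
      show "L1 (\<lambda>s. \<bar>unit_ind s * k s x\<bar>)" using i by (rule integrable_abs)
      then show "L1 (\<lambda>s. \<bar>indicator {t..1} s * k s x\<bar>)"
      proof (rule L1_bound)
        show "AE s in lborel. norm \<bar>indicator {t..1} s * k s x\<bar> \<le> norm \<bar>unit_ind s * k s x\<bar>"
          using AE_lborel_singleton[of 1] by eventually_elim (use t in "auto simp: indicator_def")
      qed measurable
      show "AE s in lborel. \<bar>indicator {t..1} s * k s x\<bar> \<le> \<bar>unit_ind s * k s x\<bar>"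
        using AE_lborel_singleton[of 1] by eventually_elim (use t in "auto simp: indicator_def")
    qed
    finally show "\<bar>mol \<rho> t u x\<bar> \<le> \<bar>mol \<rho> 1 u x\<bar> + K x" using FTC[of t 1 x] t by simp
  qed
  have K0: "0 \<le> \<bar>mol \<rho> 1 u x\<bar> + K x" for x unfolding K_def by (intro add_nonneg_nonneg integral_nonneg_AE) auto
  have domi: "L1 (\<lambda>x. indicator (cball 0 R) x * (\<bar>mol \<rho> 1 u x\<bar> + K x))" for R
    using locint_ball_abs[OF molb, of R] Kint[of R] by (simp add: distrib_left)
  have wloc: "locint w"
    unfolding locint_def set_integrable_def
  proof (intro conjI allI wm)
    fix R show "L1 (\<lambda>x. indicat_real (cball 0 R) x *\<^sub>R w x)"
    proof (rule L1_bound[OF domi[of R]])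
      show "AE x in lborel. norm (indicat_real (cball 0 R) x *\<^sub>R w x) \<le> norm (indicat_real (cball 0 R) x * (\<bar>mol \<rho> 1 u x\<bar> + K x))"
        using AEint by eventually_elim (use bnd(2)[where t=1] in "force simp: indicator_def")
      show "(\<lambda>x. indicat_real (cball 0 R) x *\<^sub>R w x) \<in> borel_measurable lborel"
        using wm by (intro borel_measurable_scaleR borel_measurable_indicator) auto
    qed
  qed
  have "AE x in lborel. mass * u x = w x"
  proof (rule AE_eq_of_box_integrals)
    show "locint (\<lambda>x. mass * u x)" using u by (auto simp: locint_def)
    show "locint w" by (rule wloc)
    fix a b :: R2
    obtain R where R: "box a b \<subseteq> cball 0 R" using box_subset_cball by blast
    let ?s = "\<lambda>n. 1 / real (Suc n)"
    have s: "\<And>n. 0 < ?s n" "?s ----> 0" "\<And>n. ?s n \<le> 1"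
      using LIMSEQ_inverse_real_of_nat by (simp_all add: inverse_eq_divide)
    have "(\<lambda>n. LBINT x. indicator (box a b) x * mol \<rho> (?s n) u x) ----> (LBINT x. indicator (box a b) x * w x)"
    proof (rule integral_dominated_convergence[where w="\<lambda>x. indicator (cball 0 R) x * (\<bar>mol \<rho> 1 u x\<bar> + K x)"])
      show "AE x in lborel. (\<lambda>n. indicator (box a b) x * mol \<rho> (?s n) u x) ----> indicator (box a b) x * w x"
        using AEint
      proof eventually_elim
        case (elim x)
        have "(\<lambda>n. LBINT s. indicator {0<..<?s n} s * k s x) ----> (\<integral>s. 0 \<partial>(lborel :: real measure))"
        proof (rule integral_dominated_convergence[where w="\<lambda>s. \<bar>unit_ind s * k s x\<bar>"])
          show "L1 (\<lambda>s. \<bar>unit_ind s * k s x\<bar>)" using elim by (rule integrable_abs)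
          show "AE y in lborel. (\<lambda>n. indicator {0<..<?s n} y * k y x) ----> 0"
          proof (rule AE_I2)
            fix y :: real
            have "\<forall>\<^sub>F n in sequentially. indicator {0<..<?s n} y * k y x = 0"
            proof (cases "y > 0")
              case True
              have "\<forall>\<^sub>F n in sequentially. ?s n < y" using s(2) True by (rule order_tendstoD)
              then show ?thesis by eventually_elim (auto simp: indicator_def)
            qed (auto simp: indicator_def)
            then show "(\<lambda>n. indicator {0<..<?s n} y * k y x) ----> 0" by (rule tendsto_eventually)
          qed
          show "AE y in lborel. norm (indicator {0<..<?s n} y * k y x) \<le> \<bar>indicator {0<..<1} y * k y x\<bar>" for n
            using less_le_trans[OF _ s(3)[of n]] by (intro AE_I2) (auto simp: indicator_def simp del: of_nat_Suc)
        qed measurable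
        then have "(\<lambda>n. indicator (box a b) x * (w x + (LBINT s. indicator {0<..<?s n} s * k s x))) ----> indicator (box a b) x * (w x + 0)"
          by (intro tendsto_intros) auto
        then show ?case using nkey[OF elim s(1) s(3)] by simp
      qed
      show "AE x in lborel. norm (indicator (box a b) x * mol \<rho> (?s n) u x) \<le> indicator (cball 0 R) x * (\<bar>mol \<rho> 1 u x\<bar> + K x)" for n
        using AEint by eventually_elim (use R bnd(1)[OF _ s(1) s(3), of _ n] K0 in "auto simp: indicator_def")
      show "L1 (\<lambda>x. indicator (cball 0 R) x * (\<bar>mol \<rho> 1 u x\<bar> + K x))" by (rule domi)
    qed measurable
    from LIMSEQ_unique[OF this mol_tendsto_box[OF u test_rho s(1,2)]]
    show "(LBINT x. indicator (box a b) x * (mass * u x)) = (LBINT x. indicator (box a b) x * w x)"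
      by (simp add: mass_def mult.left_commute)
  qed
  with AEint show ?thesis
  proof eventually_elim
    case (elim x)
    show ?case
    proof (intro conjI allI impI)
      show "L1 (\<lambda>s. unit_ind s * k s x)" by (rule elim)
      fix t :: real assume "0 < t \<and> t \<le> 1"
      then show "mass * u x = mol \<rho> t u x - (LBINT s. indicator {0<..<t} s * k s x)"
        using nkey[OF elim(1)] elim(2) by auto
    qed
  qed
qed

lemma kgrad_borel:
  assumes "sqint G" shows "(\<lambda>(x, s). kgrad G s x) \<in> Bor"
proof -
  note [measurable] = sqint_borel[OF assms]
  have B: "axis 1 1 \<in> (Basis :: R2 set)" "axis 2 1 \<in> (Basis :: R2 set)" by (auto simp: R2_Basis)
  note [measurable] = test_fun_borel[OF test_fun_pdv[OF test_psi B(1)]] test_fun_borel[OF test_fun_pdv[OF test_psi B(2)]]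
  have "(\<lambda>p. kgrad G (snd p) (fst p)) \<in> borel_measurable (borel \<Otimes>\<^sub>M borel)"
    unfolding kgrad_def R2_sum_Basis by measurable
  then show ?thesis by (simp add: case_prod_beta' borel_prod)
qed

text \<open>Bounds the squared L2 norm of \<open>kgrad\<close>: one squared L1 norm for each partial
  derivative of the kernel, and a factor 2 for squaring a sum of two terms.\<close>

definition kconst :: real where
  "kconst = 2 * (\<Sum>i\<in>(Basis::R2 set). (LBINT z. \<bar>pdv i \<psi> z\<bar>)\<^sup>2)"

lemma kconst_nonneg: "kconst \<ge> 0" by (simp add: kconst_def sum_nonneg)

lemma kgrad_L2:
  assumes G: "sqint G" and s: "s > 0"
  shows "sqint (kgrad G s)" "nsq (kgrad G s) \<le> kconst * nsq G"
proof -
  have m: "sqint (mol (pdv i \<psi>) s (\<lambda>y. G y \<bullet> i))"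
    "nsq (mol (pdv i \<psi>) s (\<lambda>y. G y \<bullet> i)) \<le> (LBINT z. \<bar>pdv i \<psi> z\<bar>)\<^sup>2 * nsq G" if i: "i \<in> Basis" for i
  proof -
    note * = mol_L2[OF sqint_inner(1)[OF G i] test_fun_pdv[OF test_psi i] s]
    show "sqint (mol (pdv i \<psi>) s (\<lambda>y. G y \<bullet> i))" by (rule *)
    show "nsq (mol (pdv i \<psi>) s (\<lambda>y. G y \<bullet> i)) \<le> (LBINT z. \<bar>pdv i \<psi> z\<bar>)\<^sup>2 * nsq G"
      by (rule order_trans[OF *(2)]) (intro mult_left_mono sqint_inner(2) G i, simp)
  qed
  have B: "axis 1 1 \<in> (Basis :: R2 set)" "axis 2 1 \<in> (Basis :: R2 set)" by (auto simp: R2_Basis)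
  show "sqint (kgrad G s)" unfolding kgrad_def[abs_def] R2_sum_Basis by (intro sqint_add m B)
  have "nsq (kgrad G s) \<le> 2 * nsq (mol (pdv (axis 1 1) \<psi>) s (\<lambda>y. G y \<bullet> axis 1 1)) + 2 * nsq (mol (pdv (axis 2 1) \<psi>) s (\<lambda>y. G y \<bullet> axis 2 1))"
    unfolding kgrad_def[abs_def] R2_sum_Basis by (rule sqint_add(2)[OF m(1)[OF B(1)] m(1)[OF B(2)]])
  also have "... \<le> kconst * nsq G"
    using m(2)[OF B(1)] m(2)[OF B(2)] by (simp add: kconst_def R2_sum_Basis algebra_simps)
  finally show "nsq (kgrad G s) \<le> kconst * nsq G" .
qed

lemma kgrad_cont:
  assumes G: "sqint G" shows "continuous_on {0<..} (\<lambda>s. kgrad G s x)"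
  unfolding kgrad_def
  by (intro continuous_on_sum mol_continuous_scale sqint_locint sqint_inner(1) G test_fun_pdv test_psi)

text \<open>The error is the integral of \<open>kgrad\<close> over the scales below
  \<open>t\<close>. Cauchy-Schwarz in the scale gives one factor \<open>t\<close>; integrating the
  scale-independent L2 bound of \<open>kgrad\<close> over the same interval gives the other.\<close>

lemma mol_approx:
  assumes u: "sob u G" and t: "0 < t" "t \<le> 1"
  shows "nsq (\<lambda>x. mass * u x - mol \<rho> t u x) \<le> t\<^sup>2 * (kconst * nsq G)"
proof -
  note G = sobD(2)[OF u]
  note [measurable] = kgrad_borel[OF G] sqint_borel[OF sobD(1)[OF u]] test_fun_borel[OF test_rho]
  have k2 [measurable]: "(\<lambda>(x, s). kgrad G s x) \<in> borel_measurable (borel \<Otimes>\<^sub>M borel)"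
    unfolding borel_prod by (rule kgrad_borel[OF G])
  define C where "C = kconst * nsq G"
  have C: "C \<ge> 0" using kconst_nonneg by (simp add: C_def nsq_nonneg)
  have sq: "(\<integral>\<^sup>+x. (\<integral>\<^sup>+s. ennreal (indicator {0<..<r} s * (kgrad G s x)\<^sup>2) \<partial>lborel) \<partial>lborel) \<le> ennreal (r * C)" if r: "0 < r" for r
  proof -
    have "(\<integral>\<^sup>+x. (\<integral>\<^sup>+s. ennreal (indicator {0<..<r} s * (kgrad G s x)\<^sup>2) \<partial>lborel) \<partial>lborel) = (\<integral>\<^sup>+s. (\<integral>\<^sup>+x. ennreal (indicator {0<..<r} s * (kgrad G s x)\<^sup>2) \<partial>lborel) \<partial>lborel)"
      by (rule lborel_pair.Fubini') measurable
    also have "... \<le> (\<integral>\<^sup>+s. ennreal C * indicator {0<..<r} s \<partial>lborel)"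
    proof (rule nn_integral_mono)
      fix s :: real
      show "(\<integral>\<^sup>+x. ennreal (indicator {0<..<r} s * (kgrad G s x)\<^sup>2) \<partial>lborel) \<le> ennreal C * indicator {0<..<r} s"
      proof (cases "s \<in> {0<..<r}")
        case True
        then have "(\<integral>\<^sup>+x. ennreal ((kgrad G s x)\<^sup>2) \<partial>lborel) = ennreal (nsq (kgrad G s))"
          using kgrad_L2(1)[OF G, of s] by (subst nn_integral_eq_integral) (auto simp: sqint_real nsq_real)
        then show ?thesis using True kgrad_L2(2)[OF G, of s] by (simp add: C_def ennreal_leI)
      qed simp
    qed
    also have "... = ennreal (r * C)" using r C by (simp add: nn_integral_cmult_indicator ennreal_mult mult.commute)
    finally show ?thesis .
  qed
  have int: "integrable lborel2 (\<lambda>(x, s). indicator (cball 0 R) x * (unit_ind s * kgrad G s x))" for R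
  proof (rule L1_bound)
    show "integrable lborel2 (\<lambda>(x::R2, s::real). indicator (cball 0 R \<times> {0<..<1}) (x, s) + unit_ind s * (kgrad G s x)\<^sup>2)"
    proof -
      have "integrable lborel2 (\<lambda>p::R2 \<times> real. indicator (cball 0 R \<times> {0<..<1}) p :: real)"
      proof (rule integrable_real_indicator)
        show "emeasure lborel2 (cball (0::R2) R \<times> {0<..<1::real}) < \<infinity>"
          using emeasure_lborel_cball_finite[of "0::R2" R]
          by (subst lborel.emeasure_pair_measure_Times) (auto simp: ennreal_mult_less_top)
      qed measurable
      moreover have "integrable lborel2 (\<lambda>p::R2 \<times> real. indicator {0<..<1} (snd p) * (kgrad G (snd p) (fst p))\<^sup>2)"
      proof (rule integrableI_nonneg)
        have "(\<integral>\<^sup>+p. ennreal (indicator {0<..<1} (snd p) * (kgrad G (snd p) (fst p))\<^sup>2) \<partial>lborel2) = (\<integral>\<^sup>+x. (\<integral>\<^sup>+s. ennreal (unit_ind s * (kgrad G s x)\<^sup>2) \<partial>lborel) \<partial>lborel)"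
          by (subst lborel.nn_integral_fst[symmetric]) auto
        then show "(\<integral>\<^sup>+p. ennreal (indicator {0<..<1} (snd p) * (kgrad G (snd p) (fst p))\<^sup>2) \<partial>lborel2) < \<infinity>"
          using sq[of 1] by (simp add: le_less_trans)
      qed auto
      ultimately show ?thesis by (simp add: case_prod_beta')
    qed
    have a: "\<bar>a\<bar> \<le> 1 + a\<^sup>2" for a :: real
      using sum_squares_bound[of "\<bar>a\<bar>" 1] by (simp add: power2_eq_square)
    show "AE p in lborel2. norm (case p of (x, s) => indicat_real (cball 0 R) x * (indicat_real {0<..<1} s * kgrad G s x))
          \<le> norm (case p of (x, s) => indicator (cball 0 R \<times> {0<..<1}) (x, s) + unit_ind s * (kgrad G s x)\<^sup>2)"
      by (intro AE_I2) (auto simp: indicator_def a)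
  qed measurable
  have "AE x in lborel. L1 (\<lambda>s. unit_ind s * kgrad G s x) \<and>
     (\<forall>t. 0 < t \<and> t \<le> 1 --> mass * u x = mol \<rho> t u x - (LBINT s. indicator {0<..<t} s * kgrad G s x))"
    using mol_rho_sderiv_sob[OF u]
    by (intro mol_reproducing sqint_locint sobD(1)[OF u] kgrad_borel G kgrad_cont int) auto
  then have rep: "AE x in lborel. ennreal ((mass * u x - mol \<rho> t u x)\<^sup>2) \<le> ennreal t * (\<integral>\<^sup>+s. ennreal (indicator {0<..<t} s * (kgrad G s x)\<^sup>2) \<partial>lborel)"
  proof eventually_elim
    case (elim x)
    then have i1: "L1 (\<lambda>s. unit_ind s * kgrad G s x)"
      and e: "mass * u x - mol \<rho> t u x = - (LBINT s. indicator {0<..<t} s * kgrad G s x)" using t by auto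
    have [measurable]: "(\<lambda>s. kgrad G s x) \<in> Bor"
      using measurable_compose[OF measurable_Pair1'[of x borel borel] k2] by simp
    have i: "L1 (\<lambda>s. indicator {0<..<t} s * kgrad G s x)"
      by (rule L1_bound[OF i1]) (use t in "auto simp: indicator_def")
    have "ennreal \<bar>LBINT s. indicator {0<..<t} s * kgrad G s x\<bar> \<le> (\<integral>\<^sup>+s. ennreal \<bar>indicator {0<..<t} s * kgrad G s x\<bar> \<partial>lborel)"
      using integral_norm_bound_ennreal[OF i] by simp
    also have "... = (\<integral>\<^sup>+s. indicator {0<..<t} s * ennreal \<bar>indicator {0<..<t} s * kgrad G s x\<bar> \<partial>lborel)"
      by (intro nn_integral_cong) (auto simp: indicator_def)
    finally have "(ennreal \<bar>LBINT s. indicator {0<..<t} s * kgrad G s x\<bar>)\<^sup>2 \<le> (\<integral>\<^sup>+s. indicator {0<..<t} s * ennreal \<bar>indicator {0<..<t} s * kgrad G s x\<bar> \<partial>lborel)\<^sup>2"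
      by (rule power_mono) simp
    also have "... \<le> (\<integral>\<^sup>+s. (indicator {0<..<t} s)\<^sup>2 \<partial>lborel) * (\<integral>\<^sup>+s. (ennreal \<bar>indicator {0<..<t} s * kgrad G s x\<bar>)\<^sup>2 \<partial>lborel)"
      by (rule Cauchy_Schwarz_nn_integral) auto
    also have "(\<integral>\<^sup>+(s::real). (indicator {0<..<t} s)\<^sup>2 \<partial>lborel) = ennreal t"
    proof -
      have "(\<integral>\<^sup>+(s::real). (indicator {0<..<t} s)\<^sup>2 \<partial>lborel) = (\<integral>\<^sup>+(s::real). indicator {0<..<t} s \<partial>lborel)"
        by (intro nn_integral_cong) (auto simp: indicator_def)
      then show ?thesis using t by simp
    qed
    also have "(\<integral>\<^sup>+s. (ennreal \<bar>indicator {0<..<t} s * kgrad G s x\<bar>)\<^sup>2 \<partial>lborel) = (\<integral>\<^sup>+s. ennreal (indicator {0<..<t} s * (kgrad G s x)\<^sup>2) \<partial>lborel)"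
      by (intro nn_integral_cong) (auto simp: indicator_def ennreal_power)
    finally show ?case unfolding e by (simp add: ennreal_power)
  qed
  have "(\<integral>\<^sup>+x. ennreal ((mass * u x - mol \<rho> t u x)\<^sup>2) \<partial>lborel) \<le> (\<integral>\<^sup>+x. ennreal t * (\<integral>\<^sup>+s. ennreal (indicator {0<..<t} s * (kgrad G s x)\<^sup>2) \<partial>lborel) \<partial>lborel)"
    by (rule nn_integral_mono_AE[OF rep])
  also have "... = ennreal t * (\<integral>\<^sup>+x. (\<integral>\<^sup>+s. ennreal (indicator {0<..<t} s * (kgrad G s x)\<^sup>2) \<partial>lborel) \<partial>lborel)"
    by (rule nn_integral_cmult) measurable
  also have "... \<le> ennreal t * ennreal (t * C)" using t by (intro mult_left_mono sq) auto
  also have "... = ennreal (t\<^sup>2 * C)" using t C by (simp add: ennreal_mult[symmetric] power2_eq_square mult.assoc)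
  finally have le: "(\<integral>\<^sup>+x. ennreal ((mass * u x - mol \<rho> t u x)\<^sup>2) \<partial>lborel) \<le> ennreal (t\<^sup>2 * C)" .
  have "sqint (\<lambda>x. mass * u x - mol \<rho> t u x)"
    by (intro sqint_diff(1) sqint_cmult(1) mol_L2(1) sobD(1)[OF u] test_rho t)
  then have "(\<integral>\<^sup>+x. ennreal ((mass * u x - mol \<rho> t u x)\<^sup>2) \<partial>lborel) = ennreal (nsq (\<lambda>x. mass * u x - mol \<rho> t u x))"
    by (subst nn_integral_eq_integral) (auto simp: sqint_real nsq_real)
  then have "ennreal (nsq (\<lambda>x. mass * u x - mol \<rho> t u x)) \<le> ennreal (t\<^sup>2 * C)" using le by simp
  then show ?thesis using C by (simp add: C_def)
qed

section \<open>The Sobolev inequality\<close>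

text \<open>By Cauchy-Schwarz the scale derivative is at most a constant times 1/s, so the change
  between the scales \<open>t\<close> and 1 is at most logarithmic: the borderline behaviour of H1
  functions in the plane.\<close>

lemma mol_log_bound:
  assumes u: "sob u G" and le: "nsq u \<le> 1" "nsq G \<le> 1" and t: "0 < t" "t \<le> 1"
  shows "\<bar>mol \<rho> t u x\<bar> \<le> (sqrt (nsq \<rho>) + (\<Sum>i\<in>Basis. sqrt (nsq (pdv i \<psi>)))) * (1 + ln (1 / t))"
proof -
  define D where "D = (\<Sum>i\<in>(Basis::R2 set). sqrt (nsq (pdv i \<psi>)))"
  have D: "D \<ge> 0" by (simp add: D_def sum_nonneg nsq_nonneg)
  have kb: "\<bar>kgrad G s x\<bar> \<le> D / s" if s: "s > 0" for s
  proof -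
    have "\<bar>kgrad G s x\<bar> \<le> (\<Sum>i\<in>Basis. \<bar>mol (pdv i \<psi>) s (\<lambda>y. G y \<bullet> i) x\<bar>)" unfolding kgrad_def by (rule sum_abs)
    also have "... \<le> (\<Sum>i\<in>Basis. sqrt (nsq (pdv i \<psi>)) / s)"
    proof (rule sum_mono)
      fix i :: R2 assume i: "i \<in> Basis"
      have "\<bar>mol (pdv i \<psi>) s (\<lambda>y. G y \<bullet> i) x\<bar> \<le> sqrt (nsq (pdv i \<psi>)) * sqrt (nsq (\<lambda>y. G y \<bullet> i)) / s"
        by (rule mol_sup[OF sqint_inner(1)[OF sobD(2)[OF u] i] test_fun_pdv[OF test_psi i] s])
      also have "... \<le> sqrt (nsq (pdv i \<psi>)) * 1 / s"
        using sqint_inner(2)[OF sobD(2)[OF u] i] le s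
        by (intro divide_right_mono mult_left_mono) (auto simp: nsq_nonneg)
      finally show "\<bar>mol (pdv i \<psi>) s (\<lambda>y. G y \<bullet> i) x\<bar> \<le> sqrt (nsq (pdv i \<psi>)) / s" by simp
    qed
    also have "... = D / s" by (simp add: D_def sum_divide_distrib)
    finally show ?thesis .
  qed
  have m1: "\<bar>mol \<rho> 1 u x\<bar> \<le> sqrt (nsq \<rho>)"
  proof -
    have "\<bar>mol \<rho> 1 u x\<bar> \<le> sqrt (nsq \<rho>) * sqrt (nsq u) / 1" by (rule mol_sup[OF sobD(1)[OF u] test_rho]) simp
    also have "... \<le> sqrt (nsq \<rho>) * 1 / 1" using le by (intro divide_right_mono mult_left_mono) (auto simp: nsq_nonneg)
    finally show ?thesis by simp
  qed
  \<comment> \<open>Integration in the scale is replaced by monotonicity: adding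
    \<open>D * ln s\<close> makes both the mollification and its negative nondecreasing in
    \<open>s\<close>.\<close>
  have "mol \<rho> t u x + D * ln t \<le> mol \<rho> 1 u x + D * ln 1"
  proof (rule DERIV_nonneg_imp_nondecreasing[OF t(2)])
    fix s assume s: "t \<le> s" "s \<le> 1"
    then have "s > 0" using t by simp
    then show "\<exists>y. ((\<lambda>s. mol \<rho> s u x + D * ln s) has_real_derivative y) (at s) \<and> 0 \<le> y"
      using abs_le_D2[OF kb, of s] mol_rho_sderiv_sob[OF u, of s x]
      by (intro exI[of _ "kgrad G s x + D * (1 / s)"] conjI) (auto intro!: derivative_eq_intros)
  qed
  moreover have "- mol \<rho> t u x + D * ln t \<le> - mol \<rho> 1 u x + D * ln 1"
  proof (rule DERIV_nonneg_imp_nondecreasing[OF t(2)])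
    fix s assume s: "t \<le> s" "s \<le> 1"
    then have "s > 0" using t by simp
    then show "\<exists>y. ((\<lambda>s. - mol \<rho> s u x + D * ln s) has_real_derivative y) (at s) \<and> 0 \<le> y"
      using abs_le_D1[OF kb, of s] mol_rho_sderiv_sob[OF u, of s x]
      by (intro exI[of _ "- kgrad G s x + D * (1 / s)"] conjI) (auto intro!: derivative_eq_intros)
  qed
  ultimately have "\<bar>mol \<rho> t u x\<bar> \<le> \<bar>mol \<rho> 1 u x\<bar> + D * ln (1 / t)" using t by (simp add: ln_div)
  also have "... \<le> sqrt (nsq \<rho>) + D * ln (1 / t)" using m1 by simp
  also have "... \<le> (sqrt (nsq \<rho>) + D) * (1 + ln (1 / t))"
  proof -
    have l: "0 \<le> ln (1 / t)" using t by simp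
    have "0 \<le> sqrt (nsq \<rho>) * ln (1 / t)" using l by (intro mult_nonneg_nonneg) (auto simp: nsq_nonneg)
    then show ?thesis using D by (simp add: algebra_simps)
  qed
  finally show ?thesis by (simp add: D_def)
qed

text \<open>Where |u| lies between 2A(1 + n) and 2A(2 + n), the mollification at scale exp(-n) is at
  most A(1 + n) by the logarithmic bound, hence differs from \<open>u\<close> by at least A(1 + n).
  Its squared L2 error is of order exp(-2 n), which beats the polynomial growth of |u|^q over the
  layers. Values up to 2A are handled by the L2 norm.\<close>

lemma sobolev_unit:
  assumes q: "q \<ge> 2"
  obtains C where "C \<ge> 0" "\<And>u G. sob u G ==> nsq u \<le> 1 ==> nsq G \<le> 1 ==>
    L1 (\<lambda>x. \<bar>u x\<bar> powr q) \<and> (LBINT x. \<bar>u x\<bar> powr q) \<le> C"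
proof -
  \<comment> \<open>The constant of the logarithmic bound for the mollification divided by
    \<open>mass\<close>; the summand 1 makes it positive.\<close>
  define A where "A = (sqrt (nsq \<rho>) + (\<Sum>i\<in>(Basis::R2 set). sqrt (nsq (pdv i \<psi>)))) / mass + 1"
  have A: "A > 0" unfolding A_def using mass_pos by (intro add_nonneg_pos divide_nonneg_pos add_nonneg_nonneg sum_nonneg) (auto simp: nsq_nonneg)
  \<comment> \<open>The upper bound for |u|^q on the n-th layer, divided by the lower bound for the
    squared mollification error there.\<close>
  define a where "a n = (2 * A * (2 + real n)) powr q / (A * (1 + real n))\<^sup>2" for n
  have a: "a n \<ge> 0" for n by (simp add: a_def)
  define K where "K = kconst / mass\<^sup>2"
  have K: "K \<ge> 0" using kconst_nonneg by (simp add: K_def)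
  obtain m :: nat where m: "q \<le> real m" using real_arch_simple by blast
  have sm: "summable (\<lambda>n. a n * (K * exp (- 2 * real n)))"
  proof (rule summable_comparison_test, intro exI[of _ 0] allI impI)
    show "summable (\<lambda>n. (2 * A) powr q / A\<^sup>2 * fact m * exp 2 * K * (exp (-1)) ^ n)"
      by (intro summable_mult summable_geometric) auto
    fix n :: nat
    have "(2 * A * (2 + real n)) powr q = (2 * A) powr q * (2 + real n) powr q" using A by (simp add: powr_mult)
    moreover have "(2 + real n) powr q \<le> fact m * exp (2 + real n)"
    proof -
      have "(2 + real n) powr q \<le> (2 + real n) powr (real m)" using m by (intro powr_mono) auto
      also have "... = (2 + real n) ^ m" by (simp add: powr_realpow)
      also have "... \<le> fact m * exp (2 + real n)"
      proof -
        have s: "(\<lambda>k. (2 + real n) ^ k /\<^sub>R fact k) sums exp (2 + real n)" by (rule exp_converges)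
        have "(2 + real n) ^ m /\<^sub>R fact m \<le> exp (2 + real n)"
          using sum_le_suminf[OF sums_summable[OF s], of "{m}"] sums_unique[OF s] by simp
        then show ?thesis by (simp add: field_simps)
      qed
      finally show ?thesis .
    qed
    ultimately have 1: "(2 * A * (2 + real n)) powr q \<le> (2 * A) powr q * (fact m * exp (2 + real n))"
      by (simp add: mult_left_mono)
    have 2: "A\<^sup>2 \<le> (A * (1 + real n))\<^sup>2" using A by (intro power_mono) auto
    have "a n \<le> (2 * A) powr q * (fact m * exp (2 + real n)) / A\<^sup>2"
      unfolding a_def using A 1 2 by (intro frac_le) auto
    then have "a n * (K * exp (- 2 * real n)) \<le> (2 * A) powr q * (fact m * exp (2 + real n)) / A\<^sup>2 * (K * exp (- 2 * real n))"
      using K by (intro mult_right_mono) auto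
    also have "... = (2 * A) powr q / A\<^sup>2 * fact m * exp 2 * K * (exp (-1)) ^ n"
      by (simp add: exp_of_nat_mult[symmetric] exp_add[symmetric] field_simps)
    finally show "norm (a n * (K * exp (- 2 * real n))) \<le> (2 * A) powr q / A\<^sup>2 * fact m * exp 2 * K * (exp (-1)) ^ n"
      using a K by simp
  qed
  define C where "C = (2 * A) powr (q - 2) + (\<Sum>n. a n * (K * exp (- 2 * real n)))"
  have S0: "0 \<le> (\<Sum>n. a n * (K * exp (- 2 * real n)))" using a K by (intro suminf_nonneg sm) auto
  have C: "C \<ge> 0" unfolding C_def using S0 by simp
  show ?thesis
  proof (rule that[OF C])
    fix u G assume u: "sob u G" and le: "nsq u \<le> 1" "nsq G \<le> 1"
    note [measurable] = sqint_borel[OF sobD(1)[OF u]] test_fun_borel[OF test_rho]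
    define v where "v n x = mol \<rho> (exp (- real n)) u x / mass" for n x
    have [measurable]: "v n \<in> Bor" for n unfolding v_def by measurable
    have vb: "\<bar>v n x\<bar> \<le> A * (1 + real n)" for n x
    proof -
      have "\<bar>mol \<rho> (exp (- real n)) u x\<bar> \<le> (sqrt (nsq \<rho>) + (\<Sum>i\<in>Basis. sqrt (nsq (pdv i \<psi>)))) * (1 + ln (1 / exp (- real n)))"
        by (rule mol_log_bound[OF u le]) auto
      then have "\<bar>v n x\<bar> \<le> (A - 1) * (1 + real n)"
        using mass_pos by (simp add: v_def A_def ln_div field_simps)
      then show ?thesis by (simp add: algebra_simps)
    qed
    have vi: "L1 (\<lambda>x. (u x - v n x)\<^sup>2)" "(LBINT x. (u x - v n x)\<^sup>2) \<le> K * exp (- 2 * real n)" for n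
    proof -
      have e: "u x - v n x = (1 / mass) * (mass * u x - mol \<rho> (exp (- real n)) u x)" for x
        using mass_pos by (simp add: v_def field_simps)
      have s: "sqint (\<lambda>x. mass * u x - mol \<rho> (exp (- real n)) u x)"
        by (intro sqint_diff(1) sqint_cmult(1) mol_L2(1) sobD(1)[OF u] test_rho) simp
      show "L1 (\<lambda>x. (u x - v n x)\<^sup>2)"
        using sqint_cmult(1)[OF s, of "1/mass"] unfolding e by (simp add: sqint_real)
      have "(LBINT x. (u x - v n x)\<^sup>2) = nsq (\<lambda>x. mass * u x - mol \<rho> (exp (- real n)) u x) / mass\<^sup>2"
        using sqint_cmult(2)[OF s, of "1/mass"] unfolding e by (simp add: nsq_real power_divide)
      also have "... \<le> (exp (- real n))\<^sup>2 * (kconst * nsq G) / mass\<^sup>2"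
        by (intro divide_right_mono mol_approx[OF u]) auto
      also have "... \<le> (exp (- real n))\<^sup>2 * (kconst * 1) / mass\<^sup>2"
        using le kconst_nonneg by (intro divide_right_mono mult_left_mono) auto
      also have "... = K * exp (- 2 * real n)" by (simp add: K_def exp_double[symmetric])
      finally show "(LBINT x. (u x - v n x)\<^sup>2) \<le> K * exp (- 2 * real n)" .
    qed
    have pt: "ennreal (\<bar>u x\<bar> powr q) \<le> ennreal ((2 * A) powr (q - 2) * (u x)\<^sup>2) + (\<Sum>n. ennreal (a n * (u x - v n x)\<^sup>2))" for x
    proof (cases "\<bar>u x\<bar> \<le> 2 * A")
      case True
      have "\<bar>u x\<bar> powr q = \<bar>u x\<bar> powr (q - 2) * \<bar>u x\<bar> powr 2" unfolding powr_add[symmetric] by simp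
      also have "... = \<bar>u x\<bar> powr (q - 2) * (u x)\<^sup>2" by (cases "u x = 0") auto
      also have "... \<le> (2 * A) powr (q - 2) * (u x)\<^sup>2" using True q by (intro mult_right_mono powr_mono2) auto
      finally have "ennreal (\<bar>u x\<bar> powr q) \<le> ennreal ((2 * A) powr (q - 2) * (u x)\<^sup>2)" by (rule ennreal_leI)
      then show ?thesis by (simp add: add_increasing2)
    next
      case False
      \<comment> \<open>The layer of \<open>x\<close>. Layer n starts at 2A(1 + n), hence the
        integer part of |u| / (2A) minus one.\<close>
      define n where "n = nat \<lfloor>\<bar>u x\<bar> / (2 * A)\<rfloor> - 1"
      have f1: "1 \<le> \<bar>u x\<bar> / (2 * A)" using False A by simp
      then have "1 \<le> \<lfloor>\<bar>u x\<bar> / (2 * A)\<rfloor>" by simp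
      then have "int n = \<lfloor>\<bar>u x\<bar> / (2 * A)\<rfloor> - 1" unfolding n_def by linarith
      then have "real n = of_int \<lfloor>\<bar>u x\<bar> / (2 * A)\<rfloor> - 1" by linarith
      then have n: "real n + 1 \<le> \<bar>u x\<bar> / (2 * A)" "\<bar>u x\<bar> / (2 * A) < real n + 2" by linarith+
      then have n': "2 * (A * (1 + real n)) \<le> \<bar>u x\<bar>" "\<bar>u x\<bar> \<le> 2 * A * (2 + real n)" using A by (simp_all add: field_simps)
      have "A * (1 + real n) \<le> \<bar>u x - v n x\<bar>" using n'(1) vb[of n x] by linarith
      then have 1: "(A * (1 + real n))\<^sup>2 \<le> (u x - v n x)\<^sup>2" using A by (simp add: abs_le_square_iff[symmetric])
      have "\<bar>u x\<bar> powr q \<le> (2 * A * (2 + real n)) powr q" using n'(2) q by (intro powr_mono2) auto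
      also have "... = a n * (A * (1 + real n))\<^sup>2" using A by (simp add: a_def)
      also have "... \<le> a n * (u x - v n x)\<^sup>2" using a 1 by (intro mult_left_mono) auto
      finally have "ennreal (\<bar>u x\<bar> powr q) \<le> ennreal (a n * (u x - v n x)\<^sup>2)" by (rule ennreal_leI)
      also have "... \<le> (\<Sum>n. ennreal (a n * (u x - v n x)\<^sup>2))"
        using sum_le_suminf[of "\<lambda>n. ennreal (a n * (u x - v n x)\<^sup>2)" "{n}"] by simp
      finally show ?thesis by (simp add: add_increasing)
    qed
    have "(\<integral>\<^sup>+x. ennreal (\<bar>u x\<bar> powr q) \<partial>lborel) \<le> (\<integral>\<^sup>+x. ennreal ((2 * A) powr (q - 2) * (u x)\<^sup>2) + (\<Sum>n. ennreal (a n * (u x - v n x)\<^sup>2)) \<partial>lborel)"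
      by (intro nn_integral_mono pt)
    also have "... = (\<integral>\<^sup>+x. ennreal ((2 * A) powr (q - 2) * (u x)\<^sup>2) \<partial>lborel) + (\<Sum>n. \<integral>\<^sup>+x. ennreal (a n * (u x - v n x)\<^sup>2) \<partial>lborel)"
      by (subst nn_integral_add) (auto simp: nn_integral_suminf)
    also have "... \<le> ennreal ((2 * A) powr (q - 2)) + (\<Sum>n. ennreal (a n * (K * exp (- 2 * real n))))"
    proof (intro add_mono suminf_le summableI)
      have "L1 (\<lambda>x. (2 * A) powr (q - 2) * (u x)\<^sup>2)" using sobD(1)[OF u] by (simp add: sqint_real)
      then have "(\<integral>\<^sup>+x. ennreal ((2 * A) powr (q - 2) * (u x)\<^sup>2) \<partial>lborel) = ennreal ((2 * A) powr (q - 2) * nsq u)"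
        by (subst nn_integral_eq_integral) (auto simp: nsq_real)
      also have "... \<le> ennreal ((2 * A) powr (q - 2) * 1)" using le by (intro ennreal_leI mult_left_mono) auto
      finally show "(\<integral>\<^sup>+x. ennreal ((2 * A) powr (q - 2) * (u x)\<^sup>2) \<partial>lborel) \<le> ennreal ((2 * A) powr (q - 2))" by simp
      fix n
      have "(\<integral>\<^sup>+x. ennreal (a n * (u x - v n x)\<^sup>2) \<partial>lborel) = ennreal (a n * (LBINT x. (u x - v n x)\<^sup>2))"
        using vi(1)[of n] a[of n] by (subst nn_integral_eq_integral) auto
      also have "... \<le> ennreal (a n * (K * exp (- 2 * real n)))" using vi(2)[of n] a[of n] by (intro ennreal_leI mult_left_mono)
      finally show "(\<integral>\<^sup>+x. ennreal (a n * (u x - v n x)\<^sup>2) \<partial>lborel) \<le> ennreal (a n * (K * exp (- 2 * real n)))" .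
    qed
    also have "(\<Sum>n. ennreal (a n * (K * exp (- 2 * real n)))) = ennreal (\<Sum>n. a n * (K * exp (- 2 * real n)))"
      using a K by (intro suminf_ennreal2 sm) auto
    also have "ennreal ((2 * A) powr (q - 2)) + ... = ennreal C" unfolding C_def using S0 by simp
    finally have le: "(\<integral>\<^sup>+x. ennreal (\<bar>u x\<bar> powr q) \<partial>lborel) \<le> ennreal C" .
    have i: "L1 (\<lambda>x. \<bar>u x\<bar> powr q)"
      by (rule integrableI_nonneg) (use le in "auto simp: le_less_trans")
    have "ennreal (LBINT x. \<bar>u x\<bar> powr q) \<le> ennreal C" using le nn_integral_eq_integral[OF i] by simp
    then show "L1 (\<lambda>x. \<bar>u x\<bar> powr q) \<and> (LBINT x. \<bar>u x\<bar> powr q) \<le> C" using i C by simp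
  qed
qed

text \<open>Homogeneity: dividing by the square root of \<open>nsq u + nsq G\<close> reduces to the
  unit ball. If this number is zero, \<open>u\<close> vanishes almost everywhere.\<close>

lemma sobolev:
  assumes q: "q \<ge> 2"
  obtains C where "C \<ge> 0" "\<And>u G. sob u G ==> L1 (\<lambda>x. \<bar>u x\<bar> powr q)"
    "\<And>u G. sob u G ==> (LBINT x. \<bar>u x\<bar> powr q) \<le> C * (nsq u + nsq G) powr (q / 2)"
proof -
  obtain C where C: "C \<ge> 0" "\<And>u G. sob u G ==> nsq u \<le> 1 ==> nsq G \<le> 1 ==>
    L1 (\<lambda>x. \<bar>u x\<bar> powr q) \<and> (LBINT x. \<bar>u x\<bar> powr q) \<le> C" using sobolev_unit[OF q] by blast
  have "L1 (\<lambda>x. \<bar>u x\<bar> powr q) \<and> (LBINT x. \<bar>u x\<bar> powr q) \<le> C * (nsq u + nsq G) powr (q / 2)" if u: "sob u G" for u G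
  proof (cases "nsq u + nsq G = 0")
    case True
    note [measurable] = sqint_borel[OF sobD(1)[OF u]]
    have "nsq u = 0" using True nsq_nonneg[of u] nsq_nonneg[of G] by linarith
    then have "AE x in lborel. (u x)\<^sup>2 = 0"
      using sobD(1)[OF u] unfolding nsq_real sqint_real by (subst integral_nonneg_eq_0_iff_AE[symmetric]) auto
    then have z: "AE x in lborel. \<bar>u x\<bar> powr q = 0" by eventually_elim (use q in auto)
    have "L1 (\<lambda>x. \<bar>u x\<bar> powr q)"
      by (rule integrable_cong_AE_imp[of _ "\<lambda>_. 0"]) (use z in auto)
    moreover have "(LBINT x. \<bar>u x\<bar> powr q) = (\<integral>x. 0 \<partial>(lborel :: R2 measure))" by (rule integral_cong_AE) (use z in auto)
    ultimately show ?thesis using C by simp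
  next
    case False
    define R where "R = sqrt (nsq u + nsq G)"
    have R: "R > 0" "R\<^sup>2 = nsq u + nsq G" using False nsq_nonneg[of u] nsq_nonneg[of G] by (auto simp: R_def)
    have R': "0 < nsq u + nsq G" using R by (metis zero_less_power)
    have s: "sob (\<lambda>x. (1/R) * u x) (\<lambda>x. (1/R) *\<^sub>R G x)" using sob_lincomb[OF u u, of "1/R" 0] by simp
    have n1: "nsq (\<lambda>x. (1/R) * u x) \<le> 1"
      using sqint_cmult(2)[OF sobD(1)[OF u], of "1/R"] R R' nsq_nonneg[of G] by (simp add: power_divide divide_le_eq_1)
    have n2: "nsq (\<lambda>x. (1/R) *\<^sub>R G x) \<le> 1"
      using sqint_scaleR(2)[OF sobD(2)[OF u], of "1/R"] R R' nsq_nonneg[of u] by (simp add: power_divide divide_le_eq_1)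
    have e: "\<bar>u x\<bar> powr q = R powr q * \<bar>(1/R) * u x\<bar> powr q" for x
      using R by (simp add: powr_mult[symmetric] abs_mult)
    have Rq: "R powr q = (nsq u + nsq G) powr (q / 2)"
      using R(1) unfolding R(2)[symmetric] by (simp add: powr_powr powr_numeral[symmetric] del: powr_numeral)
    have "L1 (\<lambda>x. R powr q * \<bar>(1/R) * u x\<bar> powr q)" using C(2)[OF s n1 n2] by simp
    moreover have "(LBINT x. R powr q * \<bar>(1/R) * u x\<bar> powr q) \<le> R powr q * C"
      using C(2)[OF s n1 n2] unfolding integral_mult_right_zero by (intro mult_left_mono) auto
    ultimately have "L1 (\<lambda>x. \<bar>u x\<bar> powr q) \<and> (LBINT x. \<bar>u x\<bar> powr q) \<le> R powr q * C"
      unfolding e[symmetric] by blast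
    then show ?thesis unfolding Rq by (simp add: mult.commute)
  qed
  then show ?thesis using that[OF C(1)] by blast
qed

section \<open>Closedness, moduli and compactness\<close>

lemma sqint_conv_integral:
  assumes F: "\<And>n. sqint (F n)" and f: "sqint f" and lim: "(\<lambda>n. dsq (F n) f) ----> 0" and g: "sqint g"
  shows "(\<lambda>n. LBINT x. F n x * g x) ----> (LBINT x. (f x * g x :: real))"
proof -
  have "(\<lambda>n. (LBINT x. F n x * g x) - (LBINT x. f x * g x)) ----> 0"
  proof (rule Lim_null_comparison)
    show "\<forall>\<^sub>F n in sequentially. norm ((LBINT x. F n x * g x) - (LBINT x. f x * g x)) \<le> sqrt (dsq (F n) f) * sqrt (nsq g)"
    proof (rule always_eventually, rule allI)
      fix n
      have "(LBINT x. F n x * g x) - (LBINT x. f x * g x) = (LBINT x. (F n x - f x) * g x)"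
        using sqint_prod(1)[OF F[of n] g] sqint_prod(1)[OF f g] by (simp add: left_diff_distrib)
      then show "norm ((LBINT x. F n x * g x) - (LBINT x. f x * g x)) \<le> sqrt (dsq (F n) f) * sqrt (nsq g)"
        using sqint_prod(2)[OF sqint_diff(1)[OF F[of n] f] g] by simp
    qed
    have "(\<lambda>n. sqrt (dsq (F n) f) * sqrt (nsq g)) ----> sqrt 0 * sqrt (nsq g)"
      by (intro tendsto_intros lim)
    then show "(\<lambda>n. sqrt (dsq (F n) f) * sqrt (nsq g)) ----> 0" by simp
  qed
  then show ?thesis by (simp add: LIM_zero_iff)
qed

lemma nsq_limit_le:
  fixes f :: "R2 => 'a::euclidean_space"
  assumes F: "\<And>n. sqint (F n)" and f: "sqint f" and lim: "(\<lambda>n. dsq (F n) f) ----> 0"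
    and A: "(\<lambda>n. a n) ----> A" "\<And>n::nat. nsq (F n) \<le> a n"
  shows "nsq f \<le> A"
proof (rule field_le_epsilon)
  fix e :: real assume e: "e > 0"
  obtain r where r: "strict_mono (r :: nat => nat)" "AE x in lborel. (\<lambda>n. F (r n) x) ----> f x"
    using sqint_conv_AE_subseq[OF F f lim] by blast
  note [measurable] = sqint_borel[OF F] sqint_borel[OF f]
  have "\<forall>\<^sub>F n in sequentially. a n < A + e" using A(1) e by (intro order_tendstoD) auto
  then obtain N where N: "\<And>n. n \<ge> N ==> a n < A + e" by (auto simp: eventually_sequentially)
  have "(LBINT x. (norm (f x))\<^sup>2) \<le> A + e"
  proof (rule Fatou_real(2)[where F="\<lambda>n x. (norm (F (r (n + N)) x))\<^sup>2"])
    show "L1 (\<lambda>x. (norm (F (r (n + N)) x))\<^sup>2)" for n using F by (simp add: sqint_def)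
    have "n + N \<le> r (n + N)" for n using r(1) by (rule strict_mono_imp_increasing)
    then have "N \<le> r (n + N)" for n by (meson le_add2 order_trans)
    then show "(LBINT x. (norm (F (r (n + N)) x))\<^sup>2) \<le> A + e" for n
      using A(2)[of "r (n + N)"] N[of "r (n + N)"] unfolding nsq_def by (meson less_imp_le order_trans)
    show "AE x in lborel. (\<lambda>n. (norm (F (r (n + N)) x))\<^sup>2) ----> (norm (f x))\<^sup>2"
      using r(2) by eventually_elim (intro tendsto_intros LIMSEQ_ignore_initial_segment)
  qed auto
  then show "nsq f \<le> A + e" by (simp add: nsq_def)
qed

lemma sob_closed:
  assumes W: "\<And>n. sob (W n) (H n)" and u: "sqint u" and G: "sqint G"
    and lim: "(\<lambda>n. dsq (W n) u) ----> 0" "(\<lambda>n. dsq (H n) G) ----> 0"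
  shows "sob u G"
  unfolding sob_def
proof (intro conjI u G allI impI ballI)
  fix \<phi> :: "R2 => real" and i :: R2 assume \<phi>: "test_fun \<phi>" and i: "i \<in> Basis"
  have "(\<lambda>n. LBINT x. W n x * pdv i \<phi> x) ----> (LBINT x. u x * pdv i \<phi> x)"
    by (intro sqint_conv_integral sobD(1)[OF W] u lim test_sqint test_fun_pdv \<phi> i)
  moreover have "(\<lambda>n. LBINT x. (H n x \<bullet> i) * \<phi> x) ----> (LBINT x. (G x \<bullet> i) * \<phi> x)"
  proof (intro sqint_conv_integral sqint_inner(1) sobD(2)[OF W] G i test_sqint \<phi>)
    have "nsq (\<lambda>x. H n x \<bullet> i - G x \<bullet> i) \<le> dsq (H n) G" for n
      using sqint_inner(2)[OF sqint_diff(1)[OF sobD(2)[OF W] G] i] by (simp add: inner_diff_left)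
    then show "(\<lambda>n. nsq (\<lambda>x. H n x \<bullet> i - G x \<bullet> i)) ----> 0"
      by (intro tendsto_sandwich[OF _ _ tendsto_const lim(2)]) (auto simp: nsq_nonneg)
  qed
  ultimately have "(\<lambda>n. LBINT x. W n x * pdv i \<phi> x) ----> - (LBINT x. (G x \<bullet> i) * \<phi> x)"
    using sobD(3)[OF W \<phi> i] by (simp add: tendsto_minus_cancel_left[symmetric])
  with \<open>(\<lambda>n. LBINT x. W n x * pdv i \<phi> x) ----> (LBINT x. u x * pdv i \<phi> x)\<close>
  show "(LBINT x. u x * pdv i \<phi> x) = - (LBINT x. (G x \<bullet> i) * \<phi> x)" by (rule LIMSEQ_unique)
qed

text \<open>Gradients of almost minimal norm over shrinking \<open>L\<^sup>2\<close>-balls around \<open>u\<close> form a Cauchy sequence,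
  by the parallelogram law; this replaces weak compactness.\<close>

lemma sob_lsc:
  assumes u: "sqint u" and U: "\<And>n. sob (U n) (G n)" and lim: "(\<lambda>n. dsq (U n) u) ----> 0"
    and A: "\<And>n. nsq (G n) \<le> A"
  shows "\<exists>G. sob u G \<and> nsq G \<le> A"
proof -
  define S where "S k = {(w, H). sob w H \<and> dsq w u \<le> 1 / real (Suc k)}" for k
  \<comment> \<open>Infimum of the squared gradient norms in the ball of squared L2 radius 1/(k + 1)
    around \<open>u\<close>; it grows as the balls shrink and stays below \<open>A\<close>.\<close>
  define a where "a k = (INF p\<in>S k. nsq (snd p))" for k
  have bdd: "bdd_below ((\<lambda>p. nsq (snd p)) ` S k)" for k by (rule bdd_belowI[of _ 0]) (auto simp: nsq_nonneg)
  have mem: "\<exists>n. (U n, G n) \<in> S k" for k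
  proof -
    have "\<forall>\<^sub>F n in sequentially. dsq (U n) u < 1 / real (Suc k)" using lim by (intro order_tendstoD) auto
    then show ?thesis using U by (auto simp: S_def eventually_sequentially intro: less_imp_le)
  qed
  have ne: "S k \<noteq> {}" for k using mem[of k] by auto
  have aA: "a k \<le> A" for k
  proof -
    obtain n where "(U n, G n) \<in> S k" using mem by blast
    then have "a k \<le> nsq (G n)" unfolding a_def using cINF_lower[OF bdd, of "(U n, G n)" k] by simp
    then show ?thesis using A[of n] by simp
  qed
  have Smono: "S m \<subseteq> S k" if "k \<le> m" for k m
  proof -
    have "1 / real (Suc m) \<le> 1 / real (Suc k)" using that by (intro divide_left_mono) auto
    then show ?thesis by (auto simp: S_def)
  qed
  have amono: "incseq a" unfolding incseq_def a_def using Smono by (auto intro!: cINF_superset_mono ne bdd)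
  obtain L where L: "a ----> L" "\<And>k. a k \<le> L" using incseq_convergent[OF amono, of A] aA by auto
  have LA: "L \<le> A" by (rule LIMSEQ_le_const2[OF L(1)]) (use aA in auto)
  have "\<exists>p\<in>S k. nsq (snd p) < a k + 1 / real (Suc k)" for k
  proof (rule ccontr)
    assume "\<not> ?thesis"
    then have "a k + 1 / real (Suc k) \<le> a k" unfolding a_def[of k] by (intro cINF_greatest ne) (auto simp: not_less)
    then show False by simp
  qed
  then obtain p where p: "\<And>k. p k \<in> S k" "\<And>k. nsq (snd (p k)) < a k + 1 / real (Suc k)" by metis
  define w where "w k = fst (p k)" for k
  define H where "H k = snd (p k)" for k
  have w: "sob (w k) (H k)" "nsq (\<lambda>x. w k x - u x) \<le> 1 / real (Suc k)" "nsq (H k) \<le> a k + 1 / real (Suc k)" for k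
    using p(1)[of k] p(2)[of k] by (auto simp: S_def w_def H_def)
  have est: "nsq (\<lambda>x. H k x - H m x) \<le> 2 * (L - a k) + 4 / real (Suc k)" if km: "k \<le> m" for k m
  proof -
    have m1: "1 / real (Suc m) \<le> 1 / real (Suc k)" using that by (intro divide_left_mono) auto
    \<comment> \<open>The midpoint stays in the ball \<open>S k\<close>, so its squared gradient
      norm is at least \<open>a k\<close>; since both gradients are nearly minimal, the
      parallelogram law forces them together.\<close>
    have "sob (\<lambda>x. 1/2 * w k x + 1/2 * w m x) (\<lambda>x. (1/2) *\<^sub>R H k x + (1/2) *\<^sub>R H m x)" by (rule sob_lincomb[OF w(1) w(1)])
    moreover have "nsq (\<lambda>x. (1/2 * w k x + 1/2 * w m x) - u x) \<le> 1 / real (Suc k)"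
    proof -
      have "nsq (\<lambda>x. (1/2) * (w k x - u x) + (1/2) * (w m x - u x)) \<le> 2 * nsq (\<lambda>x. (1/2) * (w k x - u x)) + 2 * nsq (\<lambda>x. (1/2) * (w m x - u x))"
        by (intro sqint_add(2) sqint_cmult(1) sqint_diff(1) sobD(1)[OF w(1)] u)
      also have "... = (1/2) * nsq (\<lambda>x. w k x - u x) + (1/2) * dsq (w m) u"
        unfolding sqint_cmult(2)[OF sqint_diff(1)[OF sobD(1)[OF w(1)] u]] by (simp add: power_divide)
      also have "... \<le> 1 / real (Suc k)" using w(2)[of k] w(2)[of m] m1 by linarith
      finally show ?thesis by (simp add: algebra_simps)
    qed
    ultimately have "(\<lambda>x. 1/2 * w k x + 1/2 * w m x, \<lambda>x. (1/2) *\<^sub>R H k x + (1/2) *\<^sub>R H m x) \<in> S k" by (simp add: S_def)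
    from cINF_lower[OF bdd this] have "a k \<le> nsq (\<lambda>x. (1/2) *\<^sub>R H k x + (1/2) *\<^sub>R H m x)" by (simp add: a_def)
    also have "... = (1/4) * nsq (\<lambda>x. H k x + H m x)"
      using sqint_scaleR(2)[OF sqint_add(1)[OF sobD(2)[OF w(1)] sobD(2)[OF w(1)]], of "1/2" k m] by (simp add: scaleR_add_right power_divide)
    finally have "4 * a k \<le> nsq (\<lambda>x. H k x + H m x)" by simp
    moreover have "nsq (\<lambda>x. H k x + H m x) + nsq (\<lambda>x. H k x - H m x) = 2 * nsq (H k) + 2 * nsq (H m)"
      by (intro nsq_parallelogram sobD(2)[OF w(1)])
    ultimately show ?thesis using w(3)[of k] w(3)[of m] L(2)[of m] m1 by simp
  qed
  have "\<exists>N. \<forall>m\<ge>N. \<forall>n\<ge>N. dsq (H m) (H n) < e" if e: "e > 0" for e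
  proof -
    have "(\<lambda>k. 2 * (L - a k) + 4 * (1 / real (Suc k))) ----> 2 * (L - L) + 4 * 0"
      using LIMSEQ_inverse_real_of_nat by (intro tendsto_intros L) (simp add: inverse_eq_divide)
    then have "\<forall>\<^sub>F k in sequentially. 2 * (L - a k) + 4 * (1 / real (Suc k)) < e" using e by (intro order_tendstoD) auto
    then obtain N where N: "\<And>k. k \<ge> N ==> 2 * (L - a k) + 4 / real (Suc k) < e" by (auto simp: eventually_sequentially)
    have "dsq (H m) (H n) < e" if "m \<ge> N" "n \<ge> N" for m n
    proof (cases "m \<le> n")
      case True then show ?thesis using est[OF True] N[OF that(1)] by linarith
    next
      case False then show ?thesis using est[of n m] N[OF that(2)] nsq_commute[of "H m" "H n"] by linarith
    qed
    then show ?thesis by blast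
  qed
  from sqint_complete[OF sobD(2)[OF w(1)] this]
  obtain F where F: "sqint F" "(\<lambda>n. dsq (H n) F) ----> 0" by blast
  have wl: "(\<lambda>n. dsq (w n) u) ----> 0"
  proof (rule tendsto_sandwich[OF _ _ tendsto_const])
    show "(\<lambda>n. 1 / real (Suc n)) ----> 0" using LIMSEQ_inverse_real_of_nat by (simp add: inverse_eq_divide)
  qed (use w(2) in "auto simp: nsq_nonneg")
  have "sob u F" by (rule sob_closed[OF w(1) u F(1) wl F(2)])
  moreover have "nsq F \<le> L + 0"
  proof (rule nsq_limit_le[OF sobD(2)[OF w(1)] F])
    show "(\<lambda>k. a k + 1 / real (Suc k)) ----> L + 0"
      using LIMSEQ_inverse_real_of_nat by (intro tendsto_intros L) (simp add: inverse_eq_divide)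
  qed (rule w(3))
  ultimately show ?thesis using LA by auto
qed

text \<open>The integral of a translate of \<open>h\<close> does not depend on the translation;
  differentiating under the integral sign at zero gives the integral of the partial
  derivative.\<close>

lemma integral_pdv_eq_0:
  assumes h: "Ck 1 h" and r: "\<And>x. norm x > r ==> h x = 0" and i: "i \<in> Basis"
  shows "(LBINT x. pdv i h x) = 0"
proof -
  have ch: "continuous_on UNIV h" and cp: "continuous_on UNIV (pdv i h)"
    using h i Ck_cont by (auto simp: One_nat_def Ck_Suc)
  have [measurable]: "h \<in> Bor" "pdv i h \<in> Bor"
    using ch cp by (auto intro: borel_measurable_continuous_onI)
  have "compact (pdv i h ` cball 0 r)" using cp by (intro compact_continuous_image) (auto intro: continuous_on_subset)
  then obtain B where B: "B > 0" "\<forall>y\<in>pdv i h ` cball 0 r. norm y \<le> B" using compact_imp_bounded bounded_pos by blast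
  have "pdv i h x = 0" if "norm x > r" for x by (rule pdv_eq_0_outside[OF r that])
  then have Bx: "\<bar>pdv i h x\<bar> \<le> B" for x using B by (cases "norm x \<le> r") auto
  have hi: "integrable lborel h"
  proof -
    have "L1 (\<lambda>x. indicator (cball 0 r) x * h x)" by (rule locint_ball[OF locint_continuous[OF ch]])
    moreover have "(\<lambda>x. indicator (cball 0 r) x * h x) = h" using r by (force simp: indicator_def)
    ultimately show ?thesis by simp
  qed
  have hs: "L1 (\<lambda>x. h (x + t *\<^sub>R i))" "(LBINT x. h (x + t *\<^sub>R i)) = (LBINT x. h x)" for t
    using lborel_integral_affine[of h 1 "t *\<^sub>R i"] hi by (auto simp: add.commute)
  have "((\<lambda>t. LBINT x. h (x + t *\<^sub>R i)) has_real_derivative (LBINT x. pdv i h x)) (at 0)"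
  proof (rule has_real_derivative_integral[where d=1 and w="\<lambda>x. B * indicator (cball 0 (r + 1)) x"])
    show "((\<lambda>t. h (y + t *\<^sub>R i)) has_real_derivative pdv i h y) (at 0)" for y
      using Ck_has_pdv[of 0 h i y 0] h i by (simp add: One_nat_def)
    show "\<bar>h (y + t *\<^sub>R i) - h (y + 0 *\<^sub>R i)\<bar> \<le> \<bar>t - 0\<bar> * (B * indicator (cball 0 (r + 1)) y)" if t: "\<bar>t - 0\<bar> < 1" for t y
    proof (cases "norm y \<le> r + 1")
      case True
      have "norm (h (y + t *\<^sub>R i) - h (y + 0 *\<^sub>R i)) \<le> B * norm (t - 0)"
        by (rule field_differentiable_bound[where S=UNIV and f="\<lambda>t. h (y + t *\<^sub>R i)" and f'="\<lambda>t. pdv i h (y + t *\<^sub>R i)"])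
           (use Ck_has_pdv[of 0 h i y] h i Bx in "auto simp: One_nat_def")
      then show ?thesis using True by (simp add: mult.commute)
    next
      case False
      have "norm y - \<bar>t\<bar> \<le> norm (y + t *\<^sub>R i)" using norm_triangle_ineq4[of "y + t *\<^sub>R i" "t *\<^sub>R i"] i by simp
      then have "h (y + t *\<^sub>R i) = 0" "h y = 0" using False t by (auto intro!: r)
      then show ?thesis using B(1) by simp
    qed
    show "L1 (\<lambda>x::R2. B * indicator (cball 0 (r + 1)) x)" by (intro integrable_mult_right integrable_indicator_cball)
  qed (use hs in auto)
  moreover have "((\<lambda>t. LBINT x. h (x + t *\<^sub>R i)) has_real_derivative 0) (at 0)" unfolding hs by simp
  ultimately show ?thesis by (rule DERIV_unique)
qed

lemma integration_by_parts:
  assumes f: "Ck 1 f" and \<phi>: "test_fun \<phi>" and i: "i \<in> Basis"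
  shows "(LBINT x. f x * pdv i \<phi> x) = - (LBINT x. pdv i f x * \<phi> x)"
proof -
  obtain r where r: "r > 0" "\<And>x. norm x > r ==> \<phi> x = 0" using test_fun_support[OF \<phi>] by blast
  have "continuous_on UNIV f" "continuous_on UNIV (pdv i f)" using f i by (auto simp: One_nat_def Ck_Suc Ck_0)
  then have lf: "locint f" "locint (pdv i f)" by (auto intro: locint_continuous)
  have ii: "L1 (\<lambda>x. f x * pdv i \<phi> x)" "L1 (\<lambda>x. pdv i f x * \<phi> x)"
    by (intro locint_test lf \<phi> test_fun_pdv i)+
  have "(LBINT x. pdv i (\<lambda>x. f x * \<phi> x) x) = 0"
    by (rule integral_pdv_eq_0[where r=r, OF Ck_mult[OF f test_fun_Ck[OF \<phi>]] _ i]) (use r in auto)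
  moreover have "pdv i (\<lambda>x. f x * \<phi> x) x = f x * pdv i \<phi> x + pdv i f x * \<phi> x" for x
    using Ck_has_pdv[of 0 f i x 0] test_fun_has_pdv[OF \<phi> i, of x 0] f i
    by (auto intro!: pdv_eqI derivative_eq_intros simp: One_nat_def)
  ultimately show ?thesis using ii by simp
qed

lemma norm_sum_Basis_sq: "(norm (\<Sum>i\<in>Basis. f i *\<^sub>R i))\<^sup>2 = (\<Sum>i\<in>(Basis :: R2 set). (f i)\<^sup>2)"
  unfolding power2_norm_eq_inner
  by (simp add: inner_sum_left inner_sum_right inner_Basis sum.delta' power2_eq_square if_distrib cong: if_cong)

lemma sob_Ck:
  assumes f: "Ck 1 f" "sqint f" and p: "\<And>i. i \<in> Basis ==> sqint (pdv i f)"
  shows "sob f (\<lambda>x. \<Sum>i\<in>Basis. pdv i f x *\<^sub>R i)" "nsq (\<lambda>x. \<Sum>i\<in>Basis. pdv i f x *\<^sub>R i) = (\<Sum>i\<in>Basis. nsq (pdv i f))"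
proof -
  have i: "L1 (\<lambda>x. (pdv i f x)\<^sup>2)" if "i \<in> Basis" for i using p[OF that] by (simp add: sqint_real)
  have m: "(\<lambda>x. \<Sum>i\<in>Basis. pdv i f x *\<^sub>R i) \<in> Bor"
    using p by (intro borel_measurable_sum borel_measurable_scaleR) auto
  have "sqint (\<lambda>x. \<Sum>i\<in>Basis. pdv i f x *\<^sub>R i)"
    using m i by (simp add: sqint_def norm_sum_Basis_sq)
  moreover have "(LBINT x. f x * pdv i \<phi> x) = - (LBINT x. ((\<Sum>i\<in>Basis. pdv i f x *\<^sub>R i) \<bullet> i) * \<phi> x)" if "test_fun \<phi>" "i \<in> Basis" for \<phi> i
    using integration_by_parts[OF f(1) that] that(2) by simp
  ultimately show "sob f (\<lambda>x. \<Sum>i\<in>Basis. pdv i f x *\<^sub>R i)" using f by (simp add: sob_def)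
  show "nsq (\<lambda>x. \<Sum>i\<in>Basis. pdv i f x *\<^sub>R i) = (\<Sum>i\<in>Basis. nsq (pdv i f))"
    using i by (simp add: nsq_def norm_sum_Basis_sq)
qed

lemma nsq_Basis: fixes G :: "R2 => R2" assumes "sqint G" shows "(\<Sum>i\<in>Basis. nsq (\<lambda>x. G x \<bullet> i)) = nsq G"
proof -
  have "(norm v)\<^sup>2 = (\<Sum>i\<in>Basis. (v \<bullet> i)\<^sup>2)" for v :: R2
    unfolding power2_norm_eq_inner by (subst euclidean_inner) (simp add: power2_eq_square)
  then have "nsq G = (LBINT x. (\<Sum>i\<in>Basis. (G x \<bullet> i)\<^sup>2))" by (simp only: nsq_def)
  then show ?thesis using sqint_inner(1)[OF assms] by (simp add: nsq_real sqint_real)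
qed

lemma mol_mass_L2:
  assumes f: "sqint f" and s: "s > 0"
  shows "sqint (\<lambda>x. mol \<rho> s f x / mass)" "nsq (\<lambda>x. mol \<rho> s f x / mass) \<le> nsq f"
proof -
  note * = sqint_cmult[OF mol_L2(1)[OF f test_rho s], of "1 / mass"]
  show "sqint (\<lambda>x. mol \<rho> s f x / mass)" using *(1) by simp
  have m: "(LBINT z. \<bar>\<rho> z\<bar>) = mass" using rho_nonneg by (simp add: mass_def)
  have "nsq (\<lambda>x. mol \<rho> s f x / mass) = nsq (mol \<rho> s f) / mass\<^sup>2" using *(2) by (simp add: power_divide)
  also have "... \<le> (mass\<^sup>2 * nsq f) / mass\<^sup>2" using mol_L2(2)[OF f test_rho s] unfolding m by (intro divide_right_mono) auto
  finally show "nsq (\<lambda>x. mol \<rho> s f x / mass) \<le> nsq f" using mass_pos by simp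
qed

lemma mol_mass_approx:
  assumes u: "sob u G" and t: "0 < t" "t \<le> 1"
  shows "nsq (\<lambda>x. mol \<rho> t u x / mass - u x) \<le> t\<^sup>2 * (kconst / mass\<^sup>2 * nsq G)"
proof -
  have s: "sqint (\<lambda>x. mass * u x - mol \<rho> t u x)"
    by (intro sqint_diff(1) sqint_cmult(1) mol_L2(1) sobD(1)[OF u] test_rho t)
  have "mol \<rho> t u x / mass - u x = (- 1 / mass) * (mass * u x - mol \<rho> t u x)" for x
    using mass_pos by (simp add: field_simps)
  then have "nsq (\<lambda>x. mol \<rho> t u x / mass - u x) = nsq (\<lambda>x. (- 1 / mass) * (mass * u x - mol \<rho> t u x))"
    by (simp only:)
  also have "... = nsq (\<lambda>x. mass * u x - mol \<rho> t u x) / mass\<^sup>2"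
    using sqint_cmult(2)[OF s, of "- 1 / mass"] by (simp add: power_divide)
  also have "... \<le> t\<^sup>2 * (kconst * nsq G) / mass\<^sup>2" by (intro divide_right_mono mol_approx[OF u t]) simp
  finally show ?thesis by (simp add: mult_ac)
qed

text \<open>The modulus is approached by smoothed moduli of mollifications. Neither the
  mollification nor the smoothing increases the gradient norm, so \<open>sob_lsc\<close> yields a
  gradient of |u| with the same bound.\<close>

lemma sob_abs:
  assumes u: "sob u G"
  shows "\<exists>H. sob (\<lambda>x. \<bar>u x\<bar>) H \<and> nsq H \<le> nsq G"
proof -
  note [measurable] = sqint_borel[OF sobD(1)[OF u]] test_fun_borel[OF test_rho]
  define s where "s n = 1 / real (Suc n)" for n
  have s: "s n > 0" "s n \<le> 1" for n by (auto simp: s_def)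
  have sl: "s ----> 0" using LIMSEQ_inverse_real_of_nat by (simp add: inverse_eq_divide s_def[abs_def])
  define w where "w n x = mol \<rho> (s n) u x / mass" for n x
  \<comment> \<open>Subtracting \<open>s n\<close> makes the smoothed modulus vanish where
    \<open>w n\<close> does; it then lies between 0 and |w n| and is square integrable on the whole
    plane.\<close>
  define v where "v n x = sqrt ((w n x)\<^sup>2 + (s n)\<^sup>2) - s n" for n x
  have pos: "(w n x)\<^sup>2 + (s n)\<^sup>2 > 0" for n x using s(1)[of n] by (simp add: add_nonneg_pos)
  have wC: "Ck k (w n)" for n k
    using Ck_mult[OF Ck_const[of _ "1 / mass"] mol_Ck[OF sqint_locint[OF sobD(1)[OF u]] s(1) test_rho]] by (simp add: w_def[abs_def])
  have wp: "pdv i (w n) = (\<lambda>x. mol \<rho> (s n) (\<lambda>y. G y \<bullet> i) x / mass)" if i: "i \<in> Basis" for i n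
  proof
    fix x
    have "((\<lambda>t. w n (x + t *\<^sub>R i)) has_real_derivative (mol (pdv i \<rho>) (s n) u x / s n) / mass) (at 0)"
      unfolding w_def using mol_has_pdv[where x=x and t=0, OF sqint_locint[OF sobD(1)[OF u]] test_rho s(1)[of n] i]
      by (intro DERIV_cdivide) simp
    then show "pdv i (w n) x = mol \<rho> (s n) (\<lambda>y. G y \<bullet> i) x / mass"
      using mol_weak_gradient[OF u test_rho i s(1)[of n], of x] s(1)[of n] by (auto dest!: pdv_eqI)
  qed
  have wL: "sqint (w n)" for n unfolding w_def[abs_def] by (rule mol_mass_L2(1)[OF sobD(1)[OF u] s(1)])
  note [measurable] = sqint_borel[OF wL]
  have vm [measurable]: "v n \<in> Bor" for n unfolding v_def[abs_def] by measurable
  have va: "0 \<le> \<bar>w n x\<bar> - v n x" "\<bar>w n x\<bar> - v n x \<le> min (s n) \<bar>w n x\<bar>" for n x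
  proof -
    have "sqrt ((w n x)\<^sup>2 + (s n)\<^sup>2) \<le> \<bar>w n x\<bar> + s n" using s(1)[of n] by (intro real_le_lsqrt) (auto simp: power2_sum)
    moreover have "\<bar>w n x\<bar> \<le> sqrt ((w n x)\<^sup>2 + (s n)\<^sup>2)" by (simp add: real_le_rsqrt)
    moreover have "s n \<le> sqrt ((w n x)\<^sup>2 + (s n)\<^sup>2)" by (simp add: real_le_rsqrt)
    ultimately show "0 \<le> \<bar>w n x\<bar> - v n x" "\<bar>w n x\<bar> - v n x \<le> min (s n) \<bar>w n x\<bar>" by (auto simp: v_def)
  qed
  have vder: "((\<lambda>t. v n (x + t *\<^sub>R i)) has_real_derivative w n x * pdv i (w n) x / sqrt ((w n x)\<^sup>2 + (s n)\<^sup>2)) (at 0)" if i: "i \<in> Basis" for n x i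
    unfolding v_def using Ck_has_pdv[OF wC i, of n x 0] pos[of n x]
    by (auto intro!: derivative_eq_intros simp: field_simps)
  have sqc: "continuous_on UNIV (\<lambda>x. sqrt ((w n x)\<^sup>2 + (s n)\<^sup>2))" for n
    by (intro continuous_intros Ck_cont[OF wC[of 0]])
  have vC: "Ck 1 (v n)" for n
    unfolding One_nat_def
  proof (rule Ck_SucI[OF _ vder])
    show "continuous_on UNIV (v n)" unfolding v_def[abs_def] by (intro continuous_intros sqc)
    fix i :: R2 assume i: "i \<in> Basis"
    have "continuous_on UNIV (pdv i (w n))" using wC[of 1 n] i by (auto simp: One_nat_def Ck_Suc Ck_0)
    then show "Ck 0 (\<lambda>x. w n x * pdv i (w n) x / sqrt ((w n x)\<^sup>2 + (s n)\<^sup>2))"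
      unfolding Ck_0 using pos[of n] s(1)[of n] by (intro continuous_intros sqc Ck_cont[OF wC[of 0]]) (auto simp: sum_power2_eq_zero_iff)
  qed
  have vp: "pdv i (v n) = (\<lambda>x. w n x * pdv i (w n) x / sqrt ((w n x)\<^sup>2 + (s n)\<^sup>2))" if "i \<in> Basis" for i n
    using vder[OF that] by (auto intro!: pdv_eqI)
  have vpb: "\<bar>pdv i (v n) x\<bar> \<le> \<bar>pdv i (w n) x\<bar>" if "i \<in> Basis" for i n x
  proof -
    have "\<bar>w n x\<bar> \<le> sqrt ((w n x)\<^sup>2 + (s n)\<^sup>2)" by (simp add: real_le_rsqrt)
    then have "\<bar>w n x\<bar> / sqrt ((w n x)\<^sup>2 + (s n)\<^sup>2) \<le> 1" using pos[of n x] by simp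
    then have "\<bar>w n x\<bar> / sqrt ((w n x)\<^sup>2 + (s n)\<^sup>2) * \<bar>pdv i (w n) x\<bar> \<le> 1 * \<bar>pdv i (w n) x\<bar>" by (intro mult_right_mono) auto
    then show ?thesis using pos[of n x] by (simp add: vp[OF that] abs_mult)
  qed
  have wpL: "sqint (pdv i (w n))" "nsq (pdv i (w n)) \<le> nsq (\<lambda>x. G x \<bullet> i)" if "i \<in> Basis" for i n
    unfolding wp[OF that] by (rule mol_mass_L2[OF sqint_inner(1)[OF sobD(2)[OF u] that] s(1)])+
  have vpL: "sqint (pdv i (v n))" "nsq (pdv i (v n)) \<le> nsq (\<lambda>x. G x \<bullet> i)" if i: "i \<in> Basis" for i n
  proof -
    have "pdv i (v n) \<in> Bor"
      using vC[of n] i by (auto simp: One_nat_def Ck_Suc Ck_0 intro: borel_measurable_continuous_onI)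
    then have *: "sqint (pdv i (v n))" "nsq (pdv i (v n)) \<le> nsq (pdv i (w n))"
      using vpb[OF i, of n] by (intro sqint_bound[OF wpL(1)[OF i, of n]]; simp)+
    then show "sqint (pdv i (v n))" "nsq (pdv i (v n)) \<le> nsq (\<lambda>x. G x \<bullet> i)" using wpL(2)[OF i, of n] by auto
  qed
  have vL: "sqint (v n)" for n
  proof (rule sqint_bound[OF wL vm], rule AE_I2)
    fix x :: R2
    have "0 \<le> v n x" unfolding v_def by (simp add: real_le_rsqrt)
    then show "norm (v n x) \<le> norm (w n x)" using va(1)[of n x] by simp
  qed
  \<comment> \<open>The smoothing error is at most min (s n) |w n|, hence at most \<open>m n\<close>
    plus |w n - u|. The uniform bound \<open>s n\<close> alone would not be square integrable;
    capped by |u|, it tends to 0 in L2 by dominated convergence.\<close>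
  define m where "m n x = min (s n) \<bar>u x\<bar>" for n x
  have [measurable]: "m n \<in> Bor" for n unfolding m_def[abs_def] by measurable
  have mL: "sqint (m n)" for n
    by (rule sqint_bound[OF sobD(1)[OF u]]) (use s(1)[of n] in "auto simp: m_def intro!: AE_I2")
  have ml: "(\<lambda>n. nsq (m n)) ----> 0"
  proof -
    have "(\<lambda>n. LBINT x. (m n x)\<^sup>2) ----> (\<integral>x. 0 \<partial>(lborel :: R2 measure))"
    proof (rule integral_dominated_convergence[where w="\<lambda>x. (u x)\<^sup>2"])
      show "L1 (sq u)" using sobD(1)[OF u] by (simp add: sqint_real)
      show "AE x in lborel. (\<lambda>n. (m n x)\<^sup>2) ----> 0"
      proof (rule AE_I2)
        fix x :: R2
        have "(\<lambda>n. m n x) ----> min 0 \<bar>u x\<bar>" unfolding m_def by (intro tendsto_intros sl)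
        then have "(\<lambda>n. (m n x)\<^sup>2) ----> (min 0 \<bar>u x\<bar>)\<^sup>2" by (intro tendsto_intros)
        then show "(\<lambda>n. (m n x)\<^sup>2) ----> 0" by simp
      qed
      show "AE x in lborel. norm ((m n x)\<^sup>2) \<le> (u x)\<^sup>2" for n
      proof (rule AE_I2)
        fix x :: R2
        have "\<bar>m n x\<bar> \<le> \<bar>u x\<bar>" using s(1)[of n] by (auto simp: m_def)
        then show "norm ((m n x)\<^sup>2) \<le> (u x)\<^sup>2" by (simp add: abs_le_square_iff)
      qed
    qed measurable
    then show ?thesis by (simp add: nsq_real)
  qed
  have wl: "(\<lambda>n. dsq (w n) u) ----> 0"
  proof (rule tendsto_sandwich[OF _ _ tendsto_const])
    show "\<forall>\<^sub>F n in sequentially. dsq (w n) u \<le> (s n)\<^sup>2 * (kconst / mass\<^sup>2 * nsq G)"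
      unfolding w_def using mol_mass_approx[OF u s] by simp
    have "(\<lambda>n. (s n)\<^sup>2 * (kconst / mass\<^sup>2 * nsq G)) ----> 0\<^sup>2 * (kconst / mass\<^sup>2 * nsq G)" by (intro tendsto_intros sl)
    then show "(\<lambda>n. (s n)\<^sup>2 * (kconst / mass\<^sup>2 * nsq G)) ----> 0" by simp
  qed (simp add: nsq_nonneg)
  have uL: "sqint (\<lambda>x. \<bar>u x\<bar>)" by (rule sqint_bound[OF sobD(1)[OF u]]) auto
  have "(\<lambda>n. nsq (\<lambda>x. v n x - \<bar>u x\<bar>)) ----> 0"
  proof (rule tendsto_sandwich[OF _ _ tendsto_const])
    show "\<forall>\<^sub>F n in sequentially. nsq (\<lambda>x. v n x - \<bar>u x\<bar>) \<le> 2 * (4 * dsq (w n) u) + 2 * nsq (m n)"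
    proof (rule always_eventually, rule allI)
      fix n
      have d: "sqint (\<lambda>x. 2 * \<bar>w n x - u x\<bar>)"
      proof (rule sqint_bound[OF sqint_cmult(1)[OF sqint_diff(1)[OF wL[of n] sobD(1)[OF u]], of 2]])
        show "AE x in lborel. norm (2 * \<bar>w n x - u x\<bar>) \<le> norm (2 * (w n x - u x))"
          unfolding real_norm_def abs_mult by simp
      qed measurable
      have "nsq (\<lambda>x. v n x - \<bar>u x\<bar>) \<le> nsq (\<lambda>x. 2 * \<bar>w n x - u x\<bar> + m n x)"
      proof (rule sqint_bound(2)[OF sqint_add(1)[OF d mL[of n]]])
        show "AE x in lborel. norm (v n x - \<bar>u x\<bar>) \<le> norm (2 * \<bar>w n x - u x\<bar> + m n x)"
          using va[of n] s(1)[of n] by (intro AE_I2) (smt (verit) m_def real_norm_def)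
      qed measurable
      also have "... \<le> 2 * nsq (\<lambda>x. 2 * \<bar>w n x - u x\<bar>) + 2 * nsq (m n)" by (rule sqint_add(2)[OF d mL])
      also have "nsq (\<lambda>x. 2 * \<bar>w n x - u x\<bar>) = 4 * dsq (w n) u" by (simp add: nsq_real power_mult_distrib)
      finally show "nsq (\<lambda>x. v n x - \<bar>u x\<bar>) \<le> 2 * (4 * dsq (w n) u) + 2 * nsq (m n)" .
    qed
    have "(\<lambda>n. 2 * (4 * dsq (w n) u) + 2 * nsq (m n)) ----> 2 * (4 * 0) + 2 * 0" by (intro tendsto_intros wl ml)
    then show "(\<lambda>n. 2 * (4 * dsq (w n) u) + 2 * nsq (m n)) ----> 0" by simp
  qed (simp add: nsq_nonneg)
  moreover have "nsq (\<lambda>x. \<Sum>i\<in>Basis. pdv i (v n) x *\<^sub>R i) \<le> nsq G" for n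
  proof -
    have "nsq (\<lambda>x. \<Sum>i\<in>Basis. pdv i (v n) x *\<^sub>R i) = (\<Sum>i\<in>Basis. nsq (pdv i (v n)))"
      by (rule sob_Ck(2)[OF vC vL]) (rule vpL(1))
    also have "... \<le> (\<Sum>i\<in>Basis. nsq (\<lambda>x. G x \<bullet> i))" by (intro sum_mono vpL(2))
    finally show ?thesis unfolding nsq_Basis[OF sobD(2)[OF u]] .
  qed
  moreover have "sob (v n) (\<lambda>x. \<Sum>i\<in>Basis. pdv i (v n) x *\<^sub>R i)" for n
    by (rule sob_Ck(1)[OF vC vL]) (rule vpL(1))
  ultimately show ?thesis
    using sob_lsc[OF uL, of v "\<lambda>n x. \<Sum>i\<in>Basis. pdv i (v n) x *\<^sub>R i" "nsq G"] by simp
qed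

text \<open>At a fixed scale the mollifications are bounded and Lipschitz uniformly in
  \<open>n\<close>, so convergence on a countable dense set extends to every point and, on balls, to
  L2. The mollification error is small uniformly in \<open>n\<close> by the gradient bound, and the
  tails by hypothesis.\<close>

lemma sob_compact:
  assumes U: "\<And>n. sob (U n) (G n)" and R: "\<And>n. nsq (U n) \<le> R" "\<And>n. nsq (G n) \<le> R"
    and tail: "\<And>e. e > 0 ==> \<exists>r. \<forall>n::nat. (LBINT x. indicator (- cball 0 r) x * (U n x)\<^sup>2) \<le> e"
  obtains k u where "strict_mono (k :: nat => nat)" "sqint u" "(\<lambda>n. nsq (\<lambda>x. U (k n) x - u x)) ----> 0"
proof -
  note [measurable] = sqint_borel[OF sobD(1)[OF U]] test_fun_borel[OF test_rho]
  have R0: "R \<ge> 0" using R(1)[of 0] nsq_nonneg[of "U 0"] by linarith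
  define s where "s j = 1 / real (Suc j)" for j
  have s: "s j > 0" "s j \<le> 1" for j by (auto simp: s_def)
  obtain D :: "R2 set" where D: "countable D" "\<And>X. open X ==> X \<noteq> {} ==> \<exists>d\<in>D. d \<in> X"
    using countable_dense_exists[where 'a=R2] by metis
  \<comment> \<open>The factor \<open>s (fst p)\<close> compensates the growth 1/s of the supremum
    bound. All values are then bounded by one constant, and a single diagonal argument covers all
    scales and all dense points.\<close>
  define f where "f n p = s (fst p) * mol \<rho> (s (fst p)) (U n) (snd p)" for n p
  have "countable ((UNIV :: nat set) \<times> D)" using D by auto
  moreover have "norm (f n p) \<le> sqrt (nsq \<rho>) * sqrt R" for n p
  proof -
    have "\<bar>mol \<rho> (s (fst p)) (U n) (snd p)\<bar> \<le> sqrt (nsq \<rho>) * sqrt (nsq (U n)) / s (fst p)"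
      by (rule mol_sup[OF sobD(1)[OF U] test_rho s(1)])
    then have "\<bar>f n p\<bar> \<le> sqrt (nsq \<rho>) * sqrt (nsq (U n))" using s(1)[of "fst p"] by (simp add: f_def abs_mult field_simps)
    also have "... \<le> sqrt (nsq \<rho>) * sqrt R" using R by (intro mult_left_mono) (auto simp: nsq_nonneg)
    finally show ?thesis by simp
  qed
  ultimately obtain k where k: "strict_mono (k :: nat => nat)" "\<And>p. p \<in> UNIV \<times> D ==> \<exists>l. (\<lambda>n. f (k n) p) ----> l"
    using function_convergent_subsequence[of "UNIV \<times> D" f "sqrt (nsq \<rho>) * sqrt R"] by blast
  define M where "M j n x = mol \<rho> (s j) (U (k n)) x / mass" for j n x
  have Mm [measurable]: "M j n \<in> Bor" for j n unfolding M_def[abs_def] by measurable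
  have conv: "convergent (\<lambda>n. M j n x)" for j x
  proof -
    define B where "B = (\<Sum>i\<in>(Basis :: R2 set). sqrt (nsq (pdv i \<rho>))) * sqrt R / s j / s j"
    have lip: "\<bar>mol \<rho> (s j) (U n) x - mol \<rho> (s j) (U n) y\<bar> \<le> 2 * B * norm (x - y)" for n y
    proof (rule Ck_lipschitz[OF mol_Ck[OF sqint_locint[OF sobD(1)[OF U]] s(1) test_rho]])
      fix i z assume i: "i \<in> (Basis :: R2 set)"
      have "pdv i (mol \<rho> (s j) (U n)) z = mol (pdv i \<rho>) (s j) (U n) z / s j"
        using mol_has_pdv[where x=z and t=0, OF sqint_locint[OF sobD(1)[OF U[of n]]] test_rho s(1)[of j] i] by (intro pdv_eqI) simp
      moreover have "\<bar>mol (pdv i \<rho>) (s j) (U n) z\<bar> \<le> sqrt (nsq (pdv i \<rho>)) * sqrt (nsq (U n)) / s j"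
        by (rule mol_sup[OF sobD(1)[OF U] test_fun_pdv[OF test_rho i] s(1)])
      moreover have "sqrt (nsq (pdv i \<rho>)) * sqrt (nsq (U n)) \<le> (\<Sum>i\<in>(Basis :: R2 set). sqrt (nsq (pdv i \<rho>))) * sqrt R"
        using i R(1)[of n] member_le_sum[of i Basis "\<lambda>i. sqrt (nsq (pdv i \<rho>))"]
        by (intro mult_mono) (auto simp: nsq_nonneg sum_nonneg)
      ultimately have "\<bar>mol (pdv i \<rho>) (s j) (U n) z\<bar> \<le> (\<Sum>i\<in>(Basis :: R2 set). sqrt (nsq (pdv i \<rho>))) * sqrt R / s j"
        using s(1)[of j] by (meson divide_right_mono less_imp_le order_trans)
      from divide_right_mono[OF this, of "s j"]
      show "\<bar>pdv i (mol \<rho> (s j) (U n)) z\<bar> \<le> B"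
        using s(1)[of j] \<open>pdv i (mol \<rho> (s j) (U n)) z = _\<close> unfolding B_def by simp
    qed
    have B0: "B \<ge> 0" using lip[of 0 "x + axis 1 1"] abs_ge_zero[of "mol \<rho> (s j) (U 0) x - mol \<rho> (s j) (U 0) (x + axis 1 1)"] by simp
    have "Cauchy (\<lambda>n. mol \<rho> (s j) (U (k n)) x)"
    proof (rule metric_CauchyI)
      fix e :: real assume e: "e > 0"
      have "0 < e / (8 * B + 8)" using e B0 by (intro divide_pos_pos) auto
      then have "ball x (e / (8 * B + 8)) \<noteq> {}" "open (ball x (e / (8 * B + 8)))" by auto
      then obtain d where d: "d \<in> D" "d \<in> ball x (e / (8 * B + 8))" using D(2) by blast
      obtain l where "(\<lambda>n. f (k n) (j, d)) ----> l" using k(2)[of "(j, d)"] d by auto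
      then have "(\<lambda>n. (1 / s j) * f (k n) (j, d)) ----> (1 / s j) * l" by (intro tendsto_intros)
      then have "(\<lambda>n. mol \<rho> (s j) (U (k n)) d) ----> (1 / s j) * l" using s(1)[of j] by (simp add: f_def)
      then have "Cauchy (\<lambda>n. mol \<rho> (s j) (U (k n)) d)" by (rule LIMSEQ_imp_Cauchy)
      then obtain N where N: "\<And>m n. m \<ge> N ==> n \<ge> N ==> dist (mol \<rho> (s j) (U (k m)) d) (mol \<rho> (s j) (U (k n)) d) < e / 2"
        using e by (metis Cauchy_def half_gt_zero)
      have "2 * B * norm (x - d) \<le> e / 4"
      proof -
        have "2 * B * norm (x - d) \<le> (2 * B + 2) * (e / (8 * B + 8))" using d B0 by (intro mult_mono) (auto simp: dist_norm)
        also have "... = e / 4" using B0 by (simp add: field_simps)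
        finally show ?thesis .
      qed
      then have q: "\<bar>mol \<rho> (s j) (U n) x - mol \<rho> (s j) (U n) d\<bar> \<le> e / 4" for n using lip[of n d] by linarith
      have "dist (mol \<rho> (s j) (U (k m)) x) (mol \<rho> (s j) (U (k n)) x) < e" if "m \<ge> N" "n \<ge> N" for m n
        using N[OF that] q[of "k m"] q[of "k n"] unfolding dist_real_def by linarith
      then show "\<exists>N. \<forall>m\<ge>N. \<forall>n\<ge>N. dist (mol \<rho> (s j) (U (k m)) x) (mol \<rho> (s j) (U (k n)) x) < e"
        by blast
    qed
    then obtain l where "(\<lambda>n. mol \<rho> (s j) (U (k n)) x) ----> l" by (auto simp: Cauchy_convergent_iff convergent_def)
    then have "(\<lambda>n. M j n x) ----> l / mass" unfolding M_def using mass_pos by (intro tendsto_intros) auto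
    then show ?thesis by (auto simp: convergent_def)
  qed
  define w where "w j x = lim (\<lambda>n. M j n x)" for j x
  have wl: "(\<lambda>n. M j n x) ----> w j x" for j x using conv by (simp add: w_def convergent_LIMSEQ_iff)
  have wm [measurable]: "w j \<in> Bor" for j unfolding w_def[abs_def] by measurable
  define C where "C j = sqrt (nsq \<rho>) * sqrt R / s j / mass" for j
  have MC: "\<bar>M j n x\<bar> \<le> C j" for j n x
  proof -
    have "\<bar>mol \<rho> (s j) (U (k n)) x\<bar> \<le> sqrt (nsq \<rho>) * sqrt (nsq (U (k n))) / s j" by (rule mol_sup[OF sobD(1)[OF U] test_rho s(1)])
    also have "... \<le> sqrt (nsq \<rho>) * sqrt R / s j" using R s(1)[of j] by (intro divide_right_mono mult_left_mono) (auto simp: nsq_nonneg)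
    finally have "\<bar>mol \<rho> (s j) (U (k n)) x\<bar> / mass \<le> sqrt (nsq \<rho>) * sqrt R / s j / mass"
      using mass_pos by (intro divide_right_mono) auto
    then show ?thesis using mass_pos by (simp add: M_def C_def)
  qed
  have wC: "\<bar>w j x\<bar> \<le> C j" for j x
    by (rule LIMSEQ_le_const2[OF tendsto_rabs[OF wl]]) (use MC in auto)
  have Mwi: "L1 (\<lambda>x. indicator (cball 0 r) x * (M j n x - w j x)\<^sup>2)" for r j n
  proof (rule L1_bound[where f="\<lambda>x. (2 * C j)\<^sup>2 * indicator (cball 0 r) x"])
    have "\<bar>M j n x - w j x\<bar> \<le> \<bar>2 * C j\<bar>" for x using MC[of j n x] wC[of j x] by linarith
    then show "AE x in lborel. norm (indicator (cball 0 r) x * (M j n x - w j x)\<^sup>2) \<le> norm ((2 * C j)\<^sup>2 * indicator (cball 0 r) x)"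
      by (intro AE_I2) (auto simp: indicator_def abs_le_square_iff)
  qed (intro integrable_mult_right integrable_indicator_cball, measurable)
  have Mw: "(\<lambda>n. LBINT x. indicator (cball 0 r) x * (M j n x - w j x)\<^sup>2) ----> 0" for r j
  proof -
    have "(\<lambda>n. LBINT x. indicator (cball 0 r) x * (M j n x - w j x)\<^sup>2) ----> (\<integral>x. 0 \<partial>(lborel :: R2 measure))"
    proof (rule integral_dominated_convergence[where w="\<lambda>x. (2 * C j)\<^sup>2 * indicator (cball 0 r) x"])
      show "AE x in lborel. (\<lambda>n. indicator (cball 0 r) x * (M j n x - w j x)\<^sup>2) ----> 0"
      proof (rule AE_I2)
        fix x :: R2
        have "(\<lambda>n. indicator (cball 0 r) x * (M j n x - w j x)\<^sup>2) ----> indicator (cball 0 r) x * (w j x - w j x)\<^sup>2"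
          by (intro tendsto_intros wl)
        then show "(\<lambda>n. indicator (cball 0 r) x * (M j n x - w j x)\<^sup>2) ----> 0" by simp
      qed
      have "\<bar>M j n x - w j x\<bar> \<le> \<bar>2 * C j\<bar>" for n x using MC[of j n x] wC[of j x] by linarith
      then show "AE x in lborel. norm (indicator (cball 0 r) x * (M j n x - w j x)\<^sup>2) \<le> (2 * C j)\<^sup>2 * indicator (cball 0 r) x" for n
        by (intro AE_I2) (auto simp: indicator_def abs_le_square_iff)
      show "L1 (\<lambda>x. (2 * C j)\<^sup>2 * indicator (cball (0::R2) r) x)" by (intro integrable_mult_right integrable_indicator_cball)
    qed measurable
    then show ?thesis by simp
  qed
  define K where "K = kconst / mass\<^sup>2 * R"
  have appr: "nsq (\<lambda>x. M j n x - U (k n) x) \<le> (s j)\<^sup>2 * K" for j n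
  proof -
    have "nsq (\<lambda>x. M j n x - U (k n) x) \<le> (s j)\<^sup>2 * (kconst / mass\<^sup>2 * nsq (G (k n)))"
      unfolding M_def by (rule mol_mass_approx[OF U s])
    also have "... \<le> (s j)\<^sup>2 * K" unfolding K_def using R(2) kconst_nonneg by (intro mult_left_mono) auto
    finally show ?thesis .
  qed
  have MU: "sqint (\<lambda>x. M j n x - U (k n) x)" for j n
    unfolding M_def by (intro sqint_diff(1) mol_mass_L2(1) sobD(1)[OF U] s)
  have "\<exists>N. \<forall>m\<ge>N. \<forall>n\<ge>N. nsq (\<lambda>x. U (k m) x - U (k n) x) < e" if e: "e > 0" for e
  proof -
    obtain r where r: "\<And>n. (LBINT x. indicator (- cball 0 r) x * (U n x)\<^sup>2) \<le> e / 16" using tail[of "e/16"] e by auto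
    have "(\<lambda>j. (s j)\<^sup>2 * K) ----> 0\<^sup>2 * K" unfolding s_def using LIMSEQ_inverse_real_of_nat by (intro tendsto_intros) (simp add: inverse_eq_divide)
    then have "\<forall>\<^sub>F j in sequentially. (s j)\<^sup>2 * K < e / 32" using e by (intro order_tendstoD) auto
    then obtain j where j: "(s j)\<^sup>2 * K < e / 32" by (auto simp: eventually_sequentially)
    have "\<forall>\<^sub>F n in sequentially. (LBINT x. indicator (cball 0 r) x * (M j n x - w j x)\<^sup>2) < e / 32"
      using Mw[of r j] e by (intro order_tendstoD) auto
    then obtain N where N: "\<And>n. n \<ge> N ==> (LBINT x. indicator (cball 0 r) x * (M j n x - w j x)\<^sup>2) < e / 32"
      by (auto simp: eventually_sequentially)
    have "nsq (\<lambda>x. U (k m) x - U (k n) x) < e" if mn: "m \<ge> N" "n \<ge> N" for m n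
    proof -
      let ?o = "indicator (- cball 0 r) :: R2 => real" and ?b = "indicator (cball 0 r) :: R2 => real"
      have oi: "L1 (\<lambda>x. ?o x * (U n x)\<^sup>2)" for n
        using sobD(1)[OF U, of n] integrable_mult_indicator[of "- cball 0 r" lborel "\<lambda>x. (U n x)\<^sup>2"] by (simp add: sqint_real)
      have mi: "L1 (\<lambda>x. (M j n x - U (k n) x)\<^sup>2)" for n using MU by (simp add: sqint_real)
      \<comment> \<open>Inside the ball two members are compared through their mollifications and
        the pointwise limit \<open>w j\<close>, four differences in all; outside it the tail bound
        is used directly.\<close>
      have p4: "(a1 - b1)\<^sup>2 \<le> 4 * ((c1 - a1)\<^sup>2 + (c1 - w1)\<^sup>2 + (c2 - w1)\<^sup>2 + (c2 - b1)\<^sup>2)" for a1 b1 c1 c2 w1 :: real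
      proof -
        have "(p + q + r' + t)\<^sup>2 \<le> 4 * (p\<^sup>2 + q\<^sup>2 + r'\<^sup>2 + t\<^sup>2)" for p q r' t :: real
          using norm_add_sq_le[of "p + q" "r' + t"] norm_add_sq_le[of p q] norm_add_sq_le[of r' t] by (simp add: add.assoc)
        from this[of "a1 - c1" "c1 - w1" "w1 - c2" "c2 - b1"] show ?thesis by (simp add: power2_commute algebra_simps)
      qed
      have p2: "(a1 - b1)\<^sup>2 \<le> 2 * a1\<^sup>2 + 2 * b1\<^sup>2" for a1 b1 :: real using norm_add_sq_le[of a1 "- b1"] by simp
      have "nsq (\<lambda>x. U (k m) x - U (k n) x) \<le> (LBINT x. 2 * (?o x * (U (k m) x)\<^sup>2) + 2 * (?o x * (U (k n) x)\<^sup>2)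
         + 4 * ((M j m x - U (k m) x)\<^sup>2 + ?b x * (M j m x - w j x)\<^sup>2 + ?b x * (M j n x - w j x)\<^sup>2 + (M j n x - U (k n) x)\<^sup>2))"
        unfolding nsq_real
      proof (rule integral_mono)
        show "L1 (\<lambda>x. (U (k m) x - U (k n) x)\<^sup>2)" using sqint_diff(1)[OF sobD(1)[OF U] sobD(1)[OF U]] by (simp add: sqint_real)
        show "L1 (\<lambda>x. 2 * (?o x * (U (k m) x)\<^sup>2) + 2 * (?o x * (U (k n) x)\<^sup>2)
         + 4 * ((M j m x - U (k m) x)\<^sup>2 + ?b x * (M j m x - w j x)\<^sup>2 + ?b x * (M j n x - w j x)\<^sup>2 + (M j n x - U (k n) x)\<^sup>2))"
          by (intro L1_add integrable_mult_right oi mi Mwi)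
        fix x :: R2
        show "(U (k m) x - U (k n) x)\<^sup>2 \<le> 2 * (?o x * (U (k m) x)\<^sup>2) + 2 * (?o x * (U (k n) x)\<^sup>2)
         + 4 * ((M j m x - U (k m) x)\<^sup>2 + ?b x * (M j m x - w j x)\<^sup>2 + ?b x * (M j n x - w j x)\<^sup>2 + (M j n x - U (k n) x)\<^sup>2)"
        proof (cases "x \<in> cball 0 r")
          case True
          then show ?thesis using p4[of "U (k m) x" "U (k n) x" "M j m x" "w j x" "M j n x"] by simp
        next
          case False
          then show ?thesis using p2[of "U (k m) x" "U (k n) x"] by (simp add: add_increasing2)
        qed
      qed
      also have "... = 2 * (LBINT x. ?o x * (U (k m) x)\<^sup>2) + 2 * (LBINT x. ?o x * (U (k n) x)\<^sup>2)
         + 4 * (nsq (\<lambda>x. M j m x - U (k m) x) + (LBINT x. ?b x * (M j m x - w j x)\<^sup>2) + (LBINT x. ?b x * (M j n x - w j x)\<^sup>2) + nsq (\<lambda>x. M j n x - U (k n) x))"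
        unfolding nsq_real by (simp add: oi mi Mwi)
      also have "... < 2 * (e / 16) + 2 * (e / 16) + 4 * (e / 32 + e / 32 + e / 32 + e / 32)"
        using r[of "k m"] r[of "k n"] le_less_trans[OF appr[of j m] j] le_less_trans[OF appr[of j n] j] N[OF mn(1)] N[OF mn(2)]
        by (intro add_le_less_mono add_mono mult_left_mono mult_strict_left_mono add_strict_mono) auto
      also have "... \<le> e" using e by simp
      finally show ?thesis .
    qed
    then show ?thesis by blast
  qed
  from sqint_complete[OF sobD(1)[OF U] this] obtain u where "sqint u" "(\<lambda>n. nsq (\<lambda>x. U (k n) x - u x)) ----> 0" by blast
  then show ?thesis using that k(1) by blast
qed

section \<open>The logarithmic kernel\<close>

text \<open>The kernel 1/|z| cut off at the unit ball is integrable in the plane. Its square root is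
  therefore square integrable, and it dominates the logarithmic singularity.\<close>

definition kap :: "R2 => real" where "kap z = indicator (cball 0 1) z / norm z"

lemma kap_nonneg: "kap z \<ge> 0" by (simp add: kap_def)

lemma kap_borel [measurable]: "kap \<in> Bor" unfolding kap_def[abs_def] by measurable

lemma emeasure_cball_le: "r \<ge> 0 ==> emeasure lborel (cball (0::R2) r) \<le> ennreal (4 * r\<^sup>2)"
proof -
  assume r: "r \<ge> 0"
  have "cball (0::R2) r \<subseteq> cbox (- (r *\<^sub>R One)) (r *\<^sub>R One)"
  proof
    fix x :: R2 assume "x \<in> cball 0 r"
    then have "\<bar>x \<bullet> i\<bar> \<le> r" if "i \<in> Basis" for i using Basis_le_norm[OF that, of x] by simp
    then show "x \<in> cbox (- (r *\<^sub>R One)) (r *\<^sub>R One)" by (force simp: mem_box abs_le_iff)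
  qed
  then have "emeasure lborel (cball (0::R2) r) \<le> emeasure lborel (cbox (- (r *\<^sub>R One)) (r *\<^sub>R One) :: R2 set)"
    by (intro emeasure_mono) auto
  also have "... = ennreal (4 * r\<^sup>2)"
  proof -
    have "(\<Prod>i\<in>(Basis :: R2 set). (r *\<^sub>R One - - (r *\<^sub>R One)) \<bullet> i) = (\<Prod>i\<in>(Basis :: R2 set). 2 * r)"
      unfolding inner_diff_left inner_minus_left inner_scaleR_left by (intro prod.cong) auto
    then show ?thesis using r by (subst emeasure_lborel_cbox) (auto simp: power2_eq_square)
  qed
  finally show ?thesis .
qed

text \<open>Dyadic balls: a point with 2^-(n+1) < |z| \<le> 2^-n has \<open>kap z\<close> at most 2
  * 2^n, and the ball of radius 2^-n has area at most 4 * 4^-n, so the sum is geometric.\<close>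

lemma kap_integrable: "integrable lborel kap"
proof (rule integrableI_nonneg)
  have pt: "ennreal (kap z) \<le> (\<Sum>n. ennreal (2 * 2^n) * indicator (cball 0 ((1/2)^n)) z)" for z :: R2
  proof (cases "z = 0 \<or> norm z > 1")
    case False
    define n where "n = nat \<lfloor>log 2 (1 / norm z)\<rfloor>"
    have l0: "0 \<le> log 2 (1 / norm z)" using False by simp
    have n: "real n \<le> log 2 (1 / norm z)" "log 2 (1 / norm z) < real n + 1" using l0 unfolding n_def by linarith+
    have "2 powr real n \<le> 1 / norm z" using n(1) False by (subst (asm) le_log_iff) auto
    then have zn: "norm z \<le> (1/2)^n" using False by (simp add: powr_realpow field_simps power_divide)
    have "1 / norm z < 2 powr (real n + 1)" using n(2) False by (subst (asm) log_less_iff) auto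
    then have "kap z \<le> 2 * 2^n" using False by (simp add: kap_def powr_add powr_realpow)
    then have le1: "ennreal (kap z) \<le> ennreal (2 * 2^n) * indicator (cball 0 ((1/2)^n)) z" using zn by (simp add: ennreal_leI)
    have "S n \<le> (\<Sum>n. S n)" for S :: "nat => ennreal"
      using sum_le_suminf[of S "{n}"] by simp
    then show ?thesis by (rule order_trans[OF le1])
  qed (auto simp: kap_def)
  have "(\<integral>\<^sup>+z. ennreal (kap z) \<partial>lborel) \<le> (\<integral>\<^sup>+z. (\<Sum>n. ennreal (2 * 2^n) * indicator (cball (0::R2) ((1/2)^n)) z) \<partial>lborel)"
    by (intro nn_integral_mono pt)
  also have "... = (\<Sum>n. ennreal (2 * 2^n) * emeasure lborel (cball (0::R2) ((1/2)^n)))"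
    by (subst nn_integral_suminf) (auto simp: nn_integral_cmult)
  also have "... \<le> (\<Sum>n. ennreal (8 * (1/2)^n))"
  proof (intro suminf_le summableI)
    fix n :: nat
    have "ennreal (2 * 2^n) * emeasure lborel (cball (0::R2) ((1/2)^n)) \<le> ennreal (2 * 2^n) * ennreal (4 * ((1/2)^n)\<^sup>2)"
      by (intro mult_left_mono emeasure_cball_le) auto
    also have "... = ennreal (2 * 2^n * (4 * ((1/2)^n)\<^sup>2))" by (subst ennreal_mult) auto
    also have "2 * 2^n * (4 * ((1/2)^n)\<^sup>2) = 8 * (1/2::real)^n" by (simp add: power2_eq_square power_divide)
    finally show "ennreal (2 * 2^n) * emeasure lborel (cball (0::R2) ((1/2)^n)) \<le> ennreal (8 * (1/2)^n)" .
  qed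
  also have "... = ennreal (\<Sum>n. 8 * (1/2)^n)" by (rule suminf_ennreal2) (auto intro!: summable_mult summable_geometric)
  finally show "(\<integral>\<^sup>+z. ennreal (kap z) \<partial>lborel) < \<infinity>" by (simp add: le_less_trans)
qed (auto simp: kap_nonneg)

definition kapc :: real where "kapc = (LBINT z. kap z)"

lemma kapc_nonneg: "kapc \<ge> 0" unfolding kapc_def by (intro integral_nonneg_AE) (auto simp: kap_nonneg)

lemma sqrt_kap_L2: "sqint (\<lambda>y. sqrt (kap (x - y)))" "nsq (\<lambda>y. sqrt (kap (x - y))) = kapc"
  using lborel_integral_affine[of kap "-1" x] kap_integrable
  by (auto simp: sqint_real nsq_real kap_nonneg kapc_def)

lemma sqrt_kap_conv:
  assumes U: "sqint U"
  shows "L1 (\<lambda>y. sqrt (kap (x - y)) * U y)" "\<bar>LBINT y. sqrt (kap (x - y)) * U y\<bar> \<le> sqrt kapc * sqrt (nsq U)"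
    "(LBINT y. \<bar>sqrt (kap (x - y)) * U y\<bar>) \<le> sqrt kapc * sqrt (nsq U)"
  using sqint_prod[OF sqrt_kap_L2(1)[of x] U] by (auto simp: sqrt_kap_L2(2))

section \<open>Pointwise bounds for the logarithm\<close>

definition lnp :: "real => real" where "lnp t = max 0 (ln t)"
definition lnm :: "real => real" where "lnm t = max 0 (- ln t)"
definition lgw :: "R2 => real" where "lgw x = ln (1 + norm x)"

lemma ln_split: "ln t = lnp t - lnm t" and lnp_nonneg: "lnp t \<ge> 0" and lnm_nonneg: "lnm t \<ge> 0"
  and lnp_le: "lnp t \<le> \<bar>ln t\<bar>" and lnm_le: "lnm t \<le> \<bar>ln t\<bar>" for t :: real
  by (auto simp: lnp_def lnm_def)

lemma lnp_borel [measurable]: "lnp \<in> Bor" and lnm_borel [measurable]: "lnm \<in> Bor"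
  and lgw_borel [measurable]: "lgw \<in> Bor"
  unfolding lnp_def[abs_def] lnm_def[abs_def] lgw_def[abs_def] by measurable

lemma lgw_nonneg: "lgw x \<ge> 0" by (simp add: lgw_def)

text \<open>The inequality ln r \<le> r - 1 at r = t^(-1/2), for the distance t \<le> 1.\<close>

lemma lnm_le_kap: "lnm (dist x y) \<le> 2 * sqrt (kap (x - y))"
proof (cases "x = y \<or> dist x y > 1")
  case False
  define t where "t = dist x y"
  have t: "0 < t" "t \<le> 1" using False by (auto simp: t_def)
  have "ln (1 / sqrt t) \<le> 1 / sqrt t - 1" using t by (intro ln_le_minus_one) auto
  then have "- ln t \<le> 2 * (1 / sqrt t)" using t by (simp add: ln_div ln_sqrt)
  moreover have "sqrt (kap (x - y)) = 1 / sqrt t" using t by (simp add: kap_def t_def dist_norm real_sqrt_divide indicator_def norm_minus_commute)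
  moreover have "ln t \<le> 0" using t by simp
  ultimately show ?thesis by (simp add: lnm_def t_def[symmetric])
next
  case True
  \<comment> \<open>On the diagonal this rests on the convention \<open>ln 0 = 0\<close>.\<close>
  then have "lnm (dist x y) = 0" by (auto simp: lnm_def)
  then show ?thesis by (simp add: kap_nonneg)
qed

lemma lnp_le_lgw: "lnp (dist x y) \<le> lgw x + lgw y"
proof (cases "dist x y \<le> 1")
  case True
  then have "lnp (dist x y) = 0" using zero_le_dist[of x y] by (cases "x = y") (auto simp: lnp_def)
  then show ?thesis by (simp add: lgw_nonneg add_nonneg_nonneg)
next
  case False
  have "0 \<le> norm x * norm y" by simp
  moreover have "(1 + norm x) * (1 + norm y) = 1 + norm x + norm y + norm x * norm y" by (simp add: algebra_simps)
  ultimately have "dist x y \<le> (1 + norm x) * (1 + norm y)"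
    using norm_triangle_ineq4[of x y] unfolding dist_norm by linarith
  then have "ln (dist x y) \<le> ln ((1 + norm x) * (1 + norm y))" using False by (subst ln_le_cancel_iff) (auto intro!: mult_pos_pos add_pos_nonneg)
  also have "... = lgw x + lgw y"
  proof -
    have "0 < 1 + norm x" "0 < 1 + norm y" by (auto intro: add_pos_nonneg)
    then show ?thesis unfolding lgw_def by (simp add: ln_mult)
  qed
  finally show ?thesis by (simp add: lnp_def lgw_nonneg add_nonneg_nonneg)
qed

text \<open>From 1 + |y| \<le> (1 + |x|)(1 + |x - y|). This converse of \<open>lnp_le_lgw\<close>,
  used with \<open>x\<close> fixed, recovers the weighted norm of a function from its positive
  logarithmic energy.\<close>

lemma lgw_le_lnp: "lgw y \<le> lgw x + ln 2 + lnp (dist x y)"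
proof -
  have p: "0 < 1 + norm x" "0 < 1 + dist x y" by (auto intro: add_pos_nonneg)
  have "norm y \<le> norm x + dist x y" using norm_triangle_ineq4[of x "x - y"] by (simp add: dist_norm)
  moreover have "0 \<le> norm x * dist x y" by simp
  moreover have "(1 + norm x) * (1 + dist x y) = 1 + norm x + dist x y + norm x * dist x y" by (simp add: algebra_simps)
  ultimately have "1 + norm y \<le> (1 + norm x) * (1 + dist x y)" by linarith
  then have "lgw y \<le> ln ((1 + norm x) * (1 + dist x y))"
    unfolding lgw_def using p by (subst ln_le_cancel_iff) (auto intro!: mult_pos_pos add_pos_nonneg)
  also have "... = lgw x + ln (1 + dist x y)" unfolding lgw_def using p by (simp add: ln_mult)
  also have "ln (1 + dist x y) \<le> ln 2 + lnp (dist x y)"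
  proof (cases "dist x y \<le> 1")
    case True
    then have "ln (1 + dist x y) \<le> ln 2" using p by simp
    then show ?thesis using lnp_nonneg[of "dist x y"] by linarith
  next
    case False
    then have "ln (1 + dist x y) \<le> ln (2 * dist x y)" using p by (subst ln_le_cancel_iff) auto
    also have "... = ln 2 + ln (dist x y)" using False by (subst ln_mult) (auto simp del: zero_less_dist_iff)
    finally show ?thesis by (simp add: lnp_def)
  qed
  finally show ?thesis by simp
qed

lemma integrable_prod_mult:
  fixes f :: "'a => real" and g :: "'b => real"
  assumes "sigma_finite_measure M" "sigma_finite_measure N" and f: "integrable M f" and g: "integrable N g"
  shows "integrable (M \<Otimes>\<^sub>M N) (\<lambda>p. f (fst p) * g (snd p))"
proof -
  interpret M: sigma_finite_measure M by fact
  interpret N: sigma_finite_measure N by fact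
  interpret pair_sigma_finite M N ..
  have [measurable]: "f \<in> borel_measurable M" "g \<in> borel_measurable N" using f g by auto
  show ?thesis
  proof (rule Fubini_integrable)
    have "(\<integral>y. norm (f (fst (x, y)) * g (snd (x, y))) \<partial>N) = \<bar>f x\<bar> * (\<integral>y. \<bar>g y\<bar> \<partial>N)" for x
      by (simp add: abs_mult)
    then show "integrable M (\<lambda>x. \<integral>y. norm (f (fst (x, y)) * g (snd (x, y))) \<partial>N)" using f by simp
  qed (use g in auto)
qed

text \<open>The densities allowed in the logarithmic double integrals, such as u^2 or u^2 + v^2: the
  weight controls large distances, and L1 together with L2 controls the singularity on the
  diagonal.\<close>

definition adm :: "(R2 => real) => bool" where
  "adm U \<longleftrightarrow> U \<in> Bor \<and> (\<forall>x. 0 \<le> U x) \<and> integrable lborel U \<and> sqint U \<and> L1 (\<lambda>x. lgw x * U x)"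

lemma admD:
  assumes "adm U"
  shows "U \<in> Bor" "0 \<le> U x" "integrable lborel U" "sqint U" "L1 (\<lambda>x. lgw x * U x)"
  using assms by (auto simp: adm_def)

text \<open>For fixed \<open>x\<close>, Cauchy-Schwarz bounds the integral over \<open>y\<close>,
  since the square root of \<open>kap\<close> has the same L2 norm around every point; integrating
  |f| over \<open>x\<close> remains.\<close>

lemma sqrt_kap_double:
  assumes f: "integrable lborel f" and g: "sqint g" and [measurable]: "f \<in> Bor"
  shows "integrable lborel2 (\<lambda>p. sqrt (kap (fst p - snd p)) * f (fst p) * g (snd p))"
    "(\<integral>p. \<bar>sqrt (kap (fst p - snd p)) * f (fst p) * g (snd p)\<bar> \<partial>lborel2) \<le> (LBINT x. \<bar>f x\<bar>) * (sqrt kapc * sqrt (nsq g))"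
proof -
  note [measurable] = sqint_borel[OF g]
  have m: "(\<lambda>p. sqrt (kap (fst p - snd p)) * f (fst p) * g (snd p)) \<in> borel_measurable lborel2" by measurable
  have e: "(LBINT y. norm (sqrt (kap (x - y)) * f x * g y)) = \<bar>f x\<bar> * (LBINT y. \<bar>sqrt (kap (x - y)) * g y\<bar>)" for x
    by (subst integral_mult_right_zero[symmetric]) (simp add: abs_mult mult_ac)
  have le: "(LBINT y. norm (sqrt (kap (x - y)) * f x * g y)) \<le> \<bar>f x\<bar> * (sqrt kapc * sqrt (nsq g))" for x
    unfolding e by (intro mult_left_mono sqrt_kap_conv(3)[OF g]) auto
  have i1: "L1 (\<lambda>x. LBINT y. norm (sqrt (kap (x - y)) * f x * g y))"
  proof (rule L1_bound[where f="\<lambda>x. \<bar>f x\<bar> * (sqrt kapc * sqrt (nsq g))"])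
    show "AE x in lborel. norm (LBINT y. norm (sqrt (kap (x - y)) * f x * g y)) \<le> norm (\<bar>f x\<bar> * (sqrt kapc * sqrt (nsq g)))"
    proof (rule AE_I2)
      fix x
      have "norm (LBINT y. norm (sqrt (kap (x - y)) * f x * g y)) = (LBINT y. norm (sqrt (kap (x - y)) * f x * g y))" by simp
      also have "... \<le> \<bar>f x\<bar> * (sqrt kapc * sqrt (nsq g))" by (rule le)
      also have "... \<le> norm (\<bar>f x\<bar> * (sqrt kapc * sqrt (nsq g)))" by simp
      finally show "norm (LBINT y. norm (sqrt (kap (x - y)) * f x * g y)) \<le> norm (\<bar>f x\<bar> * (sqrt kapc * sqrt (nsq g)))" .
    qed
  qed (use f in auto)
  have i2: "L1 (\<lambda>y. sqrt (kap (x - y)) * f x * g y)" for x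
    using integrable_mult_right[OF sqrt_kap_conv(1)[OF g, of x], of "f x"] by (simp add: mult_ac)
  show i: "integrable lborel2 (\<lambda>p. sqrt (kap (fst p - snd p)) * f (fst p) * g (snd p))"
    by (rule lborel_pair.Fubini_integrable[OF m]) (use i1 i2 in auto)
  have "(\<integral>p. \<bar>sqrt (kap (fst p - snd p)) * f (fst p) * g (snd p)\<bar> \<partial>lborel2) = (LBINT x. (LBINT y. \<bar>sqrt (kap (x - y)) * f x * g y\<bar>))"
    using lborel_pair.integral_fst'[OF integrable_abs[OF i]] by simp
  also have "... \<le> (LBINT x. \<bar>f x\<bar> * (sqrt kapc * sqrt (nsq g)))"
    using i1 le f by (intro integral_mono) auto
  finally show "(\<integral>p. \<bar>sqrt (kap (fst p - snd p)) * f (fst p) * g (snd p)\<bar> \<partial>lborel2) \<le> (LBINT x. \<bar>f x\<bar>) * (sqrt kapc * sqrt (nsq g))"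
    by simp
qed

lemma ln_abs_le: "\<bar>ln (dist x y)\<bar> \<le> lgw x + lgw y + 2 * sqrt (kap (x - y))"
  using ln_split[of "dist x y"] lnp_le_lgw[of x y] lnm_le_kap[of x y] lnp_nonneg[of "dist x y"] lnm_nonneg[of "dist x y"] by linarith

text \<open>\<open>K\<close> stands for \<open>ln\<close>, \<open>lnp\<close> or \<open>lnm\<close>.
  The common majorant \<open>U\<close> of both densities covers the mixed terms that appear when the
  logarithmic energy is expanded along a line.\<close>

lemma log_double_integrable:
  assumes U: "adm U" and [measurable]: "f \<in> Bor" "g \<in> Bor" "K \<in> Bor"
    and b: "\<And>x. \<bar>f x\<bar> \<le> U x" "\<And>x. \<bar>g x\<bar> \<le> U x" "\<And>t. \<bar>K t\<bar> \<le> \<bar>ln t :: real\<bar>"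
  shows "integrable lborel2 (\<lambda>p. K (dist (fst p) (snd p)) * f (fst p) * g (snd p))"
proof (rule L1_bound)
  note u = admD[OF U]
  note [measurable] = u(1)
  have s: "sigma_finite_measure (lborel :: R2 measure)" by (rule sigma_finite_lborel)
  show "integrable lborel2 (\<lambda>p. (lgw (fst p) * U (fst p)) * U (snd p) + U (fst p) * (lgw (snd p) * U (snd p))
      + 2 * (sqrt (kap (fst p - snd p)) * U (fst p) * U (snd p)))"
    by (intro L1_add integrable_mult_right integrable_prod_mult[OF s s] sqrt_kap_double(1) u)
  show "AE p in lborel2. norm (K (dist (fst p) (snd p)) * f (fst p) * g (snd p)) \<le>
     norm ((lgw (fst p) * U (fst p)) * U (snd p) + U (fst p) * (lgw (snd p) * U (snd p)) + 2 * (sqrt (kap (fst p - snd p)) * U (fst p) * U (snd p)))"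
  proof (rule AE_I2)
    fix p :: "R2 \<times> R2"
    obtain x y where p: "p = (x, y)" by (cases p)
    have "\<bar>K (dist x y) * f x * g y\<bar> = \<bar>K (dist x y)\<bar> * (\<bar>f x\<bar> * \<bar>g y\<bar>)" by (simp add: abs_mult)
    also have "... \<le> (lgw x + lgw y + 2 * sqrt (kap (x - y))) * (U x * U y)"
      using b(1)[of x] b(2)[of y] b(3)[of "dist x y"] ln_abs_le[of x y] u(2)[of x] u(2)[of y]
      by (intro mult_mono) (auto intro: order_trans mult_nonneg_nonneg)
    finally have "\<bar>K (dist x y) * f x * g y\<bar> \<le> (lgw x * U x) * U y + U x * (lgw y * U y) + 2 * (sqrt (kap (x - y)) * U x * U y)"
      by (simp add: algebra_simps)
    then show "norm (K (dist (fst p) (snd p)) * f (fst p) * g (snd p)) \<le>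
     norm ((lgw (fst p) * U (fst p)) * U (snd p) + U (fst p) * (lgw (snd p) * U (snd p)) + 2 * (sqrt (kap (fst p - snd p)) * U (fst p) * U (snd p)))"
      unfolding p real_norm_def fst_conv snd_conv by linarith
  qed
  show "(\<lambda>p. K (dist (fst p) (snd p)) * f (fst p) * g (snd p)) \<in> borel_measurable lborel2" by measurable
qed

definition dbl :: "(real => real) => (R2 => real) => (R2 => real) => real" where
  "dbl K f g = (\<integral>p. K (dist (fst p) (snd p)) * f (fst p) * g (snd p) \<partial>lborel2)"

lemma dbl_fubini:
  assumes "integrable lborel2 (\<lambda>p. K (dist (fst p) (snd p)) * f (fst p) * g (snd p))"
  shows "dbl K f g = (LBINT y. (LBINT x. K (dist x y) * f x) * g y)"
    "AE x in lborel. L1 (\<lambda>y. K (dist x y) * f x * g y)"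
    "AE y in lborel. L1 (\<lambda>x. K (dist x y) * f x * g y)"
    "L1 (\<lambda>y. (LBINT x. K (dist x y) * f x) * g y)"
proof -
  have i: "integrable lborel2 (case_prod (\<lambda>x y. K (dist x y) * f x * g y))" using assms by (simp add: case_prod_beta')
  show "dbl K f g = (LBINT y. (LBINT x. K (dist x y) * f x) * g y)"
    using lborel_pair.integral_snd[OF i] by (simp add: dbl_def case_prod_beta')
  show "AE x in lborel. L1 (\<lambda>y. K (dist x y) * f x * g y)" using lborel_pair.AE_integrable_fst[OF i] .
  show "AE y in lborel. L1 (\<lambda>x. K (dist x y) * f x * g y)" using lborel_pair.AE_integrable_snd[OF i] .
  show "L1 (\<lambda>y. (LBINT x. K (dist x y) * f x) * g y)" using lborel_pair.integrable_snd[OF i] by simp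
qed

lemma dbl_commute: "dbl K f g = dbl K g f" if "(\<lambda>p. K (dist (fst p) (snd p)) * f (fst p) * g (snd p)) \<in> borel_measurable lborel2"
  using lborel_pair.integral_product_swap[OF that] by (simp add: dbl_def case_prod_beta' dist_commute mult_ac)

lemma dbl_lnm_bound:
  assumes U: "adm U" shows "dbl lnm U U \<le> 2 * sqrt kapc * sqrt (nsq U) * (LBINT x. U x)"
proof -
  note u = admD[OF U]
  have "dbl lnm U U \<le> (\<integral>p. 2 * \<bar>sqrt (kap (fst p - snd p)) * U (fst p) * U (snd p)\<bar> \<partial>lborel2)"
    unfolding dbl_def
  proof (rule integral_mono)
    show "integrable lborel2 (\<lambda>p. lnm (dist (fst p) (snd p)) * U (fst p) * U (snd p))"
      by (rule log_double_integrable[OF U]) (use u lnm_le lnm_nonneg in auto)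
    show "integrable lborel2 (\<lambda>p. 2 * \<bar>sqrt (kap (fst p - snd p)) * U (fst p) * U (snd p)\<bar>)"
      by (intro integrable_mult_right integrable_abs sqrt_kap_double(1) u)
    fix p :: "R2 \<times> R2"
    have "lnm (dist (fst p) (snd p)) * (U (fst p) * U (snd p)) \<le> 2 * sqrt (kap (fst p - snd p)) * (U (fst p) * U (snd p))"
      using u(2) by (intro mult_right_mono lnm_le_kap) auto
    then show "lnm (dist (fst p) (snd p)) * U (fst p) * U (snd p) \<le> 2 * \<bar>sqrt (kap (fst p - snd p)) * U (fst p) * U (snd p)\<bar>"
      using u(2) by (simp add: abs_mult kap_nonneg mult_ac)
  qed
  also have "... \<le> 2 * ((LBINT x. \<bar>U x\<bar>) * (sqrt kapc * sqrt (nsq U)))"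
    using sqrt_kap_double(2)[OF u(3,4,1)] by simp
  also have "(LBINT x. \<bar>U x\<bar>) = (LBINT x. U x)" using u(2) by simp
  finally show ?thesis by (simp add: mult_ac)
qed

section \<open>The function space\<close>

text \<open>\<open>W\<close> stands for a Borel representative of the potential, modified on a null
  set so that the lower bound \<open>c0\<close> holds everywhere. The variational argument runs
  entirely on such representatives; only at the end are the results transferred to
  \<open>V\<close>.\<close>

locale planar =
  fixes W :: "R2 => real" and c0 b p :: real
  assumes W_borel [measurable]: "W \<in> Bor" and c0: "c0 > 0" and W_ge: "\<And>x. W x \<ge> c0"
    and W_loc: "locint W" and W_fin: "\<And>M. emeasure lborel {x. W x \<le> M} < \<infinity>"
    and b0: "b \<ge> 0" and p4: "p \<ge> 4"
begin

definition X :: "(R2 => real) set" where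
  "X = {u. (\<exists>G. sob u G) \<and> L1 (\<lambda>x. W x * (u x)\<^sup>2) \<and> L1 (\<lambda>x. lgw x * (u x)\<^sup>2)}"

definition gr :: "(R2 => real) => R2 => R2" where "gr u = (SOME G. sob u G)"

text \<open>The three energies are homogeneous of degrees 2, 4 and \<open>p\<close>. Hence
  \<open>Q u\<close> is the derivative of \<open>J\<close> along the ray through \<open>u\<close>,
  taken at \<open>u\<close>, and its zeros form the Nehari constraint.\<close>

definition Aen :: "(R2 => real) => real" where "Aen u = nsq (gr u) + (LBINT x. W x * (u x)\<^sup>2)"
definition Nen :: "(R2 => real) => real" where "Nen u = dbl ln (sq u) (sq u) / (2 * pi)"
definition Cen :: "(R2 => real) => real" where "Cen u = (LBINT x. \<bar>u x\<bar> powr p)"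
definition J :: "(R2 => real) => real" where "J u = Aen u / 2 + Nen u / 4 - b / p * Cen u"
definition Q :: "(R2 => real) => real" where "Q u = Aen u + Nen u - b * Cen u"

lemma X_sob: "u \<in> X ==> sob u (gr u)" unfolding gr_def X_def by (auto intro: someI_ex[of "sob u"])

lemma gr_nsq: assumes "sob u G" shows "nsq (gr u) = nsq G"
proof -
  have g: "sob u (gr u)" unfolding gr_def using assms by (rule someI[of "sob u"])
  note [measurable] = sqint_borel[OF sobD(2)[OF g]] sqint_borel[OF sobD(2)[OF assms]]
  show ?thesis unfolding nsq_def by (rule integral_cong_AE) (use sob_unique[OF g assms] in auto)
qed

lemma XD:
  assumes "u \<in> X"
  shows "sqint u" "u \<in> Bor" "L1 (sq u)" "sqint (gr u)"
    "L1 (\<lambda>x. W x * (u x)\<^sup>2)" "L1 (\<lambda>x. lgw x * (u x)\<^sup>2)"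
  using assms sobD[OF X_sob[OF assms]] by (auto simp: X_def sqint_real)

lemma XI:
  assumes "sob u G" "L1 (\<lambda>x. W x * (u x)\<^sup>2)" "L1 (\<lambda>x. lgw x * (u x)\<^sup>2)"
  shows "u \<in> X"
  using assms by (auto simp: X_def)

lemma weighted_lincomb:
  fixes w u v :: "R2 => real" and s t :: real
  assumes [measurable]: "w \<in> Bor" "u \<in> Bor" "v \<in> Bor"
    and w: "\<And>x. 0 \<le> w x" and u: "L1 (\<lambda>x. w x * (u x)\<^sup>2)" and v: "L1 (\<lambda>x. w x * (v x)\<^sup>2)"
  shows "L1 (\<lambda>x. w x * (s * u x + t * v x)\<^sup>2)" "L1 (\<lambda>x. w x * (u x * v x))"
proof -
  have i: "L1 (\<lambda>x. 2 * s\<^sup>2 * (w x * (u x)\<^sup>2) + 2 * t\<^sup>2 * (w x * (v x)\<^sup>2))" using u v by simp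
  show "L1 (\<lambda>x. w x * (s * u x + t * v x)\<^sup>2)"
  proof (rule L1_bound[OF i])
    show "AE x in lborel. norm (w x * (s * u x + t * v x)\<^sup>2) \<le> norm (2 * s\<^sup>2 * (w x * (u x)\<^sup>2) + 2 * t\<^sup>2 * (w x * (v x)\<^sup>2))"
    proof (rule AE_I2)
      fix x
      have "w x * (s * u x + t * v x)\<^sup>2 \<le> w x * (2 * (s * u x)\<^sup>2 + 2 * (t * v x)\<^sup>2)"
        using norm_add_sq_le[of "s * u x" "t * v x"] w by (intro mult_left_mono) auto
      then show "norm (w x * (s * u x + t * v x)\<^sup>2) \<le> norm (2 * s\<^sup>2 * (w x * (u x)\<^sup>2) + 2 * t\<^sup>2 * (w x * (v x)\<^sup>2))"
        using w[of x] by (simp add: power_mult_distrib algebra_simps)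
    qed
  qed measurable
  have i2: "L1 (\<lambda>x. w x * (u x)\<^sup>2 + w x * (v x)\<^sup>2)" using u v by simp
  show "L1 (\<lambda>x. w x * (u x * v x))"
  proof (rule L1_bound[OF i2])
    show "AE x in lborel. norm (w x * (u x * v x)) \<le> norm (w x * (u x)\<^sup>2 + w x * (v x)\<^sup>2)"
    proof (rule AE_I2)
      fix x
      have "2 * (\<bar>u x\<bar> * \<bar>v x\<bar>) \<le> (u x)\<^sup>2 + (v x)\<^sup>2" using sum_squares_bound[of "\<bar>u x\<bar>" "\<bar>v x\<bar>"] by simp
      then have "\<bar>u x * v x\<bar> \<le> (u x)\<^sup>2 + (v x)\<^sup>2" unfolding abs_mult by (smt (verit) abs_ge_zero mult_nonneg_nonneg)
      then have "w x * \<bar>u x * v x\<bar> \<le> w x * ((u x)\<^sup>2 + (v x)\<^sup>2)" using w by (intro mult_left_mono) auto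
      then show "norm (w x * (u x * v x)) \<le> norm (w x * (u x)\<^sup>2 + w x * (v x)\<^sup>2)"
        using w[of x] by (simp add: abs_mult algebra_simps)
    qed
  qed measurable
qed

lemma W_nonneg: "0 \<le> W x" using W_ge[of x] c0 by linarith

lemma X_lincomb: assumes u: "u \<in> X" and v: "v \<in> X" shows "(\<lambda>x. s * u x + t * v x) \<in> X"
proof (rule XI[OF sob_lincomb[OF X_sob[OF u] X_sob[OF v]]])
  show "L1 (\<lambda>x. W x * (s * u x + t * v x)\<^sup>2)"
    using XD[OF u] XD[OF v] W_nonneg by (intro weighted_lincomb(1)) auto
  show "L1 (\<lambda>x. lgw x * (s * u x + t * v x)\<^sup>2)"
    using XD[OF u] XD[OF v] lgw_nonneg by (intro weighted_lincomb(1)) auto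
qed

lemma X_scale: "u \<in> X ==> (\<lambda>x. s * u x) \<in> X"
  using X_lincomb[of u u s 0] by simp

lemma X_add_scale: "u \<in> X ==> v \<in> X ==> (\<lambda>x. u x + t * v x) \<in> X"
  using X_lincomb[of u v 1 t] by simp

lemma X_powr: assumes u: "u \<in> X" "q \<ge> 2" shows "L1 (\<lambda>x. \<bar>u x\<bar> powr q)"
proof -
  from sobolev[OF assms(2)] obtain C where "\<And>u G. sob u G ==> L1 (\<lambda>x. \<bar>u x\<bar> powr q)" by metis
  then show ?thesis using X_sob[OF u(1)] .
qed

lemma powr_4: "\<bar>a\<bar> powr 4 = (a\<^sup>2)\<^sup>2" for a :: real
  by (cases "a = 0") (auto simp: power_even_abs_numeral)

lemma X_sq_sqint: assumes u: "u \<in> X" shows "sqint (sq u)"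
  using X_powr[OF u, of 4] XD(2)[OF u] by (simp add: sqint_real powr_4)

lemma X_adm: assumes u: "u \<in> X" and v: "v \<in> X" shows "adm (\<lambda>x. (u x)\<^sup>2 + (v x)\<^sup>2)"
  using XD[OF u] XD[OF v] sqint_add(1)[OF X_sq_sqint[OF u] X_sq_sqint[OF v]] by (simp add: adm_def distrib_left)

lemma X_adm1: assumes u: "u \<in> X" shows "adm (sq u)"
  using XD[OF u] X_sq_sqint[OF u] by (simp add: adm_def)

lemma dbl_int: assumes u: "u \<in> X" and [measurable]: "K \<in> Bor" and K: "\<And>t. \<bar>K t\<bar> \<le> \<bar>ln t :: real\<bar>"
  shows "integrable lborel2 (\<lambda>p. K (dist (fst p) (snd p)) * (u (fst p))\<^sup>2 * (u (snd p))\<^sup>2)"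
  using log_double_integrable[OF X_adm1[OF u], of "\<lambda>x. (u x)\<^sup>2" "\<lambda>x. (u x)\<^sup>2" K] XD(2)[OF u] K by auto

lemma Nen_split: assumes u: "u \<in> X"
  shows "Nen u = (dbl lnp (sq u) (sq u) - dbl lnm (sq u) (sq u)) / (2 * pi)"
proof -
  have "dbl ln (sq u) (sq u) = dbl lnp (sq u) (sq u) - dbl lnm (sq u) (sq u)"
    unfolding dbl_def
    by (subst Bochner_Integration.integral_diff[symmetric])
       (use dbl_int[OF u, of lnp] dbl_int[OF u, of lnm] lnp_le lnm_le lnp_nonneg lnm_nonneg in \<open>auto simp: ln_split[of "dist _ _"] algebra_simps\<close>)
  then show ?thesis by (simp add: Nen_def)
qed

definition Bform :: "(R2 => real) => (R2 => real) => real" where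
  "Bform u v = (LBINT x. gr u x \<bullet> gr v x) + (LBINT x. W x * (u x * v x))"

lemma sqint_inner_prod:
  fixes G H :: "R2 => R2" assumes "sqint G" "sqint H" shows "L1 (\<lambda>x. G x \<bullet> H x)"
proof -
  have "L1 (\<lambda>x. \<Sum>i\<in>Basis. (G x \<bullet> i) * (H x \<bullet> i))"
    by (intro L1_sum sqint_prod(1) sqint_inner(1) assms)
  then show ?thesis by (simp add: euclidean_inner[symmetric])
qed

lemma Aen_expand: assumes u: "u \<in> X" and v: "v \<in> X"
  shows "Aen (\<lambda>x. u x + t * v x) = Aen u + 2 * t * Bform u v + t\<^sup>2 * Aen v"
proof -
  have s: "sob (\<lambda>x. u x + t * v x) (\<lambda>x. gr u x + t *\<^sub>R gr v x)" using sob_lincomb[OF X_sob[OF u] X_sob[OF v], of 1 t] by simp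
  have i: "L1 (\<lambda>x. gr u x \<bullet> gr v x)" by (intro sqint_inner_prod XD u v)
  have n: "L1 (\<lambda>x. (norm (gr u x))\<^sup>2)" "L1 (\<lambda>x. (norm (gr v x))\<^sup>2)"
    using XD(4)[OF u] XD(4)[OF v] by (auto simp: sqint_def)
  have "(norm (gr u x + t *\<^sub>R gr v x))\<^sup>2 = (norm (gr u x))\<^sup>2 + (2 * t * (gr u x \<bullet> gr v x) + t\<^sup>2 * (norm (gr v x))\<^sup>2)" for x
    unfolding power2_norm_eq_inner by (simp add: inner_add_left inner_add_right inner_commute power2_eq_square algebra_simps)
  then have "nsq (\<lambda>x. gr u x + t *\<^sub>R gr v x) = (LBINT x. (norm (gr u x))\<^sup>2 + (2 * t * (gr u x \<bullet> gr v x) + t\<^sup>2 * (norm (gr v x))\<^sup>2))"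
    by (simp only: nsq_def)
  then have 1: "nsq (\<lambda>x. gr u x + t *\<^sub>R gr v x) = nsq (gr u) + 2 * t * (LBINT x. gr u x \<bullet> gr v x) + t\<^sup>2 * nsq (gr v)"
    using i n by (simp add: nsq_def)
  have w: "L1 (\<lambda>x. W x * (u x * v x))" using XD[OF u] XD[OF v] W_nonneg by (intro weighted_lincomb(2)) auto
  have "W x * (u x + t * v x)\<^sup>2 = W x * (u x)\<^sup>2 + (2 * t * (W x * (u x * v x)) + t\<^sup>2 * (W x * (v x)\<^sup>2))" for x
    by (simp add: power2_eq_square algebra_simps)
  then have "(LBINT x. W x * (u x + t * v x)\<^sup>2) = (LBINT x. W x * (u x)\<^sup>2 + (2 * t * (W x * (u x * v x)) + t\<^sup>2 * (W x * (v x)\<^sup>2)))"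
    by (simp only:)
  then have 2: "(LBINT x. W x * (u x + t * v x)\<^sup>2) = (LBINT x. W x * (u x)\<^sup>2) + 2 * t * (LBINT x. W x * (u x * v x)) + t\<^sup>2 * (LBINT x. W x * (v x)\<^sup>2)"
    using w XD(5)[OF u] XD(5)[OF v] by simp
  show ?thesis unfolding Aen_def gr_nsq[OF s] 1 2 Bform_def by (simp add: algebra_simps)
qed

lemma scale_energies: assumes u: "u \<in> X"
  shows "Aen (\<lambda>x. t * u x) = t\<^sup>2 * Aen u" "Nen (\<lambda>x. t * u x) = t^4 * Nen u" "t > 0 ==> Cen (\<lambda>x. t * u x) = t powr p * Cen u"
proof -
  have s: "sob (\<lambda>x. t * u x) (\<lambda>x. t *\<^sub>R gr u x)" using sob_lincomb[OF X_sob[OF u] X_sob[OF u], of t 0] by simp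
  have "nsq (gr (\<lambda>x. t * u x)) = t\<^sup>2 * nsq (gr u)" unfolding gr_nsq[OF s] by (rule sqint_scaleR(2)[OF XD(4)[OF u]])
  moreover have "(LBINT x. W x * (t * u x)\<^sup>2) = t\<^sup>2 * (LBINT x. W x * (u x)\<^sup>2)"
    by (subst integral_mult_right_zero[symmetric]) (simp add: power_mult_distrib mult_ac)
  ultimately show "Aen (\<lambda>x. t * u x) = t\<^sup>2 * Aen u" by (simp add: Aen_def distrib_left)
  have "dbl ln (\<lambda>x. (t * u x)\<^sup>2) (\<lambda>x. (t * u x)\<^sup>2) = t^4 * dbl ln (sq u) (sq u)"
    unfolding dbl_def by (subst integral_mult_right_zero[symmetric]) (simp add: power_mult_distrib mult_ac power4_eq_xxxx power2_eq_square)
  then show "Nen (\<lambda>x. t * u x) = t^4 * Nen u" by (simp add: Nen_def)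
  show "Cen (\<lambda>x. t * u x) = t powr p * Cen u" if "t > 0"
    unfolding Cen_def using that by (subst integral_mult_right_zero[symmetric]) (simp add: abs_mult powr_mult)
qed

definition Pot :: "(R2 => real) => R2 => real" where
  "Pot u x = (LBINT y. ln (dist x y) * (u y)\<^sup>2)"

text \<open>Along a line \<open>Nen\<close> is a polynomial of degree four in the parameter; its
  coefficients are double integrals of products of u^2, 2uv and v^2, all dominated by u^2 + v^2. The
  linear coefficient consists of two terms that are equal by symmetry of the kernel.\<close>

lemma Nen_deriv: assumes u: "u \<in> X" and v: "v \<in> X"
  shows "((\<lambda>t. Nen (\<lambda>x. u x + t * v x)) has_real_derivative 4 * (1 / (2 * pi) * (LBINT x. Pot u x * (u x * v x)))) (at 0)"
    "L1 (\<lambda>x. Pot u x * (u x * v x))"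
proof -
  note [measurable] = XD(2)[OF u] XD(2)[OF v]
  define U where "U x = (u x)\<^sup>2 + (v x)\<^sup>2" for x
  have U: "adm U" unfolding U_def[abs_def] by (rule X_adm[OF u v])
  define f h k where "f x = (u x)\<^sup>2" and "h x = 2 * (u x * v x)" and "k x = (v x)\<^sup>2" for x
  have [measurable]: "f \<in> Bor" "h \<in> Bor" "k \<in> Bor"
    unfolding f_def[abs_def] h_def[abs_def] k_def[abs_def] by measurable
  have hU: "\<bar>h x\<bar> \<le> U x" for x
    using sum_squares_bound[of "\<bar>u x\<bar>" "\<bar>v x\<bar>"] by (simp add: h_def U_def abs_mult)
  have b: "\<And>x. \<bar>f x\<bar> \<le> U x" "\<And>x. \<bar>k x\<bar> \<le> U x" by (auto simp: f_def k_def U_def)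
  have lnb: "(ln :: real => real) \<in> Bor" by measurable
  have I: "integrable lborel2 (\<lambda>p. ln (dist (fst p) (snd p)) * f' (fst p) * g' (snd p))"
    if "f' \<in> {f, h, k}" "g' \<in> {f, h, k}" for f' g'
    using that hU b by (intro log_double_integrable[OF U _ _ lnb]) auto
  define E1 where "E1 t = dbl ln f f + (t * (dbl ln f h + dbl ln h f) + (t\<^sup>2 * (dbl ln h h + (dbl ln f k + dbl ln k f)) + (t^3 * (dbl ln h k + dbl ln k h) + t^4 * dbl ln k k)))" for t
  have ex: "dbl ln (\<lambda>x. (u x + t * v x)\<^sup>2) (\<lambda>x. (u x + t * v x)\<^sup>2) = E1 t" for t
  proof -
    let ?D = "\<lambda>f' g' p. ln (dist (fst p) (snd p)) * f' (fst p) * g' (snd p) :: real"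
    have "?D (\<lambda>x. (u x + t * v x)\<^sup>2) (\<lambda>x. (u x + t * v x)\<^sup>2) q = ?D f f q + (t * (?D f h q + ?D h f q) + (t\<^sup>2 * (?D h h q + (?D f k q + ?D k f q)) + (t^3 * (?D h k q + ?D k h q) + t^4 * ?D k k q)))" for q
    proof -
      have e: "(u x + t * v x)\<^sup>2 = f x + t * h x + t\<^sup>2 * k x" for x by (simp add: f_def h_def k_def power2_eq_square algebra_simps)
      show ?thesis unfolding e by (simp add: algebra_simps power2_eq_square power3_eq_cube power4_eq_xxxx)
    qed
    then have "dbl ln (\<lambda>x. (u x + t * v x)\<^sup>2) (\<lambda>x. (u x + t * v x)\<^sup>2) = (\<integral>q. ?D f f q + (t * (?D f h q + ?D h f q) + (t\<^sup>2 * (?D h h q + (?D f k q + ?D k f q)) + (t^3 * (?D h k q + ?D k h q) + t^4 * ?D k k q))) \<partial>lborel2)"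
      unfolding dbl_def by (simp only:)
    also have "... = E1 t" unfolding E1_def dbl_def
      by (simp add: I)
    finally show ?thesis .
  qed
  have D: "(E1 has_real_derivative (dbl ln f h + dbl ln h f)) (at 0)"
    unfolding E1_def by (auto intro!: derivative_eq_intros)
  have c: "dbl ln f h = dbl ln h f" by (rule dbl_commute) measurable
  have fb: "dbl ln f h = 2 * (LBINT x. Pot u x * (u x * v x))"
  proof -
    have "dbl ln f h = (LBINT y. (LBINT x. ln (dist x y) * f x) * h y)" by (rule dbl_fubini(1)[OF I]) auto
    also have "... = (LBINT y. 2 * (Pot u y * (u y * v y)))" by (simp add: Pot_def f_def h_def dist_commute mult_ac)
    finally show ?thesis by simp
  qed
  have "L1 (\<lambda>y. (LBINT x. ln (dist x y) * f x) * h y)" by (rule dbl_fubini(4)[OF I]) auto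
  moreover have "(\<lambda>y. (LBINT x. ln (dist x y) * f x) * h y) = (\<lambda>y. 2 * (Pot u y * (u y * v y)))"
    by (simp add: Pot_def f_def h_def dist_commute mult_ac)
  ultimately show "L1 (\<lambda>x. Pot u x * (u x * v x))" by simp
  have "((\<lambda>t. E1 t / (2 * pi)) has_real_derivative (dbl ln f h + dbl ln h f) / (2 * pi)) (at 0)" by (rule DERIV_cdivide[OF D])
  then show "((\<lambda>t. Nen (\<lambda>x. u x + t * v x)) has_real_derivative 4 * (1 / (2 * pi) * (LBINT x. Pot u x * (u x * v x)))) (at 0)"
    unfolding Nen_def ex using c fb by simp
qed

end

lemma abs_powr_has_derivative:
  assumes "q > 1"
  shows "((\<lambda>t::real. \<bar>t\<bar> powr q) has_real_derivative q * (\<bar>t\<bar> powr (q - 2) * t)) (at t)"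
proof -
  consider "t > 0" | "t < 0" | "t = 0" by linarith
  then show ?thesis
  proof cases
    case 1
    have "((\<lambda>t. t powr q) has_real_derivative q * t powr (q - 1)) (at t)" using 1 by (intro has_real_derivative_powr) auto
    moreover have "t powr (q - 1) = \<bar>t\<bar> powr (q - 2) * t" using 1 powr_add[of t "q - 2" 1] by simp
    ultimately have "((\<lambda>t. t powr q) has_real_derivative q * (\<bar>t\<bar> powr (q - 2) * t)) (at t)" by simp
    then show ?thesis by (rule has_field_derivative_transform_within_open[of _ _ _ "{0<..}"]) (use 1 in auto)
  next
    case 2
    have "((\<lambda>t. (- t) powr q) has_real_derivative q * (- t) powr (q - 1) * (- 1)) (at t)"
      using 2 by (intro DERIV_chain2[OF has_real_derivative_powr]) (auto intro!: derivative_eq_intros)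
    moreover have "(- t) powr (q - 1) = \<bar>t\<bar> powr (q - 2) * (- t)" using 2 powr_add[of "- t" "q - 2" 1] by simp
    ultimately have "((\<lambda>t. (- t) powr q) has_real_derivative q * (\<bar>t\<bar> powr (q - 2) * t)) (at t)" by simp
    then show ?thesis by (rule has_field_derivative_transform_within_open[of _ _ _ "{..<0}"]) (use 2 in auto)
  next
    case 3
    have "((\<lambda>h. \<bar>h\<bar> powr (q - 1)) \<longlongrightarrow> \<bar>0\<bar> powr (q - 1)) (at (0::real))"
      using assms by (intro tendsto_powr' tendsto_intros) auto
    then have l: "((\<lambda>h. \<bar>h\<bar> powr (q - 1)) \<longlongrightarrow> 0) (at (0::real))" using assms by simp
    have "((\<lambda>h. \<bar>h\<bar> powr q / h) \<longlongrightarrow> 0) (at (0::real))"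
    proof (rule Lim_null_comparison[OF _ l])
      have "norm (\<bar>h\<bar> powr q / h) \<le> \<bar>h\<bar> powr (q - 1)" for h :: real
        using powr_add[of "\<bar>h\<bar>" "q - 1" 1] by (cases "h = 0") auto
      then show "\<forall>\<^sub>F h in at (0::real). norm (\<bar>h\<bar> powr q / h) \<le> \<bar>h\<bar> powr (q - 1)" by simp
    qed
    then show ?thesis using 3 by (simp add: DERIV_def)
  qed
qed

lemma abs_powr_diff_le:
  fixes a c :: real
  assumes q: "q \<ge> 2"
  shows "\<bar>\<bar>a\<bar> powr q - \<bar>c\<bar> powr q\<bar> \<le> q * (\<bar>a\<bar> powr (q - 1) + \<bar>c\<bar> powr (q - 1)) * \<bar>a - c\<bar>"
proof -
  define m where "m = max \<bar>a\<bar> \<bar>c\<bar>"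
  have "norm (\<bar>a\<bar> powr q - \<bar>c\<bar> powr q) \<le> (q * m powr (q - 1)) * norm (a - c)"
  proof (rule field_differentiable_bound[where S="{- m..m}" and f'="\<lambda>t. q * (\<bar>t\<bar> powr (q - 2) * t)"])
    fix t assume "t \<in> {- m..m}"
    then have t: "\<bar>t\<bar> \<le> m" by auto
    show "((\<lambda>t. \<bar>t\<bar> powr q) has_real_derivative q * (\<bar>t\<bar> powr (q - 2) * t)) (at t within {- m..m})"
      by (rule has_field_derivative_at_within[OF abs_powr_has_derivative]) (use q in simp)
    have "\<bar>\<bar>t\<bar> powr (q - 2) * t\<bar> = \<bar>t\<bar> powr (q - 1)" using powr_add[of "\<bar>t\<bar>" "q - 2" 1] by (cases "t = 0") (auto simp: abs_mult)
    also have "... \<le> m powr (q - 1)" using q t by (intro powr_mono2) auto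
    finally show "norm (q * (\<bar>t\<bar> powr (q - 2) * t)) \<le> q * m powr (q - 1)" using q by (simp add: abs_mult mult_left_mono)
  qed (auto simp: m_def)
  also have "... \<le> (q * (\<bar>a\<bar> powr (q - 1) + \<bar>c\<bar> powr (q - 1))) * norm (a - c)"
    using q by (intro mult_right_mono mult_left_mono) (auto simp: m_def max_def)
  finally show ?thesis by simp
qed

lemma (in planar) Cen_deriv: assumes u: "u \<in> X" and v: "v \<in> X"
  shows "((\<lambda>t. Cen (\<lambda>x. u x + t * v x)) has_real_derivative p * (LBINT x. \<bar>u x\<bar> powr (p - 2) * u x * v x)) (at 0)"
proof -
  note [measurable] = XD(2)[OF u] XD(2)[OF v]
  \<comment> \<open>For |t| < 1 both arguments are at most twice max |u| |v|; the mean value bound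
    for the power gives this majorant.\<close>
  define w where "w x = 2 * p * 2 powr (p - 1) * (\<bar>u x\<bar> powr p + \<bar>v x\<bar> powr p)" for x
  have p: "p \<ge> 2" using p4 by simp
  have "((\<lambda>t. LBINT x. \<bar>u x + t * v x\<bar> powr p) has_real_derivative (LBINT x. p * (\<bar>u x\<bar> powr (p - 2) * u x * v x))) (at 0)"
  proof (rule has_real_derivative_integral[where d=1 and w=w])
    show "L1 (\<lambda>x. \<bar>u x + t * v x\<bar> powr p)" for t by (rule X_powr[OF X_add_scale[OF u v] p])
    show "integrable lborel w" unfolding w_def using X_powr[OF u p] X_powr[OF v p] by simp
    show "((\<lambda>t. \<bar>u y + t * v y\<bar> powr p) has_real_derivative p * (\<bar>u y\<bar> powr (p - 2) * u y * v y)) (at 0)" for y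
    proof -
      have "((\<lambda>t. \<bar>u y + t * v y\<bar> powr p) has_real_derivative (p * (\<bar>u y + 0 * v y\<bar> powr (p - 2) * (u y + 0 * v y))) * v y) (at 0)"
        by (rule DERIV_chain2[OF abs_powr_has_derivative]) (use p in "auto intro!: derivative_eq_intros")
      then show ?thesis by (simp add: mult_ac)
    qed
    show "\<bar>\<bar>u y + t * v y\<bar> powr p - \<bar>u y + 0 * v y\<bar> powr p\<bar> \<le> \<bar>t - 0\<bar> * w y" if t: "\<bar>t - 0\<bar> < 1" for t y
    proof -
      define m where "m = max \<bar>u y\<bar> \<bar>v y\<bar>"
      have m0: "m \<ge> 0" "\<bar>v y\<bar> \<le> m" "\<bar>u y\<bar> \<le> m" by (auto simp: m_def)
      have "\<bar>t * v y\<bar> \<le> 1 * \<bar>v y\<bar>" unfolding abs_mult using t by (intro mult_right_mono) auto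
      then have m: "\<bar>u y + t * v y\<bar> \<le> 2 * m" using m0 by linarith
      have pw: "\<bar>u y + t * v y\<bar> powr (p - 1) \<le> (2 * m) powr (p - 1)" "\<bar>u y\<bar> powr (p - 1) \<le> (2 * m) powr (p - 1)"
        using m m0 p by (intro powr_mono2; simp)+
      have "\<bar>\<bar>u y + t * v y\<bar> powr p - \<bar>u y\<bar> powr p\<bar> \<le> p * (\<bar>u y + t * v y\<bar> powr (p - 1) + \<bar>u y\<bar> powr (p - 1)) * \<bar>(u y + t * v y) - u y\<bar>"
        by (rule abs_powr_diff_le[OF p])
      also have "... \<le> p * (2 * (2 * m) powr (p - 1)) * (\<bar>t\<bar> * m)"
        using pw m0 p by (intro mult_mono) (auto simp: abs_mult intro!: mult_left_mono)
      also have "... = \<bar>t\<bar> * (2 * p * 2 powr (p - 1) * (m powr (p - 1) * m))" using m0 by (simp add: powr_mult)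
      also have "m powr (p - 1) * m = m powr p" using powr_add[of m "p - 1" 1] m0 by (cases "m = 0") auto
      also have "\<bar>t\<bar> * (2 * p * 2 powr (p - 1) * m powr p) \<le> \<bar>t\<bar> * w y"
        unfolding w_def using p by (intro mult_left_mono) (auto simp: m_def max_def)
      finally show ?thesis by simp
    qed
  qed auto
  then show ?thesis unfolding Cen_def by simp
qed

section \<open>Fibre maps\<close>

text \<open>The derivative of \<open>fphi\<close> divided by \<open>t\<close>. Dividing out the zero
  at the origin leaves a function continuous on [0, \<infinity>) with the positive value \<alpha> at
  0, to which the intermediate value theorem applies.\<close>

definition fqf :: "real => real => real => real => real => real => real" where
  "fqf \<alpha> \<beta> \<gamma> b p t = \<alpha> + \<beta> * t\<^sup>2 - b * \<gamma> * t powr (p - 2)"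

definition fphi :: "real => real => real => real => real => real => real" where
  "fphi \<alpha> \<beta> \<gamma> b p t = \<alpha> * t\<^sup>2 / 2 + \<beta> * t^4 / 4 - b / p * \<gamma> * t powr p"

locale fibre =
  fixes \<alpha> \<beta> \<gamma> b p :: real
  assumes b0: "b \<ge> 0" and p4: "p \<ge> 4" and \<alpha>: "\<alpha> > 0" and \<gamma>: "\<gamma> \<ge> 0"
begin

abbreviation qf :: "real => real" where "qf \<equiv> fqf \<alpha> \<beta> \<gamma> b p"
abbreviation phi :: "real => real" where "phi \<equiv> fphi \<alpha> \<beta> \<gamma> b p"

lemmas qf_def = fqf_def[of \<alpha> \<beta> \<gamma> b p]
lemmas phi_def = fphi_def[of \<alpha> \<beta> \<gamma> b p]

lemma qf_cont: "continuous_on {0..} qf"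
  unfolding fqf_def[abs_def] using p4 by (intro continuous_intros continuous_on_powr') auto

lemma phi_deriv: assumes "t > 0" shows "(phi has_real_derivative t * qf t) (at t)"
proof -
  have "(phi has_real_derivative \<alpha> * t + \<beta> * t^3 - b * \<gamma> * t powr (p - 1)) (at t)"
    unfolding fphi_def[abs_def] using assms p4
    by (auto intro!: derivative_eq_intros has_real_derivative_powr simp: field_simps)
  moreover have "t powr (p - 1) = t * t powr (p - 2)" using powr_add[of t 1 "p - 2"] assms by simp
  ultimately show ?thesis by (simp add: qf_def algebra_simps power3_eq_cube power2_eq_square)
qed

text \<open>Eliminating \<beta> through the constraint leaves \<alpha> (1 - t^2) + b \<gamma> (t^2 -
  t^(p-2)). Since p - 2 \<ge> 2, both terms change sign in the same direction at t = 1.\<close>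

lemma qf_sign:
  assumes "\<alpha> + \<beta> - b * \<gamma> = 0"
  shows "0 < t ==> t < 1 ==> qf t > 0" "1 < t ==> qf t < 0"
proof -
  have e: "qf t = \<alpha> * (1 - t\<^sup>2) + b * \<gamma> * (t powr 2 - t powr (p - 2))" if "t > 0" for t
  proof -
    have "\<beta> = b * \<gamma> - \<alpha>" using assms by linarith
    then show ?thesis using that unfolding \<open>\<beta> = b * \<gamma> - \<alpha>\<close> fqf_def by (simp add: algebra_simps)
  qed
  show "qf t > 0" if t: "0 < t" "t < 1"
  proof -
    have "t\<^sup>2 < 1" using t by (simp add: power_less_one_iff abs_square_less_1)
    then have "\<alpha> * (1 - t\<^sup>2) > 0" using \<alpha> by simp
    moreover have "t powr (p - 2) \<le> t powr 2" using t p4 by (intro powr_mono') auto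
    then have "b * \<gamma> * (t powr 2 - t powr (p - 2)) \<ge> 0" using b0 \<gamma> by (intro mult_nonneg_nonneg) auto
    ultimately show ?thesis using e[OF t(1)] by linarith
  qed
  show "qf t < 0" if t: "1 < t"
  proof -
    have "1 < t\<^sup>2" using t by (simp add: one_less_power)
    then have "\<alpha> * (1 - t\<^sup>2) < 0" using \<alpha> by (simp add: mult_pos_neg)
    moreover have "t powr 2 \<le> t powr (p - 2)" using t p4 by (intro powr_mono) auto
    then have "b * \<gamma> * (t powr 2 - t powr (p - 2)) \<le> 0" using b0 \<gamma> by (intro mult_nonneg_nonpos) auto
    ultimately show ?thesis using e[of t] t by linarith
  qed
qed

lemma phi_max:
  assumes "\<alpha> + \<beta> - b * \<gamma> = 0" "t > 0" shows "phi t \<le> phi 1"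
proof (cases "t \<le> 1")
  case True
  show ?thesis
  proof (rule DERIV_nonneg_imp_nondecreasing[OF True])
    fix s assume s: "t \<le> s" "s \<le> 1"
    then have "s > 0" using assms by simp
    moreover have "qf s \<ge> 0" using qf_sign(1)[OF assms(1), of s] s \<open>s > 0\<close> assms(1) by (cases "s = 1") (auto simp: qf_def)
    ultimately show "\<exists>y. (phi has_real_derivative y) (at s) \<and> 0 \<le> y" using phi_deriv by (intro exI[of _ "s * qf s"]) auto
  qed
next
  case False
  then have "1 \<le> t" by simp
  then show ?thesis
  proof (rule DERIV_nonpos_imp_nonincreasing)
    fix s assume s: "1 \<le> s" "s \<le> t"
    then have "s > 0" by simp
    moreover have "qf s \<le> 0" using qf_sign(2)[OF assms(1), of s] s assms(1) by (cases "s = 1") (auto simp: qf_def)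
    ultimately show "\<exists>y. (phi has_real_derivative y) (at s) \<and> y \<le> 0" using phi_deriv by (intro exI[of _ "s * qf s"]) (auto simp: mult_nonneg_nonpos)
  qed
qed

lemma qf_zero:
  assumes "t1 > 0" "qf t1 \<le> 0" shows "\<exists>t. 0 < t \<and> t \<le> t1 \<and> qf t = 0"
proof -
  have q0: "qf 0 = \<alpha>" using p4 by (simp add: qf_def)
  have "\<exists>t\<ge>0. t \<le> t1 \<and> qf t = 0"
    using assms \<alpha> q0 by (intro IVT2') (auto intro: continuous_on_subset[OF qf_cont])
  then show ?thesis using q0 \<alpha> by (metis less_le order_less_irrefl)
qed

text \<open>Without a zero, \<open>qf\<close> stays positive, which forces \<beta> \<ge> 0
  (otherwise it is nonpositive at t^2 = \<alpha> / -\<beta>) and bounds the power term by the two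
  others. As 1/p \<le> 1/4, the quartic terms cancel and \<alpha> t^2 / 4 remains as lower
  bound.\<close>

lemma phi_unbounded:
  assumes "\<And>t. t > 0 ==> qf t \<noteq> 0" shows "\<exists>t>0. M < phi t"
proof -
  have q: "qf t > 0" if "t > 0" for t
  proof (rule ccontr)
    assume "\<not> qf t > 0"
    then show False using qf_zero[OF that] assms by force
  qed
  have B: "\<beta> \<ge> 0"
  proof (rule ccontr)
    assume n: "\<not> \<beta> \<ge> 0"
    define r where "r = \<alpha> / - \<beta>"
    have r: "r > 0" unfolding r_def using n \<alpha> by (intro divide_pos_pos) auto
    define t where "t = sqrt r"
    have t: "t > 0" "t\<^sup>2 = r" using r by (auto simp: t_def)
    have "qf t \<le> \<alpha> + \<beta> * t\<^sup>2" unfolding qf_def using b0 \<gamma> by simp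
    also have "... = 0" using t(2) n by (simp add: r_def)
    finally show False using q[OF t(1)] by simp
  qed
  have lb: "\<alpha> * t\<^sup>2 / 4 \<le> phi t" if t: "t > 0" for t
  proof -
    have "t powr p = t\<^sup>2 * t powr (p - 2)" using powr_add[of t 2 "p - 2"] t by simp
    then have "b * \<gamma> * t powr p \<le> \<alpha> * t\<^sup>2 + \<beta> * t^4"
      using mult_left_mono[OF less_imp_le[OF q[OF t]], of "t\<^sup>2"] by (simp add: qf_def algebra_simps power4_eq_xxxx power2_eq_square)
    then have "(b * \<gamma> * t powr p) * (1 / p) \<le> (\<alpha> * t\<^sup>2 + \<beta> * t^4) * (1 / p)" using p4 by (intro mult_right_mono) auto
    also have "... \<le> (\<alpha> * t\<^sup>2 + \<beta> * t^4) * (1 / 4)"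
      using p4 \<alpha> B by (intro mult_left_mono) (auto simp: field_simps)
    finally show ?thesis by (simp add: phi_def field_simps)
  qed
  define t where "t = sqrt (4 * (\<bar>M\<bar> + 1) / \<alpha>)"
  have "t > 0" "t\<^sup>2 = 4 * (\<bar>M\<bar> + 1) / \<alpha>" using \<alpha> by (auto simp: t_def)
  then have "M < phi t" using lb[of t] \<alpha> by simp
  then show ?thesis using \<open>t > 0\<close> by blast
qed

end

text \<open>The intermediate value theorem moves the Nehari constraint slightly away from \<open>(1, 0)\<close>;
  comparing with the fibre maximum at \<open>s = 0\<close> leaves only the derivative in direction \<open>s\<close>.\<close>

lemma constrained_min_derivative_nonneg:
  fixes \<alpha> \<beta> \<gamma> :: "real => real"
  assumes b0: "b \<ge> 0" and p4: "p \<ge> 4" and \<alpha>0: "\<alpha> 0 > 0" and \<gamma>0: "\<gamma> 0 \<ge> 0"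
    and der: "(\<alpha> has_real_derivative \<alpha>') (at 0)" "(\<beta> has_real_derivative \<beta>') (at 0)" "(\<gamma> has_real_derivative \<gamma>') (at 0)"
    and q: "\<alpha> 0 + \<beta> 0 - b * \<gamma> 0 = 0"
    and min: "\<And>s t. 0 < s ==> 0 < t ==> \<alpha> s + \<beta> s * t\<^sup>2 - b * \<gamma> s * t powr (p - 2) = 0 ==>
      \<alpha> 0 / 2 + \<beta> 0 / 4 - b / p * \<gamma> 0 \<le> \<alpha> s * t\<^sup>2 / 2 + \<beta> s * t^4 / 4 - b / p * \<gamma> s * t powr p"
  shows "0 \<le> \<alpha>' / 2 + \<beta>' / 4 - b / p * \<gamma>'"
proof -
  interpret f: fibre "\<alpha> 0" "\<beta> 0" "\<gamma> 0" b p by unfold_locales (use assms in auto)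
  have ct: "(\<alpha> \<longlongrightarrow> \<alpha> 0) (at 0)" "(\<beta> \<longlongrightarrow> \<beta> 0) (at 0)" "(\<gamma> \<longlongrightarrow> \<gamma> 0) (at 0)"
    using der[THEN DERIV_isCont] by (auto simp: isCont_def)
  have "\<exists>s t. 0 < s \<and> s < 1 / real (Suc n) \<and> \<bar>t - 1\<bar> \<le> 1 / real (n + 2) \<and> \<alpha> s + \<beta> s * t\<^sup>2 - b * \<gamma> s * t powr (p - 2) = 0" for n
  proof -
    \<comment> \<open>The denominator \<open>n + 2\<close> keeps \<open>d\<close> below one, so that
      \<open>1 - d\<close> is positive and the sign of \<open>qf\<close> there is known.\<close>
    define d where "d = 1 / real (n + 2)"
    have d: "0 < d" "d < 1" by (auto simp: d_def)
    define Z where "Z s t = \<alpha> s + \<beta> s * t\<^sup>2 - b * \<gamma> s * t powr (p - 2)" for s t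
    have lim: "((\<lambda>s. Z s t) \<longlongrightarrow> f.qf t) (at 0)" for t
      unfolding Z_def fqf_def by (intro tendsto_intros ct)
    have "\<forall>\<^sub>F s in at_right 0. Z s (1 - d) > 0"
      using lim[of "1 - d"] f.qf_sign(1)[OF q, of "1 - d"] d by (intro order_tendstoD) (auto simp: filterlim_at_split)
    moreover have "\<forall>\<^sub>F s in at_right 0. Z s (1 + d) < 0"
      using lim[of "1 + d"] f.qf_sign(2)[OF q, of "1 + d"] d by (intro order_tendstoD) (auto simp: filterlim_at_split)
    moreover have "\<forall>\<^sub>F s in at_right (0::real). s < 1 / real (Suc n)" by (rule eventually_at_right_real[THEN eventually_mono]) auto
    moreover have "\<forall>\<^sub>F s in at_right (0::real). 0 < s" by (simp add: eventually_at_right_less)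
    ultimately have "\<forall>\<^sub>F s in at_right 0. Z s (1 - d) > 0 \<and> Z s (1 + d) < 0 \<and> s < 1 / real (Suc n) \<and> 0 < s"
      by eventually_elim auto
    then obtain s where s: "Z s (1 - d) > 0" "Z s (1 + d) < 0" "s < 1 / real (Suc n)" "0 < s"
      using eventually_happens[of _ "at_right (0::real)"] by (auto simp: trivial_limit_at_right_real)
    have "\<exists>t\<ge>1 - d. t \<le> 1 + d \<and> Z s t = 0"
      using s d p4 unfolding Z_def by (intro IVT2') (auto intro!: continuous_intros continuous_on_powr')
    then obtain t where "1 - d \<le> t" "t \<le> 1 + d" "Z s t = 0" by blast
    then show ?thesis using s unfolding Z_def d_def by (intro exI[of _ s] exI[of _ t]) (auto simp: abs_le_iff)
  qed
  then obtain s t where st: "\<And>n. 0 < s n" "\<And>n. s n < 1 / real (Suc n)" "\<And>n. \<bar>t n - 1\<bar> \<le> 1 / real (n + 2)"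
    "\<And>n. \<alpha> (s n) + \<beta> (s n) * (t n)\<^sup>2 - b * \<gamma> (s n) * t n powr (p - 2) = 0" by metis
  have l1: "(\<lambda>n. 1 / real (Suc n)) ----> 0" using LIMSEQ_inverse_real_of_nat by (simp add: inverse_eq_divide)
  have sl: "s ----> 0" by (rule tendsto_sandwich[OF _ _ tendsto_const l1]) (use less_imp_le[OF st(1)] less_imp_le[OF st(2)] in "auto simp del: of_nat_Suc")
  have "(\<lambda>n. t n - 1) ----> 0"
    by (rule Lim_null_comparison[OF _ LIMSEQ_Suc[OF l1]]) (use st(3) in auto)
  then have tl: "t ----> 1" by (simp add: LIM_zero_iff)
  have tp: "t n > 0" for n
  proof -
    have "1 / real (n + 2) < 1" by simp
    then show ?thesis using st(3)[of n] by linarith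
  qed
  have dq: "(\<lambda>n. (h (s n) - h 0) / s n) ----> h'" if "(h has_real_derivative h') (at 0)" for h h'
  proof -
    have "((\<lambda>x. (h x - h 0) / (x - 0)) \<longlongrightarrow> h') (at 0)" using that by (simp add: has_field_derivative_iff)
    moreover have "s n \<noteq> 0" for n using st(1)[of n] by simp
    then have "filterlim s (at 0) sequentially" using sl by (simp add: filterlim_at)
    ultimately have "(\<lambda>n. (h (s n) - h 0) / (s n - 0)) ----> h'" by (rule filterlim_compose)
    then show ?thesis by simp
  qed
  let ?T = "\<lambda>n. (t n)\<^sup>2 / 2 * ((\<alpha> (s n) - \<alpha> 0) / s n) + (t n)^4 / 4 * ((\<beta> (s n) - \<beta> 0) / s n) - b / p * (t n powr p) * ((\<gamma> (s n) - \<gamma> 0) / s n)"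
  have "?T ----> 1\<^sup>2 / 2 * \<alpha>' + 1^4 / 4 * \<beta>' - b / p * (1 powr p) * \<gamma>'"
    by (intro tendsto_intros dq der tl) auto
  moreover have "0 \<le> ?T n" for n
  proof -
    have "f.phi (t n) \<le> f.phi 1" by (rule f.phi_max[OF q tp])
    also have "... = \<alpha> 0 / 2 + \<beta> 0 / 4 - b / p * \<gamma> 0" by (simp add: fphi_def)
    also have "... \<le> \<alpha> (s n) * (t n)\<^sup>2 / 2 + \<beta> (s n) * (t n)^4 / 4 - b / p * \<gamma> (s n) * t n powr p" by (rule min[OF st(1) tp st(4)])
    finally have "0 \<le> (t n)\<^sup>2 / 2 * (\<alpha> (s n) - \<alpha> 0) + (t n)^4 / 4 * (\<beta> (s n) - \<beta> 0) - b / p * (t n powr p) * (\<gamma> (s n) - \<gamma> 0)"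
      by (simp add: fphi_def algebra_simps diff_divide_distrib)
    then have "0 \<le> ((t n)\<^sup>2 / 2 * (\<alpha> (s n) - \<alpha> 0) + (t n)^4 / 4 * (\<beta> (s n) - \<beta> 0) - b / p * (t n powr p) * (\<gamma> (s n) - \<gamma> 0)) / s n"
      using st(1)[of n] by simp
    moreover have "(A * a + B * c - D * e) / r = A * (a / r) + B * (c / r) - D * (e / r)" for A a B c D e r :: real
      by (simp add: diff_divide_distrib add_divide_distrib)
    ultimately show ?thesis by (simp only:)
  qed
  ultimately have "0 \<le> 1\<^sup>2 / 2 * \<alpha>' + 1^4 / 4 * \<beta>' - b / p * (1 powr p) * \<gamma>'"
    by (intro LIMSEQ_le_const) auto
  then show ?thesis by simp
qed

section \<open>The Nehari manifold\<close>

lemma Fatou_lim: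
  fixes g :: "'a => real"
  assumes [measurable]: "g \<in> borel_measurable M"
    and F: "\<And>n::nat. integrable M (F n)" "\<And>n x. F n x \<ge> 0" "(\<lambda>n. \<integral>x. F n x \<partial>M) ----> L"
    and lim: "AE x in M. (\<lambda>n. F n x) ----> g x"
  shows "integrable M g" "(\<integral>x. g x \<partial>M) \<le> L"
proof -
  have *: "integrable M g \<and> (\<integral>x. g x \<partial>M) \<le> L + e" if e: "e > 0" for e
  proof -
    have "\<forall>\<^sub>F n in sequentially. (\<integral>x. F n x \<partial>M) < L + e" using F(3) e by (intro order_tendstoD) auto
    then obtain N where N: "\<And>n. n \<ge> N ==> (\<integral>x. F n x \<partial>M) < L + e" by (auto simp: eventually_sequentially)
    have "AE x in M. (\<lambda>n. F (n + N) x) ----> g x" using lim by eventually_elim (rule LIMSEQ_ignore_initial_segment)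
    moreover have "(\<integral>x. F (n + N) x \<partial>M) \<le> L + e" for n using N[of "n + N"] by simp
    ultimately show ?thesis using Fatou_real[of g M "\<lambda>n. F (n + N)" "L + e"] F(1,2) by auto
  qed
  show "integrable M g" using *[of 1] by simp
  show "(\<integral>x. g x \<partial>M) \<le> L" by (rule field_le_epsilon) (use * in auto)
qed

lemma AE_pair_fst_snd:
  assumes "AE x in lborel. P (x :: R2)"
  shows "AE q in lborel \<Otimes>\<^sub>M (lborel :: R2 measure). P (fst q)" "AE q in (lborel :: R2 measure) \<Otimes>\<^sub>M lborel. P (snd q)"
proof -
  obtain N where N: "{x \<in> space lborel. \<not> P x} \<subseteq> N" "N \<in> null_sets lborel" using assms by (auto elim!: AE_E simp: null_sets_def)
  have "N \<times> UNIV \<in> null_sets (lborel \<Otimes>\<^sub>M (lborel :: R2 measure))" "UNIV \<times> N \<in> null_sets ((lborel :: R2 measure) \<Otimes>\<^sub>M lborel)"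
    using N(2) by (auto simp: null_sets_def lborel.emeasure_pair_measure_Times)
  note n = this
  show "AE q in lborel \<Otimes>\<^sub>M (lborel :: R2 measure). P (fst q)" using N(1) by (intro AE_I'[OF n(1)]) auto
  show "AE q in (lborel :: R2 measure) \<Otimes>\<^sub>M lborel. P (snd q)" using N(1) by (intro AE_I'[OF n(2)]) auto
qed

text \<open>Here \<open>h\<close> may change sign; applied to differences of squares this yields
  continuity of the negative logarithmic energy.\<close>

lemma dbl_lnm_general:
  assumes h: "integrable lborel h" "h \<in> Bor" and g: "sqint g"
  shows "integrable lborel2 (\<lambda>q. lnm (dist (fst q) (snd q)) * h (fst q) * g (snd q))"
    "\<bar>dbl lnm h g\<bar> \<le> 2 * sqrt kapc * sqrt (nsq g) * (LBINT x. \<bar>h x\<bar>)"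
proof -
  note [measurable] = h(2) sqint_borel[OF g]
  have le: "\<bar>lnm (dist x y) * h x * g y\<bar> \<le> 2 * \<bar>sqrt (kap (x - y)) * h x * g y\<bar>" for x y
  proof -
    have "lnm (dist x y) * (\<bar>h x\<bar> * \<bar>g y\<bar>) \<le> 2 * sqrt (kap (x - y)) * (\<bar>h x\<bar> * \<bar>g y\<bar>)" by (intro mult_right_mono lnm_le_kap) auto
    then show ?thesis by (simp add: abs_mult lnm_nonneg kap_nonneg mult_ac)
  qed
  have i: "integrable lborel2 (\<lambda>q. 2 * \<bar>sqrt (kap (fst q - snd q)) * h (fst q) * g (snd q)\<bar>)"
    by (intro integrable_mult_right integrable_abs sqrt_kap_double(1) h g)
  show j: "integrable lborel2 (\<lambda>q. lnm (dist (fst q) (snd q)) * h (fst q) * g (snd q))"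
    by (rule L1_bound[OF i]) (use le in "auto intro!: AE_I2")
  have "\<bar>dbl lnm h g\<bar> \<le> (\<integral>q. \<bar>lnm (dist (fst q) (snd q)) * h (fst q) * g (snd q)\<bar> \<partial>lborel2)"
    unfolding dbl_def by (rule integral_abs_bound)
  also have "... \<le> (\<integral>q. 2 * \<bar>sqrt (kap (fst q - snd q)) * h (fst q) * g (snd q)\<bar> \<partial>lborel2)"
    by (intro integral_mono integrable_abs j i le)
  also have "... \<le> 2 * ((LBINT x. \<bar>h x\<bar>) * (sqrt kapc * sqrt (nsq g)))"
    using sqrt_kap_double(2)[OF h(1) g h(2)] by simp
  finally show "\<bar>dbl lnm h g\<bar> \<le> 2 * sqrt kapc * sqrt (nsq g) * (LBINT x. \<bar>h x\<bar>)" by (simp add: mult_ac)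
qed

definition nz :: "(R2 => real) => bool" where "nz u \<longleftrightarrow> \<not> (AE x in lborel. u x = 0)"

lemma nz_continuous: assumes "continuous_on UNIV f" "f x \<noteq> 0" shows "nz f"
  unfolding nz_def
proof
  assume "AE x in lborel. f x = 0"
  then have "AE x in lebesgue. x \<in> {x. f x = 0}" by (auto intro: AE_completion)
  moreover have "closed {x. f x = 0}" using assms(1) by (intro closed_Collect_eq) auto
  ultimately show False using mem_closed_if_AE_lebesgue assms(2) by blast
qed

lemma nz_scale: "nz u ==> t \<noteq> 0 ==> nz (\<lambda>x. t * u x)" by (simp add: nz_def)

lemma nz_nsq: assumes "sqint u" "nz u" shows "nsq u > 0"
proof -
  have "nsq u \<noteq> 0"
  proof
    assume "nsq u = 0"
    then have "AE x in lborel. (u x)\<^sup>2 = 0"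
      using assms(1) unfolding nsq_real sqint_real by (subst integral_nonneg_eq_0_iff_AE[symmetric]) auto
    then show False using assms(2) by (simp add: nz_def)
  qed
  then show ?thesis using nsq_nonneg[of u] by simp
qed

context planar
begin

lemma Cen_nonneg: "Cen u \<ge> 0" unfolding Cen_def by (intro integral_nonneg_AE) auto

lemma Wint_nonneg: "0 \<le> (LBINT x. W x * (u x)\<^sup>2)" using W_nonneg by (intro integral_nonneg_AE) auto

lemma Aen_bounds: assumes u: "u \<in> X" shows "nsq (gr u) \<le> Aen u" "c0 * nsq u \<le> Aen u" "(LBINT x. W x * (u x)\<^sup>2) \<le> Aen u"
proof -
  show "nsq (gr u) \<le> Aen u" "(LBINT x. W x * (u x)\<^sup>2) \<le> Aen u" using Wint_nonneg[of u] nsq_nonneg[of "gr u"] by (auto simp: Aen_def)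
  have "c0 * nsq u = (LBINT x. c0 * (u x)\<^sup>2)" by (simp add: nsq_real)
  also have "... \<le> (LBINT x. W x * (u x)\<^sup>2)"
    using XD(3,5)[OF u] W_ge by (intro integral_mono) (auto intro!: mult_right_mono)
  also have "... \<le> Aen u" using nsq_nonneg[of "gr u"] by (simp add: Aen_def)
  finally show "c0 * nsq u \<le> Aen u" .
qed

lemma Aen_pos: assumes "u \<in> X" "nz u" shows "Aen u > 0"
  using Aen_bounds(2)[OF assms(1)] nz_nsq[OF XD(1)[OF assms(1)] assms(2)] c0 by (meson less_le_trans mult_pos_pos)

lemma Aen_nonneg: "Aen u \<ge> 0" using Wint_nonneg[of u] nsq_nonneg[of "gr u"] by (simp add: Aen_def)

lemma fibreI: assumes "u \<in> X" "nz u" shows "fibre (Aen u) (Cen u) b p"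
  by unfold_locales (use b0 p4 Aen_pos[OF assms] Cen_nonneg in auto)

lemma JQ_scale: assumes u: "u \<in> X" and t: "t > 0"
  shows "J (\<lambda>x. t * u x) = fphi (Aen u) (Nen u) (Cen u) b p t"
    "Q (\<lambda>x. t * u x) = t\<^sup>2 * fqf (Aen u) (Nen u) (Cen u) b p t"
proof -
  have e: "t powr p = t\<^sup>2 * t powr (p - 2)" using powr_add[of t 2 "p - 2"] t by simp
  show "J (\<lambda>x. t * u x) = fphi (Aen u) (Nen u) (Cen u) b p t"
    unfolding J_def scale_energies(1,2)[OF u] scale_energies(3)[OF u t] fphi_def by (simp add: mult_ac)
  show "Q (\<lambda>x. t * u x) = t\<^sup>2 * fqf (Aen u) (Nen u) (Cen u) b p t"
    unfolding Q_def scale_energies(1,2)[OF u] scale_energies(3)[OF u t] fqf_def e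
    by (simp add: algebra_simps power4_eq_xxxx power2_eq_square)
qed

end

lemma quarter_sum_le: "x \<le> a ==> a \<le> s ==> y \<le> z ==> s / 4 + z = c ==> x / 4 + y \<le> c" for x a s y z c :: real
  by linarith

context planar
begin

definition NB :: "(R2 => real) set" where "NB = {u \<in> X. nz u \<and> Q u = 0}"

text \<open>Eliminating \<open>Nen\<close>, the only term without sign, leaves two nonnegative
  terms. So a bound on \<open>J\<close> bounds \<open>Aen\<close> on the constraint.\<close>

lemma J_NB: assumes "u \<in> NB" shows "J u = Aen u / 4 + b * (1/4 - 1/p) * Cen u"
proof -
  have "Nen u = b * Cen u - Aen u" using assms by (simp add: NB_def Q_def)
  then show ?thesis unfolding J_def \<open>Nen u = _\<close> using p4 by (simp add: field_simps)
qed

lemma scale_in_NB: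
  assumes u: "u \<in> X" "nz u" and t: "t > 0" "fqf (Aen u) (Nen u) (Cen u) b p t = 0"
  shows "(\<lambda>x. t * u x) \<in> NB"
  using X_scale[OF u(1), of t] nz_scale[OF u(2), of t] JQ_scale(2)[OF u(1) t(1)] t by (simp add: NB_def)

lemma kappa_nonneg: "b * (1/4 - 1/p) \<ge> 0" using b0 p4 by (intro mult_nonneg_nonneg) (auto simp: field_simps)

text \<open>The fibre function is positive at 0 and nonpositive at 1, so the ray meets the
  constraint with a factor at most one.\<close>

lemma project_NB:
  assumes u: "u \<in> X" "nz u" and q: "Q u \<le> 0"
  shows "\<exists>t. 0 < t \<and> t \<le> 1 \<and> (\<lambda>x. t * u x) \<in> NB \<and> J (\<lambda>x. t * u x) = t\<^sup>2 * Aen u / 4 + b * (1/4 - 1/p) * (t powr p * Cen u)"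
proof -
  interpret f: fibre "Aen u" "Nen u" "Cen u" b p using fibreI[OF u] .
  have "fqf (Aen u) (Nen u) (Cen u) b p 1 \<le> 0" using q by (simp add: fqf_def Q_def)
  then obtain t where t: "0 < t" "t \<le> 1" "fqf (Aen u) (Nen u) (Cen u) b p t = 0" using f.qf_zero[of 1] by auto
  have m: "(\<lambda>x. t * u x) \<in> NB" by (rule scale_in_NB[OF u t(1,3)])
  show ?thesis using t m J_NB[OF m] scale_energies(1)[OF u(1), of t] scale_energies(3)[OF u(1) t(1)] by auto
qed

lemma test_X: assumes \<phi>: "test_fun \<phi>" shows "\<phi> \<in> X"
proof (rule XI[OF sob_Ck(1)])
  show "Ck 1 \<phi>" by (rule test_fun_Ck[OF \<phi>])
  show "sqint \<phi>" by (rule test_sqint[OF \<phi>])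
  show "sqint (pdv i \<phi>)" if "i \<in> Basis" for i by (intro test_sqint test_fun_pdv \<phi> that)
  have "continuous_on UNIV lgw" unfolding lgw_def[abs_def] by (intro continuous_intros) (auto simp: add_nonneg_eq_0_iff)
  then have l: "locint lgw" by (rule locint_continuous)
  have sq: "test_fun (\<lambda>x. \<phi> x * \<phi> x)" by (intro test_fun_mult_Ck \<phi> test_fun_Ck)
  show "L1 (\<lambda>x. W x * (\<phi> x)\<^sup>2)" using locint_test[OF W_loc sq] by (simp add: power2_eq_square)
  show "L1 (\<lambda>x. lgw x * (\<phi> x)\<^sup>2)" using locint_test[OF l sq] by (simp add: power2_eq_square)
qed

text \<open>A bump concentrated on a small ball sees only distances below one, where the logarithm
  is negative. Then \<open>Nen\<close> is negative, and the fibre function is nonpositive once t^2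
  reaches -Aen / Nen.\<close>

lemma NB_nonempty: "NB \<noteq> {}"
proof -
  \<comment> \<open>The factor 8 puts the support in the ball of radius 1/8, so distances within it
    are at most 1/4 and their logarithms at most -ln 4.\<close>
  define v where "v x = \<psi> (0 + 8 *\<^sub>R x)" for x
  have tv: "test_fun v" unfolding v_def[abs_def] by (rule test_fun_affine[OF test_psi]) simp
  note v = test_X[OF tv]
  note [measurable] = XD(2)[OF v]
  have "v 0 \<noteq> 0" using psi_pos[of 0] by (simp add: v_def)
  then have nzv: "nz v" by (rule nz_continuous[OF test_fun_cont[OF tv]])
  have v0: "v x = 0" if "norm x > 1/8" for x using psi_outside[of "8 *\<^sub>R x"] that by (simp add: v_def)
  have D: "integrable lborel2 (\<lambda>q. ln (dist (fst q) (snd q)) * (v (fst q))\<^sup>2 * (v (snd q))\<^sup>2)"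
    by (rule dbl_int[OF v]) auto
  have inner: "(LBINT x. ln (dist x y) * (v x)\<^sup>2) \<le> - ln 4 * nsq v" if i: "L1 (\<lambda>x. ln (dist x y) * (v x)\<^sup>2)" and y: "norm y \<le> 1/8" for y
  proof -
    have "(LBINT x. ln (dist x y) * (v x)\<^sup>2) \<le> (LBINT x. - ln 4 * (v x)\<^sup>2)"
    proof (rule integral_mono_AE[OF i])
      show "L1 (\<lambda>x. - ln 4 * (v x)\<^sup>2)" using XD(3)[OF v] by simp
      show "AE x in lborel. ln (dist x y) * (v x)\<^sup>2 \<le> - ln 4 * (v x)\<^sup>2"
        using AE_lborel_singleton[of y]
      proof eventually_elim
        case (elim x)
        show ?case
        proof (cases "norm x \<le> 1/8")
          case True
          have d: "0 < dist x y" "dist x y \<le> 1/4" using elim True y norm_triangle_ineq4[of x y] by (auto simp: dist_norm)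
          then have "ln (dist x y) \<le> ln (1/4)" by (subst ln_le_cancel_iff) auto
          also have "ln (1/4 :: real) = - ln 4" by (simp add: ln_div)
          finally show ?thesis by (intro mult_right_mono) auto
        qed (use v0[of x] in auto)
      qed
    qed
    then show ?thesis by (simp add: nsq_real)
  qed
  have "dbl ln (sq v) (sq v) = (LBINT y. (LBINT x. ln (dist x y) * (v x)\<^sup>2) * (v y)\<^sup>2)"
    by (rule dbl_fubini(1)[OF D])
  also have "... \<le> (LBINT y. - ln 4 * nsq v * (v y)\<^sup>2)"
  proof (rule integral_mono_AE)
    show "L1 (\<lambda>y. (LBINT x. ln (dist x y) * (v x)\<^sup>2) * (v y)\<^sup>2)" by (rule dbl_fubini(4)[OF D])
    show "L1 (\<lambda>y. - ln 4 * nsq v * (v y)\<^sup>2)" using XD(3)[OF v] by simp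
    show "AE y in lborel. (LBINT x. ln (dist x y) * (v x)\<^sup>2) * (v y)\<^sup>2 \<le> - ln 4 * nsq v * (v y)\<^sup>2"
      using dbl_fubini(3)[OF D]
    proof eventually_elim
      case (elim y)
      show ?case
      proof (cases "v y = 0")
        case False
        have "norm y \<le> 1/8" using v0[of y] False by force
        have "L1 (\<lambda>x. (1 / (v y)\<^sup>2) * (ln (dist x y) * (v x)\<^sup>2 * (v y)\<^sup>2))" using elim by (rule integrable_mult_right)
        then have "L1 (\<lambda>x. ln (dist x y) * (v x)\<^sup>2)" using False by simp
        then show ?thesis using inner \<open>norm y \<le> 1/8\<close> by (intro mult_right_mono) auto
      qed simp
    qed
  qed
  also have "... = - ln 4 * nsq v * nsq v" by (simp add: nsq_real)
  also have "... < 0" using nz_nsq[OF XD(1)[OF v] nzv] by (simp add: mult_neg_pos)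
  finally have N: "Nen v < 0" by (simp add: Nen_def divide_neg_pos)
  interpret f: fibre "Aen v" "Nen v" "Cen v" b p using fibreI[OF v nzv] .
  have "\<exists>t>0. fqf (Aen v) (Nen v) (Cen v) b p t = 0"
  proof (rule ccontr)
    assume "\<not> ?thesis"
    then have n: "fqf (Aen v) (Nen v) (Cen v) b p t \<noteq> 0" if "t > 0" for t using that by auto
    define r where "r = Aen v / - Nen v"
    have r: "r > 0" unfolding r_def using N f.\<alpha> by (intro divide_pos_pos) auto
    have "fqf (Aen v) (Nen v) (Cen v) b p (sqrt r) \<le> Aen v + Nen v * r"
      unfolding fqf_def using b0 Cen_nonneg[of v] r by simp
    also have "... = 0" using N by (simp add: r_def)
    finally show False using f.qf_zero[of "sqrt r"] r n by auto
  qed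
  then show ?thesis using scale_in_NB[OF v nzv] by blast
qed

section \<open>A priori bounds and compactness of minimizing sequences\<close>

lemma energy_bounds:
  obtains K where "K \<ge> 0" "\<And>u. u \<in> X ==> nsq (sq u) \<le> K * (Aen u)\<^sup>2"
    "\<And>u. u \<in> X ==> Cen u \<le> K * Aen u powr (p / 2)"
    "\<And>u. u \<in> X ==> dbl lnm (sq u) (sq u) \<le> K * (Aen u)\<^sup>2"
proof -
  have q4: "(2::real) \<le> 4" and q2: "2 \<le> p" using p4 by auto
  obtain C4 where C4: "C4 \<ge> 0" "\<And>u G. sob u G ==> (LBINT x. \<bar>u x\<bar> powr 4) \<le> C4 * (nsq u + nsq G) powr (4 / 2)"
    using sobolev[OF q4] by metis
  obtain Cp where Cp: "Cp \<ge> 0" "\<And>u G. sob u G ==> (LBINT x. \<bar>u x\<bar> powr p) \<le> Cp * (nsq u + nsq G) powr (p / 2)"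
    using sobolev[OF q2] by metis
  \<comment> \<open>\<open>Aen\<close> bounds \<open>nsq u\<close> with factor 1/c0 and the squared
    gradient norm with factor 1; \<open>m\<close> adds the two.\<close>
  define m where "m = 1 / c0 + 1"
  have m: "m > 0" using c0 by (simp add: m_def add_pos_pos)
  have nm: "nsq u + nsq (gr u) \<le> m * Aen u" if u: "u \<in> X" for u
  proof -
    have "nsq u \<le> 1 / c0 * Aen u" using Aen_bounds(2)[OF u] c0 by (simp add: field_simps)
    then show ?thesis using Aen_bounds(1)[OF u] by (simp add: m_def distrib_right)
  qed
  define K1 where "K1 = C4 * m\<^sup>2"
  define K2 where "K2 = Cp * m powr (p / 2)"
  define K3 where "K3 = 2 * sqrt kapc * sqrt K1 * (1 / c0)"
  have K0: "K1 \<ge> 0" "K2 \<ge> 0" "K3 \<ge> 0" using C4(1) Cp(1) c0 kapc_nonneg by (auto simp: K1_def K2_def K3_def)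
  have b1: "nsq (sq u) \<le> K1 * (Aen u)\<^sup>2" if u: "u \<in> X" for u
  proof -
    have "nsq (sq u) = (LBINT x. \<bar>u x\<bar> powr 4)" by (simp add: nsq_real powr_4)
    also have "... \<le> C4 * (nsq u + nsq (gr u)) powr (4 / 2)" by (rule C4(2)[OF X_sob[OF u]])
    also have "(nsq u + nsq (gr u)) powr (4 / 2) \<le> (m * Aen u) powr (4 / 2)"
      using nm[OF u] nsq_nonneg[of u] nsq_nonneg[of "gr u"] by (intro powr_mono2) auto
    also have "(m * Aen u) powr (4 / 2) = m\<^sup>2 * (Aen u)\<^sup>2" using m Aen_nonneg[of u] by (simp add: powr_numeral power_mult_distrib)
    finally show ?thesis using C4(1) by (simp add: K1_def mult_left_mono mult.assoc)
  qed
  have b2: "Cen u \<le> K2 * Aen u powr (p / 2)" if u: "u \<in> X" for u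
  proof -
    have "Cen u \<le> Cp * (nsq u + nsq (gr u)) powr (p / 2)" unfolding Cen_def by (rule Cp(2)[OF X_sob[OF u]])
    also have "... \<le> Cp * (m * Aen u) powr (p / 2)"
      using nm[OF u] nsq_nonneg[of u] nsq_nonneg[of "gr u"] Cp(1) p4 by (intro mult_left_mono powr_mono2) auto
    also have "(m * Aen u) powr (p / 2) = m powr (p / 2) * Aen u powr (p / 2)" using m Aen_nonneg[of u] by (simp add: powr_mult)
    finally show ?thesis by (simp add: K2_def mult.assoc)
  qed
  have b3: "dbl lnm (sq u) (sq u) \<le> K3 * (Aen u)\<^sup>2" if u: "u \<in> X" for u
  proof -
    have "dbl lnm (sq u) (sq u) \<le> 2 * sqrt kapc * sqrt (nsq (sq u)) * (LBINT x. (u x)\<^sup>2)"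
      by (rule dbl_lnm_bound[OF X_adm1[OF u]])
    also have "... \<le> 2 * sqrt kapc * (sqrt K1 * Aen u) * (1 / c0 * Aen u)"
    proof (intro mult_mono mult_left_mono)
      have "sqrt (nsq (sq u)) \<le> sqrt (K1 * (Aen u)\<^sup>2)" using b1[OF u] by simp
      then show "sqrt (nsq (sq u)) \<le> sqrt K1 * Aen u" using Aen_nonneg[of u] by (simp add: real_sqrt_mult)
      show "(LBINT x. (u x)\<^sup>2) \<le> 1 / c0 * Aen u" using Aen_bounds(2)[OF u] c0 by (simp add: nsq_real field_simps)
    qed (use kapc_nonneg K0 Aen_nonneg[of u] in "auto simp: nsq_nonneg")
    also have "... = K3 * (Aen u)\<^sup>2" by (simp add: K3_def power2_eq_square)
    finally show ?thesis .
  qed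
  define K where "K = K1 + K2 + K3"
  have le: "K1 \<le> K" "K2 \<le> K" "K3 \<le> K" "0 \<le> K" using K0 by (auto simp: K_def)
  show ?thesis
  proof (rule that[OF le(4)])
    fix u assume u: "u \<in> X"
    show "nsq (sq u) \<le> K * (Aen u)\<^sup>2" using b1[OF u] mult_right_mono[OF le(1), of "(Aen u)\<^sup>2"] by simp
    show "Cen u \<le> K * Aen u powr (p / 2)" using b2[OF u] mult_right_mono[OF le(2), of "Aen u powr (p / 2)"] by simp
    show "dbl lnm (sq u) (sq u) \<le> K * (Aen u)\<^sup>2" using b3[OF u] mult_right_mono[OF le(3), of "(Aen u)\<^sup>2"] by simp
  qed
qed

lemma dbl_lnp_nonneg: "0 \<le> dbl lnp (sq u) (sq u)"
  unfolding dbl_def by (intro integral_nonneg_AE) (auto simp: lnp_nonneg)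

text \<open>On the constraint \<open>Aen\<close> equals \<open>b * Cen - Nen\<close>. For
  \<open>Aen \<le> 1\<close> the right side is at most a constant times the square of
  \<open>Aen\<close>, because p/2 \<ge> 2; dividing by \<open>Aen\<close> gives the lower bound. It
  prevents minimizing sequences from converging to zero.\<close>

lemma NB_lower_bound: obtains a where "a > 0" "\<And>u. u \<in> NB ==> a \<le> Aen u"
proof -
  obtain K where K: "K \<ge> 0" "\<And>u. u \<in> X ==> Cen u \<le> K * Aen u powr (p / 2)"
    "\<And>u. u \<in> X ==> dbl lnm (sq u) (sq u) \<le> K * (Aen u)\<^sup>2" using energy_bounds by metis
  define L where "L = K / (2 * pi) + b * K + 1"
  have L: "L \<ge> 1" using K b0 by (simp add: L_def)
  have "1 / L \<le> Aen u" if u: "u \<in> NB" for u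
  proof (cases "Aen u \<le> 1")
    case True
    have uX: "u \<in> X" "nz u" "Q u = 0" using u by (auto simp: NB_def)
    have A: "Aen u > 0" by (rule Aen_pos[OF uX(1,2)])
    have "Aen u = b * Cen u - Nen u" using uX(3) by (simp add: Q_def)
    also have "... \<le> b * Cen u + dbl lnm (sq u) (sq u) / (2 * pi)"
      using dbl_lnp_nonneg[of u] by (simp add: Nen_split[OF uX(1)] diff_divide_distrib)
    also have "... \<le> b * (K * (Aen u)\<^sup>2) + K * (Aen u)\<^sup>2 / (2 * pi)"
    proof (intro add_mono mult_left_mono divide_right_mono K(3) uX b0)
      have "Aen u powr (p / 2) \<le> Aen u powr 2" using A True p4 by (intro powr_mono') auto
      then have "Aen u powr (p / 2) \<le> (Aen u)\<^sup>2" using A by simp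
      then show "Cen u \<le> K * (Aen u)\<^sup>2" using K(2)[OF uX(1)] mult_left_mono[of _ _ K] K(1) by fastforce
    qed auto
    also have "... \<le> L * (Aen u)\<^sup>2" by (simp add: L_def algebra_simps)
    finally have "Aen u * 1 \<le> Aen u * (L * Aen u)" by (simp add: power2_eq_square mult_ac)
    then have "1 \<le> L * Aen u" using A by simp
    then show ?thesis using L by (simp add: field_simps)
  next
    case False
    have "1 / L \<le> 1" using L by simp
    then show ?thesis using False by linarith
  qed
  then show ?thesis using that[of "1 / L"] L by simp
qed

text \<open>Where \<open>W\<close> exceeds \<open>L\<close>, u^2 is at most W u^2 / L, small by the
  energy bound. The part of the sublevel set outside the ball has measure tending to zero, and there
  Cauchy-Schwarz with the L4 bound gives smallness uniformly in \<open>n\<close>.\<close>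

lemma X_tail:
  assumes U: "\<And>n::nat. U n \<in> X" and M: "\<And>n. Aen (U n) \<le> M" and e: "e > 0"
  shows "\<exists>r. \<forall>n. (LBINT x. indicator (- cball 0 r) x * (U n x)\<^sup>2) \<le> e"
proof -
  obtain K where K: "K \<ge> 0" "\<And>u. u \<in> X ==> nsq (sq u) \<le> K * (Aen u)\<^sup>2" using energy_bounds by metis
  have M0: "M \<ge> 0" using M[of 0] Aen_nonneg[of "U 0"] by linarith
  \<comment> \<open>Chosen so that M / L \<le> e / 2; the summand 1 keeps it positive when
    \<open>M\<close> is zero.\<close>
  define L where "L = 2 * M / e + 1"
  have L: "L > 0" using M0 e by (simp add: L_def add_nonneg_pos)
  define A where "A r = {x. W x \<le> L} - cball 0 (real r)" for r :: nat
  have [measurable]: "{x. W x \<le> L} \<in> sets borel" by measurable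
  have Am [measurable]: "A r \<in> sets borel" for r unfolding A_def by measurable
  have Af: "emeasure lborel (A r) < \<infinity>" for r
    by (rule le_less_trans[OF emeasure_mono W_fin[of L]]) (auto simp: A_def)
  have "(\<lambda>r. measure lborel (A r)) ----> measure lborel (\<Inter>r. A r)"
  proof (rule Lim_measure_decseq)
    show "emeasure lborel (A r) \<noteq> \<infinity>" for r using Af[of r] by simp
  qed (auto simp: decseq_def A_def)
  moreover have "(\<Inter>r. A r) = {}"
  proof -
    have "\<exists>r. x \<notin> A r" for x using real_arch_simple[of "norm x"] by (auto simp: A_def)
    then show ?thesis by blast
  qed
  ultimately have Al: "(\<lambda>r. measure lborel (A r)) ----> 0" by simp
  have "(\<lambda>r. sqrt (measure lborel (A r)) * (sqrt K * M)) ----> sqrt 0 * (sqrt K * M)" by (intro tendsto_intros Al)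
  then have "\<forall>\<^sub>F r in sequentially. sqrt (measure lborel (A r)) * (sqrt K * M) < e / 2" using e by (intro order_tendstoD) auto
  then obtain r where r: "sqrt (measure lborel (A r)) * (sqrt K * M) < e / 2" by (auto simp: eventually_sequentially)
  have "(LBINT x. indicator (- cball 0 (real r)) x * (U n x)\<^sup>2) \<le> e" for n
  proof -
    note [measurable] = XD(2)[OF U]
    have sA: "sqint (indicator (A r) :: R2 => real)" "nsq (indicator (A r) :: R2 => real) = measure lborel (A r)"
    proof -
      have "(\<lambda>x. (indicator (A r) x :: real)\<^sup>2) = indicator (A r)" by (auto simp: indicator_def)
      then show "sqint (indicator (A r) :: R2 => real)" "nsq (indicator (A r) :: R2 => real) = measure lborel (A r)"
        using Af[of r] by (auto simp: sqint_real nsq_real)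
    qed
    have i2: "L1 (\<lambda>x. indicator (A r) x * (U n x)\<^sup>2)" by (rule sqint_prod(1)[OF sA(1) X_sq_sqint[OF U]])
    have "(LBINT x. indicator (- cball 0 (real r)) x * (U n x)\<^sup>2) \<le> (LBINT x. (1 / L) * (W x * (U n x)\<^sup>2) + indicator (A r) x * (U n x)\<^sup>2)"
    proof (rule integral_mono)
      show "L1 (\<lambda>x. indicator (- cball 0 (real r)) x * (U n x)\<^sup>2)"
        using integrable_mult_indicator[of "- cball 0 (real r)" lborel "\<lambda>x. (U n x)\<^sup>2"] XD(3)[OF U] by simp
      show "L1 (\<lambda>x. (1 / L) * (W x * (U n x)\<^sup>2) + indicator (A r) x * (U n x)\<^sup>2)" using XD(5)[OF U] i2 by simp
      fix x :: R2
      have w0: "0 \<le> (1 / L) * (W x * (U n x)\<^sup>2)" using L W_nonneg by simp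
      have "(U n x)\<^sup>2 \<le> (1 / L) * (W x * (U n x)\<^sup>2)" if "\<not> W x \<le> L"
      proof -
        have "L * (U n x)\<^sup>2 \<le> W x * (U n x)\<^sup>2" using that by (intro mult_right_mono) auto
        then show ?thesis using L by (simp add: field_simps)
      qed
      then show "indicator (- cball 0 (real r)) x * (U n x)\<^sup>2 \<le> (1 / L) * (W x * (U n x)\<^sup>2) + indicator (A r) x * (U n x)\<^sup>2"
        using w0 by (cases "x \<in> cball 0 (real r)"; cases "W x \<le> L") (auto simp: indicator_def A_def)
    qed
    also have "... = (1 / L) * (LBINT x. W x * (U n x)\<^sup>2) + (LBINT x. indicator (A r) x * (U n x)\<^sup>2)"
      using XD(5)[OF U] i2 by simp
    also have "... \<le> (1 / L) * M + sqrt (measure lborel (A r)) * (sqrt K * M)"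
    proof (intro add_mono mult_left_mono)
      show "(LBINT x. W x * (U n x)\<^sup>2) \<le> M" using Aen_bounds(3)[OF U] M order_trans by blast
      have "(LBINT x. indicator (A r) x * (U n x)\<^sup>2) \<le> sqrt (measure lborel (A r)) * sqrt (nsq (sq (U n)))"
        using sqint_prod(2)[OF sA(1) X_sq_sqint[OF U, of n]] sA(2) by (simp add: abs_le_iff)
      also have "... \<le> sqrt (measure lborel (A r)) * (sqrt K * M)"
      proof (intro mult_left_mono)
        have "nsq (sq (U n)) \<le> K * M\<^sup>2"
          using K(2)[OF U, of n] mult_left_mono[OF power_mono[OF M[of n] Aen_nonneg, of 2] K(1)] by linarith
        then have "sqrt (nsq (sq (U n))) \<le> sqrt (K * M\<^sup>2)" by simp
        then show "sqrt (nsq (sq (U n))) \<le> sqrt K * M" using M0 by (simp add: real_sqrt_mult)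
      qed simp
      finally show "(LBINT x. indicator (A r) x * (U n x)\<^sup>2) \<le> sqrt (measure lborel (A r)) * (sqrt K * M)" .
    qed (use L in auto)
    also have "(1 / L) * M \<le> e / 2"
    proof -
      have "2 * M \<le> e * L" using e by (simp add: L_def field_simps)
      then show ?thesis using L by (simp add: field_simps)
    qed
    finally show ?thesis using r by simp
  qed
  then show ?thesis by blast
qed

lemma int_abs_sq_diff:
  assumes u: "sqint u" and v: "sqint v"
  shows "L1 (\<lambda>x. (u x)\<^sup>2 - (v x)\<^sup>2 :: real)" "(LBINT x. \<bar>(u x)\<^sup>2 - (v x)\<^sup>2\<bar>) \<le> sqrt (dsq u v) * sqrt (nsq (\<lambda>x. u x + v x))"
proof -
  have e: "(u x)\<^sup>2 - (v x)\<^sup>2 = (u x - v x) * (u x + v x)" for x by (simp add: power2_eq_square algebra_simps)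
  show "L1 (\<lambda>x. (u x)\<^sup>2 - (v x)\<^sup>2)" "(LBINT x. \<bar>(u x)\<^sup>2 - (v x)\<^sup>2\<bar>) \<le> sqrt (dsq u v) * sqrt (nsq (\<lambda>x. u x + v x))"
    unfolding e using sqint_prod[OF sqint_diff(1)[OF u v] sqint_add(1)[OF u v]] by auto
qed

text \<open>By symmetry the difference of two energies is the difference \<open>d n\<close> of the
  squares paired with each of the squares. \<open>d n\<close> tends to 0 in L1, and the squares are
  bounded in L2.\<close>

lemma lnm_energy_tendsto:
  assumes U: "\<And>n::nat. sqint (U n)" "\<And>n. sqint (sq (U n))" "\<And>n. nsq (sq (U n)) \<le> M" "\<And>n. nsq (U n) \<le> M"
    and u: "sqint u" "sqint (sq u)" and lim: "(\<lambda>n. dsq (U n) u) ----> 0"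
  shows "(\<lambda>n. dbl lnm (sq (U n)) (sq (U n))) ----> dbl lnm (sq u) (sq u)"
proof -
  note [measurable] = sqint_borel[OF U(1)] sqint_borel[OF u(1)]
  have M0: "M \<ge> 0" using U(4)[of 0] nsq_nonneg[of "U 0"] by linarith
  define d where "d n x = (U n x)\<^sup>2 - (u x)\<^sup>2" for n x
  have [measurable]: "d n \<in> Bor" for n unfolding d_def[abs_def] by measurable
  have di: "L1 (d n)" for n unfolding d_def[abs_def] by (rule int_abs_sq_diff(1)[OF U(1) u(1)])
  have ui: "L1 (sq u)" using u(1) by (simp add: sqint_real)
  define S where "S = 2 * M + 2 * nsq u"
  have db: "(LBINT x. \<bar>d n x\<bar>) \<le> sqrt (dsq (U n) u) * sqrt S" for n
  proof -
    have "nsq (\<lambda>x. U n x + u x) \<le> S" using sqint_add(2)[OF U(1) u(1), of n] U(4)[of n] by (simp add: S_def)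
    then show ?thesis unfolding d_def using int_abs_sq_diff(2)[OF U(1) u(1), of n]
      by (smt (verit) mult_left_mono nsq_nonneg real_sqrt_ge_zero real_sqrt_le_iff)
  qed
  have sd: "sqint (d n)" for n unfolding d_def[abs_def] by (rule sqint_diff(1)[OF U(2) u(2)])
  have e: "dbl lnm (sq (U n)) (sq (U n)) - dbl lnm (sq u) (sq u) = dbl lnm (d n) (sq (U n)) + dbl lnm (d n) (sq u)" for n
  proof -
    have Ui: "L1 (sq (U n))" using U(1) by (simp add: sqint_real)
    have c: "dbl lnm (d n) (sq u) = dbl lnm (sq u) (d n)" by (rule dbl_commute) measurable
    have i1: "integrable lborel2 (\<lambda>q. lnm (dist (fst q) (snd q)) * (U n (fst q))\<^sup>2 * (U n (snd q))\<^sup>2)"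
      by (rule dbl_lnm_general(1)[OF Ui _ U(2)]) measurable
    have i2: "integrable lborel2 (\<lambda>q. lnm (dist (fst q) (snd q)) * (u (fst q))\<^sup>2 * (u (snd q))\<^sup>2)"
      by (rule dbl_lnm_general(1)[OF ui _ u(2)]) measurable
    have i3: "integrable lborel2 (\<lambda>q. lnm (dist (fst q) (snd q)) * d n (fst q) * (U n (snd q))\<^sup>2)"
      by (rule dbl_lnm_general(1)[OF di _ U(2)]) measurable
    have i4: "integrable lborel2 (\<lambda>q. lnm (dist (fst q) (snd q)) * (u (fst q))\<^sup>2 * d n (snd q))"
      by (rule dbl_lnm_general(1)[OF ui _ sd]) measurable
    show ?thesis unfolding c unfolding dbl_def
      using i1 i2 i3 i4
      by (subst Bochner_Integration.integral_diff[symmetric], simp, simp, subst Bochner_Integration.integral_add[symmetric])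
         (auto simp: d_def algebra_simps)
  qed
  have "(\<lambda>n. dbl lnm (sq (U n)) (sq (U n)) - dbl lnm (sq u) (sq u)) ----> 0"
  proof (rule Lim_null_comparison)
    define T where "T = 2 * sqrt kapc * (sqrt M + sqrt (nsq (sq u)))"
    have T0: "T \<ge> 0" using M0 kapc_nonneg by (simp add: T_def nsq_nonneg)
    show "\<forall>\<^sub>F n in sequentially. norm (dbl lnm (sq (U n)) (sq (U n)) - dbl lnm (sq u) (sq u)) \<le> T * (sqrt (dsq (U n) u) * sqrt S)"
    proof (rule always_eventually, rule allI)
      fix n
      define I0 where "I0 = (LBINT x. \<bar>d n x\<bar>)"
      have I0: "I0 \<ge> 0" unfolding I0_def by simp
      have 1: "\<bar>dbl lnm (d n) (sq (U n))\<bar> \<le> 2 * sqrt kapc * sqrt (nsq (sq (U n))) * I0"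
        unfolding I0_def by (rule dbl_lnm_general(2)[OF di _ U(2)]) measurable
      have 2: "\<bar>dbl lnm (d n) (sq u)\<bar> \<le> 2 * sqrt kapc * sqrt (nsq (sq u)) * I0"
        unfolding I0_def by (rule dbl_lnm_general(2)[OF di _ u(2)]) measurable
      have 3: "2 * sqrt kapc * sqrt (nsq (sq (U n))) * I0 \<le> 2 * sqrt kapc * sqrt M * I0"
        using U(3)[of n] kapc_nonneg I0 by (intro mult_right_mono mult_left_mono) auto
      have "norm (dbl lnm (sq (U n)) (sq (U n)) - dbl lnm (sq u) (sq u)) \<le> T * I0"
        unfolding e T_def real_norm_def using 1 2 3 by (simp add: algebra_simps)
      also have "... \<le> T * (sqrt (dsq (U n) u) * sqrt S)" unfolding I0_def by (rule mult_left_mono[OF db T0])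
      finally show "norm (dbl lnm (sq (U n)) (sq (U n)) - dbl lnm (sq u) (sq u)) \<le> T * (sqrt (dsq (U n) u) * sqrt S)" .
    qed
    have "(\<lambda>n. T * (sqrt (dsq (U n) u) * sqrt S)) ----> T * (sqrt 0 * sqrt S)" by (intro tendsto_intros lim)
    then show "(\<lambda>n. T * (sqrt (dsq (U n) u) * sqrt S)) ----> 0" by simp
  qed
  then show ?thesis by (simp add: LIM_zero_iff)
qed

text \<open>The mean value bound for the power and Cauchy-Schwarz reduce the difference to the L2
  distance, with a factor involving the exponent 2p - 2 that the Sobolev inequality bounds
  uniformly.\<close>

lemma Cen_tendsto:
  assumes U: "\<And>n::nat. sob (U n) (G n)" "\<And>n. nsq (U n) + nsq (G n) \<le> M" and u: "sob u H" and lim: "(\<lambda>n. dsq (U n) u) ----> 0"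
  shows "(\<lambda>n. Cen (U n)) ----> Cen u"
proof -
  note [measurable] = sqint_borel[OF sobD(1)[OF U(1)]] sqint_borel[OF sobD(1)[OF u]]
  have p: "p \<ge> 2" "2 * p - 2 \<ge> 2" using p4 by auto
  have M0: "M \<ge> 0" using U(2)[of 0] nsq_nonneg[of "U 0"] nsq_nonneg[of "G 0"] by linarith
  obtain C where C: "C \<ge> 0" "\<And>u G. sob u G ==> L1 (\<lambda>x. \<bar>u x\<bar> powr (2 * p - 2))"
    "\<And>u G. sob u G ==> (LBINT x. \<bar>u x\<bar> powr (2 * p - 2)) \<le> C * (nsq u + nsq G) powr ((2 * p - 2) / 2)" using sobolev[OF p(2)] by metis
  obtain C' where C': "\<And>u G. sob u G ==> L1 (\<lambda>x. \<bar>u x\<bar> powr p)" using sobolev[OF p(1)] by metis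
  have sq: "(\<bar>a\<bar> powr (p - 1))\<^sup>2 = \<bar>a\<bar> powr (2 * p - 2)" for a :: real
    by (simp add: power2_eq_square powr_add[symmetric])
  define B where "B = sqrt (C * M powr (p - 1)) + sqrt (LBINT x. \<bar>u x\<bar> powr (2 * p - 2))"
  have s: "sqint (\<lambda>x. \<bar>w x\<bar> powr (p - 1))" "nsq (\<lambda>x. \<bar>w x\<bar> powr (p - 1)) = (LBINT x. \<bar>w x\<bar> powr (2 * p - 2))" if w: "sob w F" for w F
    using C(2)[OF w] sqint_borel[OF sobD(1)[OF w]] by (auto simp: sqint_real nsq_real sq)
  have "(\<lambda>n. Cen (U n) - Cen u) ----> 0"
  proof (rule Lim_null_comparison)
    show "\<forall>\<^sub>F n in sequentially. norm (Cen (U n) - Cen u) \<le> p * (B * sqrt (dsq (U n) u))"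
    proof (rule always_eventually, rule allI)
      fix n
      have Us: "nsq (\<lambda>x. \<bar>U n x\<bar> powr (p - 1)) \<le> C * M powr (p - 1)"
      proof -
        have "nsq (\<lambda>x. \<bar>U n x\<bar> powr (p - 1)) \<le> C * (nsq (U n) + nsq (G n)) powr ((2 * p - 2) / 2)" unfolding s(2)[OF U(1)] by (rule C(3)[OF U(1)])
        also have "(2 * p - 2) / 2 = p - 1" by (simp add: field_simps)
        also have "C * (nsq (U n) + nsq (G n)) powr (p - 1) \<le> C * M powr (p - 1)"
          using U(2)[of n] C(1) p nsq_nonneg[of "U n"] nsq_nonneg[of "G n"] by (intro mult_left_mono powr_mono2) auto
        finally show ?thesis .
      qed
      have ds: "sqint (\<lambda>x. U n x - u x)" by (rule sqint_diff(1)[OF sobD(1)[OF U(1)] sobD(1)[OF u]])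
      note P1 = sqint_prod[OF s(1)[OF U(1)[of n]] ds] and P2 = sqint_prod[OF s(1)[OF u] ds]
      have "Cen (U n) - Cen u = (LBINT x. \<bar>U n x\<bar> powr p - \<bar>u x\<bar> powr p)"
        unfolding Cen_def using C'[OF U(1)] C'[OF u] by simp
      also have "\<bar>...\<bar> \<le> (LBINT x. \<bar>\<bar>U n x\<bar> powr p - \<bar>u x\<bar> powr p\<bar>)" by (rule integral_abs_bound)
      also have "... \<le> (LBINT x. p * (\<bar>\<bar>U n x\<bar> powr (p - 1) * (U n x - u x)\<bar> + \<bar>\<bar>u x\<bar> powr (p - 1) * (U n x - u x)\<bar>))"
      proof (rule integral_mono)
        show "L1 (\<lambda>x. \<bar>\<bar>U n x\<bar> powr p - \<bar>u x\<bar> powr p\<bar>)"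
          by (intro integrable_abs L1_diff C'[OF U(1)] C'[OF u])
        show "L1 (\<lambda>x. p * (\<bar>\<bar>U n x\<bar> powr (p - 1) * (U n x - u x)\<bar> + \<bar>\<bar>u x\<bar> powr (p - 1) * (U n x - u x)\<bar>))"
          by (intro integrable_mult_right L1_add integrable_abs P1 P2)
        show "\<bar>\<bar>U n x\<bar> powr p - \<bar>u x\<bar> powr p\<bar> \<le> p * (\<bar>\<bar>U n x\<bar> powr (p - 1) * (U n x - u x)\<bar> + \<bar>\<bar>u x\<bar> powr (p - 1) * (U n x - u x)\<bar>)" for x
          using abs_powr_diff_le[OF p(1), of "U n x" "u x"] unfolding abs_mult distrib_left distrib_right by (simp add: mult.assoc)
      qed
      also have "... = p * ((LBINT x. \<bar>\<bar>U n x\<bar> powr (p - 1) * (U n x - u x)\<bar>) + (LBINT x. \<bar>\<bar>u x\<bar> powr (p - 1) * (U n x - u x)\<bar>))"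
        using integrable_abs[OF P1(1)] integrable_abs[OF P2(1)] by simp
      also have "... \<le> p * (sqrt (C * M powr (p - 1)) * sqrt (dsq (U n) u) + sqrt (LBINT x. \<bar>u x\<bar> powr (2 * p - 2)) * sqrt (dsq (U n) u))"
      proof (intro mult_left_mono add_mono)
        have "sqrt (nsq (\<lambda>x. \<bar>U n x\<bar> powr (p - 1))) \<le> sqrt (C * M powr (p - 1))" using Us by simp
        from mult_right_mono[OF this, of "sqrt (dsq (U n) u)"]
        show "(LBINT x. \<bar>\<bar>U n x\<bar> powr (p - 1) * (U n x - u x)\<bar>) \<le> sqrt (C * M powr (p - 1)) * sqrt (dsq (U n) u)"
          using P1(3) by (simp add: nsq_nonneg)
        show "(LBINT x. \<bar>\<bar>u x\<bar> powr (p - 1) * (U n x - u x)\<bar>) \<le> sqrt (LBINT x. \<bar>u x\<bar> powr (2 * p - 2)) * sqrt (dsq (U n) u)"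
          using P2(3) unfolding s(2)[OF u] .
      qed (use p in auto)
      finally show "norm (Cen (U n) - Cen u) \<le> p * (B * sqrt (dsq (U n) u))" by (simp add: B_def algebra_simps)
    qed
    have "(\<lambda>n. p * (B * sqrt (dsq (U n) u))) ----> p * (B * sqrt 0)" by (intro tendsto_intros lim)
    then show "(\<lambda>n. p * (B * sqrt (dsq (U n) u))) ----> 0" by simp
  qed
  then show ?thesis by (simp add: LIM_zero_iff)
qed

text \<open>The bound on \<open>J\<close> controls \<open>Aen\<close> but not the logarithmic
  weight, so compactness is used in L2 only; the limit is shown to lie in \<open>X\<close>
  afterwards and is then scaled back to the constraint.\<close>

lemma NB_minimizer_exists: "\<exists>u\<in>NB. \<forall>w\<in>NB. J u \<le> J w"
proof -
  define c where "c = (INF u\<in>NB. J u)"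
  have Jnn: "J u \<ge> 0" if "u \<in> NB" for u
    unfolding J_NB[OF that] using Aen_nonneg[of u] Cen_nonneg[of u] kappa_nonneg by simp
  have bdd: "bdd_below (J ` NB)" using Jnn by (intro bdd_belowI[of _ 0]) auto
  have cle: "c \<le> J w" if "w \<in> NB" for w unfolding c_def by (rule cINF_lower[OF bdd that])
  have "\<exists>u\<in>NB. J u < c + 1 / real (Suc n)" for n
  proof (rule ccontr)
    assume "\<not> ?thesis"
    then have "c + 1 / real (Suc n) \<le> c" unfolding c_def by (intro cINF_greatest[OF NB_nonempty]) (auto simp: not_less)
    then show False by simp
  qed
  then obtain U0 where U0: "\<And>n. U0 n \<in> NB" "\<And>n. J (U0 n) < c + 1 / real (Suc n)" by metis
  have U0X: "U0 n \<in> X" for n using U0(1) by (simp add: NB_def)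
  \<comment> \<open>On the constraint \<open>J\<close> is at least \<open>Aen / 4\<close>, and the
    minimizing sequence has \<open>J\<close> below c + 1.\<close>
  define M where "M = 4 * (c + 1)"
  have AM: "Aen (U0 n) \<le> M" for n
  proof -
    define k where "k = b * (1/4 - 1/p) * Cen (U0 n)"
    have "0 \<le> k" unfolding k_def using kappa_nonneg Cen_nonneg by (rule mult_nonneg_nonneg)
    moreover have "J (U0 n) < c + 1" by (rule less_le_trans[OF U0(2)]) simp
    ultimately have "Aen (U0 n) / 4 + 0 \<le> c + 1" unfolding J_NB[OF U0(1)] k_def[symmetric]
      by (meson add_left_mono less_imp_le order_trans)
    then show ?thesis by (simp add: M_def)
  qed
  have M0: "M \<ge> 0" using AM[of 0] Aen_nonneg[of "U0 0"] by linarith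
  define M' where "M' = M + M / c0"
  have nb: "nsq (U0 n) \<le> M'" "nsq (gr (U0 n)) \<le> M'" "nsq (U0 n) + nsq (gr (U0 n)) \<le> M'" for n
  proof -
    have 1: "nsq (U0 n) \<le> M / c0" using Aen_bounds(2)[OF U0X, of n] AM[of n] c0 by (simp add: field_simps)
    have 2: "nsq (gr (U0 n)) \<le> M" using Aen_bounds(1)[OF U0X, of n] AM[of n] by linarith
    show "nsq (U0 n) \<le> M'" "nsq (gr (U0 n)) \<le> M'" "nsq (U0 n) + nsq (gr (U0 n)) \<le> M'"
      using 1 2 nsq_nonneg[of "U0 n"] nsq_nonneg[of "gr (U0 n)"] by (auto simp: M'_def)
  qed
  obtain k1 u where k1: "strict_mono (k1 :: nat => nat)" and us: "sqint u" and l1: "(\<lambda>n. nsq (\<lambda>x. U0 (k1 n) x - u x)) ----> 0"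
  proof (rule sob_compact[OF X_sob[OF U0X] nb(1,2)])
    show "\<exists>r. \<forall>n. (LBINT x. indicator (- cball 0 r) x * (U0 n x)\<^sup>2) \<le> e" if "e > 0" for e
      by (rule X_tail[OF U0X AM that])
  qed
  obtain k2 where k2: "strict_mono (k2 :: nat => nat)" "AE x in lborel. (\<lambda>n. U0 (k1 (k2 n)) x) ----> u x"
    by (rule sqint_conv_AE_subseq[of "\<lambda>n. U0 (k1 n)", OF XD(1)[OF U0X] us l1])
  obtain K where K: "K \<ge> 0" "\<And>u. u \<in> X ==> nsq (sq u) \<le> K * (Aen u)\<^sup>2" "\<And>u. u \<in> X ==> Cen u \<le> K * Aen u powr (p / 2)"
    "\<And>u. u \<in> X ==> dbl lnm (sq u) (sq u) \<le> K * (Aen u)\<^sup>2" using energy_bounds by metis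
  define N1 where "N1 v = dbl lnp (sq v) (sq v)" for v
  define N2 where "N2 v = dbl lnm (sq v) (sq v)" for v
  define Wi where "Wi v = (LBINT x. W x * (v x)\<^sup>2)" for v
  define B where "B = M + (K * M\<^sup>2 + 2 * pi * (b * (K * M powr (p / 2))))"
  \<comment> \<open>Three bounded quantities, indexed by \<open>i\<close>, are made to converge
    along one subsequence: gradient norm, potential term and positive logarithmic energy. For these
    only lower semicontinuity is used below; the bound on the third comes from the
    constraint.\<close>
  define f where "f n i = (if i = (0::nat) then nsq (gr (U0 (k1 (k2 n)))) else if i = 1 then Wi (U0 (k1 (k2 n))) else N1 (U0 (k1 (k2 n))))" for n i
  have B0: "0 \<le> K * M\<^sup>2" "0 \<le> 2 * pi * (b * (K * M powr (p / 2)))" using K(1) b0 by auto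
  have QN: "Aen (U0 n) + (N1 (U0 n) - N2 (U0 n)) / (2 * pi) - b * Cen (U0 n) = 0" for n
    using U0(1)[of n] Nen_split[OF U0X, of n] by (simp add: NB_def Q_def N1_def N2_def)
  have N1b: "N1 (U0 n) \<le> K * M\<^sup>2 + 2 * pi * (b * (K * M powr (p / 2)))" for n
  proof -
    have "N1 (U0 n) = N2 (U0 n) + 2 * pi * (b * Cen (U0 n)) - 2 * pi * Aen (U0 n)"
      using QN[of n] by (simp add: field_simps)
    moreover have "0 \<le> 2 * pi * Aen (U0 n)" using Aen_nonneg by simp
    moreover have "N2 (U0 n) \<le> K * M\<^sup>2"
      using K(4)[OF U0X, of n] mult_left_mono[OF power_mono[OF AM[of n] Aen_nonneg, of 2] K(1)] unfolding N2_def by linarith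
    moreover have "Cen (U0 n) \<le> K * M powr (p / 2)"
      using K(3)[OF U0X, of n] mult_left_mono[OF powr_mono2[OF _ Aen_nonneg AM[of n], of "p/2"] K(1)] p4 by simp
    then have "2 * pi * (b * Cen (U0 n)) \<le> 2 * pi * (b * (K * M powr (p / 2)))" using b0 by (intro mult_left_mono) auto
    ultimately show ?thesis by linarith
  qed
  have fb: "norm (f n i) \<le> B" for n i
  proof -
    have "nsq (gr (U0 m)) \<le> M" "Wi (U0 m) \<le> M" for m
      using Aen_bounds(1,3)[OF U0X, of m] AM[of m] by (auto simp: Wi_def)
    moreover have "0 \<le> Wi v" for v unfolding Wi_def by (rule Wint_nonneg)
    moreover have "0 \<le> N1 v" for v unfolding N1_def by (rule dbl_lnp_nonneg)
    ultimately have "0 \<le> f n i \<and> f n i \<le> B" using B0 M0 N1b[of "k1 (k2 n)"] unfolding f_def B_def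
      by (auto simp: nsq_nonneg intro: add_increasing2 order_trans)
    then show ?thesis by simp
  qed
  obtain k3 where k3: "strict_mono (k3 :: nat => nat)" "\<And>i. i \<in> {0,1,2::nat} ==> \<exists>l. (\<lambda>n. f (k3 n) i) ----> l"
    using function_convergent_subsequence[of "{0,1,2::nat}" f B] fb by auto
  define V where "V n = U0 (k1 (k2 (k3 n)))" for n
  have sm: "strict_mono (\<lambda>n. k1 (k2 (k3 n)))" "strict_mono (\<lambda>n. k2 (k3 n))"
    using k1 k2(1) k3(1) by (auto simp: strict_mono_def)
  have VN: "V n \<in> NB" "V n \<in> X" for n using U0(1) U0X by (auto simp: V_def)
  obtain g\<^sub>0 h\<^sub>0 n\<^sub>0 where gl: "(\<lambda>n. nsq (gr (V n))) ----> g\<^sub>0" and hl: "(\<lambda>n. Wi (V n)) ----> h\<^sub>0" and nl: "(\<lambda>n. N1 (V n)) ----> n\<^sub>0"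
    using k3(2)[of 0] k3(2)[of 1] k3(2)[of 2] by (auto simp: f_def V_def)
  have Vl: "(\<lambda>n. dsq (V n) u) ----> 0"
    using LIMSEQ_subseq_LIMSEQ[OF l1 sm(2)] by (simp add: V_def comp_def)
  have Vae: "AE x in lborel. (\<lambda>n. V n x) ----> u x"
    using k2(2) by eventually_elim (auto dest: LIMSEQ_subseq_LIMSEQ[OF _ k3(1)] simp: V_def comp_def)
  note [measurable] = XD(2)[OF VN(2)] sqint_borel[OF us]
  \<comment> \<open>Lower semicontinuity is applied to tails of the sequence, whose squared gradient
    norms are below \<open>g\<^sub>0 + e\<close>; letting \<open>e\<close> tend to 0 gives the bound
    by the limit.\<close>
  have sobu: "(\<exists>G. sob u G) \<and> nsq (gr u) \<le> g\<^sub>0 + e" if e: "e > 0" for e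
  proof -
    have "\<forall>\<^sub>F n in sequentially. nsq (gr (V n)) < g\<^sub>0 + e" using gl e by (intro order_tendstoD) auto
    then obtain m where m: "\<And>n. n \<ge> m ==> nsq (gr (V n)) < g\<^sub>0 + e" by (auto simp: eventually_sequentially)
    have "\<exists>G. sob u G \<and> nsq G \<le> g\<^sub>0 + e"
    proof (rule sob_lsc[OF us X_sob[OF VN(2)]])
      show "(\<lambda>n. nsq (\<lambda>x. V (n + m) x - u x)) ----> 0" by (rule LIMSEQ_ignore_initial_segment[OF Vl])
      show "nsq (gr (V (n + m))) \<le> g\<^sub>0 + e" for n using m[of "n + m"] by simp
    qed
    then show ?thesis using gr_nsq by auto
  qed
  obtain H where su: "sob u H" using sobu[of 1] by auto
  have gu: "nsq (gr u) \<le> g\<^sub>0" by (rule field_le_epsilon) (use sobu in auto)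
  have Wu: "L1 (\<lambda>x. W x * (u x)\<^sup>2)" "(LBINT x. W x * (u x)\<^sup>2) \<le> h\<^sub>0"
  proof -
    have "AE x in lborel. (\<lambda>n. W x * (V n x)\<^sup>2) ----> W x * (u x)\<^sup>2"
      using Vae by eventually_elim (intro tendsto_intros)
    then show "L1 (\<lambda>x. W x * (u x)\<^sup>2)" "(LBINT x. W x * (u x)\<^sup>2) \<le> h\<^sub>0"
      using Fatou_lim[of "\<lambda>x. W x * (u x)\<^sup>2" lborel "\<lambda>n x. W x * (V n x)\<^sup>2" h\<^sub>0] XD(5)[OF VN(2)] W_nonneg hl by (auto simp: Wi_def)
  qed
  have Nu: "integrable lborel2 (\<lambda>q. lnp (dist (fst q) (snd q)) * (u (fst q))\<^sup>2 * (u (snd q))\<^sup>2)" "N1 u \<le> n\<^sub>0"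
  proof -
    have ae: "AE q in lborel2. (\<lambda>n. lnp (dist (fst q) (snd q)) * (V n (fst q))\<^sup>2 * (V n (snd q))\<^sup>2) ----> lnp (dist (fst q) (snd q)) * (u (fst q))\<^sup>2 * (u (snd q))\<^sup>2"
      using AE_pair_fst_snd[OF Vae] by eventually_elim (intro tendsto_intros)
    have i: "integrable lborel2 (\<lambda>q. lnp (dist (fst q) (snd q)) * (V n (fst q))\<^sup>2 * (V n (snd q))\<^sup>2)" for n
      by (rule dbl_int[OF VN(2)]) (use lnp_le lnp_nonneg in auto)
    show "integrable lborel2 (\<lambda>q. lnp (dist (fst q) (snd q)) * (u (fst q))\<^sup>2 * (u (snd q))\<^sup>2)" "N1 u \<le> n\<^sub>0"
      unfolding N1_def dbl_def
      by (rule Fatou_lim[where F="\<lambda>n q. lnp (dist (fst q) (snd q)) * (V n (fst q))\<^sup>2 * (V n (snd q))\<^sup>2" and L=n\<^sub>0];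
          use i ae nl lnp_nonneg in \<open>auto simp: N1_def dbl_def\<close>)+
  qed
  have uq: "sqint (sq u)"
  proof -
    have q4: "(2::real) \<le> 4" by simp
    have "L1 (\<lambda>x. \<bar>u x\<bar> powr 4)" using sobolev[OF q4] su by metis
    then show ?thesis by (simp add: sqint_real powr_4)
  qed
  have N2l: "(\<lambda>n. N2 (V n)) ----> N2 u"
    unfolding N2_def
  proof (rule lnm_energy_tendsto[where M="max M' (K * M\<^sup>2)", OF XD(1)[OF VN(2)] X_sq_sqint[OF VN(2)] _ _ us uq Vl])
    fix n
    have "nsq (\<lambda>x. (V n x)\<^sup>2) \<le> K * M\<^sup>2"
      using K(2)[OF VN(2), of n] mult_left_mono[OF power_mono[OF AM Aen_nonneg, of _ 2] K(1)] unfolding V_def by (meson order_trans)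
    then show "nsq (\<lambda>x. (V n x)\<^sup>2) \<le> max M' (K * M\<^sup>2)" by simp
    show "nsq (V n) \<le> max M' (K * M\<^sup>2)" using nb(1) by (auto simp: V_def le_max_iff_disj)
  qed
  have Cl: "(\<lambda>n. Cen (V n)) ----> Cen u"
    by (rule Cen_tendsto[OF X_sob[OF VN(2)] _ su Vl]) (use nb(3) in "auto simp: V_def")
  have QV: "nsq (gr (V n)) + Wi (V n) + (N1 (V n) - N2 (V n)) / (2 * pi) - b * Cen (V n) = 0" for n
    using QN[of "k1 (k2 (k3 n))"] by (simp add: V_def Aen_def Wi_def)
  have "(\<lambda>n. nsq (gr (V n)) + Wi (V n) + (N1 (V n) - N2 (V n)) / (2 * pi) - b * Cen (V n)) ----> g\<^sub>0 + h\<^sub>0 + (n\<^sub>0 - N2 u) / (2 * pi) - b * Cen u"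
    by (intro tendsto_intros gl hl nl N2l Cl) auto
  then have lim0: "g\<^sub>0 + h\<^sub>0 + (n\<^sub>0 - N2 u) / (2 * pi) - b * Cen u = 0" unfolding QV by (simp add: LIMSEQ_const_iff)
  have n0: "0 \<le> n\<^sub>0" using Nu(2) dbl_lnp_nonneg[of u] by (simp add: N1_def)
  \<comment> \<open>If the limit vanished, \<open>Cen\<close> and \<open>N2\<close> would vanish
    with it, and the limiting constraint would force \<open>g\<^sub>0 + h\<^sub>0 \<le> 0\<close>,
    against the lower bound for \<open>Aen\<close> on the constraint.\<close>
  have nzu: "nz u"
    unfolding nz_def
  proof
    assume z: "AE x in lborel. u x = 0"
    have "Cen u = (\<integral>x. 0 \<partial>(lborel :: R2 measure))" unfolding Cen_def by (rule integral_cong_AE) (use z p4 in auto)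
    moreover have "N2 u = (\<integral>q. 0 \<partial>(lborel2 :: (R2 \<times> R2) measure))"
      unfolding N2_def dbl_def by (rule integral_cong_AE) (use AE_pair_fst_snd(1)[OF z] in auto)
    ultimately have "g\<^sub>0 + h\<^sub>0 \<le> 0" using lim0 n0 by simp (smt (verit) divide_nonneg_nonneg pi_ge_zero)
    moreover obtain a where a: "a > 0" "\<And>u. u \<in> NB ==> a \<le> Aen u" using NB_lower_bound by metis
    have "a \<le> g\<^sub>0 + h\<^sub>0"
    proof (rule LIMSEQ_le_const)
      show "(\<lambda>n. nsq (gr (V n)) + Wi (V n)) ----> g\<^sub>0 + h\<^sub>0" by (intro tendsto_intros gl hl)
      show "\<exists>N. \<forall>n\<ge>N. a \<le> nsq (gr (V n)) + Wi (V n)" using a(2)[OF VN(1)] by (auto simp: Aen_def Wi_def)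
    qed
    ultimately show False using a(1) by linarith
  qed
  \<comment> \<open>Finite positive logarithmic energy gives, by Fubini, a point \<open>x\<close>
    with u(x) nonzero at which the single integral over \<open>y\<close> is finite; there
    \<open>lgw y\<close> is bounded by a constant plus \<open>lnp (dist x y)\<close>.\<close>
  have lu: "L1 (\<lambda>x. lgw x * (u x)\<^sup>2)"
  proof -
    have ae: "AE x in lborel. L1 (\<lambda>y. lnp (dist x y) * (u x)\<^sup>2 * (u y)\<^sup>2)" by (rule dbl_fubini(2)[OF Nu(1)])
    have "\<exists>x. u x \<noteq> 0 \<and> L1 (\<lambda>y. lnp (dist x y) * (u x)\<^sup>2 * (u y)\<^sup>2)"
    proof (rule ccontr)
      assume n: "\<not> ?thesis"
      have "AE x in lborel. u x = 0" using ae by eventually_elim (use n in auto)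
      then show False using nzu by (simp add: nz_def)
    qed
    then obtain x where x: "u x \<noteq> 0" "L1 (\<lambda>y. lnp (dist x y) * (u x)\<^sup>2 * (u y)\<^sup>2)" by blast
    have "L1 (\<lambda>y. (1 / (u x)\<^sup>2) * (lnp (dist x y) * (u x)\<^sup>2 * (u y)\<^sup>2))" using x(2) by (rule integrable_mult_right)
    then have i: "L1 (\<lambda>y. lnp (dist x y) * (u y)\<^sup>2)" using x(1) by (simp add: mult_ac)
    have i2: "L1 (\<lambda>y. (lgw x + ln 2) * (u y)\<^sup>2 + lnp (dist x y) * (u y)\<^sup>2)"
      using i us by (simp add: sqint_real)
    show ?thesis
    proof (rule L1_bound[OF i2])
      show "AE y in lborel. norm (lgw y * (u y)\<^sup>2) \<le> norm ((lgw x + ln 2) * (u y)\<^sup>2 + lnp (dist x y) * (u y)\<^sup>2)"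
      proof (rule AE_I2)
        fix y
        have "lgw y * (u y)\<^sup>2 \<le> (lgw x + ln 2 + lnp (dist x y)) * (u y)\<^sup>2" by (intro mult_right_mono lgw_le_lnp) auto
        moreover have "0 \<le> lgw y * (u y)\<^sup>2" using lgw_nonneg by simp
        ultimately show "norm (lgw y * (u y)\<^sup>2) \<le> norm ((lgw x + ln 2) * (u y)\<^sup>2 + lnp (dist x y) * (u y)\<^sup>2)"
          unfolding distrib_right[symmetric] real_norm_def by linarith
      qed
    qed measurable
  qed
  have uX: "u \<in> X" by (rule XI[OF su Wu(1) lu])
  have Au: "Aen u \<le> g\<^sub>0 + h\<^sub>0" using gu Wu(2) by (simp add: Aen_def)
  \<comment> \<open>\<open>N2\<close> and \<open>Cen\<close> pass to the limit exactly while the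
    other terms can only drop, so the limiting constraint becomes an inequality for
    \<open>u\<close>.\<close>
  have "Q u \<le> 0"
  proof -
    have "Q u = Aen u + (N1 u - N2 u) / (2 * pi) - b * Cen u" by (simp add: Q_def Nen_split[OF uX] N1_def N2_def)
    also have "... \<le> g\<^sub>0 + h\<^sub>0 + (n\<^sub>0 - N2 u) / (2 * pi) - b * Cen u"
      using Au Nu(2) by (intro diff_mono add_mono divide_right_mono) auto
    finally show ?thesis using lim0 by simp
  qed
  then obtain t where t: "0 < t" "t \<le> 1" "(\<lambda>x. t * u x) \<in> NB" "J (\<lambda>x. t * u x) = t\<^sup>2 * Aen u / 4 + b * (1/4 - 1/p) * (t powr p * Cen u)"
    using project_NB[OF uX nzu] by blast
  have "(\<lambda>n. J (V n)) ----> c"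
  proof (rule tendsto_sandwich[OF _ _ tendsto_const])
    show "\<forall>\<^sub>F n in sequentially. c \<le> J (V n)" using cle VN(1) by simp
    have l: "(\<lambda>n. 1 / real (Suc n)) ----> 0" using LIMSEQ_inverse_real_of_nat by (simp add: inverse_eq_divide)
    have "(\<lambda>n. c + 1 / real (Suc n)) ----> c + 0" by (intro tendsto_intros l)
    from LIMSEQ_subseq_LIMSEQ[OF this sm(1)]
    show "(\<lambda>n. c + 1 / real (Suc (k1 (k2 (k3 n))))) ----> c" by (simp add: comp_def)
    show "\<forall>\<^sub>F n in sequentially. J (V n) \<le> c + 1 / real (Suc (k1 (k2 (k3 n))))"
      unfolding V_def using less_imp_le[OF U0(2)] by simp
  qed
  moreover have "(\<lambda>n. J (V n)) ----> (g\<^sub>0 + h\<^sub>0) / 4 + b * (1/4 - 1/p) * Cen u"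
  proof -
    have "J (V n) = (nsq (gr (V n)) + Wi (V n)) / 4 + b * (1/4 - 1/p) * Cen (V n)" for n
      unfolding J_NB[OF VN(1)] by (simp add: Aen_def Wi_def)
    moreover have "(\<lambda>n. (nsq (gr (V n)) + Wi (V n)) / 4 + b * (1/4 - 1/p) * Cen (V n)) ----> (g\<^sub>0 + h\<^sub>0) / 4 + b * (1/4 - 1/p) * Cen u"
      by (intro tendsto_intros gl hl Cl) auto
    ultimately show ?thesis by (simp only:)
  qed
  ultimately have ceq: "(g\<^sub>0 + h\<^sub>0) / 4 + b * (1/4 - 1/p) * Cen u = c" by (rule LIMSEQ_unique[symmetric])
  have "t\<^sup>2 * Aen u \<le> 1 * Aen u" using t(1,2) Aen_nonneg[of u] by (intro mult_right_mono) (auto simp: power_le_one)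
  then have tA: "t\<^sup>2 * Aen u \<le> Aen u" by simp
  have tC: "b * (1/4 - 1/p) * (t powr p * Cen u) \<le> b * (1/4 - 1/p) * Cen u"
  proof (rule mult_left_mono[OF _ kappa_nonneg])
    have "t powr p \<le> 1" using t(1,2) p4 by (simp add: powr_le1)
    then show "t powr p * Cen u \<le> Cen u" using mult_right_mono[of "t powr p" 1 "Cen u"] Cen_nonneg by simp
  qed
  \<comment> \<open>The infimum equals the elimination formula at the limits; lower semicontinuity
    and a factor \<open>t \<le> 1\<close> can only decrease that expression.\<close>
  have "J (\<lambda>x. t * u x) \<le> c" unfolding t(4) by (rule quarter_sum_le[OF tA Au tC ceq])
  then show ?thesis using t(3) cle by (meson order_trans)
qed

section \<open>First variation and moduli of minimizers\<close>

definition dJ :: "(R2 => real) => (R2 => real) => real" where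
  "dJ u v = Bform u v + 1 / (2 * pi) * (LBINT x. Pot u x * (u x * v x)) - b * (LBINT x. \<bar>u x\<bar> powr (p - 2) * u x * v x)"

lemma Aen_deriv: assumes u: "u \<in> X" and v: "v \<in> X"
  shows "((\<lambda>t. Aen (\<lambda>x. u x + t * v x)) has_real_derivative 2 * Bform u v) (at 0)"
  unfolding Aen_expand[OF u v] by (auto intro!: derivative_eq_intros)

lemma J_deriv: assumes u: "u \<in> X" and v: "v \<in> X"
  shows "((\<lambda>t. J (\<lambda>x. u x + t * v x)) has_real_derivative dJ u v) (at 0)"
proof -
  have "((\<lambda>t. J (\<lambda>x. u x + t * v x)) has_real_derivative (2 * Bform u v) / 2 + (4 * (1 / (2 * pi) * (LBINT x. Pot u x * (u x * v x)))) / 4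
     - b / p * (p * (LBINT x. \<bar>u x\<bar> powr (p - 2) * u x * v x))) (at 0)"
    unfolding J_def by (intro derivative_intros DERIV_cdivide DERIV_cmult Aen_deriv[OF u v] Nen_deriv(1)[OF u v] Cen_deriv[OF u v])
  then show ?thesis using p4 by (simp add: dJ_def)
qed

lemma dJ_minus: assumes u: "u \<in> X" and v: "v \<in> X" shows "dJ u (\<lambda>x. - v x) = - dJ u v"
proof -
  have m: "(\<lambda>x. - v x) \<in> X" using X_scale[OF v, of "-1"] by simp
  have "((\<lambda>t. J (\<lambda>x. u x + (- t) * v x)) has_real_derivative dJ u v * (- 1)) (at 0)"
    by (rule DERIV_chain2[of "\<lambda>t. J (\<lambda>x. u x + t * v x)" _ "\<lambda>t. - t"]) (use J_deriv[OF u v] in "auto intro!: derivative_eq_intros")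
  then show ?thesis using DERIV_unique[OF J_deriv[OF u m]] by simp
qed

text \<open>Minimality gives a nonnegative derivative in every direction; a direction and its
  opposite together force zero. No Lagrange multiplier is computed, since the constraint enters only
  through nearby points on rays.\<close>

lemma minimizer_critical:
  assumes u: "u \<in> NB" and min: "\<And>w. w \<in> NB ==> J u \<le> J w" and v: "v \<in> X"
  shows "dJ u v = 0"
proof -
  have uX: "u \<in> X" "nz u" "Q u = 0" using u by (auto simp: NB_def)
  have nn: "0 \<le> dJ u v" if v: "v \<in> X" for v
  proof -
    \<comment> \<open>\<open>Aen\<close> is continuous along the line and positive at
      \<open>u\<close>, so functions close to \<open>u\<close> on the line cannot vanish almost
      everywhere.\<close>
    have nzs: "\<exists>d>0. \<forall>s. 0 < s \<and> s < d --> nz (\<lambda>x. u x + s * v x)"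
    proof -
      have "((\<lambda>s. Aen (\<lambda>x. u x + s * v x)) \<longlongrightarrow> Aen (\<lambda>x. u x + 0 * v x)) (at 0)"
        using DERIV_isCont[OF Aen_deriv[OF uX(1) v]] by (simp add: isCont_def)
      then have "\<forall>\<^sub>F s in at 0. Aen (\<lambda>x. u x + s * v x) > 0" using Aen_pos[OF uX(1,2)] by (intro order_tendstoD) auto
      then obtain d where d: "d > 0" "\<And>s. s \<noteq> 0 ==> dist s 0 < d ==> Aen (\<lambda>x. u x + s * v x) > 0" by (auto simp: eventually_at)
      have "nz (\<lambda>x. u x + s * v x)" if s: "0 < s" "s < d" for s
        unfolding nz_def
      proof
        assume z: "AE x in lborel. u x + s * v x = 0"
        have wX: "(\<lambda>x. u x + s * v x) \<in> X" by (rule X_add_scale[OF uX(1) v])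
        note [measurable] = XD(2)[OF wX]
        have "sob (\<lambda>x. 0) (\<lambda>x. 0)" using sob_lincomb[OF X_sob[OF wX] X_sob[OF wX], of 0 0] by simp
        then have "sob (\<lambda>x. u x + s * v x) (\<lambda>x. 0)" by (rule sob_cong_AE) (use z in auto)
        then have "nsq (gr (\<lambda>x. u x + s * v x)) = 0" using gr_nsq by (simp add: nsq_def)
        moreover have "(LBINT x. W x * (u x + s * v x)\<^sup>2) = (\<integral>x. 0 \<partial>(lborel :: R2 measure))" by (rule integral_cong_AE) (use z in auto)
        ultimately have "Aen (\<lambda>x. u x + s * v x) = 0" by (simp add: Aen_def)
        then show False using d(2)[of s] s by simp
      qed
      then show ?thesis using d(1) by blast
    qed
    then obtain d where d: "d > 0" "\<And>s. 0 < s ==> s < d ==> nz (\<lambda>x. u x + s * v x)" by blast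
    \<comment> \<open>The general criterion quantifies over all positive parameters, whereas u + s v
      is known to be nonzero only for s < d. Truncating the parameter at d/2 meets the criterion
      without changing derivatives at 0.\<close>
    define r where "r s = min s (d / 2)" for s :: real
    have rs: "(r has_real_derivative 1) (at 0)"
      by (rule has_field_derivative_transform_within_open[of "\<lambda>s. s" _ _ "{..<d/2}"]) (use d(1) in "auto simp: r_def")
    have r0: "r 0 = 0" using d(1) by (simp add: r_def)
    have ch: "((\<lambda>s. h (r s)) has_real_derivative h') (at 0)" if "(h has_real_derivative h') (at 0)" for h h'
      using DERIV_chain2[of h h' r 0 1] that rs r0 by simp
    have "0 \<le> (2 * Bform u v) / 2 + (4 * (1 / (2 * pi) * (LBINT x. Pot u x * (u x * v x)))) / 4
     - b / p * (p * (LBINT x. \<bar>u x\<bar> powr (p - 2) * u x * v x))"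
    proof (rule constrained_min_derivative_nonneg[OF b0 p4 _ _ ch[OF Aen_deriv[OF uX(1) v]] ch[OF Nen_deriv(1)[OF uX(1) v]] ch[OF Cen_deriv[OF uX(1) v]]])
      fix s t :: real assume st: "0 < s" "0 < t" and q: "Aen (\<lambda>x. u x + r s * v x) + Nen (\<lambda>x. u x + r s * v x) * t\<^sup>2 - b * Cen (\<lambda>x. u x + r s * v x) * t powr (p - 2) = 0"
      have w: "(\<lambda>x. u x + r s * v x) \<in> X" "nz (\<lambda>x. u x + r s * v x)"
        using X_add_scale[OF uX(1) v] d st by (auto simp: r_def intro!: d(2))
      have "(\<lambda>x. t * (u x + r s * v x)) \<in> NB" by (rule scale_in_NB[OF w st(2)]) (use q in "simp add: fqf_def")
      from min[OF this] show "Aen (\<lambda>x. u x + r 0 * v x) / 2 + Nen (\<lambda>x. u x + r 0 * v x) / 4 - b / p * Cen (\<lambda>x. u x + r 0 * v x)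
        \<le> Aen (\<lambda>x. u x + r s * v x) * t\<^sup>2 / 2 + Nen (\<lambda>x. u x + r s * v x) * t ^ 4 / 4 - b / p * Cen (\<lambda>x. u x + r s * v x) * t powr p"
        unfolding JQ_scale(1)[OF w(1) st(2)] fphi_def by (simp add: J_def r0)
    qed (use Aen_pos[OF uX(1,2)] Cen_nonneg uX(3) r0 in "auto simp: Q_def")
    then show ?thesis using p4 by (simp add: dJ_def)
  qed
  have m: "(\<lambda>x. - v x) \<in> X" using X_scale[OF v, of "-1"] by simp
  show ?thesis using nn[OF v] nn[OF m] dJ_minus[OF uX(1) v] by simp
qed

lemma X_abs: assumes u: "u \<in> X"
  shows "(\<lambda>x. \<bar>u x\<bar>) \<in> X" "Aen (\<lambda>x. \<bar>u x\<bar>) \<le> Aen u" "Nen (\<lambda>x. \<bar>u x\<bar>) = Nen u" "Cen (\<lambda>x. \<bar>u x\<bar>) = Cen u"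
proof -
  obtain H where H: "sob (\<lambda>x. \<bar>u x\<bar>) H" "nsq H \<le> nsq (gr u)" using sob_abs[OF X_sob[OF u]] by blast
  show "(\<lambda>x. \<bar>u x\<bar>) \<in> X" by (rule XI[OF H(1)]) (use XD[OF u] in auto)
  show "Aen (\<lambda>x. \<bar>u x\<bar>) \<le> Aen u" using H(2) by (simp add: Aen_def gr_nsq[OF H(1)])
  show "Nen (\<lambda>x. \<bar>u x\<bar>) = Nen u" "Cen (\<lambda>x. \<bar>u x\<bar>) = Cen u" by (simp_all add: Nen_def Cen_def)
qed

text \<open>Passing to the modulus can only lower \<open>Aen\<close>, so the modulus projects to the
  constraint with a factor \<open>t \<le> 1\<close>. With t < 1 the energy would drop strictly below
  the minimum; hence t = 1 and the modulus already satisfies the constraint.\<close>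

lemma minimizer_abs:
  assumes u: "u \<in> NB" and min: "\<And>w. w \<in> NB ==> J u \<le> J w"
  shows "(\<lambda>x. \<bar>u x\<bar>) \<in> NB" "J (\<lambda>x. \<bar>u x\<bar>) = J u"
proof -
  have uX: "u \<in> X" "nz u" "Q u = 0" using u by (auto simp: NB_def)
  let ?a = "\<lambda>x. \<bar>u x\<bar>"
  note a = X_abs[OF uX(1)]
  have nza: "nz ?a" using uX(2) by (simp add: nz_def)
  have "Q ?a \<le> 0" using a uX(3) by (simp add: Q_def)
  then obtain t where t: "0 < t" "t \<le> 1" "(\<lambda>x. t * ?a x) \<in> NB" "J (\<lambda>x. t * ?a x) = t\<^sup>2 * Aen ?a / 4 + b * (1/4 - 1/p) * (t powr p * Cen ?a)"
    using project_NB[OF a(1) nza] by blast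
  have "J u \<le> J (\<lambda>x. t * ?a x)" by (rule min[OF t(3)])
  then have le: "Aen u / 4 + b * (1/4 - 1/p) * Cen u \<le> t\<^sup>2 * Aen ?a / 4 + b * (1/4 - 1/p) * (t powr p * Cen u)"
    unfolding t(4) J_NB[OF u] using a(4) by simp
  have C: "b * (1/4 - 1/p) * (t powr p * Cen u) \<le> b * (1/4 - 1/p) * Cen u"
  proof (rule mult_left_mono[OF _ kappa_nonneg])
    have "t powr p \<le> 1" using t(1,2) p4 by (simp add: powr_le1)
    then show "t powr p * Cen u \<le> Cen u" using mult_right_mono[of "t powr p" 1 "Cen u"] Cen_nonneg by simp
  qed
  have "t\<^sup>2 * Aen ?a \<le> t\<^sup>2 * Aen u" using a(2) by (intro mult_left_mono) auto
  then have "1 * Aen u \<le> t\<^sup>2 * Aen u" using le C by linarith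
  then have "1 \<le> t\<^sup>2" using Aen_pos[OF uX(1,2)] by simp
  then have t1: "t = 1" using t(1,2) by (metis abs_le_square_iff abs_of_pos one_power2 order_antisym abs_one)
  show "?a \<in> NB" using t(3) t1 by simp
  have "J ?a \<le> J u" using a by (simp add: J_def)
  then show "J ?a = J u" using min[OF \<open>?a \<in> NB\<close>] by simp
qed

end

section \<open>Local Hoelder continuity\<close>

text \<open>Exponent and constant may depend on the ball, as \<open>loc_holder\<close> allows for
  compact sets; balls around the origin replace general compact sets.\<close>

definition lh :: "(R2 => real) => bool" where
  "lh f \<longleftrightarrow> (\<forall>R>0. \<exists>\<alpha> C. 0 < \<alpha> \<and> \<alpha> \<le> 1 \<and> 0 \<le> C \<and> (\<forall>x\<in>cball 0 R. \<forall>y\<in>cball 0 R. \<bar>f x - f y\<bar> \<le> C * dist x y powr \<alpha>))"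

lemma lhI:
  assumes "\<And>R. R > 0 ==> \<exists>\<alpha> C. 0 < \<alpha> \<and> \<alpha> \<le> 1 \<and> (\<forall>x\<in>cball 0 R. \<forall>y\<in>cball 0 R. \<bar>f x - f y\<bar> \<le> C * dist x y powr \<alpha>)"
  shows "lh f"
  unfolding lh_def
proof (intro allI impI)
  fix R :: real assume "R > 0"
  then obtain \<alpha> C where a: "0 < \<alpha>" "\<alpha> \<le> 1" and le: "\<And>x y. x \<in> cball 0 R ==> y \<in> cball 0 R ==> \<bar>f x - f y\<bar> \<le> C * dist x y powr \<alpha>" using assms by blast
  have "\<bar>f x - f y\<bar> \<le> \<bar>C\<bar> * dist x y powr \<alpha>" if "x \<in> cball 0 R" "y \<in> cball 0 R" for x y
    by (rule order_trans[OF le[OF that]]) (intro mult_right_mono, auto)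
  then show "\<exists>\<alpha> C. 0 < \<alpha> \<and> \<alpha> \<le> 1 \<and> 0 \<le> C \<and> (\<forall>x\<in>cball 0 R. \<forall>y\<in>cball 0 R. \<bar>f x - f y\<bar> \<le> C * dist x y powr \<alpha>)" using a abs_ge_zero by blast
qed

lemma lhD:
  assumes "lh f" "R > 0"
  obtains \<alpha> C where "0 < \<alpha>" "\<alpha> \<le> 1" "0 \<le> C" "\<And>x y. norm x \<le> R ==> norm y \<le> R ==> \<bar>f x - f y\<bar> \<le> C * dist x y powr \<alpha>"
  using assms by (auto simp: lh_def)

lemma loc_holder_lh: "loc_holder V ==> lh V"
  unfolding loc_holder_def by (rule lhI) (meson compact_cball)

lemma lh_continuous: assumes "lh f" shows "continuous_on UNIV f"
proof -
  have "(f \<longlongrightarrow> f x) (at x)" for x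
  proof -
    obtain \<alpha> C where a: "0 < \<alpha>" "\<alpha> \<le> 1" and le: "\<And>u v. norm u \<le> norm x + 1 ==> norm v \<le> norm x + 1 ==> \<bar>f u - f v\<bar> \<le> C * dist u v powr \<alpha>"
      using lhD[OF assms, of "norm x + 1"] by (metis add_nonneg_pos norm_ge_zero zero_less_one)
    have "((\<lambda>y. C * dist y x powr \<alpha>) \<longlongrightarrow> C * dist x x powr \<alpha>) (at x)"
      using a by (intro tendsto_intros tendsto_powr' tendsto_dist) auto
    then have l: "((\<lambda>y. C * dist y x powr \<alpha>) \<longlongrightarrow> 0) (at x)" by simp
    have "((\<lambda>y. f y - f x) \<longlongrightarrow> 0) (at x)"
    proof (rule Lim_null_comparison[OF _ l])
      have "norm (f y - f x) \<le> C * dist y x powr \<alpha>" if "dist y x < 1" for y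
        using le[of y x] that norm_triangle_ineq2[of y x] by (simp add: dist_norm)
      then show "\<forall>\<^sub>F y in at x. norm (f y - f x) \<le> C * dist y x powr \<alpha>"
        unfolding eventually_at by (intro exI[of _ 1]) auto
    qed
    then show ?thesis by (simp add: LIM_zero_iff)
  qed
  then show ?thesis by (simp add: continuous_on_eq_continuous_at isCont_def)
qed

lemma continuous_bounded_cball:
  fixes f :: "R2 => real"
  assumes "continuous_on UNIV f" obtains B where "B > 0" "\<And>x. norm x \<le> R ==> \<bar>f x\<bar> \<le> B"
proof -
  have "compact (f ` cball 0 R)" using assms by (intro compact_continuous_image) (auto intro: continuous_on_subset)
  then obtain B where "B > 0" "\<forall>y\<in>f ` cball 0 R. norm y \<le> B" using compact_imp_bounded bounded_pos by blast
  then show ?thesis using that[of B] by auto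
qed

lemma powr_exponent_le:
  assumes "0 \<le> d" "d \<le> D" "0 < \<beta>" "\<beta> \<le> \<alpha>" "\<alpha> \<le> 1"
  shows "d powr \<alpha> \<le> (1 + D) * d powr (\<beta>::real)"
proof (cases "d = 0")
  case False
  have "d powr \<alpha> = d powr (\<alpha> - \<beta>) * d powr \<beta>" by (simp add: powr_add[symmetric])
  also have "d powr (\<alpha> - \<beta>) \<le> (1 + D) powr (\<alpha> - \<beta>)" using assms by (intro powr_mono2) auto
  also have "(1 + D) powr (\<alpha> - \<beta>) \<le> (1 + D) powr 1" using assms by (intro powr_mono) auto
  finally show ?thesis using assms by (simp add: mult_right_mono)
qed simp

text \<open>The smaller of the two exponents serves both functions; on a ball of radius
  \<open>R\<close> passing to it costs a factor 1 + 2R, because distances there are at most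
  2R.\<close>

lemma lh_common:
  assumes "lh f" "lh g" "R > 0"
  obtains \<alpha> C where "0 < \<alpha>" "\<alpha> \<le> 1" "0 \<le> C" "\<And>x y. norm x \<le> R ==> norm y \<le> R ==> \<bar>f x - f y\<bar> \<le> C * dist x y powr \<alpha>"
    "\<And>x y. norm x \<le> R ==> norm y \<le> R ==> \<bar>g x - g y\<bar> \<le> C * dist x y powr \<alpha>"
proof -
  obtain \<alpha>1 C1 where 1: "0 < \<alpha>1" "\<alpha>1 \<le> 1" "0 \<le> C1" "\<And>x y. norm x \<le> R ==> norm y \<le> R ==> \<bar>f x - f y\<bar> \<le> C1 * dist x y powr \<alpha>1" using lhD[OF assms(1,3)] by metis
  obtain \<alpha>2 C2 where 2: "0 < \<alpha>2" "\<alpha>2 \<le> 1" "0 \<le> C2" "\<And>x y. norm x \<le> R ==> norm y \<le> R ==> \<bar>g x - g y\<bar> \<le> C2 * dist x y powr \<alpha>2" using lhD[OF assms(2,3)] by metis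
  define \<alpha> where "\<alpha> = min \<alpha>1 \<alpha>2"
  define C where "C = (C1 + C2) * (1 + 2 * R)"
  have key: "K * dist x y powr \<gamma> \<le> C * dist x y powr \<alpha>" if x: "norm x \<le> R" "norm y \<le> R" and K: "0 \<le> K" "K \<le> C1 + C2" and g: "\<alpha> \<le> \<gamma>" "\<gamma> \<le> 1" for K \<gamma> and x y :: R2
  proof -
    have "dist x y \<le> 2 * R" using x norm_triangle_ineq4[of x y] by (simp add: dist_norm)
    then have "dist x y powr \<gamma> \<le> (1 + 2 * R) * dist x y powr \<alpha>" using 1 2 g by (intro powr_exponent_le) (auto simp: \<alpha>_def)
    then have "K * dist x y powr \<gamma> \<le> (C1 + C2) * ((1 + 2 * R) * dist x y powr \<alpha>)" using K 1 2 by (intro mult_mono) auto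
    then show ?thesis by (simp add: C_def mult.assoc)
  qed
  show ?thesis
  proof (rule that[of \<alpha> C])
    show "0 < \<alpha>" "\<alpha> \<le> 1" "0 \<le> C" using 1 2 assms(3) by (auto simp: \<alpha>_def C_def)
    fix x y :: R2 assume xy: "norm x \<le> R" "norm y \<le> R"
    show "\<bar>f x - f y\<bar> \<le> C * dist x y powr \<alpha>" by (rule order_trans[OF 1(4)[OF xy] key[OF xy]]) (use 1 2 in \<open>auto simp: \<alpha>_def\<close>)
    show "\<bar>g x - g y\<bar> \<le> C * dist x y powr \<alpha>" by (rule order_trans[OF 2(4)[OF xy] key[OF xy]]) (use 1 2 in \<open>auto simp: \<alpha>_def\<close>)
  qed
qed

lemma lh_add: assumes "lh f" "lh g" shows "lh (\<lambda>x. f x + g x)"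
proof (rule lhI)
  fix R :: real assume "R > 0"
  then obtain \<alpha> C where c: "0 < \<alpha>" "\<alpha> \<le> 1" "\<And>x y. norm x \<le> R ==> norm y \<le> R ==> \<bar>f x - f y\<bar> \<le> C * dist x y powr \<alpha>"
    "\<And>x y. norm x \<le> R ==> norm y \<le> R ==> \<bar>g x - g y\<bar> \<le> C * dist x y powr \<alpha>" using lh_common[OF assms] by metis
  have "\<bar>(f x + g x) - (f y + g y)\<bar> \<le> (2 * C) * dist x y powr \<alpha>" if "norm x \<le> R" "norm y \<le> R" for x y
    using c(3)[OF that] c(4)[OF that] by linarith
  then show "\<exists>\<alpha> C. 0 < \<alpha> \<and> \<alpha> \<le> 1 \<and> (\<forall>x\<in>cball 0 R. \<forall>y\<in>cball 0 R. \<bar>f x + g x - (f y + g y)\<bar> \<le> C * dist x y powr \<alpha>)"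
    using c(1,2) by (intro exI[of _ \<alpha>] exI[of _ "2 * C"]) auto
qed

lemma lh_mult: assumes "lh f" "lh g" shows "lh (\<lambda>x. f x * g x)"
proof (rule lhI)
  fix R :: real assume "R > 0"
  then obtain \<alpha> C where c: "0 < \<alpha>" "\<alpha> \<le> 1" "0 \<le> C" "\<And>x y. norm x \<le> R ==> norm y \<le> R ==> \<bar>f x - f y\<bar> \<le> C * dist x y powr \<alpha>"
    "\<And>x y. norm x \<le> R ==> norm y \<le> R ==> \<bar>g x - g y\<bar> \<le> C * dist x y powr \<alpha>" using lh_common[OF assms] by metis
  obtain B1 where B1: "B1 > 0" "\<And>x. norm x \<le> R ==> \<bar>f x\<bar> \<le> B1" using continuous_bounded_cball[OF lh_continuous[OF assms(1)]] by metis
  obtain B2 where B2: "B2 > 0" "\<And>x. norm x \<le> R ==> \<bar>g x\<bar> \<le> B2" using continuous_bounded_cball[OF lh_continuous[OF assms(2)]] by metis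
  have "\<bar>f x * g x - f y * g y\<bar> \<le> ((B1 + B2) * C) * dist x y powr \<alpha>" if xy: "norm x \<le> R" "norm y \<le> R" for x y
  proof -
    have "f x * g x - f y * g y = f x * (g x - g y) + (f x - f y) * g y" by (simp add: algebra_simps)
    then have "\<bar>f x * g x - f y * g y\<bar> \<le> \<bar>f x\<bar> * \<bar>g x - g y\<bar> + \<bar>f x - f y\<bar> * \<bar>g y\<bar>"
      by (metis abs_mult abs_triangle_ineq)
    also have "... \<le> B1 * (C * dist x y powr \<alpha>) + (C * dist x y powr \<alpha>) * B2"
      using c(3) c(4)[OF xy] c(5)[OF xy] B1(2)[OF xy(1)] B2(2)[OF xy(2)] B1(1) by (intro add_mono mult_mono) auto
    finally show ?thesis by (simp add: algebra_simps)
  qed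
  then show "\<exists>\<alpha> C. 0 < \<alpha> \<and> \<alpha> \<le> 1 \<and> (\<forall>x\<in>cball 0 R. \<forall>y\<in>cball 0 R. \<bar>f x * g x - f y * g y\<bar> \<le> C * dist x y powr \<alpha>)"
    using c(1,2) by (intro exI[of _ \<alpha>] exI[of _ "(B1 + B2) * C"]) auto
qed

lemma lh_const: "lh (\<lambda>x. c)"
  by (rule lhI) (intro exI[of _ 1] exI[of _ 0], simp)

lemma lh_abs_powr: assumes "lh f" "q \<ge> 2" shows "lh (\<lambda>x. \<bar>f x\<bar> powr q)"
proof (rule lhI)
  fix R :: real assume "R > 0"
  then obtain \<alpha> C where c: "0 < \<alpha>" "\<alpha> \<le> 1" "0 \<le> C" "\<And>x y. norm x \<le> R ==> norm y \<le> R ==> \<bar>f x - f y\<bar> \<le> C * dist x y powr \<alpha>" using lhD[OF assms(1)] by metis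
  obtain B where B: "B > 0" "\<And>x. norm x \<le> R ==> \<bar>f x\<bar> \<le> B" using continuous_bounded_cball[OF lh_continuous[OF assms(1)]] by metis
  have "\<bar>\<bar>f x\<bar> powr q - \<bar>f y\<bar> powr q\<bar> \<le> (q * (2 * B powr (q - 1)) * C) * dist x y powr \<alpha>" if xy: "norm x \<le> R" "norm y \<le> R" for x y
  proof -
    have "\<bar>\<bar>f x\<bar> powr q - \<bar>f y\<bar> powr q\<bar> \<le> q * (\<bar>f x\<bar> powr (q - 1) + \<bar>f y\<bar> powr (q - 1)) * \<bar>f x - f y\<bar>" by (rule abs_powr_diff_le[OF assms(2)])
    also have "... \<le> q * (B powr (q - 1) + B powr (q - 1)) * (C * dist x y powr \<alpha>)"
      using assms(2) B(2)[OF xy(1)] B(2)[OF xy(2)] c(4)[OF xy] by (intro mult_mono mult_left_mono add_mono powr_mono2) auto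
    finally show ?thesis by (simp add: mult_ac)
  qed
  then show "\<exists>\<alpha> C. 0 < \<alpha> \<and> \<alpha> \<le> 1 \<and> (\<forall>x\<in>cball 0 R. \<forall>y\<in>cball 0 R. \<bar>\<bar>f x\<bar> powr q - \<bar>f y\<bar> powr q\<bar> \<le> C * dist x y powr \<alpha>)"
    using c(1,2) by (intro exI[of _ \<alpha>] exI[of _ "q * (2 * B powr (q - 1)) * C"]) auto
qed

section \<open>Regularity for the Poisson equation\<close>

definition weak_lap :: "(R2 => real) => (R2 => real) => bool" where
  "weak_lap u g \<longleftrightarrow> (\<forall>\<phi>. test_fun \<phi> --> (LBINT x. u x * laplacian \<phi> x) = (LBINT x. g x * \<phi> x))"

lemma mol_weak_lap:
  assumes u: "locint u" and g: "locint g" and w: "weak_lap u g" and \<phi>: "test_fun \<phi>" and s: "s > 0"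
  shows "mol (laplacian \<phi>) s u x = s\<^sup>2 * mol \<phi> s g x"
proof -
  note [measurable] = locint_borel[OF u] locint_borel[OF g] test_fun_borel[OF \<phi>] test_fun_borel[OF test_fun_laplacian[OF \<phi>]]
  have "(LBINT y. u y * laplacian (\<lambda>y. \<phi> ((1 / s) *\<^sub>R (x - y))) y) = (LBINT y. g y * \<phi> ((1 / s) *\<^sub>R (x - y)))"
    using w test_kernel[OF \<phi> s, of x] unfolding weak_lap_def by blast
  then have "(LBINT y. u y * laplacian \<phi> ((1 / s) *\<^sub>R (x - y))) / s\<^sup>2 = (LBINT y. g y * \<phi> ((1 / s) *\<^sub>R (x - y)))"
    by (simp add: laplacian_kernel[OF \<phi> s])
  then show ?thesis using s by (simp add: mol_kernel)
qed

lemma mol_rho_sderiv_lap: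
  assumes u: "locint u" and g: "locint g" and w: "weak_lap u g" and s: "s > 0"
  shows "((\<lambda>s. mol \<rho> s u x) has_real_derivative s * mol \<psi> s g x) (at s)"
  using mol_rho_has_sderiv[OF u s, of x] s unfolding mol_weak_lap[OF u g w test_psi s] by (simp add: power2_eq_square)

lemma mol_local:
  assumes \<phi>: "\<And>z. norm z > 1 ==> \<phi> z = 0" and s: "0 < s" "s \<le> 1" and eq: "\<And>y. norm y \<le> norm x + 1 ==> f y = g y"
  shows "mol \<phi> s f x = mol \<phi> s g x"
  unfolding mol_def
proof (rule Bochner_Integration.integral_cong[OF refl])
  fix z :: R2
  show "f (x - s *\<^sub>R z) * \<phi> z = g (x - s *\<^sub>R z) * \<phi> z"
  proof (cases "norm z \<le> 1")
    case True
    have "norm (s *\<^sub>R z) \<le> 1 * 1" unfolding norm_scaleR using True s by (intro mult_mono) auto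
    then show ?thesis using eq[of "x - s *\<^sub>R z"] norm_triangle_ineq4[of x "s *\<^sub>R z"] by simp
  qed (use \<phi>[of z] in auto)
qed

text \<open>The condition on \<open>c\<close> covers two situations: c = 0 with any kernel, where
  \<open>K\<close> is a plain bound, and c = f(x) with a kernel of mean zero, where \<open>K\<close>
  is an oscillation and becomes small with the scale.\<close>

lemma mol_abs_le:
  assumes f: "locint f" and \<phi>: "test_fun \<phi>" and sup: "\<And>z. norm z > 1 ==> \<phi> z = 0" and s: "0 < s"
    and K: "\<And>y. norm (x - y) \<le> s ==> \<bar>f y - c\<bar> \<le> K" and c: "c * (LBINT z. \<phi> z) = 0"
  shows "\<bar>mol \<phi> s f x\<bar> \<le> K * (LBINT z. \<bar>\<phi> z\<bar>)"
proof -
  have i1: "L1 (\<lambda>z. f (x - s *\<^sub>R z) * \<phi> z)" by (rule mol_integrable[OF f \<phi> s(1)])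
  have i2: "L1 (\<lambda>z. c * \<phi> z)" using test_integrable[OF \<phi>] by simp
  have "mol \<phi> s f x = (LBINT z. f (x - s *\<^sub>R z) * \<phi> z - c * \<phi> z)"
    unfolding mol_def using i1 i2 c by simp
  also have "\<bar>...\<bar> \<le> (LBINT z. \<bar>f (x - s *\<^sub>R z) * \<phi> z - c * \<phi> z\<bar>)" by (rule integral_abs_bound)
  also have "... \<le> (LBINT z. K * \<bar>\<phi> z\<bar>)"
  proof (rule integral_mono)
    show "L1 (\<lambda>z. \<bar>f (x - s *\<^sub>R z) * \<phi> z - c * \<phi> z\<bar>)" using i1 i2 by (intro integrable_abs L1_diff)
    show "L1 (\<lambda>z. K * \<bar>\<phi> z\<bar>)" using test_fun_abs_integrable[OF \<phi>] by simp
    fix z :: R2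
    show "\<bar>f (x - s *\<^sub>R z) * \<phi> z - c * \<phi> z\<bar> \<le> K * \<bar>\<phi> z\<bar>"
    proof (cases "norm z \<le> 1")
      case True
      have "norm (x - (x - s *\<^sub>R z)) \<le> s" using True s by (simp add: mult_left_le)
      from K[OF this] have "\<bar>f (x - s *\<^sub>R z) - c\<bar> * \<bar>\<phi> z\<bar> \<le> K * \<bar>\<phi> z\<bar>" by (intro mult_right_mono) auto
      then show ?thesis by (simp add: abs_mult[symmetric] left_diff_distrib)
    qed (use sup[of z] in auto)
  qed
  finally show ?thesis by simp
qed

lemma integral_param_continuous:
  fixes F :: "R2 => real => real"
  assumes m: "\<And>x. F x \<in> borel_measurable lborel" and c: "\<And>s. continuous_on UNIV (\<lambda>x. F x s)"
    and h: "\<And>R. R > 0 ==> \<exists>h. integrable lborel h \<and> (\<forall>x s. norm x \<le> R --> \<bar>F x s\<bar> \<le> h s)"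
  shows "continuous_on UNIV (\<lambda>x. LBINT s. F x s)"
  unfolding continuous_on_sequentially
proof (intro ballI allI impI, elim conjE)
  fix Y :: "nat => R2" and x assume Y: "Y ----> x"
  obtain R where R: "R > 0" "\<And>n. norm (Y n) \<le> R" using convergent_imp_Bseq[OF convergentI[OF Y]] by (auto simp: Bseq_def)
  obtain h where h: "integrable lborel h" "\<And>x s. norm x \<le> R ==> \<bar>F x s\<bar> \<le> h s" using assms(3)[OF R(1)] by blast
  have "(\<lambda>n. LBINT s. F (Y n) s) ----> (LBINT s. F x s)"
  proof (rule integral_dominated_convergence[OF m m h(1)])
    show "AE s in lborel. (\<lambda>n. F (Y n) s) ----> F x s"
      using c Y by (auto simp: continuous_on_sequentially comp_def)
    show "AE s in lborel. norm (F (Y n) s) \<le> h s" for n using h(2)[OF R(2)] by simp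
  qed
  then show "((\<lambda>x. LBINT s. F x s) \<circ> Y) ----> (LBINT s. F x s)" by (simp add: comp_def)
qed

lemma integrable_powr_unit: assumes "a > -1" shows "L1 (\<lambda>s. unit_ind s * s powr a :: real)"
proof -
  have "(\<lambda>s. s powr a) absolutely_integrable_on {0..1}"
    using integrable_on_powr_from_0[of a 1] assms by (intro nonnegative_absolutely_integrable_1) auto
  then have "set_integrable lebesgue {0..1} (\<lambda>s. s powr a)" .
  then have "integrable lebesgue (\<lambda>s. indicator {0..1} s * s powr a)" by (simp add: set_integrable_def)
  then have i: "L1 (\<lambda>s. indicator {0..1} s * s powr a)" by (subst (asm) integrable_completion) auto
  show ?thesis by (rule L1_bound[OF i]) (auto simp: indicator_def)
qed

text \<open>Since derivatives of \<^term>\<open>\<psi>\<close> have vanishing integral, each of the first two derivatives of the integrand costs one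
  power of the scale, and Hoelder continuity of the right-hand side restores integrability in the second one.\<close>

lemma poisson_C2:
  assumes g: "lh g"
  shows "Ck 2 (\<lambda>x. LBINT s. unit_ind s * (s * mol \<psi> s g x))"
proof -
  have gc: "continuous_on UNIV g" by (rule lh_continuous[OF g])
  have gl: "locint g" by (rule locint_continuous[OF gc])
  note [measurable] = locint_borel[OF gl]
  \<comment> \<open>Power of the scale and kernel are kept as parameters because a derivative in
    \<open>x\<close> replaces the exponent by \<open>e - 1\<close> and the kernel by its partial
    derivative. From exponent 1 and kernel \<open>\<psi>\<close>, two derivatives lead to exponent
    -1.\<close>
  define S where "S e \<phi> x = (LBINT s. unit_ind s * (s powr e * mol \<phi> s g x))" for e \<phi> x
  let ?F = "\<lambda>e \<phi> x s. unit_ind s * (s powr e * mol \<phi> s g x)"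
  have I0: "(LBINT z. pdv i \<phi> z) = 0" if t: "test_fun \<phi>" and i: "i \<in> Basis" for \<phi> i
  proof -
    obtain r where r: "r > 0" "\<And>x. norm x > r ==> \<phi> x = 0" using test_fun_support[OF t] by metis
    show ?thesis by (rule integral_pdv_eq_0[OF test_fun_Ck[OF t] r(2) i])
  qed
  have bnd0: "\<exists>B\<ge>0. \<forall>x s. norm x \<le> R --> 0 < s --> s \<le> 1 --> \<bar>mol \<phi> s g x\<bar> \<le> B"
    if \<phi>: "test_fun \<phi>" "\<And>z. norm z > 1 ==> \<phi> z = 0" for \<phi> R
  proof -
    obtain B where B: "B > 0" "\<And>x. norm x \<le> R + 1 ==> \<bar>g x\<bar> \<le> B" using continuous_bounded_cball[OF gc] by metis
    have "\<bar>mol \<phi> s g x\<bar> \<le> B * (LBINT z. \<bar>\<phi> z\<bar>)" if x: "norm x \<le> R" "0 < s" "s \<le> 1" for x s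
    proof (rule mol_abs_le[OF gl \<phi>(1,2) x(2), where c=0])
      fix y assume "norm (x - y) \<le> s"
      then show "\<bar>g y - 0\<bar> \<le> B" using B(2)[of y] x norm_triangle_ineq2[of y x] by (simp add: norm_minus_commute)
    qed auto
    moreover have "0 \<le> B * (LBINT z. \<bar>\<phi> z\<bar>)" using B(1) by simp
    ultimately show ?thesis by blast
  qed
  have bnd1: "\<exists>\<alpha> B. 0 < \<alpha> \<and> B \<ge> 0 \<and> (\<forall>x s. norm x \<le> R --> 0 < s --> s \<le> 1 --> \<bar>mol \<phi> s g x\<bar> \<le> B * s powr \<alpha>)"
    if \<phi>: "test_fun \<phi>" "\<And>z. norm z > 1 ==> \<phi> z = 0" "(LBINT z. \<phi> z) = 0" and R: "R > 0" for \<phi> R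
  proof -
    obtain \<alpha> C where c: "0 < \<alpha>" "\<alpha> \<le> 1" "0 \<le> C" "\<And>x y. norm x \<le> R + 1 ==> norm y \<le> R + 1 ==> \<bar>g x - g y\<bar> \<le> C * dist x y powr \<alpha>"
      using lhD[OF g, of "R + 1"] R by (metis add_pos_pos zero_less_one)
    have "\<bar>mol \<phi> s g x\<bar> \<le> (C * s powr \<alpha>) * (LBINT z. \<bar>\<phi> z\<bar>)" if x: "norm x \<le> R" "0 < s" "s \<le> 1" for x s
    proof (rule mol_abs_le[OF gl \<phi>(1,2) x(2), where c="g x"])
      fix y assume y: "norm (x - y) \<le> s"
      have "norm y \<le> R + 1" using x y norm_triangle_ineq2[of y x] by (simp add: norm_minus_commute)
      then have "\<bar>g y - g x\<bar> \<le> C * dist y x powr \<alpha>" using x by (intro c(4)) auto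
      also have "... \<le> C * s powr \<alpha>" using y c by (intro mult_left_mono powr_mono2) (auto simp: dist_norm norm_minus_commute)
      finally show "\<bar>g y - g x\<bar> \<le> C * s powr \<alpha>" .
    qed (use \<phi>(3) in auto)
    then have "\<bar>mol \<phi> s g x\<bar> \<le> (C * (LBINT z. \<bar>\<phi> z\<bar>)) * s powr \<alpha>" if "norm x \<le> R" "0 < s" "s \<le> 1" for x s
      using that by (simp add: mult_ac)
    moreover have "0 \<le> C * (LBINT z. \<bar>\<phi> z\<bar>)" using c(3) by simp
    ultimately show ?thesis using c(1) by blast
  qed
  have meas: "(\<lambda>s. ?F e \<phi> x s) \<in> borel_measurable lborel" if \<phi>: "test_fun \<phi>" for e \<phi> x
  proof -
    note [measurable] = test_fun_borel[OF \<phi>]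
    show ?thesis by measurable
  qed
  \<comment> \<open>Asks for a majorant integrable in the scale, uniform for \<open>x\<close> in
    balls. For nonnegative exponents local boundedness of \<open>g\<close> provides it; for -1 a
    kernel of mean zero and Hoelder continuity give s^(\<alpha> - 1).\<close>
  define dom where "dom e \<phi> \<longleftrightarrow> test_fun \<phi> \<and> (\<forall>R>0. \<exists>h. integrable lborel h \<and> (\<forall>s. 0 \<le> h s) \<and> (\<forall>x s. norm x \<le> R --> \<bar>?F e \<phi> x s\<bar> \<le> h s))" for e :: real and \<phi>
  have dom0: "dom e \<phi>" if \<phi>: "test_fun \<phi>" "\<And>z. norm z > 1 ==> \<phi> z = 0" and e: "e \<ge> 0" for e \<phi>
    unfolding dom_def
  proof (intro conjI allI impI \<phi>(1))
    fix R :: real assume "R > 0"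
    obtain B where B: "B \<ge> 0" "\<And>x s. norm x \<le> R ==> 0 < s ==> s \<le> 1 ==> \<bar>mol \<phi> s g x\<bar> \<le> B" using bnd0[OF \<phi>] by metis
    have "\<bar>?F e \<phi> x s\<bar> \<le> B * unit_ind s" if "norm x \<le> R" for x s
    proof (cases "s \<in> {0<..<1}")
      case True
      have "s powr e \<le> 1" using True e by (simp add: powr_le1)
      then have "s powr e * \<bar>mol \<phi> s g x\<bar> \<le> 1 * B" using B(2)[OF that] True B(1) by (intro mult_mono) auto
      then show ?thesis using True by (simp add: abs_mult)
    qed simp
    then show "\<exists>h. integrable lborel h \<and> (\<forall>s. 0 \<le> h s) \<and> (\<forall>x s. norm x \<le> R --> \<bar>?F e \<phi> x s\<bar> \<le> h s)"
      using B(1) by (intro exI[of _ "\<lambda>s. B * unit_ind s"]) auto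
  qed
  have dom1: "dom (-1) \<phi>" if \<phi>: "test_fun \<phi>" "\<And>z. norm z > 1 ==> \<phi> z = 0" "(LBINT z. \<phi> z) = 0" for \<phi>
    unfolding dom_def
  proof (intro conjI allI impI \<phi>(1))
    fix R :: real assume R: "R > 0"
    obtain \<alpha> B where B: "0 < \<alpha>" "B \<ge> 0" "\<And>x s. norm x \<le> R ==> 0 < s ==> s \<le> 1 ==> \<bar>mol \<phi> s g x\<bar> \<le> B * s powr \<alpha>" using bnd1[OF \<phi> R] by metis
    have "\<bar>?F (-1) \<phi> x s\<bar> \<le> B * (unit_ind s * s powr (\<alpha> - 1))" if "norm x \<le> R" for x s
    proof (cases "s \<in> {0<..<1}")
      case True
      have "s powr (-1) * \<bar>mol \<phi> s g x\<bar> \<le> s powr (-1) * (B * s powr \<alpha>)" using B(3)[OF that] True by (intro mult_left_mono) auto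
      also have "... = B * s powr (\<alpha> - 1)" using powr_add[of s "-1" \<alpha>] by (simp add: mult_ac)
      finally show ?thesis using True by (simp add: abs_mult)
    qed simp
    moreover have "L1 (\<lambda>s. B * (unit_ind s * s powr (\<alpha> - 1)))"
      using B(1) by (intro integrable_mult_right integrable_powr_unit) simp
    ultimately show "\<exists>h. integrable lborel h \<and> (\<forall>s. 0 \<le> h s) \<and> (\<forall>x s. norm x \<le> R --> \<bar>?F (-1) \<phi> x s\<bar> \<le> h s)"
      using B(2) by (intro exI[of _ "\<lambda>s. B * (unit_ind s * s powr (\<alpha> - 1))"]) auto
  qed
  have Scont: "continuous_on UNIV (S e \<phi>)" if d: "dom e \<phi>" for e \<phi>
    unfolding S_def[abs_def]
  proof (rule integral_param_continuous)
    have \<phi>: "test_fun \<phi>" using d by (simp add: dom_def)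
    show "(\<lambda>s. ?F e \<phi> x s) \<in> borel_measurable lborel" for x by (rule meas[OF \<phi>])
    show "continuous_on UNIV (\<lambda>x. ?F e \<phi> x s)" for s
      by (cases "s \<in> {0<..<1}") (auto intro!: continuous_intros mol_continuous gl \<phi>)
    show "\<exists>h. integrable lborel h \<and> (\<forall>x s. norm x \<le> R --> \<bar>?F e \<phi> x s\<bar> \<le> h s)" if "R > 0" for R
      using d that unfolding dom_def by blast
  qed
  have Sder: "((\<lambda>t. S e \<phi> (x + t *\<^sub>R i)) has_real_derivative S (e - 1) (pdv i \<phi>) x) (at 0)"
    if d: "dom e \<phi>" and d': "dom (e - 1) (pdv i \<phi>)" and i: "i \<in> Basis" for e \<phi> i x
  proof -
    have \<phi>: "test_fun \<phi>" using d by (simp add: dom_def)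
    have pos: "norm x + 1 > 0" by (simp add: add_nonneg_pos)
    obtain h where h: "integrable lborel h" "\<And>s. 0 \<le> h s" "\<And>y s. norm y \<le> norm x + 1 ==> \<bar>?F (e - 1) (pdv i \<phi>) y s\<bar> \<le> h s"
      using d' pos unfolding dom_def by blast
    obtain h0 where h0: "integrable lborel h0" "\<And>y s. norm y \<le> norm x + 1 ==> \<bar>?F e \<phi> y s\<bar> \<le> h0 s"
      using d pos unfolding dom_def by blast
    have ny: "norm (x + t *\<^sub>R i) \<le> norm x + 1" if "\<bar>t\<bar> < 1" for t
      using norm_triangle_ineq[of x "t *\<^sub>R i"] that i by simp
    have sder: "((\<lambda>t. ?F e \<phi> (x + t *\<^sub>R i) s) has_real_derivative ?F (e - 1) (pdv i \<phi>) (x + t *\<^sub>R i) s) (at t)" for s t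
    proof (cases "s \<in> {0<..<1}")
      case True
      then have s: "s > 0" by simp
      have "((\<lambda>t. s powr e * mol \<phi> s g (x + t *\<^sub>R i)) has_real_derivative s powr e * (mol (pdv i \<phi>) s g (x + t *\<^sub>R i) / s)) (at t)"
        by (rule DERIV_cmult[OF mol_has_pdv[OF gl \<phi> s i]])
      moreover have "s powr e * (mol (pdv i \<phi>) s g (x + t *\<^sub>R i) / s) = s powr (e - 1) * mol (pdv i \<phi>) s g (x + t *\<^sub>R i)"
        using s by (simp add: powr_diff)
      ultimately show ?thesis using True by simp
    qed simp
    have "((\<lambda>t. LBINT s. ?F e \<phi> (x + t *\<^sub>R i) s) has_real_derivative
       (LBINT s. ?F (e - 1) (pdv i \<phi>) x s)) (at 0)"
    proof (rule has_real_derivative_integral[where d=1 and w=h])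
      show "L1 (\<lambda>s. ?F e \<phi> (x + t *\<^sub>R i) s)" if "\<bar>t - 0\<bar> < 1" for t
        by (rule L1_bound[OF h0(1) meas[OF \<phi>]])
           (use h0(2)[OF ny[of t]] that in "auto intro!: AE_I2 intro: order_trans[OF _ abs_ge_self]")
      show "(\<lambda>s. ?F (e - 1) (pdv i \<phi>) x s) \<in> borel_measurable lborel" by (rule meas[OF test_fun_pdv[OF \<phi> i]])
      show "((\<lambda>t. ?F e \<phi> (x + t *\<^sub>R i) s) has_real_derivative ?F (e - 1) (pdv i \<phi>) x s) (at 0)" for s
        using sder[of s 0] by simp
      show "\<bar>?F e \<phi> (x + t *\<^sub>R i) s - ?F e \<phi> (x + 0 *\<^sub>R i) s\<bar> \<le> \<bar>t - 0\<bar> * h s" if t: "\<bar>t - 0\<bar> < 1" for t s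
      proof -
        have "norm (?F e \<phi> (x + t *\<^sub>R i) s - ?F e \<phi> (x + 0 *\<^sub>R i) s) \<le> h s * norm (t - 0)"
        proof (rule field_differentiable_bound[where S="ball 0 1" and f="\<lambda>t. ?F e \<phi> (x + t *\<^sub>R i) s" and f'="\<lambda>t. ?F (e - 1) (pdv i \<phi>) (x + t *\<^sub>R i) s"])
          show "((\<lambda>t. ?F e \<phi> (x + t *\<^sub>R i) s) has_real_derivative ?F (e - 1) (pdv i \<phi>) (x + t *\<^sub>R i) s) (at t within ball 0 1)" for t
            by (rule has_field_derivative_at_within[OF sder])
          show "norm (?F (e - 1) (pdv i \<phi>) (x + t *\<^sub>R i) s) \<le> h s" if "t \<in> ball 0 1" for t
            using h(3)[OF ny[of t]] that by simp
        qed (use t in auto)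
        then show ?thesis by (simp add: mult.commute)
      qed
    qed (use h in auto)
    then show ?thesis unfolding S_def .
  qed
  have p1: "test_fun (pdv i \<psi>)" "norm z > 1 ==> pdv i \<psi> z = 0" if "i \<in> Basis" for i z
    using that by (auto intro!: test_fun_pdv test_psi pdv_eq_0_outside[of 1 \<psi>] psi_outside)
  have p2: "test_fun (pdv j (pdv i \<psi>))" "norm z > 1 ==> pdv j (pdv i \<psi>) z = 0" "(LBINT z. pdv j (pdv i \<psi>) z) = 0" if "i \<in> Basis" "j \<in> Basis" for i j z
    using that by (auto intro!: test_fun_pdv p1 pdv_eq_0_outside[of 1 "pdv i \<psi>"] I0)
  have d1: "dom 1 \<psi>" by (rule dom0[OF test_psi psi_outside]) auto
  have d0: "dom 0 (pdv i \<psi>)" if "i \<in> Basis" for i by (rule dom0[OF p1[OF that]]) auto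
  have dm: "dom (-1) (pdv j (pdv i \<psi>))" if "i \<in> Basis" "j \<in> Basis" for i j by (rule dom1[OF p2[OF that]])
  have C1: "Ck (Suc 0) (S 0 (pdv i \<psi>))" if i: "i \<in> Basis" for i
  proof (rule Ck_SucI[where f'="\<lambda>j. S (-1) (pdv j (pdv i \<psi>))"])
    show "continuous_on UNIV (S 0 (pdv i \<psi>))" by (rule Scont[OF d0[OF i]])
    show "((\<lambda>t. S 0 (pdv i \<psi>) (x + t *\<^sub>R j)) has_real_derivative S (-1) (pdv j (pdv i \<psi>)) x) (at 0)" if "j \<in> Basis" for j x
      using Sder[OF d0[OF i], of j x] dm[OF i that] that by simp
    show "Ck 0 (S (-1) (pdv j (pdv i \<psi>)))" if "j \<in> Basis" for j unfolding Ck_0 by (rule Scont[OF dm[OF i that]])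
  qed
  have "Ck (Suc (Suc 0)) (S 1 \<psi>)"
  proof (rule Ck_SucI[where f'="\<lambda>i. S 0 (pdv i \<psi>)"])
    show "continuous_on UNIV (S 1 \<psi>)" by (rule Scont[OF d1])
    show "((\<lambda>t. S 1 \<psi> (x + t *\<^sub>R i)) has_real_derivative S 0 (pdv i \<psi>) x) (at 0)" if "i \<in> Basis" for i x
      using Sder[OF d1, of i x] d0[OF that] that by simp
  qed (rule C1)
  moreover have "S 1 \<psi> = (\<lambda>x. LBINT s. unit_ind s * (s * mol \<psi> s g x))"
    unfolding S_def by (intro ext Bochner_Integration.integral_cong) (auto simp: indicator_def)
  ultimately show ?thesis by (simp add: numeral_2_eq_2)
qed

lemma continuous_AE_eq:
  fixes f g :: "R2 => real"
  assumes "continuous_on UNIV f" "continuous_on UNIV g" "AE x in lborel. f x = g x"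
  shows "f x = g x"
proof (rule ccontr)
  assume "f x \<noteq> g x"
  then have "nz (\<lambda>x. f x - g x)" using assms by (intro nz_continuous[of _ x] continuous_intros) auto
  then show False using assms(3) by (simp add: nz_def)
qed

lemma mol_lipschitz:
  assumes f: "sqint f" and \<phi>: "test_fun \<phi>" and s: "s > 0" and D: "\<And>i. i \<in> Basis ==> sqrt (nsq (pdv i \<phi>)) \<le> D"
  shows "\<bar>mol \<phi> s f x - mol \<phi> s f y\<bar> \<le> 2 * (D * sqrt (nsq f) / s\<^sup>2) * norm (x - y)"
proof (rule Ck_lipschitz[OF mol_Ck[OF sqint_locint[OF f] s \<phi>, of "Suc 0"]])
  fix i x assume i: "i \<in> (Basis :: R2 set)"
  have "pdv i (mol \<phi> s f) x = mol (pdv i \<phi>) s f x / s"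
    using mol_has_pdv[OF sqint_locint[OF f] \<phi> s i, of x 0] by (intro pdv_eqI) simp
  also have "\<bar>...\<bar> \<le> (sqrt (nsq (pdv i \<phi>)) * sqrt (nsq f) / s) / s"
    using divide_right_mono[OF mol_sup[OF f test_fun_pdv[OF \<phi> i] s, of x], of s] s by simp
  also have "... \<le> D * sqrt (nsq f) / s\<^sup>2"
    using D[OF i] s by (auto simp: power2_eq_square intro!: divide_right_mono mult_right_mono nsq_nonneg)
  finally show "\<bar>pdv i (mol \<phi> s f) x\<bar> \<le> D * sqrt (nsq f) / s\<^sup>2" .
qed

lemma test_fun_gradient_bound: obtains D where "D \<ge> 0" "\<And>i. i \<in> (Basis :: R2 set) ==> sqrt (nsq (pdv i \<phi>)) \<le> D"
proof
  show "0 \<le> (\<Sum>i\<in>(Basis :: R2 set). sqrt (nsq (pdv i \<phi>)))" by (intro sum_nonneg) (auto intro: nsq_nonneg)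
  show "sqrt (nsq (pdv i \<phi>)) \<le> (\<Sum>i\<in>(Basis :: R2 set). sqrt (nsq (pdv i \<phi>)))" if "i \<in> Basis" for i
    using that by (intro member_le_sum) (auto intro: nsq_nonneg)
qed

locale locally_L2 =
  fixes g :: "R2 => real"
  assumes g_borel [measurable]: "g \<in> Bor" and g_L2: "\<And>r. L1 (\<lambda>x. indicator (cball 0 r) x * (g x)\<^sup>2)"
begin

lemma g_locint: "locint g" by (rule locint_L2[OF g_borel g_L2])

lemma g_cutoff: "sqint (\<lambda>y. indicator (cball 0 r) y * g y)"
proof -
  have "(\<lambda>x. (indicator (cball 0 r) x * g x)\<^sup>2) = (\<lambda>x. indicator (cball 0 r) x * (g x)\<^sup>2)" by (auto simp: indicator_def)
  then show ?thesis using g_L2[of r] by (simp add: sqint_real)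
qed

text \<open>At scales up to one only the values of \<open>g\<close> on the ball of radius R + 1
  matter, so \<open>g\<close> can be cut off to a square integrable function. The mollification then
  has supremum of order 1/s and Lipschitz constant of order 1/s^2, and the factor \<open>s\<close>
  improves both by one power.\<close>

lemma poisson_kernel_bounds:
  obtains C D where "C \<ge> 0" "D \<ge> 0" "\<And>x s. norm x \<le> R ==> 0 < s ==> s \<le> 1 ==> \<bar>s * mol \<psi> s g x\<bar> \<le> C"
    "\<And>x y s. norm x \<le> R ==> norm y \<le> R ==> 0 < s ==> s \<le> 1 ==> \<bar>s * mol \<psi> s g x - s * mol \<psi> s g y\<bar> \<le> D * norm (x - y) / s"
proof -
  let ?h = "\<lambda>y. indicator (cball 0 (R + 1)) y * g y"
  obtain D where D: "D \<ge> 0" "\<And>i. i \<in> (Basis :: R2 set) ==> sqrt (nsq (pdv i \<psi>)) \<le> D" by (rule test_fun_gradient_bound[of \<psi>]) blast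
  have loc: "mol \<psi> s g x = mol \<psi> s ?h x" if "norm x \<le> R" "0 < s" "s \<le> 1" for x s
    using that by (intro mol_local psi_outside) (auto simp: indicator_def)
  show ?thesis
  proof (rule that[of "sqrt (nsq \<psi>) * sqrt (nsq ?h)" "2 * (D * sqrt (nsq ?h))"])
    show "\<bar>s * mol \<psi> s g x\<bar> \<le> sqrt (nsq \<psi>) * sqrt (nsq ?h)" if "norm x \<le> R" "0 < s" "s \<le> 1" for x s
      using mol_sup[OF g_cutoff test_psi that(2), of "R + 1" x] that unfolding loc[OF that] by (simp add: abs_mult field_simps)
    show "\<bar>s * mol \<psi> s g x - s * mol \<psi> s g y\<bar> \<le> 2 * (D * sqrt (nsq ?h)) * norm (x - y) / s"
      if "norm x \<le> R" "norm y \<le> R" "0 < s" "s \<le> 1" for x y s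
    proof -
      have "s * \<bar>mol \<psi> s ?h x - mol \<psi> s ?h y\<bar> \<le> s * (2 * (D * sqrt (nsq ?h) / s\<^sup>2) * norm (x - y))"
        using mol_lipschitz[OF g_cutoff test_psi that(3) D(2), of "R + 1" x y] that by (intro mult_left_mono) auto
      also have "... = 2 * (D * sqrt (nsq ?h)) * norm (x - y) / s" using that by (simp add: power2_eq_square)
      finally show ?thesis using that unfolding loc[OF that(1,3,4)] loc[OF that(2,3,4)] by (simp add: abs_mult right_diff_distrib[symmetric])
    qed
  qed (use D in "auto intro!: mult_nonneg_nonneg nsq_nonneg")
qed

lemma poisson_integrable: "L1 (\<lambda>s. unit_ind s * (s * mol \<psi> s g x))"
proof -
  obtain C where C: "\<And>y s. norm y \<le> norm x ==> 0 < s ==> s \<le> 1 ==> \<bar>s * mol \<psi> s g y\<bar> \<le> C" by (rule poisson_kernel_bounds[of "norm x"]) blast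
  note [measurable] = test_fun_borel[OF test_psi]
  have "L1 (\<lambda>s::real. C * unit_ind s)" by simp
  then show ?thesis
    by (rule L1_bound) (use C[of x] in "auto simp: indicator_def intro!: AE_I2 intro: order_trans[OF _ abs_ge_self]")
qed

text \<open>Below scale \<open>norm (x - y)\<close> use boundedness of the kernel, above it the Lipschitz bound.\<close>

lemma poisson_lh: "lh (\<lambda>x. LBINT s. unit_ind s * (s * mol \<psi> s g x))"
proof (rule lhI)
  fix R :: real assume "R > 0"
  obtain C D where C: "C \<ge> 0" "D \<ge> 0" "\<And>x s. norm x \<le> R ==> 0 < s ==> s \<le> 1 ==> \<bar>s * mol \<psi> s g x\<bar> \<le> C"
    and D: "\<And>x y s. norm x \<le> R ==> norm y \<le> R ==> 0 < s ==> s \<le> 1 ==> \<bar>s * mol \<psi> s g x - s * mol \<psi> s g y\<bar> \<le> D * norm (x - y) / s"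
    by (rule poisson_kernel_bounds[of R]) blast
  have pt: "\<bar>s * mol \<psi> s g x - s * mol \<psi> s g y\<bar> \<le> (2 * C + D) * dist x y powr (1/2) * s powr (-(1/2))"
    if h: "norm x \<le> R" "norm y \<le> R" "0 < s" "s \<le> 1" for x y s
  proof -
    \<comment> \<open>With \<open>q\<close> the distance in units of the scale, the two bounds give
      a multiple of min 1 q, which is at most sqrt q. This yields the Hoelder exponent 1/2 and
      leaves s^(-1/2), integrable at zero.\<close>
    define q where "q = dist x y / s"
    have q: "q \<ge> 0" using h by (simp add: q_def)
    have "\<bar>s * mol \<psi> s g x - s * mol \<psi> s g y\<bar> \<le> (2 * C + D) * sqrt q"
    proof (cases "q \<le> 1")
      case True
      have "q * q \<le> 1 * q" using True q by (intro mult_right_mono) auto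
      then have "q \<le> sqrt q" using q by (simp add: real_le_rsqrt power2_eq_square)
      then have "D * q \<le> (2 * C + D) * sqrt q" using C q by (intro mult_mono) auto
      then show ?thesis using D[OF h] by (simp add: q_def dist_norm)
    next
      case False
      then have "1 \<le> sqrt q" by simp
      have "\<bar>s * mol \<psi> s g x - s * mol \<psi> s g y\<bar> \<le> 2 * C" using C(3)[of x s] C(3)[of y s] h by linarith
      also have "... \<le> (2 * C + D) * 1" using C(2) by simp
      also have "... \<le> (2 * C + D) * sqrt q" by (rule mult_left_mono[OF \<open>1 \<le> sqrt q\<close>]) (use C in simp)
      finally show ?thesis .
    qed
    also have "sqrt q = dist x y powr (1/2) * s powr (-(1/2))"
    proof -
      have "s powr (-(1/2)) = 1 / sqrt s" using h by (simp only: powr_minus powr_half_sqrt less_imp_le inverse_eq_divide)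
      then show ?thesis unfolding q_def real_sqrt_divide using powr_half_sqrt[of "dist x y"] by simp
    qed
    finally show ?thesis by (simp add: mult_ac)
  qed
  let ?K = "LBINT s. unit_ind s * s powr (-(1/2))"
  have iK: "L1 (\<lambda>s. unit_ind s * s powr (-(1/2)) :: real)" by (rule integrable_powr_unit) simp
  have "\<bar>(LBINT s. unit_ind s * (s * mol \<psi> s g x)) - (LBINT s. unit_ind s * (s * mol \<psi> s g y))\<bar>
      \<le> ((2 * C + D) * ?K) * dist x y powr (1/2)" if xy: "norm x \<le> R" "norm y \<le> R" for x y
  proof -
    have "\<bar>(LBINT s. unit_ind s * (s * mol \<psi> s g x)) - (LBINT s. unit_ind s * (s * mol \<psi> s g y))\<bar>
      = \<bar>LBINT s. unit_ind s * (s * mol \<psi> s g x) - unit_ind s * (s * mol \<psi> s g y)\<bar>"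
      using poisson_integrable by simp
    also have "... \<le> (LBINT s. \<bar>unit_ind s * (s * mol \<psi> s g x) - unit_ind s * (s * mol \<psi> s g y)\<bar>)"
      by (rule integral_abs_bound)
    also have "... \<le> (LBINT s. ((2 * C + D) * dist x y powr (1/2)) * (unit_ind s * s powr (-(1/2))))"
    proof (rule integral_mono)
      show "L1 (\<lambda>s. \<bar>unit_ind s * (s * mol \<psi> s g x) - unit_ind s * (s * mol \<psi> s g y)\<bar>)"
        by (intro integrable_abs L1_diff poisson_integrable)
      show "L1 (\<lambda>s. ((2 * C + D) * dist x y powr (1/2)) * (unit_ind s * s powr (-(1/2))))"
        by (intro integrable_mult_right iK)
      show "\<bar>unit_ind s * (s * mol \<psi> s g x) - unit_ind s * (s * mol \<psi> s g y)\<bar>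
         \<le> ((2 * C + D) * dist x y powr (1/2)) * (unit_ind s * s powr (-(1/2)))" for s
        using pt[OF xy, of s] by (cases "s \<in> {0<..<1}") auto
    qed
    also have "... = ((2 * C + D) * ?K) * dist x y powr (1/2)" unfolding integral_mult_right_zero by (simp only: mult_ac)
    finally show ?thesis .
  qed
  then show "\<exists>\<alpha> C. 0 < \<alpha> \<and> \<alpha> \<le> 1 \<and> (\<forall>x\<in>cball 0 R. \<forall>y\<in>cball 0 R.
      \<bar>(LBINT s. unit_ind s * (s * mol \<psi> s g x)) - (LBINT s. unit_ind s * (s * mol \<psi> s g y))\<bar> \<le> C * dist x y powr \<alpha>)"
    by (intro exI[of _ "1/2"] exI[of _ "(2 * C + D) * ?K"]) auto
qed

text \<open>At t = 1 the reproducing formula becomes a parametrix: up to \<open>mass\<close>,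
  \<open>u\<close> is a mollification at scale one, which is smooth, minus a scale integral of its
  weak Laplacian.\<close>

lemma poisson_representation:
  assumes u: "sqint u" and w: "weak_lap u g"
  shows "AE x in lborel. u x = (1 / mass) * (mol \<rho> 1 u x + (-1) * (LBINT s. unit_ind s * (s * mol \<psi> s g x)))"
proof -
  note [measurable] = test_fun_borel[OF test_psi]
  have "AE x in lborel. L1 (\<lambda>s. unit_ind s * (s * mol \<psi> s g x)) \<and>
     (\<forall>t. 0 < t \<and> t \<le> 1 --> mass * u x = mol \<rho> t u x - (LBINT s. indicator {0<..<t} s * (s * mol \<psi> s g x)))"
  proof (rule mol_reproducing[OF sqint_locint[OF u]])
    show "(\<lambda>(x, s). s * mol \<psi> s g x) \<in> Bor"
      unfolding borel_prod[symmetric] case_prod_beta' by measurable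
    show "((\<lambda>s. mol \<rho> s u x) has_real_derivative s * mol \<psi> s g x) (at s)" if "0 < s" for x s
      by (rule mol_rho_sderiv_lap[OF sqint_locint[OF u] g_locint w that])
    show "continuous_on {0<..} (\<lambda>s. s * mol \<psi> s g x)" for x
      by (intro continuous_intros mol_continuous_scale g_locint test_psi)
    fix R
    obtain C where C: "\<And>y s. norm y \<le> R ==> 0 < s ==> s \<le> 1 ==> \<bar>s * mol \<psi> s g y\<bar> \<le> C" by (rule poisson_kernel_bounds[of R]) blast
    have "integrable lborel2 (\<lambda>p::R2 \<times> real. C * (indicator (cball 0 R) (fst p) * indicator {0<..<1} (snd p)))"
      by (intro integrable_mult_right integrable_prod_mult lborel.sigma_finite_measure_axioms integrable_indicator_cball) simp
    then show "integrable lborel2 (\<lambda>(x, s). indicator (cball 0 R) x * (unit_ind s * (s * mol \<psi> s g x)))"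
    proof (rule L1_bound)
      show "(\<lambda>(x, s). indicator (cball 0 R) x * (unit_ind s * (s * mol \<psi> s g x))) \<in> borel_measurable lborel2"
        unfolding case_prod_beta' by measurable
    qed (use C in "auto simp: indicator_def split_beta intro!: AE_I2 intro: order_trans[OF _ abs_ge_self]")
  qed
  then show ?thesis by (rule AE_mp) (use mass_pos in "auto intro!: AE_I2 simp: field_simps")
qed

end

lemma mol_rho_lh: assumes u: "sqint u" shows "lh (mol \<rho> 1 u)"
proof (rule lhI)
  obtain D where D: "D \<ge> 0" "\<And>i. i \<in> (Basis :: R2 set) ==> sqrt (nsq (pdv i \<rho>)) \<le> D" by (rule test_fun_gradient_bound[of \<rho>]) blast
  show "\<exists>\<alpha> C. 0 < \<alpha> \<and> \<alpha> \<le> 1 \<and> (\<forall>x\<in>cball 0 R. \<forall>y\<in>cball 0 R. \<bar>mol \<rho> 1 u x - mol \<rho> 1 u y\<bar> \<le> C * dist x y powr \<alpha>)" for R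
    using mol_lipschitz[OF u test_rho zero_less_one D(2)]
    by (intro exI[of _ 1] exI[of _ "2 * (D * sqrt (nsq u))"]) (auto simp: dist_norm)
qed

text \<open>The first regularity step: a locally square integrable right-hand side already makes
  \<open>u\<close> Hoelder continuous. For a right-hand side built from \<open>u\<close>, this
  prepares \<open>weak_lap_classical\<close>.\<close>

lemma weak_lap_regular:
  assumes u: "sqint u" and g: "locally_L2 g" and w: "weak_lap u g"
  obtains v where "lh v" "AE x in lborel. v x = u x"
proof (rule that)
  let ?v = "\<lambda>x. (1 / mass) * (mol \<rho> 1 u x + (-1) * (LBINT s. unit_ind s * (s * mol \<psi> s g x)))"
  show "lh ?v" by (intro lh_mult lh_add lh_const mol_rho_lh[OF u] locally_L2.poisson_lh[OF g])
  show "AE x in lborel. ?v x = u x" using locally_L2.poisson_representation[OF g u w] by eventually_elim simp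
qed

lemma lh_locally_L2: assumes "lh g" shows "locally_L2 g"
proof
  have c: "continuous_on UNIV g" by (rule lh_continuous[OF assms])
  show "g \<in> Bor" by (rule borel_measurable_continuous_onI[OF c])
  show "L1 (\<lambda>x. indicator (cball 0 r) x * (g x)\<^sup>2)" for r
    by (rule locint_ball[OF locint_continuous]) (intro continuous_intros c)
qed

lemma laplacian_eq_of_weak_lap:
  assumes v: "Ck 2 v" and g: "continuous_on UNIV g" and w: "weak_lap v g"
  shows "laplacian v x = g x"
proof -
  have v1: "Ck 1 v" and v2: "\<And>i. i \<in> Basis ==> Ck 1 (pdv i v)" and v3: "\<And>i. i \<in> Basis ==> continuous_on UNIV (pdv i (pdv i v))"
    using v Ck_dec[of 1 v] by (auto simp: numeral_2_eq_2 Ck_Suc Ck_0)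
  have cl: "continuous_on UNIV (laplacian v)" unfolding laplacian_def[abs_def] by (intro continuous_on_sum v3)
  have l3: "\<And>i. i \<in> Basis ==> locint (pdv i (pdv i v))" using v3 by (rule locint_continuous)
  have "(LBINT x. laplacian v x * \<phi> x) = (LBINT x. g x * \<phi> x)" if \<phi>: "test_fun \<phi>" for \<phi>
  proof -
    have ibp: "(LBINT x. v x * pdv i (pdv i \<phi>) x) = (LBINT x. pdv i (pdv i v) x * \<phi> x)" if i: "i \<in> Basis" for i
      using integration_by_parts[OF v1 test_fun_pdv[OF \<phi> i] i] integration_by_parts[OF v2[OF i] \<phi> i] by simp
    have "(LBINT x. laplacian v x * \<phi> x) = (\<Sum>i\<in>Basis. LBINT x. pdv i (pdv i v) x * \<phi> x)"
      unfolding laplacian_def sum_distrib_right by (rule Bochner_Integration.integral_sum) (rule locint_test[OF l3 \<phi>])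
    also have "... = (\<Sum>i\<in>Basis. LBINT x. v x * pdv i (pdv i \<phi>) x)" by (intro sum.cong) (simp_all add: ibp)
    also have "... = (LBINT x. v x * laplacian \<phi> x)"
      unfolding laplacian_def sum_distrib_left
      by (rule Bochner_Integration.integral_sum[symmetric]) (intro locint_test locint_continuous Ck_cont[OF v] test_fun_pdv \<phi>)
    also have "... = (LBINT x. g x * \<phi> x)" using w \<phi> by (simp add: weak_lap_def)
    finally show ?thesis .
  qed
  then have "AE x in lborel. laplacian v x = g x" by (intro fundamental_lemma locint_continuous cl g)
  then show ?thesis by (rule continuous_AE_eq[OF cl g])
qed

lemma weak_lap_cong:
  assumes w: "weak_lap u g" and [measurable]: "u \<in> Bor" "u' \<in> Bor" "g \<in> Bor" "g' \<in> Bor"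
    and uu: "AE x in lborel. u' x = u x" and gg: "AE x in lborel. g' x = g x"
  shows "weak_lap u' g'"
  unfolding weak_lap_def
proof (intro allI impI)
  fix \<phi> assume \<phi>: "test_fun \<phi>"
  note [measurable] = test_fun_borel[OF \<phi>] test_fun_borel[OF test_fun_laplacian[OF \<phi>]]
  have "(LBINT x. u' x * laplacian \<phi> x) = (LBINT x. u x * laplacian \<phi> x)" using uu by (intro integral_cong_AE) auto
  moreover have "(LBINT x. g' x * \<phi> x) = (LBINT x. g x * \<phi> x)" using gg by (intro integral_cong_AE) auto
  ultimately show "(LBINT x. u' x * laplacian \<phi> x) = (LBINT x. g' x * \<phi> x)" using w \<phi> by (simp add: weak_lap_def)
qed

lemma weak_lap_classical:
  assumes u: "sqint u" "continuous_on UNIV u" and g: "lh g" and w: "weak_lap u g"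
  shows "Ck 2 u" "laplacian u x = g x"
proof -
  let ?v = "\<lambda>x. (1 / mass) * (mol \<rho> 1 u x + (-1) * (LBINT s. unit_ind s * (s * mol \<psi> s g x)))"
  have C: "Ck 2 ?v" by (intro Ck_mult Ck_add Ck_const poisson_C2[OF g] mol_Ck sqint_locint u test_rho) simp
  have "u = ?v"
    using locally_L2.poisson_representation[OF lh_locally_L2[OF g] u(1) w] continuous_AE_eq[OF u(2) Ck_cont[OF C]] by blast
  then show C2: "Ck 2 u" using C by metis
  show "laplacian u x = g x" by (rule laplacian_eq_of_weak_lap[OF C2 lh_continuous[OF g] w])
qed

text \<open>The spherical-type mean \<open>m s = mol \<rho> s a x0\<close> satisfies \<open>m' \<le> C m\<close> and vanishes at scale zero, so it vanishes identically.\<close>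

lemma strong_maximum_principle:
  assumes a: "continuous_on UNIV a" "\<And>x. a x \<ge> 0" and h: "locint h" and w: "weak_lap a h"
    and le: "\<And>R. \<exists>C\<ge>0. \<forall>x. norm x \<le> R --> h x \<le> C * a x" and x0: "a x0 = 0"
  shows "a x = 0"
proof -
  have al: "locint a" by (rule locint_continuous[OF a(1)])
  \<comment> \<open>Radius one because \<open>\<rho>\<close> is positive on the open unit ball: a
    vanishing mean of the nonnegative \<open>a\<close> at scale one forces \<open>a\<close> to
    vanish there. The zero set is therefore open as well as closed.\<close>
  have zball: "a y = 0" if z: "a z = 0" and y: "dist z y < 1" for z y
  proof -
    obtain C where C: "C \<ge> 0" "\<And>x. norm x \<le> norm z + 1 ==> h x \<le> C * a x" using le by blast
    define m where "m s = mol \<rho> s a z" for s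
    have m: "(m has_real_derivative s * mol \<psi> s h z) (at s)" if "s > 0" for s
      unfolding m_def by (rule mol_rho_sderiv_lap[OF al h w that])
    have m0: "m s \<ge> 0" for s unfolding m_def mol_def by (intro integral_nonneg_AE) (simp add: a rho_nonneg)
    \<comment> \<open>From h \<le> C a and 2 \<psi> \<le> \<rho> the mean of \<open>h\<close>
      against \<open>\<psi>\<close> is at most \<open>C\<close> times the mean of \<open>a\<close>
      against \<open>\<rho>\<close>; the factor \<open>s\<close> is at most one.\<close>
    have mle: "s * mol \<psi> s h z \<le> C * m s" if s: "0 < s" "s \<le> 1" for s
    proof -
      have "mol \<psi> s h z \<le> C * m s"
        unfolding m_def mol_def integral_mult_right_zero[symmetric]
      proof (rule integral_mono)
        show "L1 (\<lambda>y. h (z - s *\<^sub>R y) * \<psi> y)" by (rule mol_integrable[OF h test_psi s(1)])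
        show "L1 (\<lambda>y. C * (a (z - s *\<^sub>R y) * \<rho> y))" by (intro integrable_mult_right mol_integrable[OF al test_rho s(1)])
        fix y
        show "h (z - s *\<^sub>R y) * \<psi> y \<le> C * (a (z - s *\<^sub>R y) * \<rho> y)"
        proof (cases "norm y \<le> 1")
          case True
          have "norm (s *\<^sub>R y) \<le> 1" using True s by (simp add: mult_le_one)
          then have "h (z - s *\<^sub>R y) \<le> C * a (z - s *\<^sub>R y)" using norm_triangle_ineq4[of z "s *\<^sub>R y"] by (intro C) simp
          then have "h (z - s *\<^sub>R y) * \<psi> y \<le> C * a (z - s *\<^sub>R y) * \<psi> y" by (intro mult_right_mono psi_nonneg)
          also have "... \<le> C * a (z - s *\<^sub>R y) * \<rho> y" using psi_le_rho[of y] psi_nonneg[of y] C(1) a(2) by (intro mult_left_mono mult_nonneg_nonneg) auto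
          finally show ?thesis by (simp add: mult_ac)
        qed (simp add: psi_outside rho_outside)
      qed
      then have "s * mol \<psi> s h z \<le> s * (C * m s)" using s by (intro mult_left_mono) auto
      also have "... \<le> 1 * (C * m s)" using s C m0 by (intro mult_right_mono mult_nonneg_nonneg) auto
      finally show ?thesis by simp
    qed
    \<comment> \<open>The differential inequality makes m(s) exp(-C s) nonincreasing, so its value
      at scale one is bounded by its values at small scales, which continuity of \<open>a\<close> at
      the zero \<open>z\<close> makes arbitrarily small.\<close>
    have mono: "m 1 * exp (- C * 1) \<le> m s * exp (- C * s)" if s: "0 < s" "s < 1" for s
    proof (rule DERIV_nonpos_imp_nonincreasing[of s 1 "\<lambda>s. m s * exp (- C * s)"])
      fix t assume t: "s \<le> t" "t \<le> 1"
      then have "t > 0" using s by simp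
      have "((\<lambda>s. m s * exp (- C * s)) has_real_derivative (t * mol \<psi> t h z - C * m t) * exp (- C * t)) (at t)"
        by (auto intro!: derivative_eq_intros m[OF \<open>t > 0\<close>] simp: algebra_simps)
      moreover have "(t * mol \<psi> t h z - C * m t) * exp (- C * t) \<le> 0"
        using mle[of t] t \<open>t > 0\<close> by (intro mult_nonpos_nonneg) auto
      ultimately show "\<exists>y. ((\<lambda>s. m s * exp (- C * s)) has_real_derivative y) (at t) \<and> y \<le> 0" by blast
    qed (use s in simp)
    have I: "(LBINT y. \<bar>\<rho> y\<bar>) = mass" by (simp add: mass_def rho_nonneg)
    have "m 1 * exp (- C) \<le> 0 + e" if e: "e > 0" for e
    proof -
      have "isCont a z" using a(1) by (simp add: continuous_on_eq_continuous_at)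
      then obtain d where d: "d > 0" "\<And>y. dist y z < d ==> dist (a y) (a z) < e / mass"
        using mass_pos e unfolding continuous_at_eps_delta by (metis divide_pos_pos)
      define s where "s = min (d / 2) (1 / 2)"
      have s: "0 < s" "s < 1" "s < d" using d by (auto simp: s_def)
      have "\<bar>m s\<bar> \<le> e / mass * (LBINT y. \<bar>\<rho> y\<bar>)" unfolding m_def
      proof (rule mol_abs_le[OF al test_rho rho_outside s(1), where c=0])
        fix y assume "norm (z - y) \<le> s"
        then have "dist y z < d" using s by (simp add: dist_norm norm_minus_commute)
        from d(2)[OF this] show "\<bar>a y - 0\<bar> \<le> e / mass" by (simp add: dist_real_def z)
      qed auto
      then have "m s \<le> e" unfolding I using mass_pos by simp
      moreover have "m s * exp (- C * s) \<le> m s * 1" using m0[of s] C(1) s by (intro mult_left_mono) auto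
      ultimately show ?thesis using mono[OF s(1,2)] by simp
    qed
    then have "m 1 * exp (- C) \<le> 0" by (rule field_le_epsilon)
    then have "m 1 = 0" using m0[of 1] by (simp add: mult_le_0_iff)
    then have "AE y in lborel. a (z - 1 *\<^sub>R y) * \<rho> y = 0"
      unfolding m_def mol_def using mol_integrable[OF al test_rho zero_less_one, of z]
      by (subst integral_nonneg_eq_0_iff_AE[symmetric]) (auto simp: a rho_nonneg)
    then have "a (z - 1 *\<^sub>R (z - y)) * \<rho> (z - y) = 0"
      by (intro continuous_AE_eq[of "\<lambda>y. a (z - 1 *\<^sub>R y) * \<rho> y" "\<lambda>y. 0"])
         (auto intro!: continuous_intros continuous_on_compose2[OF a(1)] test_fun_cont[OF test_rho])
    moreover have "\<rho> (z - y) > 0" using y by (intro rho_pos) (simp add: dist_norm)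
    ultimately show ?thesis by simp
  qed
  have "open {x. a x = 0}" unfolding open_dist using zball by (intro ballI exI[of _ 1]) (auto simp: dist_commute)
  moreover have "closed {x. a x = 0}" using a(1) by (intro closed_Collect_eq) auto
  ultimately have "{x. a x = 0} = UNIV" using x0 clopen[of "{x. a x = 0}"] by blast
  then show ?thesis by blast
qed

section \<open>Regularity and sign of minimizers\<close>

text \<open>For x = y (1 + t) with t \<ge> 0: ln (1 + t) = 2 ln (sqrt (1 + t)) \<le> 2 sqrt t. The
  modulus of exponent 1/2 leaves inverse square roots of distances, which are square integrable near
  their singularity in the plane.\<close>

lemma ln_diff_le_sqrt: assumes "0 < x" "0 < (y::real)" shows "\<bar>ln x - ln y\<bar> \<le> 2 * sqrt \<bar>x - y\<bar> * (1 / sqrt x + 1 / sqrt y)"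
proof -
  have *: "\<bar>ln x - ln y\<bar> \<le> 2 * sqrt \<bar>x - y\<bar> * (1 / sqrt x + 1 / sqrt y)" if "0 < y" "y \<le> x" for x y :: real
  proof -
    define t where "t = (x - y) / y"
    have t: "t \<ge> 0" and xt: "x = y * (1 + t)" using that by (auto simp: t_def field_simps)
    have s1: "sqrt (1 + t) \<le> 1 + sqrt t" using sqrt_add_le_add_sqrt[of 1 t] t by simp
    have "\<bar>ln x - ln y\<bar> = ln (1 + t)" using that t xt by (simp add: ln_mult)
    also have "... = 2 * ln (sqrt (1 + t))" using t by (simp add: ln_sqrt)
    also have "... \<le> 2 * (sqrt (1 + t) - 1)" using t by (intro mult_left_mono ln_le_minus_one) auto
    also have "... \<le> 2 * sqrt t" using s1 by simp
    also have "... = 2 * sqrt \<bar>x - y\<bar> * (1 / sqrt y)" using that by (simp add: t_def real_sqrt_divide)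
    also have "... \<le> 2 * sqrt \<bar>x - y\<bar> * (1 / sqrt x + 1 / sqrt y)" using that by (intro mult_left_mono) auto
    finally show ?thesis .
  qed
  show ?thesis using *[of y x] *[of x y] assms by (cases "y \<le> x") (auto simp: abs_minus_commute add.commute)
qed

lemma abs_powr_mult_self_sq: "(\<bar>t\<bar> powr (q - 2) * t)\<^sup>2 = \<bar>t\<bar> powr (2 * (q - 1))" for t q :: real
proof -
  have "(\<bar>t\<bar> powr (q - 2) * t)\<^sup>2 = (\<bar>t\<bar> powr (q - 2))\<^sup>2 * (\<bar>t\<bar> powr 1)\<^sup>2" by (simp add: power_mult_distrib)
  also have "... = \<bar>t\<bar> powr ((q - 2) + (q - 2) + (1 + 1))" by (simp only: power2_eq_square powr_add mult.assoc)
  also have "(q - 2) + (q - 2) + (1 + 1) = 2 * (q - 1)" by simp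
  finally show ?thesis .
qed

lemma inverse_sqrt_le_kap: "1 / sqrt (norm z) \<le> 1 + sqrt (kap z)"
proof (cases "norm z \<le> 1")
  case True then show ?thesis by (simp add: kap_def real_sqrt_divide)
next
  case False
  then have "1 \<le> sqrt (norm z)" by simp
  then have "1 / sqrt (norm z) \<le> 1" by (simp only: divide_le_eq_1) simp
  also have "1 \<le> 1 + sqrt (kap z)" using kap_nonneg[of z] by simp
  finally show ?thesis .
qed

context planar
begin

lemma Pot_integrable: assumes u: "u \<in> X" shows "L1 (\<lambda>y. ln (dist x y) * (u y)\<^sup>2)"
proof (rule L1_bound)
  note [measurable] = XD(2)[OF u]
  show "L1 (\<lambda>y. lgw x * (u y)\<^sup>2 + lgw y * (u y)\<^sup>2 + 2 * (sqrt (kap (x - y)) * (u y)\<^sup>2))"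
    by (intro L1_add integrable_mult_right XD[OF u] sqrt_kap_conv(1) X_sq_sqint[OF u])
  show "(\<lambda>y. ln (dist x y) * (u y)\<^sup>2) \<in> borel_measurable lborel" by measurable
  show "AE y in lborel. norm (ln (dist x y) * (u y)\<^sup>2) \<le> norm (lgw x * (u y)\<^sup>2 + lgw y * (u y)\<^sup>2 + 2 * (sqrt (kap (x - y)) * (u y)\<^sup>2))"
  proof (rule AE_I2)
    fix y
    have "\<bar>ln (dist x y)\<bar> * (u y)\<^sup>2 \<le> (lgw x + lgw y + 2 * sqrt (kap (x - y))) * (u y)\<^sup>2" by (intro mult_right_mono ln_abs_le) simp
    also have "... \<le> \<bar>...\<bar>" by simp
    finally show "norm (ln (dist x y) * (u y)\<^sup>2) \<le> norm (lgw x * (u y)\<^sup>2 + lgw y * (u y)\<^sup>2 + 2 * (sqrt (kap (x - y)) * (u y)\<^sup>2))"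
      by (simp add: abs_mult algebra_simps)
  qed
qed

text \<open>Distances to a common point differ by at most dist x z, so
  \<open>ln_diff_le_sqrt\<close> produces the factor sqrt (dist x z). The inverse square roots are
  integrated against u^2 by Cauchy-Schwarz with the square root of \<open>kap\<close>, uniformly in
  both points.\<close>

lemma Pot_lh: assumes u: "u \<in> X" shows "lh (Pot u)"
proof (rule lhI)
  fix R :: real
  define K where "K = 4 * (LBINT y. (u y)\<^sup>2) + 4 * (sqrt kapc * sqrt (nsq (\<lambda>y. (u y)\<^sup>2)))"
  have "\<bar>Pot u x - Pot u z\<bar> \<le> K * dist x z powr (1/2)" for x z
  proof -
    let ?d = "sqrt (dist x z)"
    have ne: "AE y in lborel. y \<noteq> x \<and> y \<noteq> z" using AE_lborel_singleton[of x] AE_lborel_singleton[of z] by eventually_elim auto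
    have "\<bar>Pot u x - Pot u z\<bar> = \<bar>LBINT y. ln (dist x y) * (u y)\<^sup>2 - ln (dist z y) * (u y)\<^sup>2\<bar>"
      unfolding Pot_def using Pot_integrable[OF u] by simp
    also have "... \<le> (LBINT y. \<bar>ln (dist x y) * (u y)\<^sup>2 - ln (dist z y) * (u y)\<^sup>2\<bar>)" by (rule integral_abs_bound)
    also have "... \<le> (LBINT y. 2 * ?d * (2 * (u y)\<^sup>2 + sqrt (kap (x - y)) * (u y)\<^sup>2 + sqrt (kap (z - y)) * (u y)\<^sup>2))"
    proof (rule integral_mono_AE)
      show "L1 (\<lambda>y. \<bar>ln (dist x y) * (u y)\<^sup>2 - ln (dist z y) * (u y)\<^sup>2\<bar>)"
        by (intro integrable_abs L1_diff Pot_integrable u)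
      show "L1 (\<lambda>y. 2 * ?d * (2 * (u y)\<^sup>2 + sqrt (kap (x - y)) * (u y)\<^sup>2 + sqrt (kap (z - y)) * (u y)\<^sup>2))"
        by (intro L1_add integrable_mult_right XD[OF u] sqrt_kap_conv(1) X_sq_sqint[OF u])
      show "AE y in lborel. \<bar>ln (dist x y) * (u y)\<^sup>2 - ln (dist z y) * (u y)\<^sup>2\<bar> \<le> 2 * ?d * (2 * (u y)\<^sup>2 + sqrt (kap (x - y)) * (u y)\<^sup>2 + sqrt (kap (z - y)) * (u y)\<^sup>2)"
        using ne
      proof eventually_elim
        fix y assume y: "y \<noteq> x \<and> y \<noteq> z"
        have tri: "\<bar>dist x y - dist z y\<bar> \<le> dist x z" using dist_triangle[of x y z] dist_triangle[of z y x] by (simp add: dist_commute abs_le_iff)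
        have "\<bar>ln (dist x y) - ln (dist z y)\<bar> \<le> 2 * sqrt \<bar>dist x y - dist z y\<bar> * (1 / sqrt (dist x y) + 1 / sqrt (dist z y))"
          using y by (intro ln_diff_le_sqrt) auto
        also have "... \<le> 2 * ?d * ((1 + sqrt (kap (x - y))) + (1 + sqrt (kap (z - y))))"
          unfolding dist_norm using inverse_sqrt_le_kap[of "x - y"] inverse_sqrt_le_kap[of "z - y"] tri
          by (intro mult_mono add_mono) (auto simp: dist_norm kap_nonneg)
        finally have "\<bar>ln (dist x y) - ln (dist z y)\<bar> * (u y)\<^sup>2 \<le> (2 * ?d * ((1 + sqrt (kap (x - y))) + (1 + sqrt (kap (z - y))))) * (u y)\<^sup>2"
          by (rule mult_right_mono) simp
        then show "\<bar>ln (dist x y) * (u y)\<^sup>2 - ln (dist z y) * (u y)\<^sup>2\<bar> \<le> 2 * ?d * (2 * (u y)\<^sup>2 + sqrt (kap (x - y)) * (u y)\<^sup>2 + sqrt (kap (z - y)) * (u y)\<^sup>2)"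
          by (simp add: left_diff_distrib[symmetric] abs_mult) (simp add: algebra_simps)
      qed
    qed
    also have "... = 2 * ?d * (2 * (LBINT y. (u y)\<^sup>2) + (LBINT y. sqrt (kap (x - y)) * (u y)\<^sup>2) + (LBINT y. sqrt (kap (z - y)) * (u y)\<^sup>2))"
      using XD(3)[OF u] sqrt_kap_conv(1)[OF X_sq_sqint[OF u]] by simp
    also have "... \<le> 2 * ?d * (2 * (LBINT y. (u y)\<^sup>2) + sqrt kapc * sqrt (nsq (\<lambda>y. (u y)\<^sup>2)) + sqrt kapc * sqrt (nsq (\<lambda>y. (u y)\<^sup>2)))"
      using sqrt_kap_conv(2)[OF X_sq_sqint[OF u], of x] sqrt_kap_conv(2)[OF X_sq_sqint[OF u], of z] by (intro mult_left_mono add_mono) auto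
    also have "... = K * dist x z powr (1/2)" by (simp add: K_def powr_half_sqrt algebra_simps)
    finally show ?thesis .
  qed
  then show "\<exists>\<alpha> C. 0 < \<alpha> \<and> \<alpha> \<le> 1 \<and> (\<forall>x\<in>cball 0 R. \<forall>y\<in>cball 0 R. \<bar>Pot u x - Pot u y\<bar> \<le> C * dist x y powr \<alpha>)"
    by (intro exI[of _ "1/2"] exI[of _ K]) auto
qed

text \<open>The Laplacian of a solution as the equation prescribes it. The potential is an argument
  because the weak equation is derived with \<open>W\<close>, while regularity uses the Hoelder
  continuous function that equals \<open>W\<close> almost everywhere.\<close>

definition rhs :: "(R2 => real) => (R2 => real) => R2 => real" where
  "rhs V u x = (V x + 1 / (2 * pi) * Pot u x) * u x - b * (\<bar>u x\<bar> powr (p - 2) * u x)"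

lemma gr_test: assumes \<phi>: "test_fun \<phi>" shows "AE x in lborel. gr \<phi> x = (\<Sum>i\<in>Basis. pdv i \<phi> x *\<^sub>R i)"
  by (rule sob_unique[OF X_sob[OF test_X[OF \<phi>]] sob_Ck(1)]) (auto intro: test_fun_Ck test_sqint test_fun_pdv \<phi>)

lemma critical_weak_lap:
  assumes u: "u \<in> X" and crit: "\<And>\<phi>. test_fun \<phi> ==> dJ u \<phi> = 0"
  shows "weak_lap u (rhs W u)"
  unfolding weak_lap_def
proof (intro allI impI)
  fix \<phi> assume \<phi>: "test_fun \<phi>"
  note ub [measurable] = XD(2)[OF u]
  note \<phi>X = test_X[OF \<phi>]
  note [measurable] = test_fun_borel[OF \<phi>] sqint_borel[OF XD(4)[OF u]] sqint_borel[OF XD(4)[OF \<phi>X]]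
  have pb: "pdv i \<phi> \<in> Bor" if "i \<in> Basis" for i using test_fun_borel[OF test_fun_pdv[OF \<phi> that]] .
  have gri: "L1 (\<lambda>x. (gr u x \<bullet> i) * pdv i \<phi> x)" if i: "i \<in> Basis" for i
  proof (rule sqint_prod(1))
    show "sqint (\<lambda>x. gr u x \<bullet> i)" by (rule sqint_bound(1)[OF XD(4)[OF u]]) (auto intro!: AE_I2 Basis_le_norm i)
    show "sqint (pdv i \<phi>)" by (rule test_sqint[OF test_fun_pdv[OF \<phi> i]])
  qed
  have upi: "L1 (\<lambda>x. u x * pdv i (pdv i \<phi>) x)" if i: "i \<in> Basis" for i
    by (intro locint_test sqint_locint XD(1)[OF u] test_fun_pdv \<phi> i)
  have "(LBINT x. gr u x \<bullet> gr \<phi> x) = (LBINT x. (\<Sum>i\<in>Basis. (gr u x \<bullet> i) * pdv i \<phi> x))"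
  proof (rule integral_cong_AE)
    show "(\<lambda>x. \<Sum>i\<in>Basis. gr u x \<bullet> i * pdv i \<phi> x) \<in> borel_measurable lborel"
      using pb by (intro borel_measurable_sum) auto
    show "AE x in lborel. gr u x \<bullet> gr \<phi> x = (\<Sum>i\<in>Basis. (gr u x \<bullet> i) * pdv i \<phi> x)"
      using gr_test[OF \<phi>] by eventually_elim (simp add: inner_sum_right mult.commute)
  qed measurable
  also have "... = (\<Sum>i\<in>Basis. LBINT x. (gr u x \<bullet> i) * pdv i \<phi> x)" by (rule Bochner_Integration.integral_sum) (rule gri)
  also have "... = (\<Sum>i\<in>Basis. - (LBINT x. u x * pdv i (pdv i \<phi>) x))"
    by (intro sum.cong refl) (simp add: sobD(3)[OF X_sob[OF u] test_fun_pdv[OF \<phi>]])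
  also have "... = - (LBINT x. u x * laplacian \<phi> x)"
    unfolding laplacian_def sum_distrib_left sum_negf using upi by (subst Bochner_Integration.integral_sum) auto
  finally have g: "(LBINT x. gr u x \<bullet> gr \<phi> x) = - (LBINT x. u x * laplacian \<phi> x)" .
  have i1: "L1 (\<lambda>x. W x * (u x * \<phi> x))"
    by (rule weighted_lincomb(2)[OF W_borel XD(2)[OF u] XD(2)[OF \<phi>X] W_nonneg XD(5)[OF u] XD(5)[OF \<phi>X]])
  have i2: "L1 (\<lambda>x. Pot u x * (u x * \<phi> x))" by (rule Nen_deriv(2)[OF u \<phi>X])
  have "locint (\<lambda>x. \<bar>u x\<bar> powr (p - 2) * u x)"
  proof (rule locint_L2)
    have "L1 (\<lambda>x. \<bar>u x\<bar> powr (2 * (p - 1)))" using p4 by (intro X_powr u) simp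
    then have "L1 (\<lambda>x. (\<bar>u x\<bar> powr (p - 2) * u x)\<^sup>2)" by (simp only: abs_powr_mult_self_sq)
    then show "L1 (\<lambda>x. indicator (cball 0 r) x * (\<bar>u x\<bar> powr (p - 2) * u x)\<^sup>2)" for r
      using integrable_mult_indicator[of "cball (0::R2) r" lborel "\<lambda>x. (\<bar>u x\<bar> powr (p - 2) * u x)\<^sup>2"] by simp
  qed measurable
  then have i3: "L1 (\<lambda>x. \<bar>u x\<bar> powr (p - 2) * u x * \<phi> x)" by (rule locint_test[OF _ \<phi>])
  have "(LBINT x. rhs W u x * \<phi> x) = (LBINT x. W x * (u x * \<phi> x) + 1 / (2 * pi) * (Pot u x * (u x * \<phi> x)) - b * (\<bar>u x\<bar> powr (p - 2) * u x * \<phi> x))"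
    by (intro Bochner_Integration.integral_cong refl) (simp add: rhs_def algebra_simps)
  also have "... = (LBINT x. W x * (u x * \<phi> x)) + 1 / (2 * pi) * (LBINT x. Pot u x * (u x * \<phi> x)) - b * (LBINT x. \<bar>u x\<bar> powr (p - 2) * u x * \<phi> x)"
    using i1 i2 i3 by (subst Bochner_Integration.integral_diff) (auto simp del: times_divide_eq_left times_divide_eq_right)
  finally show "(LBINT x. u x * laplacian \<phi> x) = (LBINT x. rhs W u x * \<phi> x)"
    using crit[OF \<phi>] g by (simp add: dJ_def Bform_def)
qed

lemma rhs_borel: assumes u: "u \<in> X" and [measurable]: "V \<in> Bor" "w \<in> Bor" and "Pot w = Pot u"
  shows "rhs V w \<in> Bor"
proof -
  note [measurable] = borel_measurable_continuous_onI[OF lh_continuous[OF Pot_lh[OF u]]]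
  show ?thesis unfolding rhs_def[abs_def] assms(4) by measurable
qed

text \<open>The linear term is controlled by local boundedness of \<open>V\<close> and of the
  logarithmic potential; the power term is square integrable because the Sobolev inequality covers
  the exponent 2(p - 1).\<close>

lemma rhs_locally_L2: assumes u: "u \<in> X" and V: "lh V" shows "locally_L2 (rhs V u)"
proof
  note [measurable] = XD(2)[OF u]
  have Vb [measurable]: "V \<in> Bor" by (rule borel_measurable_continuous_onI[OF lh_continuous[OF V]])
  show [measurable]: "rhs V u \<in> Bor" by (rule rhs_borel[OF u]) auto
  fix r
  have "continuous_on UNIV (\<lambda>x. V x + 1 / (2 * pi) * Pot u x)" by (intro continuous_intros lh_continuous V Pot_lh u)
  from continuous_bounded_cball[OF this, of r]
  obtain B where B: "B > 0" "\<And>x. norm x \<le> r ==> \<bar>V x + 1 / (2 * pi) * Pot u x\<bar> \<le> B" by blast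
  have i: "L1 (\<lambda>x. 2 * (B\<^sup>2 * (u x)\<^sup>2) + 2 * (b\<^sup>2 * \<bar>u x\<bar> powr (2 * (p - 1))))"
    using p4 by (intro L1_add integrable_mult_right XD(3)[OF u] X_powr u) simp
  show "L1 (\<lambda>x. indicator (cball 0 r) x * (rhs V u x)\<^sup>2)"
  proof (rule L1_bound[OF i])
    show "AE x in lborel. norm (indicator (cball 0 r) x * (rhs V u x)\<^sup>2) \<le> norm (2 * (B\<^sup>2 * (u x)\<^sup>2) + 2 * (b\<^sup>2 * \<bar>u x\<bar> powr (2 * (p - 1))))"
    proof (rule AE_I2)
      fix x
      show "norm (indicator (cball 0 r) x * (rhs V u x)\<^sup>2) \<le> norm (2 * (B\<^sup>2 * (u x)\<^sup>2) + 2 * (b\<^sup>2 * \<bar>u x\<bar> powr (2 * (p - 1))))"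
      proof (cases "norm x \<le> r")
        case True
        let ?a = "(V x + 1 / (2 * pi) * Pot u x) * u x" and ?c = "b * (\<bar>u x\<bar> powr (p - 2) * u x)"
        have "(?a - ?c)\<^sup>2 \<le> 2 * ?a\<^sup>2 + 2 * ?c\<^sup>2" using sum_squares_bound[of "?a" "- ?c"] by (simp add: power2_diff)
        moreover have "?a\<^sup>2 \<le> B\<^sup>2 * (u x)\<^sup>2"
          unfolding power_mult_distrib using power_mono[OF B(2)[OF True], of 2] by (intro mult_right_mono) simp_all
        moreover have "?c\<^sup>2 = b\<^sup>2 * \<bar>u x\<bar> powr (2 * (p - 1))" by (simp only: power_mult_distrib[of b] abs_powr_mult_self_sq)
        ultimately have "(rhs V u x)\<^sup>2 \<le> 2 * (B\<^sup>2 * (u x)\<^sup>2) + 2 * (b\<^sup>2 * \<bar>u x\<bar> powr (2 * (p - 1)))"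
          unfolding rhs_def by linarith
        then show ?thesis using True by (simp add: indicator_def)
      qed (simp add: indicator_def)
    qed
  qed measurable
qed

lemma Pot_cong: assumes "AE x in lborel. (w x)\<^sup>2 = (u x)\<^sup>2" and [measurable]: "w \<in> Bor" "u \<in> Bor" shows "Pot w = Pot u"
  unfolding Pot_def[abs_def] by (intro ext integral_cong_AE) (use assms(1) in auto)

lemma weak_lap_rhs_cong:
  assumes u: "u \<in> X" and crit: "\<And>\<phi>. test_fun \<phi> ==> dJ u \<phi> = 0" and V: "V \<in> Bor" "AE x in lborel. W x = V x"
    and w: "w \<in> Bor" "AE x in lborel. w x = u x"
  shows "weak_lap w (rhs V w)" "Pot w = Pot u"
proof -
  note [measurable] = w(1) XD(2)[OF u] V(1)
  have sq: "AE x in lborel. (w x)\<^sup>2 = (u x)\<^sup>2" using w(2) by eventually_elim simp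
  show P: "Pot w = Pot u" by (rule Pot_cong[OF sq]) measurable
  show "weak_lap w (rhs V w)"
  proof (rule weak_lap_cong[OF critical_weak_lap[OF u crit] _ _ _ _ w(2)])
    show "AE x in lborel. rhs V w x = rhs W u x" using w(2) V(2) by eventually_elim (simp add: rhs_def P)
    show "rhs V w \<in> Bor" by (rule rhs_borel[OF u _ _ P]) auto
    show "rhs W u \<in> Bor" by (rule rhs_borel[OF u]) auto
  qed auto
qed

lemma rhs_lh: assumes "lh V" "lh w" "lh (Pot w)" shows "lh (rhs V w)"
proof -
  have "lh (\<lambda>x. (V x + 1 / (2 * pi) * Pot w x) * w x + (- b) * (\<bar>w x\<bar> powr (p - 2) * w x))"
    using p4 by (intro lh_add lh_mult lh_const lh_abs_powr assms) simp
  then show ?thesis by (simp add: rhs_def[abs_def])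
qed

text \<open>Regularity takes two rounds: a locally square integrable right-hand side gives Hoelder
  continuity, after which the right-hand side is Hoelder continuous and the solution C2. For the
  sign, the modulus is again a minimizer and solves an equation of the same form; it has no zeros by
  the maximum principle, so continuity fixes the sign of \<open>w\<close>.\<close>

theorem minimizer_classical:
  assumes u: "u \<in> NB" and min: "\<And>w. w \<in> NB ==> J u \<le> J w" and V: "lh V" "AE x in lborel. W x = V x"
  obtains w where "AE x in lborel. w x = u x" "Ck 2 w" "\<And>x. laplacian w x = rhs V w x" "(\<forall>x. w x \<ge> 0) \<or> (\<forall>x. w x \<le> 0)"
proof -
  have uX: "u \<in> X" and unz: "nz u" using u by (auto simp: NB_def)
  note [measurable] = XD(2)[OF uX]
  have Vb [measurable]: "V \<in> Bor" by (rule borel_measurable_continuous_onI[OF lh_continuous[OF V(1)]])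
  have crit: "dJ u \<phi> = 0" if "test_fun \<phi>" for \<phi> by (rule minimizer_critical[OF u min test_X[OF that]])
  have "weak_lap u (rhs V u)" by (rule weak_lap_rhs_cong(1)[OF uX crit Vb V(2)]) auto
  then obtain w where w: "lh w" "AE x in lborel. w x = u x"
    using weak_lap_regular[OF XD(1)[OF uX] rhs_locally_L2[OF uX V(1)]] by metis
  have wc: "continuous_on UNIV w" by (rule lh_continuous[OF w(1)])
  have wb [measurable]: "w \<in> Bor" by (rule borel_measurable_continuous_onI[OF wc])
  note wl = weak_lap_rhs_cong[OF uX crit Vb V(2) wb w(2)]
  have Plh: "lh (Pot w)" using Pot_lh[OF uX] wl(2) by simp
  have wsq: "sqint w" using w(2) by (intro sqint_bound(1)[OF XD(1)[OF uX]]) auto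
  note cl = weak_lap_classical[OF wsq wc rhs_lh[OF V(1) w(1) Plh] wl(1)]

  let ?a = "\<lambda>x. \<bar>w x\<bar>" and ?ua = "\<lambda>x. \<bar>u x\<bar>"
  have ua: "?ua \<in> NB" "J ?ua = J u" using minimizer_abs[OF u] min by blast+
  have uaX: "?ua \<in> X" using ua(1) by (simp add: NB_def)
  have acrit: "dJ ?ua \<phi> = 0" if "test_fun \<phi>" for \<phi>
    by (rule minimizer_critical[OF ua(1) _ test_X[OF that]]) (simp add: ua(2) min)
  have al: "weak_lap ?a (rhs V ?a)" "Pot ?a = Pot ?ua"
    by (rule weak_lap_rhs_cong[OF uaX acrit Vb V(2)]; (use w(2) in "auto"))+
  have Pc: "continuous_on UNIV (Pot ?a)" unfolding al(2) by (rule lh_continuous[OF Pot_lh[OF uaX]])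
  have alh: "lh ?a"
  proof (rule lhI)
    fix R :: real assume "R > 0"
    obtain \<alpha> C where c: "0 < \<alpha>" "\<alpha> \<le> 1" "0 \<le> C" "\<And>x y. norm x \<le> R ==> norm y \<le> R ==> \<bar>w x - w y\<bar> \<le> C * dist x y powr \<alpha>"
      using lhD[OF w(1) \<open>R > 0\<close>] by metis
    then show "\<exists>\<alpha> C. 0 < \<alpha> \<and> \<alpha> \<le> 1 \<and> (\<forall>x\<in>cball 0 R. \<forall>y\<in>cball 0 R. \<bar>\<bar>w x\<bar> - \<bar>w y\<bar>\<bar> \<le> C * dist x y powr \<alpha>)"
      by (intro exI[of _ \<alpha>] exI[of _ C]) (auto intro: order_trans[OF abs_triangle_ineq3])
  qed
  have nzw: "w x \<noteq> 0" for x
  proof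
    assume x: "w x = 0"
    have "?a y = 0" for y
    proof (rule strong_maximum_principle[where a="?a" and ?x0.0=x, OF _ _ _ al(1)])
      show "continuous_on UNIV ?a" by (intro continuous_intros wc)
      have "lh (Pot ?a)" using Pot_lh[OF uaX] al(2) by simp
      then show "locint (rhs V ?a)" by (intro locint_continuous lh_continuous rhs_lh V alh)
      fix R :: real
      have "continuous_on UNIV (\<lambda>x. V x + 1 / (2 * pi) * Pot ?a x)" by (intro continuous_intros lh_continuous[OF V(1)] Pc)
      from continuous_bounded_cball[OF this, of R]
      obtain B where B: "B > 0" "\<And>x. norm x \<le> R ==> \<bar>V x + 1 / (2 * pi) * Pot ?a x\<bar> \<le> B" by blast
      have "rhs V ?a x \<le> B * ?a x" if "norm x \<le> R" for x
      proof -
        have "(V x + 1 / (2 * pi) * Pot ?a x) * ?a x \<le> B * ?a x" using B(2)[OF that] by (intro mult_right_mono) auto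
        \<comment> \<open>The power term enters the right-hand side with a minus sign; dropping it
          leaves the one-sided linear bound that the maximum principle requires.\<close>
        moreover have "0 \<le> b * (\<bar>?a x\<bar> powr (p - 2) * ?a x)" using b0 by simp
        ultimately show ?thesis unfolding rhs_def by linarith
      qed
      then show "\<exists>C\<ge>0. \<forall>x. norm x \<le> R --> rhs V ?a x \<le> C * ?a x" using B(1) by (intro exI[of _ B]) auto
    qed (use x in auto)
    then have "w y = 0" for y by simp
    with w(2) have "AE x in lborel. u x = 0" by simp
    then show False using unz by (simp add: nz_def)
  qed
  have "(\<forall>x. w x \<ge> 0) \<or> (\<forall>x. w x \<le> 0)"
  proof (rule ccontr)
    assume "\<not> ((\<forall>x. w x \<ge> 0) \<or> (\<forall>x. w x \<le> 0))"
    then obtain x y where xy: "w x < 0" "w y > 0" by (auto simp: not_le)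
    have "connected (range w)" by (rule connected_continuous_image[OF wc connected_UNIV])
    then have "{w x..w y} \<subseteq> range w" by (intro connected_contains_Icc) auto
    moreover have "0 \<in> {w x..w y}" using xy by simp
    ultimately have "0 \<in> range w" by blast
    then show False using nzw by (metis rangeE)
  qed
  then show ?thesis using that w(2) cl by blast
qed

end

section \<open>Passage from Lebesgue measurable to Borel representatives\<close>

lemma lebesgue_of_borel:
  fixes f g :: "R2 => 'a::euclidean_space"
  assumes g [measurable]: "g \<in> Bor" and eq: "AE x in lborel. f x = g x"
  shows "f \<in> borel_measurable lebesgue" "(\<integral>x. f x \<partial>lebesgue) = (LBINT x. g x)" "integrable lebesgue f \<longleftrightarrow> integrable lborel g"
proof -
  have gl [measurable]: "g \<in> borel_measurable lebesgue" by (intro measurable_completion) simp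
  have eq': "AE x in lebesgue. f x = g x" by (rule AE_completion[OF eq])
  then have "AE x in lebesgue. g x = f x" by eventually_elim simp
  then show fl: "f \<in> borel_measurable lebesgue" by (rule borel_measurable_AE[OF gl])
  have "(\<integral>x. f x \<partial>lebesgue) = (\<integral>x. g x \<partial>lebesgue)" by (rule integral_cong_AE[OF fl gl eq'])
  also have "... = (LBINT x. g x)" by (rule integral_completion) simp
  finally show "(\<integral>x. f x \<partial>lebesgue) = (LBINT x. g x)" .
  have "integrable lebesgue f \<longleftrightarrow> integrable lebesgue g" by (rule integrable_cong_AE[OF fl gl eq'])
  also have "... \<longleftrightarrow> integrable lborel g" by (rule integrable_completion) simp
  finally show "integrable lebesgue f \<longleftrightarrow> integrable lborel g" .
qed

lemma nn_integral_lebesgue_finite_iff: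
  fixes f g :: "R2 => real"
  assumes [measurable]: "g \<in> Bor" and eq: "AE x in lborel. f x = g x" and g0: "AE x in lborel. g x \<ge> 0"
  shows "(\<integral>\<^sup>+ x. ennreal (f x) \<partial>lebesgue) < \<infinity> \<longleftrightarrow> integrable lborel g"
proof -
  have "(\<integral>\<^sup>+ x. ennreal (f x) \<partial>lebesgue) = (\<integral>\<^sup>+ x. ennreal (g x) \<partial>lborel)"
    unfolding nn_integral_completion using eq by (intro nn_integral_cong_AE) auto
  also have "... < \<infinity> \<longleftrightarrow> integrable lborel g"
  proof
    assume "(\<integral>\<^sup>+ x. ennreal (g x) \<partial>lborel) < \<infinity>"
    then show "integrable lborel g" using g0 by (intro integrableI_nonneg) auto
  next
    assume "integrable lborel g"
    then show "(\<integral>\<^sup>+ x. ennreal (g x) \<partial>lborel) < \<infinity>" by (simp add: nn_integral_eq_integral[OF _ g0])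
  qed
  finally show ?thesis .
qed

lemma lebesgue_ex_borel:
  fixes f :: "R2 => real"
  assumes "f \<in> borel_measurable lebesgue" obtains g where "g \<in> Bor" "AE x in lborel. f x = g x"
  using completion_ex_borel_measurable_real[OF assms] by auto

lemma lebesgue_ex_borel_R2:
  fixes G :: "R2 => R2"
  assumes G: "G \<in> borel_measurable lebesgue" obtains H where "H \<in> Bor" "AE x in lborel. G x = H x"
proof -
  have "\<exists>h\<in>borel_measurable borel. AE x in lborel. G x \<bullet> i = h x" for i
  proof -
    have "(\<lambda>x. G x \<bullet> i) \<in> borel_measurable lebesgue" using G by measurable
    then show ?thesis using lebesgue_ex_borel by metis
  qed
  then obtain h where h: "\<And>i. h i \<in> Bor" "\<And>i. AE x in lborel. G x \<bullet> i = h i x" by metis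
  show ?thesis
  proof (rule that)
    show "(\<lambda>x. \<Sum>i\<in>Basis. h i x *\<^sub>R i) \<in> Bor" using h(1) by measurable
    have "AE x in lborel. \<forall>i\<in>Basis. G x \<bullet> i = h i x" using h(2) by (intro AE_finite_allI) auto
    then show "AE x in lborel. G x = (\<Sum>i\<in>Basis. h i x *\<^sub>R i)"
    proof eventually_elim
      fix x assume "\<forall>i\<in>Basis. G x \<bullet> i = h i x"
      then have "(\<Sum>i\<in>Basis. h i x *\<^sub>R i) = (\<Sum>i\<in>Basis. (G x \<bullet> i) *\<^sub>R i)" by (intro sum.cong) auto
      then show "G x = (\<Sum>i\<in>Basis. h i x *\<^sub>R i)" by (simp add: euclidean_representation)
    qed
  qed
qed

lemma distr_lebesgue_lborel: "distr lebesgue lborel (\<lambda>x. x) = (lborel :: R2 measure)"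
proof (rule measure_eqI)
  fix A :: "R2 set" assume "A \<in> sets (distr lebesgue lborel (\<lambda>x. x))"
  then have A: "A \<in> sets lborel" by simp
  have id: "(\<lambda>x. x) \<in> measurable lebesgue (lborel :: R2 measure)" by (rule measurable_completion) simp
  show "emeasure (distr lebesgue lborel (\<lambda>x. x)) A = emeasure lborel A"
    unfolding emeasure_distr[OF id A] using A by simp
qed simp

text \<open>\<open>N0\<close> integrates over the product of two completed measures. The identity
  pushes this product forward to the Borel product, which transfers both integrals and null sets to
  Borel representatives.\<close>

lemma distr_lebesgue_pair:
  "distr (lebesgue \<Otimes>\<^sub>M lebesgue) lborel2 (\<lambda>(x, y). (x, y)) = (lborel2 :: (R2 \<times> R2) measure)"
proof -
  have id: "(\<lambda>x. x) \<in> measurable lebesgue (lborel :: R2 measure)" by (rule measurable_completion) simp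
  show ?thesis
    using pair_measure_distr[OF id id] by (simp add: distr_lebesgue_lborel lborel.sigma_finite_measure_axioms)
qed

lemma measurable_lebesgue_pair: "(\<lambda>(x, y). (x, y)) \<in> measurable (lebesgue \<Otimes>\<^sub>M lebesgue) (lborel2 :: (R2 \<times> R2) measure)"
proof -
  have id [measurable]: "(\<lambda>x. x) \<in> measurable lebesgue (lborel :: R2 measure)" by (rule measurable_completion) simp
  have "(\<lambda>q. (fst q, snd q)) \<in> measurable (lebesgue \<Otimes>\<^sub>M lebesgue) (lborel2 :: (R2 \<times> R2) measure)"
    by (intro measurable_Pair measurable_compose[OF measurable_fst id] measurable_compose[OF measurable_snd id])
  then show ?thesis by (simp add: case_prod_beta')
qed

lemma AE_lebesgue_pair:
  assumes "AE x in lborel. P (x :: R2)"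
  shows "AE q in lebesgue \<Otimes>\<^sub>M lebesgue. P (fst q) \<and> P (snd q)"
proof -
  obtain N where N: "N \<in> null_sets lborel" "{x. \<not> P x} \<subseteq> N" using assms by (auto simp: eventually_ae_filter)
  note [measurable] = null_setsD2[OF N(1)]
  have "AE x in lborel. x \<notin> N" by (rule AE_not_in[OF N(1)])
  from AE_pair_fst_snd[OF this] have "AE q in lborel2. fst q \<notin> N \<and> snd q \<notin> N" by (auto elim: eventually_elim2)
  then have "AE q in distr (lebesgue \<Otimes>\<^sub>M lebesgue) lborel2 (\<lambda>(x, y). (x, y)). fst q \<notin> N \<and> snd q \<notin> N"
    by (simp only: distr_lebesgue_pair)
  then have "AE q in lebesgue \<Otimes>\<^sub>M lebesgue. fst (case q of (x, y) => (x, y)) \<notin> N \<and> snd (case q of (x, y) => (x, y)) \<notin> N"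
    by (subst (asm) AE_distr_iff[OF measurable_lebesgue_pair]) measurable
  then show ?thesis by eventually_elim (use N(2) in auto)
qed

lemma N0_eq_dbl:
  assumes u' [measurable]: "u' \<in> Bor" and eq: "AE x in lborel. u x = u' x"
  shows "N0 u = 1 / (2 * pi) * dbl ln (sq u') (sq u')"
proof -
  let ?F = "\<lambda>u z. ln (dist (fst z) (snd z)) * (u (fst z))\<^sup>2 * (u (snd z))\<^sup>2 :: real"
  have [measurable]: "u \<in> borel_measurable lebesgue" by (rule lebesgue_of_borel(1)[OF u' eq])
  have F': "?F u' \<in> borel_measurable lborel2" by measurable
  have d: "(\<lambda>z::R2 \<times> R2. ln (dist (fst z) (snd z))) \<in> borel_measurable (lebesgue \<Otimes>\<^sub>M lebesgue)"
    using measurable_compose[OF measurable_lebesgue_pair, of "\<lambda>z. ln (dist (fst z) (snd z))" borel] by (simp add: case_prod_beta')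
  have Fu: "?F u \<in> borel_measurable (lebesgue \<Otimes>\<^sub>M lebesgue)" using d by measurable
  have Fu': "?F u' \<in> borel_measurable (lebesgue \<Otimes>\<^sub>M lebesgue)"
    using measurable_compose[OF measurable_lebesgue_pair F'] by (simp add: case_prod_beta')
  have "integral\<^sup>L (lebesgue \<Otimes>\<^sub>M lebesgue) (?F u) = integral\<^sup>L (lebesgue \<Otimes>\<^sub>M lebesgue) (?F u')"
  proof (rule integral_cong_AE[OF Fu Fu'])
    show "AE q in lebesgue \<Otimes>\<^sub>M lebesgue. ?F u q = ?F u' q" using AE_lebesgue_pair[OF eq] by eventually_elim simp
  qed
  also have "... = integral\<^sup>L (distr (lebesgue \<Otimes>\<^sub>M lebesgue) lborel2 (\<lambda>(x, y). (x, y))) (?F u')"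
    by (subst integral_distr[OF measurable_lebesgue_pair F']) (simp add: case_prod_beta')
  finally show ?thesis unfolding N0_def dbl_def distr_lebesgue_pair by (rule arg_cong)
qed

lemma sob_L2_grad:
  assumes s: "sob u' G" and eq: "AE x in lborel. u x = u' x" shows "L2_grad u G"
proof -
  note [measurable] = sqint_borel[OF sobD(1)[OF s]] sqint_borel[OF sobD(2)[OF s]]
  have "L1 (\<lambda>x. (norm (G x))\<^sup>2)" using sobD(2)[OF s] by (simp add: sqint_def)
  then have f: "(\<integral>\<^sup>+ x. ennreal ((norm (G x))\<^sup>2) \<partial>lebesgue) < \<infinity>"
    by (subst nn_integral_lebesgue_finite_iff[where g="\<lambda>x. (norm (G x))\<^sup>2"]) auto
  have "weak_gradient u G" unfolding weak_gradient_def
  proof (intro allI impI ballI)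
    fix \<phi> i assume \<phi>: "test_fun \<phi>" and i: "i \<in> (Basis :: R2 set)"
    note [measurable] = test_fun_borel[OF \<phi>] test_fun_borel[OF test_fun_pdv[OF \<phi> i]]
    have "(\<integral>x. u x * pdv i \<phi> x \<partial>lebesgue) = (LBINT x. u' x * pdv i \<phi> x)"
      using eq by (intro lebesgue_of_borel(2)) auto
    also have "... = - (LBINT x. (G x \<bullet> i) * \<phi> x)" by (rule sobD(3)[OF s \<phi> i])
    also have "(LBINT x. (G x \<bullet> i) * \<phi> x) = (\<integral>x. (G x \<bullet> i) * \<phi> x \<partial>lebesgue)"
      by (rule lebesgue_of_borel(2)[symmetric]) auto
    finally show "(\<integral>x. u x * pdv i \<phi> x \<partial>lebesgue) = - (\<integral>x. (G x \<bullet> i) * \<phi> x \<partial>lebesgue)" .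
  qed
  moreover have "G \<in> borel_measurable lebesgue" by (rule lebesgue_of_borel(1)[of G G]) auto
  ultimately show ?thesis using f by (simp add: L2_grad_def)
qed

lemma L2_grad_sob:
  assumes G: "L2_grad u G" and u': "sqint u'" and eq: "AE x in lborel. u x = u' x"
  obtains H where "sob u' H" "AE x in lborel. G x = H x"
proof -
  have Gm: "G \<in> borel_measurable lebesgue" using G by (simp add: L2_grad_def)
  obtain H where H [measurable]: "H \<in> Bor" and GH: "AE x in lborel. G x = H x" by (rule lebesgue_ex_borel_R2[OF Gm])
  note [measurable] = sqint_borel[OF u']
  have "(\<integral>\<^sup>+ x. ennreal ((norm (G x))\<^sup>2) \<partial>lebesgue) < \<infinity>" using G by (simp add: L2_grad_def)
  then have "L1 (\<lambda>x. (norm (H x))\<^sup>2)"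
    by (subst (asm) nn_integral_lebesgue_finite_iff[where g="\<lambda>x. (norm (H x))\<^sup>2"]) (use GH in auto)
  then have Hs: "sqint H" by (simp add: sqint_def)
  have "sob u' H" unfolding sob_def
  proof (intro conjI allI impI ballI u' Hs)
    fix \<phi> i assume \<phi>: "test_fun \<phi>" and i: "i \<in> (Basis :: R2 set)"
    note [measurable] = test_fun_borel[OF \<phi>] test_fun_borel[OF test_fun_pdv[OF \<phi> i]]
    have "(LBINT x. u' x * pdv i \<phi> x) = (\<integral>x. u x * pdv i \<phi> x \<partial>lebesgue)"
      using eq by (intro lebesgue_of_borel(2)[symmetric]) auto
    also have "... = - (\<integral>x. (G x \<bullet> i) * \<phi> x \<partial>lebesgue)" using G \<phi> i by (simp add: L2_grad_def weak_gradient_def)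
    also have "(\<integral>x. (G x \<bullet> i) * \<phi> x \<partial>lebesgue) = (LBINT x. (H x \<bullet> i) * \<phi> x)"
      using GH by (intro lebesgue_of_borel(2)) auto
    finally show "(LBINT x. u' x * pdv i \<phi> x) = - (LBINT x. (H x \<bullet> i) * \<phi> x)" .
  qed
  then show ?thesis using that GH by blast
qed

text \<open>Measurability of \<open>V\<close> is read off from its integrability on balls, as a
  pointwise limit of cutoffs. Taking the maximum of a Borel representative with the infimum of
  \<open>V\<close> makes the lower bound hold everywhere and changes it on a null set only.\<close>

lemma V0_cond_planar:
  assumes V: "V0_cond V" and b: "b \<ge> 0" and p: "p \<ge> 4"
  obtains W c0 where "planar W c0 b p" "AE x in lborel. W x = V x"
proof -
  define c0 where "c0 = (INF x. V x)"
  have c0: "c0 > 0" and Vge: "\<And>x. c0 \<le> V x" using V by (auto simp: V0_cond_def c0_def intro: cINF_lower)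
  have Vk: "set_integrable lebesgue (cball 0 r) V" for r using V by (auto simp: V0_cond_def)
  have Vm: "V \<in> borel_measurable lebesgue"
  proof (rule borel_measurable_LIMSEQ_real)
    show "(\<lambda>x. indicator (cball 0 (real n)) x * V x) \<in> borel_measurable lebesgue" for n
      using Vk[of n] by (auto simp: set_integrable_def intro: borel_measurable_integrable)
    fix x :: R2
    obtain N :: nat where "norm x \<le> N" using real_arch_simple by blast
    then have "indicator (cball 0 (real n)) x * V x = V x" if "n \<ge> N" for n using that by (simp add: indicator_def)
    then show "(\<lambda>n. indicator (cball 0 (real n)) x * V x) ----> V x"
      by (intro tendsto_eventually) (auto simp: eventually_sequentially)
  qed
  obtain W0 where [measurable]: "W0 \<in> Bor" and W0: "AE x in lborel. V x = W0 x" by (rule lebesgue_ex_borel[OF Vm])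
  define W where "W x = max (W0 x) c0" for x
  have Wb [measurable]: "W \<in> Bor" unfolding W_def[abs_def] by measurable
  have VW: "AE x in lborel. V x = W x" using W0
  proof eventually_elim
    fix x assume "V x = W0 x" then show "V x = W x" using Vge[of x] by (simp add: W_def)
  qed
  have "planar W c0 b p"
  proof
    show "locint W" unfolding locint_def set_integrable_def
    proof (intro conjI allI Wb)
      fix r
      have "integrable lebesgue (\<lambda>x. indicator (cball 0 r) x *\<^sub>R V x)" using Vk[of r] by (simp add: set_integrable_def)
      then show "L1 (\<lambda>x. indicator (cball 0 r) x *\<^sub>R W x)"
        by (subst (asm) lebesgue_of_borel(3)[where g="\<lambda>x. indicator (cball 0 r) x *\<^sub>R W x"]) (use VW in auto)
    qed
    show "emeasure lborel {x. W x \<le> M} < \<infinity>" for M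
    proof -
      \<comment> \<open>Finite measure is assumed for positive levels only; enlarging the level
        covers every real \<open>M\<close>.\<close>
      let ?M = "max M 1"
      have "emeasure lborel {x. W x \<le> M} \<le> emeasure lborel {x. W x \<le> ?M}" by (intro emeasure_mono) auto
      also have "... = emeasure lebesgue {x. W x \<le> ?M}" by simp
      also have "... = emeasure lebesgue {x. V x \<le> ?M}"
      proof (rule emeasure_eq_AE)
        show "AE x in lebesgue. (x \<in> {x. W x \<le> ?M}) = (x \<in> {x. V x \<le> ?M})" using AE_completion[OF VW] by eventually_elim simp
        have "{x \<in> space lebesgue. V x \<le> ?M} \<in> sets lebesgue" using Vm by measurable
        then show "{x. V x \<le> ?M} \<in> sets lebesgue" by simp
      qed simp
      also have "... < \<infinity>" using V by (simp add: V0_cond_def)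
      finally show ?thesis .
    qed
  qed (use c0 b p in "auto simp: W_def")
  moreover have "AE x in lborel. W x = V x" using VW by eventually_elim simp
  ultimately show ?thesis by (rule that)
qed

locale planar_rep = planar +
  fixes V :: "R2 => real"
  assumes WV: "AE x in lborel. W x = V x"
begin

text \<open>Relates a function on the Lebesgue side to a Borel representative in \<open>X\<close>.
  The energies on the two sides agree exactly, so minimality and derivatives can be
  transferred.\<close>

definition rep :: "(R2 => real) => (R2 => real) => bool" where
  "rep u' u \<longleftrightarrow> u' \<in> X \<and> (AE x in lborel. u x = u' x)"

lemma rep_self: "u \<in> X ==> rep u u" by (simp add: rep_def)

lemma rep_add_scale: "rep u' u ==> rep v' v ==> rep (\<lambda>x. u' x + t * v' x) (\<lambda>x. u x + t * v x)"
  unfolding rep_def using X_add_scale[of u' v' t] by (auto elim: eventually_elim2)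

lemma rep_scale: "rep u' u ==> rep (\<lambda>x. t * u' x) (\<lambda>x. t * u x)"
  unfolding rep_def using X_scale[of u' t] by (auto elim: eventually_mono)

lemma rep_E: assumes r: "rep u' u" shows "u \<in> E V"
proof -
  have u': "u' \<in> X" and eq: "AE x in lborel. u x = u' x" using r by (auto simp: rep_def)
  note [measurable] = XD(2)[OF u']
  have "(\<integral>\<^sup>+ x. ennreal ((u x)\<^sup>2) \<partial>lebesgue) < \<infinity>"
    by (subst nn_integral_lebesgue_finite_iff[where g="\<lambda>x. (u' x)\<^sup>2"]) (use eq XD(3)[OF u'] in auto)
  moreover have "(\<integral>\<^sup>+ x. ennreal (V x * (u x)\<^sup>2) \<partial>lebesgue) < \<infinity>"
  proof (subst nn_integral_lebesgue_finite_iff[where g="\<lambda>x. W x * (u' x)\<^sup>2"])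
    show "AE x in lborel. V x * (u x)\<^sup>2 = W x * (u' x)\<^sup>2" using eq WV by eventually_elim simp
  qed (use XD(5)[OF u'] W_nonneg in auto)
  moreover have "(\<integral>\<^sup>+ x. ennreal (ln (1 + norm x) * (u x)\<^sup>2) \<partial>lebesgue) < \<infinity>"
  proof (subst nn_integral_lebesgue_finite_iff[where g="\<lambda>x. lgw x * (u' x)\<^sup>2"])
    show "AE x in lborel. ln (1 + norm x) * (u x)\<^sup>2 = lgw x * (u' x)\<^sup>2" using eq by eventually_elim (simp add: lgw_def)
  qed (use XD(6)[OF u'] lgw_nonneg in auto)
  moreover have "u \<in> borel_measurable lebesgue" by (rule lebesgue_of_borel(1)[OF _ eq]) simp
  moreover have "\<exists>G. L2_grad u G" using sob_L2_grad[OF X_sob[OF u'] eq] by blast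
  ultimately show ?thesis by (simp add: E_def H1_def)
qed

lemma E_rep: assumes "u \<in> E V" obtains u' where "rep u' u"
proof -
  have um: "u \<in> borel_measurable lebesgue" using assms by (simp add: E_def H1_def)
  obtain u' where [measurable]: "u' \<in> Bor" and eq: "AE x in lborel. u x = u' x" by (rule lebesgue_ex_borel[OF um])
  obtain G where G: "L2_grad u G" using assms by (auto simp: E_def H1_def)
  have i1: "L1 (sq u')"
    using assms eq by (subst nn_integral_lebesgue_finite_iff[where f="\<lambda>x. (u x)\<^sup>2", symmetric]) (auto simp: E_def H1_def)
  then have s: "sqint u'" by (simp add: sqint_real)
  have i2: "L1 (\<lambda>x. W x * (u' x)\<^sup>2)"
  proof (subst nn_integral_lebesgue_finite_iff[where f="\<lambda>x. V x * (u x)\<^sup>2", symmetric])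
    show "AE x in lborel. V x * (u x)\<^sup>2 = W x * (u' x)\<^sup>2" using eq WV by eventually_elim simp
  qed (use assms W_nonneg in "auto simp: E_def")
  have i3: "L1 (\<lambda>x. lgw x * (u' x)\<^sup>2)"
  proof (subst nn_integral_lebesgue_finite_iff[where f="\<lambda>x. ln (1 + norm x) * (u x)\<^sup>2", symmetric])
    show "AE x in lborel. ln (1 + norm x) * (u x)\<^sup>2 = lgw x * (u' x)\<^sup>2" using eq by eventually_elim (simp add: lgw_def)
  qed (use assms lgw_nonneg in "auto simp: E_def")
  obtain H where "sob u' H" by (rule L2_grad_sob[OF G s eq]) blast
  then have "u' \<in> X" using i2 i3 by (rule XI)
  then show ?thesis using that eq by (simp add: rep_def)
qed

lemma rep_I: assumes r: "rep u' u" shows "I V b p u = J u'"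
proof -
  have u': "u' \<in> X" and eq: "AE x in lborel. u x = u' x" using r by (auto simp: rep_def)
  note [measurable] = XD(2)[OF u']
  have "L2_grad u (grad u)" unfolding grad_def by (rule someI[of "L2_grad u"]) (rule sob_L2_grad[OF X_sob[OF u'] eq])
  then obtain H where H: "sob u' H" "AE x in lborel. grad u x = H x" by (rule L2_grad_sob[OF _ XD(1)[OF u'] eq]) blast
  note [measurable] = sqint_borel[OF sobD(2)[OF H(1)]]
  have "normV_sq V u = (LBINT x. (norm (H x))\<^sup>2 + W x * (u' x)\<^sup>2)"
    unfolding normV_sq_def
  proof (rule lebesgue_of_borel(2))
    show "AE x in lborel. (norm (grad u x))\<^sup>2 + V x * (u x)\<^sup>2 = (norm (H x))\<^sup>2 + W x * (u' x)\<^sup>2"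
      using H(2) eq WV by eventually_elim simp
  qed measurable
  also have "... = nsq H + (LBINT x. W x * (u' x)\<^sup>2)"
    unfolding nsq_def using sobD(2)[OF H(1)] XD(5)[OF u'] by (intro Bochner_Integration.integral_add) (auto simp: sqint_def)
  also have "... = Aen u'" by (simp add: Aen_def gr_nsq[OF H(1)])
  finally have A: "normV_sq V u = Aen u'" .
  have "N0 u = Nen u'" using N0_eq_dbl[OF _ eq] by (simp add: Nen_def)
  moreover have "Lp_pow p u = Cen u'" unfolding Lp_pow_def Cen_def using eq by (intro lebesgue_of_borel(2)) auto
  ultimately show ?thesis by (simp add: I_def J_def A)
qed

lemma rep_nonzero: "rep u' u ==> nonzero u \<longleftrightarrow> nz u'"
  unfolding rep_def nonzero_def nz_def AE_completion_iff by (auto elim: eventually_elim2)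

text \<open>Along a line the two energies coincide as functions of the parameter, so the directional
  derivative exists on the Lebesgue side too and has the same value.\<close>

lemma rep_dI: assumes u: "rep u' u" and v: "rep v' v" shows "dI V b p u v D \<longleftrightarrow> D = dJ u' v'"
proof -
  have "(\<lambda>t. I V b p (\<lambda>x. u x + t * v x)) = (\<lambda>t. J (\<lambda>x. u' x + t * v' x))"
    using rep_I[OF rep_add_scale[OF u v]] by auto
  moreover have "((\<lambda>t. J (\<lambda>x. u' x + t * v' x)) has_real_derivative dJ u' v') (at 0)"
    using u v by (intro J_deriv) (auto simp: rep_def)
  ultimately show ?thesis unfolding dI_def by (auto dest: DERIV_unique)
qed

text \<open>The direction \<open>u\<close> stays on the ray through \<open>u\<close>: u + t u = (t +
  1) u. For t > -1 the energy is the fibre map at t + 1, whose derivative at 1 is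
  \<open>Q u\<close>.\<close>

lemma dJ_self: assumes u: "u \<in> X" "nz u" shows "dJ u u = Q u"
proof -
  let ?f = "fphi (Aen u) (Nen u) (Cen u) b p"
  have "(?f has_real_derivative 1 * fqf (Aen u) (Nen u) (Cen u) b p 1) (at 1)" by (rule fibre.phi_deriv[OF fibreI[OF u]]) simp
  then have "((\<lambda>t. ?f (t + 1)) has_real_derivative Q u) (at 0)"
    using DERIV_shift[of ?f "Q u" 0 1] by (simp add: fqf_def Q_def)
  moreover have "eventually (\<lambda>t. ?f (t + 1) = J (\<lambda>x. u x + t * u x)) (nhds (0::real))"
  proof -
    have "eventually (\<lambda>t. t > -1) (nhds (0::real))" using eventually_nhds_in_open[of "{-1<..}" "0::real"] by (simp add: open_greaterThan)
    then show ?thesis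
    proof eventually_elim
      fix t :: real assume "t > -1"
      then show "?f (t + 1) = J (\<lambda>x. u x + t * u x)" using JQ_scale(1)[OF u(1), of "t + 1"] by (simp add: algebra_simps)
    qed
  qed
  ultimately have "((\<lambda>t. J (\<lambda>x. u x + t * u x)) has_real_derivative Q u) (at 0)"
    using DERIV_cong_ev[OF refl _ refl, of "\<lambda>t. ?f (t + 1)" "\<lambda>t. J (\<lambda>x. u x + t * u x)" 0 "Q u"] by simp
  then show ?thesis using J_deriv[OF u(1) u(1)] DERIV_unique by blast
qed

lemma rep_Nehari: assumes "rep u' u" shows "u \<in> Nehari V b p \<longleftrightarrow> u' \<in> NB"
  using assms rep_E[OF assms] rep_nonzero[OF assms] rep_dI[OF assms assms, of 0] dJ_self[of u']
  by (auto simp: Nehari_def NB_def rep_def)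

lemma Nehari_rep: assumes "u \<in> Nehari V b p" obtains u' where "rep u' u" "u' \<in> NB"
proof -
  have "u \<in> E V" using assms by (simp add: Nehari_def)
  then obtain u' where "rep u' u" by (rule E_rep)
  then show ?thesis using that rep_Nehari assms by blast
qed

lemma minimizer_rep:
  assumes "\<And>w. w \<in> Nehari V b p ==> I V b p u \<le> I V b p w" and r: "rep u' u" and w: "w \<in> NB"
  shows "J u' \<le> J w"
proof -
  have "rep w w" using w by (intro rep_self) (simp add: NB_def)
  then show ?thesis using assms(1)[of w] rep_Nehari[of w w] rep_I[of w w] rep_I[OF r] w by simp
qed

lemma Nehari_minimizer_exists: "\<exists>u\<in>Nehari V b p. \<forall>w\<in>Nehari V b p. I V b p u \<le> I V b p w"
proof -
  obtain u where u: "u \<in> NB" "\<And>w. w \<in> NB ==> J u \<le> J w" using NB_minimizer_exists by blast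
  have r: "rep u u" using u(1) by (intro rep_self) (simp add: NB_def)
  show ?thesis
  proof (intro bexI ballI)
    show "u \<in> Nehari V b p" using rep_Nehari[OF r] u(1) by simp
    fix w assume "w \<in> Nehari V b p"
    then obtain w' where "rep w' w" "w' \<in> NB" by (rule Nehari_rep)
    then show "I V b p u \<le> I V b p w" using u(2) rep_I[OF r] rep_I[of w' w] by simp
  qed
qed

lemma minimizer_ground_state:
  assumes u: "u \<in> Nehari V b p" and min: "\<And>w. w \<in> Nehari V b p ==> I V b p u \<le> I V b p w"
  shows "ground_state V b p u"
proof -
  obtain u' where r: "rep u' u" and u': "u' \<in> NB" using u by (rule Nehari_rep)
  have "dI V b p u v 0" if v: "v \<in> E V" for v
  proof -
    obtain v' where v': "rep v' v" using v by (rule E_rep)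
    have "dJ u' v' = 0" by (rule minimizer_critical[OF u' minimizer_rep[OF min r]]) (use v' in "auto simp: rep_def")
    then show ?thesis using rep_dI[OF r v'] by simp
  qed
  moreover have "I V b p u \<le> I V b p w" if "critical V b p w" "nonzero w" for w
    using that by (intro min) (auto simp: Nehari_def critical_def)
  ultimately show ?thesis using u by (simp add: ground_state_def critical_def Nehari_def)
qed

lemma rep_fibre: assumes "rep v' v" "t > 0" shows "I V b p (\<lambda>x. t * v x) = fphi (Aen v') (Nen v') (Cen v') b p t"
  using rep_I[OF rep_scale[OF assms(1), of t]] JQ_scale(1)[of v' t] assms by (simp add: rep_def)

text \<open>If the ray of \<open>v\<close> meets the Nehari set, its energy there is at least the
  minimum; otherwise the energy is unbounded above along the ray. For the minimizer itself the
  supremum is attained at t = 1. Extended reals are used because the supremum can be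
  infinite.\<close>

lemma minimizer_minimax:
  assumes u: "u \<in> Nehari V b p" and min: "\<And>w. w \<in> Nehari V b p ==> I V b p u \<le> I V b p w"
  shows "ereal (I V b p u) = (INF v\<in>{v \<in> E V. nonzero v}. SUP t\<in>{0<..}. ereal (I V b p (\<lambda>x. t * v x)))"
proof (rule antisym)
  obtain u' where r: "rep u' u" and u': "u' \<in> NB" using u by (rule Nehari_rep)
  have uX: "u' \<in> X" "nz u'" "Q u' = 0" using u' by (auto simp: NB_def)
  show "ereal (I V b p u) \<le> (INF v\<in>{v \<in> E V. nonzero v}. SUP t\<in>{0<..}. ereal (I V b p (\<lambda>x. t * v x)))"
  proof (rule INF_greatest)
    fix v assume "v \<in> {v \<in> E V. nonzero v}"
    then have v: "v \<in> E V" "nonzero v" by auto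
    obtain v' where v': "rep v' v" using v(1) by (rule E_rep)
    have vX: "v' \<in> X" "nz v'" using v' v(2) rep_nonzero[OF v'] by (auto simp: rep_def)
    have "\<exists>t>0. I V b p u \<le> I V b p (\<lambda>x. t * v x)"
    proof (cases "\<exists>t>0. fqf (Aen v') (Nen v') (Cen v') b p t = 0")
      case True
      then obtain t where t: "t > 0" "fqf (Aen v') (Nen v') (Cen v') b p t = 0" by blast
      have "(\<lambda>x. t * v' x) \<in> NB" by (rule scale_in_NB[OF vX t])
      then have "J u' \<le> J (\<lambda>x. t * v' x)" by (intro minimizer_rep[OF _ r] min)
      then show ?thesis using t(1) rep_I[OF r] rep_I[OF rep_scale[OF v', of t]] by auto
    next
      case False
      then obtain t where "t > 0" "I V b p u < fphi (Aen v') (Nen v') (Cen v') b p t"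
        using fibre.phi_unbounded[OF fibreI[OF vX], of "Nen v'" "I V b p u"] by blast
      then show ?thesis using rep_fibre[OF v', of t] by (intro exI[of _ t]) auto
    qed
    then obtain t where t: "t > 0" "I V b p u \<le> I V b p (\<lambda>x. t * v x)" by blast
    show "ereal (I V b p u) \<le> (SUP t\<in>{0<..}. ereal (I V b p (\<lambda>x. t * v x)))"
      by (rule SUP_upper2[of t]) (use t in auto)
  qed
  show "(INF v\<in>{v \<in> E V. nonzero v}. SUP t\<in>{0<..}. ereal (I V b p (\<lambda>x. t * v x))) \<le> ereal (I V b p u)"
  proof (rule INF_lower2)
    show "u \<in> {v \<in> E V. nonzero v}" using u by (simp add: Nehari_def)
    show "(SUP t\<in>{0<..}. ereal (I V b p (\<lambda>x. t * u x))) \<le> ereal (I V b p u)"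
    proof (rule SUP_least)
      fix t :: real assume "t \<in> {0<..}"
      then have t: "t > 0" by simp
      have "fphi (Aen u') (Nen u') (Cen u') b p t \<le> fphi (Aen u') (Nen u') (Cen u') b p 1"
        by (rule fibre.phi_max[OF fibreI[OF uX(1,2)] _ t]) (use uX(3) in "simp add: Q_def")
      then show "ereal (I V b p (\<lambda>x. t * u x)) \<le> ereal (I V b p u)" using rep_fibre[OF r t] rep_fibre[OF r, of 1] by simp
    qed
  qed
qed

lemma minimizer_regular:
  assumes u: "u \<in> Nehari V b p" and min: "\<And>w. w \<in> Nehari V b p ==> I V b p u \<le> I V b p w" and V: "loc_holder V"
  shows "\<exists>w. (AE x in lebesgue. w x = u x) \<and> classical_sol V b p w \<and> ((\<forall>x. w x \<ge> 0) \<or> (\<forall>x. w x \<le> 0))"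
proof -
  obtain u' where r: "rep u' u" and u': "u' \<in> NB" using u by (rule Nehari_rep)
  obtain w where w: "AE x in lborel. w x = u' x" "Ck 2 w" "\<And>x. laplacian w x = rhs V w x" "(\<forall>x. w x \<ge> 0) \<or> (\<forall>x. w x \<le> 0)"
    by (rule minimizer_classical[OF u' minimizer_rep[OF min r] loc_holder_lh[OF V] WV]) blast+
  have [measurable]: "w \<in> Bor" by (rule borel_measurable_continuous_onI[OF Ck_cont[OF w(2)]])
  have "AE x in lborel. u x = u' x" using r by (simp add: rep_def)
  with w(1) have "AE x in lborel. w x = u x" by eventually_elim simp
  then have "AE x in lebesgue. w x = u x" by (rule AE_completion)
  moreover have "classical_sol V b p w"
    unfolding classical_sol_def
  proof (intro conjI allI w(2))
    fix x
    have "(\<integral>y. ln (dist x y) * (w y)\<^sup>2 \<partial>lebesgue) = Pot w x" unfolding Pot_def by (rule integral_completion) measurable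
    then show "- laplacian w x + V x * w x + 1 / (2 * pi) * (\<integral>y. ln (dist x y) * (w y)\<^sup>2 \<partial>lebesgue) * w x = b * \<bar>w x\<bar> powr (p - 2) * w x"
      unfolding w(3) rhs_def by (simp add: algebra_simps)
  qed
  ultimately show ?thesis using w(4) by blast
qed

end

text \<open>Elements of \<open>E V\<close> are functions, not classes; regularity, the classical
  equation and the sign are therefore claimed for a representative that agrees with the minimizer
  almost everywhere.\<close>

theorem theorem1p1:
  fixes V :: "R2 \<Rightarrow> real" and b p :: real
  assumes "b \<ge> 0" and "p \<ge> 4" and "V0_cond V"
  shows "(\<exists>u\<in>Nehari V b p. \<forall>w\<in>Nehari V b p. I V b p u \<le> I V b p w)
    \<and> (\<forall>u. u \<in> Nehari V b p \<and> (\<forall>w\<in>Nehari V b p. I V b p u \<le> I V b p w) \<longrightarrow>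
          ground_state V b p u \<and>
          ereal (I V b p u) = (INF v\<in>{v \<in> E V. nonzero v}. SUP t\<in>{0<..}. ereal (I V b p (\<lambda>x. t * v x))))
    \<and> (loc_holder V \<longrightarrow>
        (\<forall>u. u \<in> Nehari V b p \<and> (\<forall>w\<in>Nehari V b p. I V b p u \<le> I V b p w) \<longrightarrow>
          (\<exists>w. (AE x in lebesgue. w x = u x) \<and> classical_sol V b p w \<and>
               ((\<forall>x. w x \<ge> 0) \<or> (\<forall>x. w x \<le> 0)))))"
proof -
  obtain W c0 where W: "planar W c0 b p" "AE x in lborel. W x = V x" by (rule V0_cond_planar[OF assms(3,1,2)])
  then interpret planar_rep W c0 b p V by (simp add: planar_rep_def planar_rep_axioms_def)
  show ?thesis
  proof (intro conjI allI impI; (elim conjE)?)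
    show "\<exists>u\<in>Nehari V b p. \<forall>w\<in>Nehari V b p. I V b p u \<le> I V b p w" by (rule Nehari_minimizer_exists)
  next
    fix u assume u: "u \<in> Nehari V b p" "\<forall>w\<in>Nehari V b p. I V b p u \<le> I V b p w"
    show "ground_state V b p u" by (rule minimizer_ground_state[OF u(1)]) (use u(2) in auto)
    show "ereal (I V b p u) = (INF v\<in>{v \<in> E V. nonzero v}. SUP t\<in>{0<..}. ereal (I V b p (\<lambda>x. t * v x)))"
      by (rule minimizer_minimax[OF u(1)]) (use u(2) in auto)
  next
    fix u assume V: "loc_holder V" and u: "u \<in> Nehari V b p" "\<forall>w\<in>Nehari V b p. I V b p u \<le> I V b p w"
    show "\<exists>w. (AE x in lebesgue. w x = u x) \<and> classical_sol V b p w \<and> ((\<forall>x. w x \<ge> 0) \<or> (\<forall>x. w x \<le> 0))"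
      by (rule minimizer_regular[OF u(1) _ V]) (use u(2) in auto)
  qed
qed

end
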